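(* Let $l>-1/2$ and let $\Phi:\mathbb{R}\to[0,\infty)$ satisfy the following assumptions: $\Phi$ is measurable; $\Phi(\eta)=0$ for $\eta<0$; there is $\eta_1>0$ with $\Phi>0$ a.e. on $[0,\eta_1]$; there is $\kappa>-1$ such that for every compact set $K\subset\mathbb{R}$ there is a constant $C>0$ with $\Phi(\eta)\le C\eta^{\kappa}$ for all $\eta\in K$ with $\eta>0$; and there are constants $c>0$, $\eta_0>0$ and $k$ with $-1<k<l+3/2$ such that $$\Phi(\eta)\ge c\,\eta^{k}\quad\text{for } \eta\in(0,\eta_0).$$ Let the three models (VP) Vlasov-Poisson, (RVP) relativistic Vlasov-Poisson, (EV) Einstein-Vlasov, together with the functions $g$ (and $h$ for EV), the reduced equation of each model, and the static systems, be as given in the context. Then for each of the three models and each $y_0>0$: 1. The reduced equation of the model has a unique solution $y\in C^1([0,\infty))$ with $y(0)=y_0$, and $y$ has a unique zero $R>0$. 2. With $r=|x|$, the function $$f(x,v)=\Phi\left(y(r)-\tfrac12|v|^2\right)|x\times v|^{2l}\quad\text{(VP)},$$ $$f(x,v)=\Phi\left(1+y(r)-\sqrt{1+|v|^2}\right)|x\times v|^{2l}\quad\text{(RVP)},$$ $$f(x,v)=\Phi\left(1-e^{-y(r)}\sqrt{1+|v|^2}\right)|x\times v|^{2l}\quad\text{(EV)}$$ defines a static, spherically symmetric solution of the respective system, where, with $y_\infty:=\lim_{r\to\infty}y(r)$, the potential is $U=y_\infty-y$ for VP and RVP, and the metric quantities are $\mu=y_\infty-y$ and $\lambda$ given by $e^{-2\lambda(r)}=1-2m(r)/r$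 for EV. 3. This solution is compactly supported, and its spatial support is the ball of radius $R$ centered at the origin. 4. $y_0=U(R)-U(0)$ for VP and RVP, and $y_0=\mu(R)-\mu(0)$ for EV. 5. $\rho,\,p\in C(\mathbb{R}^3)\cap C^1(B_R(0))$, where $B_R(0)$ is the ball of radius $R$ centered at the origin, and $\rho$ and $p$ are the density and pressure induced by $f$ as given in the context.
   Context: Notation. $x,v\in\mathbb{R}^3$, $r=|x|$, $'=d/dr$; radial functions of $x$ are identified with functions of $r$. A function $f=f(x,v)\ge 0$ is spherically symmetric if $f(Ax,Av)=f(x,v)$ for all $A\in\mathrm{SO}(3)$. If $l<0$, $f$ is considered where $x\times v\neq0$ (a set of full measure). If $l=0$, $|x\times v|^{2l}=1$. Functions $g$ and $h$. In all cases $g(y)=0$ and $h(y)=0$ for $y\le0$. For $y>0$: VP: $g(y)=c_l\int_0^y\Phi(\eta)(y-\eta)^{l+1/2}\,d\eta$ with $c_l=2^{l+3/2}\pi\int_0^1\frac{s^l}{\sqrt{1-s}}\,ds$. RVP: $g(y)=c_l\int_0^y\Phi(\eta)(1+y-\eta)\left((1+y-\eta)^2-1\right)^{l+1/2}d\eta$ with $c_l=2\pi\int_0^1\frac{s^l}{\sqrt{1-s}}\,ds$. EV: $g(y)=c_l e^{3y}\int_0^{1-e^{-y}}\Phi(\eta)(1-\eta)^2\left(e^{2y}(1-\eta)^2-1\right)^{l+1/2}d\eta$ with $c_l$ as in RVP, and $h(y)=d_l e^{y}\int_0^{1-e^{-y}}\Phi(\eta)\left(e^{2y}(1-\eta)^2-1\right)^{l+3/2}d\eta$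 with $d_l=2\pi\int_0^1 s^l\sqrt{1-s}\,ds$. Mass function: $m(r)=4\pi\int_0^r s^{2l+2}g(y(s))\,ds$. Reduced equations (the right hand sides are understood as their limit $0$ at $r=0$): VP and RVP: $y'(r)=-\dfrac{m(r)}{r^2}$. EV: $y'(r)=-\dfrac{1}{1-2m(r)/r}\left(\dfrac{m(r)}{r^2}+4\pi r^{1+2l}h(y(r))\right)$, where being a solution includes $2m(r)<r$ for all $r>0$. Static systems. Since $\Phi$ is only measurable, "$f$ satisfies the Vlasov equation" means that $f$ is constant along the solutions of the characteristic system of that equation. VP: Vlasov equation $v\cdot\nabla_xf-\nabla U\cdot\nabla_vf=0$ (characteristics $\dot x=v$, $\dot v=-\nabla U(x)$); $\rho(x)=\int f(x,v)\,dv$; Poisson equation $\Delta U=4\pi\rho$, $\lim_{|x|\to\infty}U(x)=0$. The induced pressure is $p(x)=\int\left(\frac{x\cdot v}{r}\right)^2f(x,v)\,dv$. RVP: Vlasov equation $\frac{v}{\sqrt{1+|v|^2}}\cdot\nabla_xf-\nabla U\cdot\nabla_vf=0$ (characteristics $\dot x=v/\sqrt{1+|v|^2}$, $\dot v=-\nabla U(x)$); $\rho$ and the Poisson equation as for VP. The induced pressure is $p(x)=\int\left(\frac{x\cdot v}{r}\right)^2f(x,v)\frac{dv}{\sqrt{1+|v|^2}}$. EV: Vlasov equation $\frac{v}{\sqrt{1+|v|^2}}\cdot\nabla_xf-\sqrt{1+|v|^2}\,\mu'\frac{x}{r}\cdot\nabla_vf=0$ (characteristics $\dot x=v/\sqrt{1+|v|^2}$,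 $\dot v=-\sqrt{1+|v|^2}\,\mu'(r)\,x/r$); field equations $e^{-2\lambda}(2r\lambda'-1)+1=8\pi r^2\rho$ and $e^{-2\lambda}(2r\mu'+1)-1=8\pi r^2p$; $\rho(x)=\int\sqrt{1+|v|^2}\,f(x,v)\,dv$, $p(x)=\int\left(\frac{x\cdot v}{r}\right)^2f(x,v)\frac{dv}{\sqrt{1+|v|^2}}$; boundary conditions $\lim_{r\to\infty}\mu(r)=\lim_{r\to\infty}\lambda(r)=0$ and $\lambda(0)=0$. (The metric is $ds^2=-e^{2\mu}dt^2+e^{2\lambda}dr^2+r^2(d\theta^2+\sin^2\theta\,d\varphi^2)$.)
   Formalization: Item 5 fails at the origin for some l: ρ and p behave like |x|^{2l} there. So for l<0 continuity and the Poisson equation are claimed only for x≠0 (with U still C^1 on R^3), and for l<0 or 0<l≤1/2 the C^1 claim is made on B_R(0) minus the origin. *)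

theory Defs
  imports "HOL-Analysis.Analysis"
begin

(* Integrals are Lebesgue integrals with respect to Lebesgue measure. Since powr is 0 at base 0,
   the exponent 2 * l is treated separately for l = 0 in the particle distributions below. *)

subsection \<open>The functions g and h, and the reduced equations\<close>

definition c_VP :: "real \<Rightarrow> real" where
  "c_VP l = 2 powr (l + 3/2) * pi * (LINT s:{0..1}|lebesgue. s powr l / sqrt (1 - s))"

definition c_rel :: "real \<Rightarrow> real" where
  "c_rel l = 2 * pi * (LINT s:{0..1}|lebesgue. s powr l / sqrt (1 - s))"

definition d_rel :: "real \<Rightarrow> real" where
  "d_rel l = 2 * pi * (LINT s:{0..1}|lebesgue. s powr l * sqrt (1 - s))"

definition g_VP :: "real \<Rightarrow> (real \<Rightarrow> real) \<Rightarrow> real \<Rightarrow> real" where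
  "g_VP l \<Phi> y = (if y \<le> 0 then 0 else
     c_VP l * (LINT \<eta>:{0..y}|lebesgue. \<Phi> \<eta> * (y - \<eta>) powr (l + 1/2)))"

definition g_RVP :: "real \<Rightarrow> (real \<Rightarrow> real) \<Rightarrow> real \<Rightarrow> real" where
  "g_RVP l \<Phi> y = (if y \<le> 0 then 0 else
     c_rel l * (LINT \<eta>:{0..y}|lebesgue.
       \<Phi> \<eta> * (1 + y - \<eta>) * ((1 + y - \<eta>)\<^sup>2 - 1) powr (l + 1/2)))"

definition g_EV :: "real \<Rightarrow> (real \<Rightarrow> real) \<Rightarrow> real \<Rightarrow> real" where
  "g_EV l \<Phi> y = (if y \<le> 0 then 0 else
     c_rel l * exp (3 * y) * (LINT \<eta>:{0..1 - exp (- y)}|lebesgue.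
       \<Phi> \<eta> * (1 - \<eta>)\<^sup>2 * (exp (2 * y) * (1 - \<eta>)\<^sup>2 - 1) powr (l + 1/2)))"

definition h_EV :: "real \<Rightarrow> (real \<Rightarrow> real) \<Rightarrow> real \<Rightarrow> real" where
  "h_EV l \<Phi> y = (if y \<le> 0 then 0 else
     d_rel l * exp y * (LINT \<eta>:{0..1 - exp (- y)}|lebesgue.
       \<Phi> \<eta> * (exp (2 * y) * (1 - \<eta>)\<^sup>2 - 1) powr (l + 3/2)))"

definition mass :: "real \<Rightarrow> (real \<Rightarrow> real) \<Rightarrow> (real \<Rightarrow> real) \<Rightarrow> real \<Rightarrow> real" where
  "mass l g y r = 4 * pi * (LINT s:{0..r}|lebesgue. s powr (2 * l + 2) * g (y s))"

(* Functions on [0,\<infinity>) are represented by functions on the reals whose values at negative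
   arguments are irrelevant; derivatives at 0 are one-sided. *)

definition has_C1_derivative :: "(real \<Rightarrow> real) \<Rightarrow> (real \<Rightarrow> real) \<Rightarrow> bool" where
  "has_C1_derivative y y' \<longleftrightarrow> continuous_on {0..} y' \<and>
     (\<forall>r\<ge>0. (y has_real_derivative y' r) (at r within {0..}))"

definition solves_reduced_newton ::
    "real \<Rightarrow> (real \<Rightarrow> real) \<Rightarrow> real \<Rightarrow> (real \<Rightarrow> real) \<Rightarrow> bool" where
  "solves_reduced_newton l g y0 y \<longleftrightarrow> y 0 = y0 \<and>
     (\<exists>y'. has_C1_derivative y y' \<and> y' 0 = 0 \<and>
        (\<forall>r>0. y' r = - mass l g y r / r\<^sup>2))"

definition solves_reduced_EV ::
    "real \<Rightarrow> (real \<Rightarrow> real) \<Rightarrow> (real \<Rightarrow> real) \<Rightarrow> real \<Rightarrow> (real \<Rightarrow> real) \<Rightarrow> bool" where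
  "solves_reduced_EV l g h y0 y \<longleftrightarrow> y 0 = y0 \<and>
     (\<forall>r>0. 2 * mass l g y r < r) \<and>
     (\<exists>y'. has_C1_derivative y y' \<and> y' 0 = 0 \<and>
        (\<forall>r>0. y' r = - (1 / (1 - 2 * mass l g y r / r)) *
           (mass l g y r / r\<^sup>2 + 4 * pi * r powr (1 + 2 * l) * h (y r))))"

subsection \<open>Particle distributions\<close>

definition angular_factor :: "real \<Rightarrow> real^3 \<Rightarrow> real^3 \<Rightarrow> real" where
  "angular_factor l x v = (if l = 0 then 1 else norm (cross3 x v) powr (2 * l))"

definition f_VP :: "real \<Rightarrow> (real \<Rightarrow> real) \<Rightarrow> (real \<Rightarrow> real) \<Rightarrow> real^3 \<Rightarrow> real^3 \<Rightarrow> real" where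
  "f_VP l \<Phi> y x v = \<Phi> (y (norm x) - (norm v)\<^sup>2 / 2) * angular_factor l x v"

definition f_RVP :: "real \<Rightarrow> (real \<Rightarrow> real) \<Rightarrow> (real \<Rightarrow> real) \<Rightarrow> real^3 \<Rightarrow> real^3 \<Rightarrow> real" where
  "f_RVP l \<Phi> y x v = \<Phi> (1 + y (norm x) - sqrt (1 + (norm v)\<^sup>2)) * angular_factor l x v"

definition f_EV :: "real \<Rightarrow> (real \<Rightarrow> real) \<Rightarrow> (real \<Rightarrow> real) \<Rightarrow> real^3 \<Rightarrow> real^3 \<Rightarrow> real" where
  "f_EV l \<Phi> y x v = \<Phi> (1 - exp (- y (norm x)) * sqrt (1 + (norm v)\<^sup>2)) * angular_factor l x v"

(* For l < 0 a distribution is only considered where x \<times> v \<noteq> 0. Consequently its velocity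
   integrals are only considered at x \<noteq> 0, because at x = 0 there is no admissible v. *)

definition phase_domain :: "real \<Rightarrow> ((real^3) \<times> (real^3)) set" where
  "phase_domain l = {(x, v). l < 0 \<longrightarrow> cross3 x v \<noteq> 0}"

definition position_domain :: "real \<Rightarrow> (real^3) set" where
  "position_domain l = {x. l < 0 \<longrightarrow> x \<noteq> 0}"

definition support_in_phase_space ::
    "real \<Rightarrow> (real^3 \<Rightarrow> real^3 \<Rightarrow> real) \<Rightarrow> ((real^3) \<times> (real^3)) set" where
  "support_in_phase_space l f = closure {(x, v). (x, v) \<in> phase_domain l \<and> f x v \<noteq> 0}"

definition spatial_support :: "real \<Rightarrow> (real^3 \<Rightarrow> real^3 \<Rightarrow> real) \<Rightarrow> (real^3) set" where
  "spatial_support l f = closure {x. \<exists>v. (x, v) \<in> phase_domain l \<and> f x v \<noteq> 0}"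

definition spherically_symmetric :: "real \<Rightarrow> (real^3 \<Rightarrow> real^3 \<Rightarrow> real) \<Rightarrow> bool" where
  "spherically_symmetric l f \<longleftrightarrow>
     (\<forall>A :: real^3^3. rotation_matrix A \<longrightarrow>
        (\<forall>(x, v) \<in> phase_domain l. f (A *v x) (A *v v) = f x v))"

subsection \<open>Density and radial pressure\<close>

(* The quotient x/|x| has no value at x = 0. There any unit vector may be taken: by spherical
   symmetry f(0,v) depends on |v| only, so the pressure integral does not depend on the choice. *)
definition radial_direction :: "real^3 \<Rightarrow> real^3" where
  "radial_direction x = (if x = 0 then axis 1 1 else x /\<^sub>R norm x)"

definition density_integrand :: "(real^3 \<Rightarrow> real^3 \<Rightarrow> real) \<Rightarrow> real^3 \<Rightarrow> real^3 \<Rightarrow> real" where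
  "density_integrand f x v = f x v"

definition energy_density_integrand :: "(real^3 \<Rightarrow> real^3 \<Rightarrow> real) \<Rightarrow> real^3 \<Rightarrow> real^3 \<Rightarrow> real" where
  "energy_density_integrand f x v = sqrt (1 + (norm v)\<^sup>2) * f x v"

definition pressure_integrand :: "(real^3 \<Rightarrow> real^3 \<Rightarrow> real) \<Rightarrow> real^3 \<Rightarrow> real^3 \<Rightarrow> real" where
  "pressure_integrand f x v = (radial_direction x \<bullet> v)\<^sup>2 * f x v"

definition rel_pressure_integrand :: "(real^3 \<Rightarrow> real^3 \<Rightarrow> real) \<Rightarrow> real^3 \<Rightarrow> real^3 \<Rightarrow> real" where
  "rel_pressure_integrand f x v =
     (radial_direction x \<bullet> v)\<^sup>2 * f x v / sqrt (1 + (norm v)\<^sup>2)"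

(* k is one of the four integrands above. *)
definition moment_exists ::
    "real \<Rightarrow> ((real^3 \<Rightarrow> real^3 \<Rightarrow> real) \<Rightarrow> real^3 \<Rightarrow> real^3 \<Rightarrow> real) \<Rightarrow>
     (real^3 \<Rightarrow> real^3 \<Rightarrow> real) \<Rightarrow> bool" where
  "moment_exists l k f \<longleftrightarrow> (\<forall>x \<in> position_domain l. integrable lebesgue (k f x))"

definition moment ::
    "((real^3 \<Rightarrow> real^3 \<Rightarrow> real) \<Rightarrow> real^3 \<Rightarrow> real^3 \<Rightarrow> real) \<Rightarrow>
     (real^3 \<Rightarrow> real^3 \<Rightarrow> real) \<Rightarrow> real^3 \<Rightarrow> real" where
  "moment k f x = (LINT v|lebesgue. k f x v)"

subsection \<open>Differential operators and the Vlasov equation\<close>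

definition C1_on :: "(real^3) set \<Rightarrow> (real^3 \<Rightarrow> 'b::real_normed_vector) \<Rightarrow> bool" where
  "C1_on S F \<longleftrightarrow> (\<exists>F' :: real^3 \<Rightarrow> (real^3) \<Rightarrow>\<^sub>L 'b.
     (\<forall>x\<in>S. (F has_derivative blinfun_apply (F' x)) (at x)) \<and> continuous_on S F')"

definition grad :: "(real^3 \<Rightarrow> real) \<Rightarrow> real^3 \<Rightarrow> real^3" where
  "grad U x = (\<chi> i. frechet_derivative U (at x) (axis i 1))"

definition laplacian :: "(real^3 \<Rightarrow> real) \<Rightarrow> real^3 \<Rightarrow> real" where
  "laplacian U x = (\<Sum>i\<in>UNIV. frechet_derivative (\<lambda>z. grad U z $ i) (at x) (axis i 1))"

definition constant_along_characteristics ::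
    "((real^3) \<times> (real^3)) set \<Rightarrow> (real^3 \<Rightarrow> real^3 \<Rightarrow> real^3) \<Rightarrow> (real^3 \<Rightarrow> real^3 \<Rightarrow> real^3) \<Rightarrow>
     (real^3 \<Rightarrow> real^3 \<Rightarrow> real) \<Rightarrow> bool" where
  "constant_along_characteristics D a b f \<longleftrightarrow>
     (\<forall>(I :: real set) X V. is_interval I \<longrightarrow>
        (\<forall>t\<in>I. (X t, V t) \<in> D \<and>
           (X has_vector_derivative a (X t) (V t)) (at t within I) \<and>
           (V has_vector_derivative b (X t) (V t)) (at t within I)) \<longrightarrow>
        (\<forall>s\<in>I. \<forall>t\<in>I. f (X s) (V s) = f (X t) (V t)))"

subsection \<open>The static systems\<close>

(* For l < 0 the density is unbounded at the origin and the Poisson equation holds classically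
   away from the origin. As U is required to be C^1 on the whole space, there is no point mass at
   the origin, and for locally integrable \<rho> the equation then holds on the whole space in the sense
   of distributions. *)
definition solves_Poisson :: "real \<Rightarrow> (real^3 \<Rightarrow> real) \<Rightarrow> (real^3 \<Rightarrow> real) \<Rightarrow> bool" where
  "solves_Poisson l \<rho> U \<longleftrightarrow>
     C1_on UNIV U \<and> C1_on (position_domain l) (grad U) \<and>
     (\<forall>x \<in> position_domain l. laplacian U x = 4 * pi * \<rho> x) \<and>
     (U \<longlongrightarrow> 0) at_infinity"

definition static_solution_VP ::
    "real \<Rightarrow> (real^3 \<Rightarrow> real^3 \<Rightarrow> real) \<Rightarrow> (real^3 \<Rightarrow> real) \<Rightarrow> bool" where
  "static_solution_VP l f U \<longleftrightarrow>
     (\<forall>(x, v) \<in> phase_domain l. 0 \<le> f x v) \<and>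
     constant_along_characteristics (phase_domain l) (\<lambda>x v. v) (\<lambda>x v. - grad U x) f \<and>
     moment_exists l density_integrand f \<and>
     solves_Poisson l (moment density_integrand f) U"

definition static_solution_RVP ::
    "real \<Rightarrow> (real^3 \<Rightarrow> real^3 \<Rightarrow> real) \<Rightarrow> (real^3 \<Rightarrow> real) \<Rightarrow> bool" where
  "static_solution_RVP l f U \<longleftrightarrow>
     (\<forall>(x, v) \<in> phase_domain l. 0 \<le> f x v) \<and>
     constant_along_characteristics (phase_domain l)
       (\<lambda>x v. v /\<^sub>R sqrt (1 + (norm v)\<^sup>2)) (\<lambda>x v. - grad U x) f \<and>
     moment_exists l density_integrand f \<and>
     solves_Poisson l (moment density_integrand f) U"

(* At x = 0 the force term evaluates to 0, which is its limit there if \<mu>'(0) = 0. *)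
definition static_solution_EV ::
    "real \<Rightarrow> (real^3 \<Rightarrow> real^3 \<Rightarrow> real) \<Rightarrow> (real \<Rightarrow> real) \<Rightarrow> (real \<Rightarrow> real) \<Rightarrow> bool" where
  "static_solution_EV l f \<mu> lam \<longleftrightarrow>
     (\<forall>(x, v) \<in> phase_domain l. 0 \<le> f x v) \<and>
     (\<exists>\<mu>' lam'. has_C1_derivative \<mu> \<mu>' \<and> \<mu>' 0 = 0 \<and> has_C1_derivative lam lam' \<and>
       constant_along_characteristics (phase_domain l)
         (\<lambda>x v. v /\<^sub>R sqrt (1 + (norm v)\<^sup>2))
         (\<lambda>x v. - (sqrt (1 + (norm v)\<^sup>2) * \<mu>' (norm x)) *\<^sub>R (x /\<^sub>R norm x)) f \<and>
       moment_exists l energy_density_integrand f \<and>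
       moment_exists l rel_pressure_integrand f \<and>
       (\<forall>x. x \<noteq> 0 \<longrightarrow>
          exp (- 2 * lam (norm x)) * (2 * norm x * lam' (norm x) - 1) + 1 =
            8 * pi * (norm x)\<^sup>2 * moment energy_density_integrand f x \<and>
          exp (- 2 * lam (norm x)) * (2 * norm x * \<mu>' (norm x) + 1) - 1 =
            8 * pi * (norm x)\<^sup>2 * moment rel_pressure_integrand f x)) \<and>
     (\<mu> \<longlongrightarrow> 0) at_top \<and> (lam \<longlongrightarrow> 0) at_top \<and> lam 0 = 0"

subsection \<open>Regularity of the induced density and pressure\<close>

(* In all three models \<rho> and p have the form |x|^(2l) G(|x|) with G continuous and G(0) > 0. At the
   origin this is continuous only if l \<ge> 0, and C^1 only if l = 0 or l > 1/2. The smoothness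
   claims at the origin are therefore made for exactly these l. *)

definition C1_domain :: "real \<Rightarrow> (real^3) set" where
  "C1_domain l = {x. l = 0 \<or> 1/2 < l \<or> x \<noteq> 0}"

end

theory Submission
  imports Defs
begin

text \<open>
  The three reduced equations are the cases \<open>a = 0\<close> (with \<open>h = 0\<close>) and \<open>a = 1\<close> of
  \<open>y' = - (m / r\<^sup>2 + 4 \<pi> r powr (1 + 2 l) h y) / (1 - 2 a m / r)\<close>. As long as \<open>y\<close> is positive, a contraction
  argument with clamped right-hand side extends the solution. The lower bound on \<open>\<Phi>\<close> gives
  \<open>g y \<ge> b y powr q\<close> with \<open>1 < q < 2 l + 3\<close>, hence \<open>y powr (1 - q) \<ge> C r powr (2 l + 2)\<close>, while a positive
  solution satisfies \<open>y \<ge> c / r\<close>; the two bounds are incompatible for large \<open>r\<close>, so \<open>y\<close> reaches \<open>0\<close> at a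
  finite radius unless \<open>1 - 2 m / r\<close> degenerates before. The latter is excluded by the
  Tolman-Oppenheimer-Volkov equation. Outside this radius the solution is explicit.

  The velocity integrals of a function of the particle energy times \<open>|x \<times> v|\<close> to the power \<open>2 l\<close> are
  convolutions of the energy profile with an explicit kernel. The constants are found by testing with
  a Gaussian. These convolutions are \<open>C\<^sup>1\<close> on the positive half-line, which gives the regularity of
  \<open>\<rho>\<close>, \<open>p\<close> and of the right-hand side of the reduced equation. For the Einstein-Vlasov system the energy
  is taken logarithmically, so that \<open>g\<close> and \<open>h\<close> are convolutions as well and \<open>h' = g + h\<close>.
\<close>

section \<open>Volterra integral equations\<close>

text \<open>Near \<open>y = 0\<close> the function \<open>g\<close> need not be Lipschitz, since
  \<Phi> may be singular at \<open>0\<close>. Fixed point arguments therefore work only while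
  \<open>y\<close> is bounded away from \<open>0\<close>, and this is the reason for the clamping.
  Passing the zero needs no Lipschitz bound: every solution is nonincreasing, so once it has reached
  \<open>0\<close> it meets only \<open>g = h = 0\<close>. The finite radius is an exponent count.
  The first bound says that \<open>y\<close> decays at least like
  \<open>r powr (- (2*l+2) / (q-1))\<close>, which is faster than \<open>1 / r\<close> exactly when
  \<open>q < 2*l+3\<close>. The convolution estimate produces \<open>q = k + l + 3/2\<close>, so
  this is the hypothesis \<open>k < l + 3/2\<close>. In the velocity integrals the profile and the
  derivative of the kernel may both be singular at \<open>0\<close>. In
  \<open>\<Psi> z * k' (y - z)\<close> these singularities sit at the opposite ends
  \<open>z = 0\<close> and \<open>z = y\<close>; they are separated exactly when
  \<open>y > 0\<close>, and so differentiability is obtained for positive \<open>y\<close>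
  only.\<close>

lemma volterra_contraction:
  fixes F :: "(real \<Rightarrow> real) \<Rightarrow> real \<Rightarrow> real"
  assumes L: "0 \<le> L" and r: "r \<in> {0..T}"
    and cont: "\<And>y. continuous_on {0..T} y \<Longrightarrow> continuous_on {0..T} (F y)"
    and lip: "\<And>y z s B. continuous_on {0..T} y \<Longrightarrow> continuous_on {0..T} z \<Longrightarrow> s \<in> {0..T} \<Longrightarrow>
        (\<And>t. t \<in> {0..s} \<Longrightarrow> \<bar>y t - z t\<bar> \<le> B) \<Longrightarrow> \<bar>F y s - F z s\<bar> \<le> L * B"
    and y: "continuous_on {0..T} y" and z: "continuous_on {0..T} z" and N: "0 \<le> N"
    and bd: "\<And>t. t \<in> {0..T} \<Longrightarrow> \<bar>y t - z t\<bar> \<le> N * exp ((2*L+1) * t)"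
  shows "\<bar>integral {0..r} (F y) - integral {0..r} (F z)\<bar> \<le> N / 2 * exp ((2*L+1) * r)"
proof -
  \<comment> \<open>In the norm weighted by \<open>exp (- a * t)\<close> the integral operator gains
    the factor \<open>L / a\<close>, at most \<open>1/2\<close>. The summand \<open>1\<close> keeps
    \<open>a\<close> positive when \<open>L = 0\<close>.\<close>
  define a where "a = 2*L+1"
  have a: "a > 0" "2*L \<le> a" using L by (auto simp: a_def)
  have sub: "{0..r} \<subseteq> {0..T}" using r by auto
  have iy: "F y integrable_on {0..r}" and iz: "F z integrable_on {0..r}"
    using cont[OF y] cont[OF z] continuous_on_subset[OF _ sub] integrable_continuous_real by blast+
  have ex: "((\<lambda>s. L * (N * exp (a * s))) has_integral (L*N/a * exp (a*r) - L*N/a * exp (a*0))) {0..r}"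
    by (rule fundamental_theorem_of_calculus)
       (use r a in \<open>auto simp flip: has_real_derivative_iff_has_vector_derivative
          intro!: derivative_eq_intros simp: field_simps\<close>)
  have pw: "\<bar>F y s - F z s\<bar> \<le> L * (N * exp (a * s))" if "s \<in> {0..r}" for s
  proof (rule lip[OF y z])
    show "s \<in> {0..T}" using that r by auto
    fix t assume t: "t \<in> {0..s}"
    have "\<bar>y t - z t\<bar> \<le> N * exp (a * t)" using bd[of t] t that r by (auto simp: a_def)
    also have "\<dots> \<le> N * exp (a * s)"
      using t N a by (intro mult_left_mono) auto
    finally show "\<bar>y t - z t\<bar> \<le> N * exp (a * s)" .
  qed
  have d: "integral {0..r} (F y) - integral {0..r} (F z) = integral {0..r} (\<lambda>s. F y s - F z s)"
    using iy iz by (simp add: integral_diff)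
  have "norm (integral {0..r} (\<lambda>s. F y s - F z s)) \<le> integral {0..r} (\<lambda>s. L * (N * exp (a * s)))"
    using pw by (intro integral_norm_bound_integral integrable_diff iy iz has_integral_integrable[OF ex]) auto
  also have "\<dots> \<le> L*N/a * exp (a * r)"
    using integral_unique[OF ex] a L N by simp
  also have "L*N/a \<le> N/2" using a N mult_right_mono[OF a(2) N] by (simp add: field_simps)
  then have "L*N/a * exp (a * r) \<le> N/2 * exp (a * r)" by (intro mult_right_mono) auto
  finally show ?thesis unfolding d a_def by simp
qed

text \<open>Banach's theorem is applied to \<open>u s = exp (- a * s) * y s\<close>, so that the
  plain sup distance of \<open>u\<close> is the weighted distance of \<open>y\<close>. The
  hypothesis \<open>lip\<close> lets \<open>F\<close> at \<open>s\<close> depend on the history of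
  its argument on \<open>{0..s}\<close>, as the mass function does.\<close>

lemma volterra_exists:
  fixes F :: "(real \<Rightarrow> real) \<Rightarrow> real \<Rightarrow> real"
  assumes T: "0 \<le> T" and L: "0 \<le> L"
    and cont: "\<And>y. continuous_on {0..T} y \<Longrightarrow> continuous_on {0..T} (F y)"
    and lip: "\<And>y z s B. continuous_on {0..T} y \<Longrightarrow> continuous_on {0..T} z \<Longrightarrow> s \<in> {0..T} \<Longrightarrow>
        (\<And>t. t \<in> {0..s} \<Longrightarrow> \<bar>y t - z t\<bar> \<le> B) \<Longrightarrow> \<bar>F y s - F z s\<bar> \<le> L * B"
  shows "\<exists>y. continuous_on {0..T} y \<and> (\<forall>r\<in>{0..T}. y r = y0 + integral {0..r} (F y))"
proof -
  define a where "a = 2*L+1"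
  \<comment> \<open>The complete space used consists of bounded continuous functions on the whole
    line; freezing the argument outside \<open>{0..T}\<close> embeds the problem there.\<close>
  define cl where "cl = (\<lambda>r. max 0 (min T r))"
  have clT: "cl r \<in> {0..T}" for r using T by (auto simp: cl_def)
  have clid: "cl r = r" if "r \<in> {0..T}" for r using that by (auto simp: cl_def)
  have clc: "continuous_on UNIV cl" unfolding cl_def by (intro continuous_intros)
  define w where "w = (\<lambda>(u::real \<Rightarrow>\<^sub>C real) s. exp (a * s) * u s)"
  have wc: "continuous_on S (w u)" for u S unfolding w_def by (intro continuous_intros) auto
  define P where "P = (\<lambda>u r. exp (- (a * cl r)) * (y0 + integral {0..cl r} (F (w u))))"
  have Pb: "P u \<in> bcontfun" for u
  proof -
    define J where "J = (\<lambda>r. exp (- (a * r)) * (y0 + integral {0..r} (F (w u))))"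
    have Jc: "continuous_on {0..T} J"
      unfolding J_def by (intro continuous_intros indefinite_integral_continuous_1
          integrable_continuous_real cont wc)
    have PJ: "P u = (\<lambda>r. J (cl r))" by (simp add: P_def J_def)
    have "continuous_on UNIV (P u)"
      unfolding PJ by (rule continuous_on_compose2[OF Jc clc]) (use clT in auto)
    moreover have "bounded (J ` {0..T})"
      using compact_continuous_image[OF Jc] compact_imp_bounded by blast
    then have "bounded (range (P u))"
      by (rule bounded_subset) (use clT in \<open>auto simp: PJ\<close>)
    ultimately show ?thesis by (simp add: bcontfun_def)
  qed
  define Op where "Op = (\<lambda>u. Bcontfun (P u))"
  have Op: "apply_bcontfun (Op u) = P u" for u unfolding Op_def using Pb by (simp add: Bcontfun_inverse)
  have "dist (Op u) (Op v) \<le> 1/2 * dist u v" for u v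
  proof (rule dist_bound)
    fix r
    have "\<bar>integral {0..cl r} (F (w u)) - integral {0..cl r} (F (w v))\<bar> \<le> dist u v / 2 * exp (a * cl r)"
      unfolding a_def
    proof (intro volterra_contraction[OF L clT cont lip wc wc zero_le_dist])
      fix t
      have "\<bar>w u t - w v t\<bar> = exp ((2*L+1) * t) * dist (u t) (v t)"
        unfolding w_def a_def dist_real_def right_diff_distrib[symmetric] by (simp add: abs_mult)
      also have "\<dots> \<le> exp ((2*L+1) * t) * dist u v"
        by (intro mult_left_mono dist_bounded) auto
      finally show "\<bar>w u t - w v t\<bar> \<le> dist u v * exp ((2*L+1) * t)" by (simp add: mult.commute)
    qed
    moreover have "dist (Op u r) (Op v r) =
       exp (- (a * cl r)) * \<bar>integral {0..cl r} (F (w u)) - integral {0..cl r} (F (w v))\<bar>"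
      unfolding Op P_def dist_real_def right_diff_distrib[symmetric] by (simp add: abs_mult)
    ultimately have "dist (Op u r) (Op v r) \<le> exp (- (a * cl r)) * (dist u v / 2 * exp (a * cl r))"
      by (simp add: mult_left_mono)
    then show "dist (Op u r) (Op v r) \<le> 1/2 * dist u v" by (simp add: exp_minus field_simps)
  qed
  then obtain u where u: "Op u = u" using banach_fix_type[of "1/2" Op] by auto
  have "w u r = y0 + integral {0..r} (F (w u))" if "r \<in> {0..T}" for r
  proof -
    have "u r = exp (- (a * r)) * (y0 + integral {0..r} (F (w u)))"
      using fun_cong[OF Op[of u], of r] by (simp add: u P_def clid[OF that])
    then show ?thesis by (simp add: w_def exp_minus field_simps)
  qed
  with wc show ?thesis by blast
qed

text \<open>At a maximum point \<open>x\<close> of the weighted distance \<open>D\<close> the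
  contraction estimate gives \<open>D x \<le> D x / 2\<close>, so the distance vanishes
  everywhere.\<close>

lemma volterra_unique:
  fixes F :: "(real \<Rightarrow> real) \<Rightarrow> real \<Rightarrow> real"
  assumes L: "0 \<le> L"
    and cont: "\<And>y. continuous_on {0..T} y \<Longrightarrow> continuous_on {0..T} (F y)"
    and lip: "\<And>y z s B. continuous_on {0..T} y \<Longrightarrow> continuous_on {0..T} z \<Longrightarrow> s \<in> {0..T} \<Longrightarrow>
        (\<And>t. t \<in> {0..s} \<Longrightarrow> \<bar>y t - z t\<bar> \<le> B) \<Longrightarrow> \<bar>F y s - F z s\<bar> \<le> L * B"
    and y: "continuous_on {0..T} y" "\<And>r. r \<in> {0..T} \<Longrightarrow> y r = y0 + integral {0..r} (F y)"
    and z: "continuous_on {0..T} z" "\<And>r. r \<in> {0..T} \<Longrightarrow> z r = y0 + integral {0..r} (F z)"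
    and r: "r \<in> {0..T}"
  shows "y r = z r"
proof -
  define a where "a = 2*L+1"
  define D where "D = (\<lambda>t. exp (- (a*t)) * \<bar>y t - z t\<bar>)"
  have "continuous_on {0..T} D" unfolding D_def using y z by (intro continuous_intros) auto
  then obtain x where x: "x \<in> {0..T}" and mx: "\<And>t. t \<in> {0..T} \<Longrightarrow> D t \<le> D x"
    using continuous_attains_sup[of "{0..T}" D] r by auto
  have "\<bar>y t - z t\<bar> \<le> D x * exp (a * t)" if "t \<in> {0..T}" for t
    using mx[OF that] by (simp add: D_def exp_minus field_simps)
  then have "\<bar>integral {0..x} (F y) - integral {0..x} (F z)\<bar> \<le> D x / 2 * exp (a * x)"
    unfolding a_def by (intro volterra_contraction[OF L x cont lip y(1) z(1)]) (auto simp: D_def)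
  then have "\<bar>y x - z x\<bar> \<le> D x / 2 * exp (a * x)" using y(2)[OF x] z(2)[OF x] by simp
  then have "D x \<le> D x / 2" by (simp add: D_def exp_minus field_simps)
  then have "D x \<le> 0" by simp
  then have "D r \<le> 0" using mx[OF r] by simp
  then show ?thesis by (simp add: D_def mult_le_0_iff)
qed

section \<open>The mass function\<close>

text \<open>The bound forces \<open>G 0 = 0\<close>, because \<open>0 powr p = 0\<close>, and
  squeezes \<open>G\<close> near \<open>0\<close>. It serves for quotients such as
  \<open>m / r\<^sup>2\<close>, whose default value \<open>0\<close> at \<open>r = 0\<close> is
  thereby shown to be their limit.\<close>

lemma continuous_on_0_powr_bound:
  fixes G :: "real \<Rightarrow> real"
  assumes c: "continuous_on {0<..T} G" and p: "0 < p"
    and b: "\<And>s. s \<in> {0..T} \<Longrightarrow> \<bar>G s\<bar> \<le> C * s powr p"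
  shows "continuous_on {0..T} G"
  unfolding continuous_on_eq_continuous_within
proof
  fix x assume x: "x \<in> {0..T}"
  show "continuous (at x within {0..T}) G"
  proof (cases "x = 0")
    case True
    have G0: "G 0 = 0" using b[of 0] x True by simp
    have "((\<lambda>s. C * s powr p) \<longlongrightarrow> C * 0 powr p) (at 0 within {0..T})"
      by (intro tendsto_intros tendsto_powr2) (use p in \<open>auto simp: eventually_at_filter\<close>)
    then have "((\<lambda>s. C * s powr p) \<longlongrightarrow> 0) (at 0 within {0..T})" using p by simp
    moreover have "eventually (\<lambda>s. norm (G s) \<le> C * s powr p) (at 0 within {0..T})"
      using b by (auto simp: eventually_at_filter)
    ultimately have "(G \<longlongrightarrow> 0) (at 0 within {0..T})" by (rule Lim_null_comparison[rotated])
    then show ?thesis using True G0 by (simp add: continuous_within)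
  next
    case False
    then have "x \<in> {0<..T}" using x by auto
    then have "continuous (at x within {0<..T}) G" using c by (simp add: continuous_on_eq_continuous_within)
    moreover have "at x within {0<..T} = at x within {0..T}"
      using \<open>x \<in> {0<..T}\<close> by (intro at_within_nhd[of _ "{0<..}"]) auto
    ultimately show ?thesis by simp
  qed
qed

locale radial_weight =
  fixes l :: real
  assumes l: "l > - 1/2"
begin

text \<open>The mass inside radius \<open>r\<close> when \<open>g\<close> is the constant
  \<open>1\<close>; all mass estimates are multiples of it.\<close>

definition w :: "real \<Rightarrow> real" where "w r = 4 * pi / (2*l+3) * r powr (2*l+3)"

lemma w_div: assumes "0 < r" shows "w r / r = 4*pi/(2*l+3) * r powr (2*l+2)"
   "w r / r\<^sup>2 = 4*pi/(2*l+3) * r powr (2*l+1)"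
proof -
  have "2*l+3 = (2*l+2)+1" "2*l+3 = (2*l+1)+2" by auto
  then have "r powr (2*l+3) = r powr (2*l+2) * r" "r powr (2*l+3) = r powr (2*l+1) * r\<^sup>2"
    using assms powr_add[of r "2*l+2" 1] powr_add[of r "2*l+1" 2] by (simp_all add: add.commute)
  then show "w r / r = 4*pi/(2*l+3) * r powr (2*l+2)" "w r / r\<^sup>2 = 4*pi/(2*l+3) * r powr (2*l+1)"
    unfolding w_def using assms l by (auto simp: divide_simps)
qed

lemma integrand_continuous:
  assumes "continuous_on UNIV g" "continuous_on {0..T} y"
  shows "continuous_on {0..T} (\<lambda>s. s powr (2*l+2) * g (y s))"
  using l by (intro continuous_intros continuous_on_powr' continuous_on_compose2[OF assms(1)] assms(2)) auto

lemma mass_eq_integral: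
  assumes "continuous_on UNIV g" "continuous_on {0..r} y"
  shows "mass l g y r = 4 * pi * integral {0..r} (\<lambda>s. s powr (2*l+2) * g (y s))"
proof -
  have "set_integrable lebesgue {0..r} (\<lambda>s. s powr (2*l+2) * g (y s))"
    by (rule absolutely_integrable_continuous_real[OF integrand_continuous[OF assms]])
  then show ?thesis unfolding mass_def by (simp add: set_lebesgue_integral_eq_integral)
qed

lemma mass_cong:
  assumes "\<And>s. s \<in> {0..r} \<Longrightarrow> g (y s) = g' (z s)"
  shows "mass l g y r = mass l g' z r"
  unfolding mass_def set_lebesgue_integral_def
  by (intro arg_cong2[where f="(*)"] refl Bochner_Integration.integral_cong) (auto simp: indicator_def assms)

lemma has_integral_powr: "0 \<le> r \<Longrightarrow> ((\<lambda>s. s powr (2*l+2)) has_integral r powr (2*l+3) / (2*l+3)) {0..r}"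
  using has_integral_powr_from_0[of "2*l+2" r] l by (simp add: add.commute)

lemma mass_diff:
  assumes g: "continuous_on UNIV g" "continuous_on {0..r} y" and g': "continuous_on UNIV g'" "continuous_on {0..r} z"
    and r: "0 \<le> r" and b: "\<And>s. s \<in> {0..r} \<Longrightarrow> \<bar>g (y s) - g' (z s)\<bar> \<le> B"
  shows "\<bar>mass l g y r - mass l g' z r\<bar> \<le> w r * B"
proof -
  let ?f = "\<lambda>s. s powr (2*l+2) * g (y s)" and ?h = "\<lambda>s. s powr (2*l+2) * g' (z s)"
  have i: "?f integrable_on {0..r}" "?h integrable_on {0..r}"
    by (intro integrable_continuous_real integrand_continuous assms)+
  have P: "((\<lambda>s. s powr (2*l+2) * B) has_integral (r powr (2*l+3) / (2*l+3) * B)) {0..r}"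
    using has_integral_powr[OF r] by (rule has_integral_mult_left)
  have "norm (integral {0..r} (\<lambda>s. ?f s - ?h s)) \<le> integral {0..r} (\<lambda>s. s powr (2*l+2) * B)"
    using b by (intro integral_norm_bound_integral integrable_diff i has_integral_integrable[OF P])
       (auto simp: abs_mult intro!: mult_left_mono simp flip: right_diff_distrib)
  also have "\<dots> = r powr (2*l+3) / (2*l+3) * B" by (rule integral_unique[OF P])
  finally have "\<bar>integral {0..r} ?f - integral {0..r} ?h\<bar> \<le> r powr (2*l+3) / (2*l+3) * B"
    using i by (simp add: integral_diff)
  then have "4*pi*\<bar>integral {0..r} ?f - integral {0..r} ?h\<bar> \<le> 4*pi*(r powr (2*l+3) / (2*l+3) * B)"
    by (intro mult_left_mono) auto
  then show ?thesis
    by (simp add: mass_eq_integral[OF g] mass_eq_integral[OF g'] w_def abs_mult mult.assoc flip: right_diff_distrib)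
qed

lemma mass_zero: "mass l (\<lambda>_. 0) y r = 0"
  by (simp add: mass_def set_lebesgue_integral_def)

lemma mass_abs_le:
  assumes g: "continuous_on UNIV g" "continuous_on {0..r} y" and r: "0 \<le> r" and b: "\<And>s. s \<in> {0..r} \<Longrightarrow> \<bar>g (y s)\<bar> \<le> B"
  shows "\<bar>mass l g y r\<bar> \<le> w r * B"
  using mass_diff[OF g, of "\<lambda>_. 0" y B] g r b by (simp add: mass_zero)

lemma mass_ge:
  assumes g: "continuous_on UNIV g" "continuous_on {0..r} y" and r: "0 \<le> r" and b: "\<And>s. s \<in> {0..r} \<Longrightarrow> B \<le> g (y s)"
  shows "w r * B \<le> mass l g y r"
proof -
  let ?f = "\<lambda>s. s powr (2*l+2) * g (y s)"
  have i: "?f integrable_on {0..r}"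
    by (intro integrable_continuous_real integrand_continuous assms)
  have P: "((\<lambda>s. s powr (2*l+2) * B) has_integral (r powr (2*l+3) / (2*l+3) * B)) {0..r}"
    using has_integral_powr[OF r] by (rule has_integral_mult_left)
  have "integral {0..r} (\<lambda>s. s powr (2*l+2) * B) \<le> integral {0..r} ?f"
    using b by (intro integral_le i has_integral_integrable[OF P]) (auto intro!: mult_left_mono)
  then have "4*pi*(r powr (2*l+3) / (2*l+3) * B) \<le> 4*pi*integral {0..r} ?f"
    using integral_unique[OF P] by (intro mult_left_mono) auto
  then show ?thesis by (simp add: mass_eq_integral[OF g] w_def)
qed

lemma mass_0: "mass l g y 0 = 0"
proof -
  have "(LINT s:{0}|lebesgue. f s) = 0" for f :: "real \<Rightarrow> real"
    unfolding set_lebesgue_integral_def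
    by (intro integral_eq_zero_AE AE_I[where N="{0}"]) (auto simp: indicator_def)
  then show ?thesis by (simp add: mass_def)
qed

lemma mass_derivative:
  assumes g: "continuous_on UNIV g" "continuous_on {0..T} y" and r: "r \<in> {0..T}"
  shows "(mass l g y has_real_derivative 4*pi*(r powr (2*l+2) * g (y r))) (at r within {0..T})"
proof -
  have "((\<lambda>r. 4*pi*integral {0..r} (\<lambda>s. s powr (2*l+2) * g (y s))) has_real_derivative 4*pi*(r powr (2*l+2) * g (y r))) (at r within {0..T})"
    by (intro DERIV_cmult integral_has_real_derivative[OF integrand_continuous[OF g] r])
  moreover have "mass l g y x = 4*pi*integral {0..x} (\<lambda>s. s powr (2*l+2) * g (y s))" if "x \<in> {0..T}" for x
    using that by (intro mass_eq_integral g(1) continuous_on_subset[OF g(2)]) auto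
  ultimately show ?thesis
    using has_field_derivative_transform_within[OF _ zero_less_one r, of _ _ "mass l g y"] by simp
qed

lemma mass_continuous:
  assumes g: "continuous_on UNIV g" "continuous_on {0..T} y"
  shows "continuous_on {0..T} (mass l g y)"
  using DERIV_continuous[OF mass_derivative[OF g]] by (simp add: continuous_on_eq_continuous_within)

lemma bounded_on_path:
  fixes g y :: "real \<Rightarrow> real"
  assumes g: "continuous_on UNIV g" "continuous_on {0..T} y"
  obtains B where "0 \<le> B" "\<And>s. s \<in> {0..T} \<Longrightarrow> \<bar>g (y s)\<bar> \<le> B"
proof -
  have "continuous_on {0..T} (\<lambda>s. g (y s))" by (rule continuous_on_compose2[OF g]) auto
  then have "bounded ((\<lambda>s. g (y s)) ` {0..T})" using compact_continuous_image compact_imp_bounded by blast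
  then obtain B where "0 < B" "\<And>s. s \<in> {0..T} \<Longrightarrow> \<bar>g (y s)\<bar> \<le> B" by (force simp: bounded_pos)
  then show ?thesis using that[of B] by auto
qed

text \<open>Here \<open>l > - 1/2\<close> enters: the mass is at most a multiple of
  \<open>r powr (2*l+3)\<close>, so the quotients are bounded by powers with the positive exponents
  \<open>2*l+2\<close> and \<open>2*l+1\<close>.\<close>

lemma mass_div_continuous:
  assumes g: "continuous_on UNIV g" "continuous_on {0..T} y"
  shows "continuous_on {0..T} (\<lambda>s. mass l g y s / s)" "continuous_on {0..T} (\<lambda>s. mass l g y s / s\<^sup>2)"
proof -
  obtain B where B: "0 \<le> B" "\<And>s. s \<in> {0..T} \<Longrightarrow> \<bar>g (y s)\<bar> \<le> B" using bounded_on_path[OF g] by blast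
  have m: "\<bar>mass l g y s\<bar> \<le> w s * B" if "s \<in> {0..T}" for s
    using that by (intro mass_abs_le g(1) continuous_on_subset[OF g(2)] B) auto
  have c: "continuous_on {0<..T} (mass l g y)" by (rule continuous_on_subset[OF mass_continuous[OF g]]) auto
  have "\<bar>mass l g y s / s\<bar> \<le> (4*pi/(2*l+3) * B) * s powr (2*l+2)" if "s \<in> {0..T}" for s
  proof (cases "s = 0")
    case False
    then have s: "0 < s" using that by simp
    have "\<bar>mass l g y s / s\<bar> \<le> w s * B / s" using m[OF that] s by (simp add: divide_right_mono)
    also have "\<dots> = (w s / s) * B" by simp
    finally show ?thesis unfolding w_div[OF s] by (simp add: mult_ac)
  qed simp
  then show "continuous_on {0..T} (\<lambda>s. mass l g y s / s)"
    by (intro continuous_on_0_powr_bound[where p="2*l+2" and C="4*pi/(2*l+3) * B"] continuous_intros c) (use l in auto)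
  have "\<bar>mass l g y s / s\<^sup>2\<bar> \<le> (4*pi/(2*l+3) * B) * s powr (2*l+1)" if "s \<in> {0..T}" for s
  proof (cases "s = 0")
    case False
    then have s: "0 < s" using that by simp
    have "\<bar>mass l g y s / s\<^sup>2\<bar> \<le> w s * B / s\<^sup>2" using m[OF that] s by (simp add: divide_right_mono)
    also have "\<dots> = (w s / s\<^sup>2) * B" by simp
    finally show ?thesis unfolding w_div[OF s] by (simp add: mult_ac)
  qed simp
  then show "continuous_on {0..T} (\<lambda>s. mass l g y s / s\<^sup>2)"
    by (intro continuous_on_0_powr_bound[where p="2*l+1" and C="4*pi/(2*l+3) * B"] continuous_intros c) (use l in auto)
qed

end

section \<open>The reduced equation\<close>

lemma C1_imp_locally_lipschitz:
  fixes g g' :: "real \<Rightarrow> real"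
  assumes d: "\<And>y. 0 < y \<Longrightarrow> (g has_real_derivative g' y) (at y)" and c: "continuous_on {0<..} g'" and e: "0 < e"
  obtains L where "0 \<le> L" "\<And>y z. y \<in> {e..Y} \<Longrightarrow> z \<in> {e..Y} \<Longrightarrow> \<bar>g y - g z\<bar> \<le> L * \<bar>y - z\<bar>"
proof -
  have "bounded (g' ` {e..Y})"
    using e by (intro compact_imp_bounded compact_continuous_image continuous_on_subset[OF c]) auto
  then obtain L where L: "0 < L" "\<And>s. s \<in> {e..Y} \<Longrightarrow> \<bar>g' s\<bar> \<le> L" by (force simp: bounded_pos)
  have "norm (g y - g z) \<le> L * norm (y - z)" if "y \<in> {e..Y}" "z \<in> {e..Y}" for y z
    by (rule field_differentiable_bound[of "{e..Y}" g g'])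
       (use that e L(2) in \<open>auto intro: DERIV_subset[OF d]\<close>)
  then show ?thesis using that[of L] L(1) by auto
qed

text \<open>\<open>h_deriv\<close> covers both cases. For \<open>a = 0\<close> it makes
  \<open>h\<close> constant on the positive axis, hence \<open>0\<close> by continuity and
  \<open>h_0\<close>; for \<open>a = 1\<close> it is the relation behind the
  Tolman-Oppenheimer-Volkov equation. The derivative of \<open>g\<close> is continuous on
  \<open>{0<..}\<close> only and may blow up at \<open>0\<close>.\<close>

locale reduced = radial_weight l for l :: real +
  fixes a q y0 :: real and g g' h :: "real \<Rightarrow> real"
  assumes a: "a = 0 \<or> a = 1"
    and g_cont: "continuous_on UNIV g" and h_cont: "continuous_on UNIV h"
    and g_nonneg: "\<And>y. 0 \<le> g y" and h_nonneg: "\<And>y. 0 \<le> h y"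
    and g_0: "\<And>y. y \<le> 0 \<Longrightarrow> g y = 0" and h_0: "\<And>y. y \<le> 0 \<Longrightarrow> h y = 0"
    and g_deriv: "\<And>y. 0 < y \<Longrightarrow> (g has_real_derivative g' y) (at y)" and g'_cont: "continuous_on {0<..} g'"
    and h_deriv: "\<And>y. 0 < y \<Longrightarrow> (h has_real_derivative a * (g y + h y)) (at y)"
    and g_lower: "\<And>Y. 0 < Y \<Longrightarrow> \<exists>c>0. \<forall>y\<in>{0<..Y}. c * y powr q \<le> g y"
    and q: "1 < q" "q < 2*l+3"
    and y0: "0 < y0"
begin

definition D :: "(real \<Rightarrow> real) \<Rightarrow> real \<Rightarrow> real" where
  "D y s = 1 - 2 * a * mass l g y s / s"

definition rhs :: "(real \<Rightarrow> real) \<Rightarrow> real \<Rightarrow> real" where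
  "rhs y s = 1 / D y s * (mass l g y s / s\<^sup>2 + 4 * pi * s powr (1 + 2*l) * h (y s))"

text \<open>The integrated equation carries no sign condition, because the global solution becomes
  negative. \<open>sol\<close> adds positivity, the range in which \<open>g\<close> is locally
  Lipschitz. For negative \<open>T\<close> the interval is empty and both hold trivially.\<close>

definition isol :: "real \<Rightarrow> (real \<Rightarrow> real) \<Rightarrow> bool" where
  "isol T y \<longleftrightarrow> continuous_on {0..T} y \<and> (\<forall>r\<in>{0..T}. 0 < D y r \<and> y r = y0 - integral {0..r} (rhs y))"

definition sol :: "real \<Rightarrow> (real \<Rightarrow> real) \<Rightarrow> bool" where
  "sol T y \<longleftrightarrow> isol T y \<and> (\<forall>r\<in>{0..T}. 0 < y r)"

lemma mass_nonneg: "continuous_on {0..r} y \<Longrightarrow> 0 \<le> r \<Longrightarrow> 0 \<le> mass l g y r"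
  using mass_ge[OF g_cont, of r y 0] g_nonneg by auto

lemma mass_mono:
  assumes y: "continuous_on {0..t} y" and "0 \<le> r" "r \<le> t"
  shows "mass l g y r \<le> mass l g y t"
proof (rule DERIV_nonneg_imp_increasing_open[OF assms(3)])
  show "continuous_on {r..t} (mass l g y)"
    using assms by (intro continuous_on_subset[OF mass_continuous[OF g_cont y]]) auto
  fix x assume x: "r < x" "x < t"
  then have "(mass l g y has_real_derivative 4*pi*(x powr (2*l+2) * g (y x))) (at x)"
    using mass_derivative[OF g_cont y, of x] at_within_Icc_at[of 0 x t] assms by auto
  then show "\<exists>z. (mass l g y has_real_derivative z) (at x) \<and> 0 \<le> z" using g_nonneg by auto
qed

lemma D_le_1: "continuous_on {0..r} y \<Longrightarrow> 0 \<le> r \<Longrightarrow> D y r \<le> 1"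
  using mass_nonneg[of r y] a by (auto simp: D_def)

lemma D_continuous: "continuous_on {0..T} y \<Longrightarrow> continuous_on {0..T} (D y)"
  unfolding D_def times_divide_eq_right[symmetric]
  by (intro continuous_intros mass_div_continuous(1)[OF g_cont])

lemma rhs_continuous:
  assumes y: "continuous_on {0..T} y" and D: "\<And>r. r \<in> {0..T} \<Longrightarrow> 0 < D y r"
  shows "continuous_on {0..T} (rhs y)"
  unfolding rhs_def
  by (intro continuous_intros mass_div_continuous(2)[OF g_cont y] D_continuous y
      continuous_on_compose2[OF h_cont y] continuous_on_powr') (use D l in fastforce)+

text \<open>Because \<open>D \<le> 1\<close> and \<open>h \<ge> 0\<close>, the relativistic force
  dominates the Newtonian one. The estimates that bound the radius use the force through this
  inequality and so serve all three models.\<close>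

lemma rhs_ge:
  assumes y: "continuous_on {0..r} y" and D: "0 < D y r" and r: "0 \<le> r"
  shows "mass l g y r / r\<^sup>2 \<le> rhs y r"
proof -
  let ?N = "mass l g y r / r\<^sup>2 + 4 * pi * r powr (1 + 2*l) * h (y r)"
  have m: "0 \<le> mass l g y r" by (rule mass_nonneg[OF y r])
  have "mass l g y r / r\<^sup>2 \<le> ?N" using h_nonneg[of "y r"] by auto
  moreover have "0 \<le> ?N" using h_nonneg[of "y r"] m by auto
  then have "?N \<le> 1 / D y r * ?N"
    using mult_right_mono[of 1 "1 / D y r" ?N] D D_le_1[OF y r] by simp
  ultimately show ?thesis unfolding rhs_def by linarith
qed

lemma rhs_nonneg:
  assumes "continuous_on {0..r} y" "0 < D y r" "0 \<le> r"
  shows "0 \<le> rhs y r"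
  using rhs_ge[OF assms] mass_nonneg[OF assms(1,3)] by (meson divide_nonneg_nonneg order_trans zero_le_power2)

lemma isol_cont: "isol T y \<Longrightarrow> continuous_on {0..T} y"
  and isol_D: "isol T y \<Longrightarrow> r \<in> {0..T} \<Longrightarrow> 0 < D y r"
  and isol_eq: "isol T y \<Longrightarrow> r \<in> {0..T} \<Longrightarrow> y r = y0 - integral {0..r} (rhs y)"
  by (auto simp: isol_def)

lemma isol_sub: "isol T y \<Longrightarrow> S \<le> T \<Longrightarrow> isol S y"
  unfolding isol_def by (auto intro: continuous_on_subset)

lemma sol_sub: "sol T y \<Longrightarrow> S \<le> T \<Longrightarrow> sol S y"
  unfolding sol_def using isol_sub by auto

lemma D_cong: "(\<And>s. s \<in> {0..r} \<Longrightarrow> y s = z s) \<Longrightarrow> D y r = D z r"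
  unfolding D_def using mass_cong[of r g y g z] by simp

lemma rhs_cong: "(\<And>s. s \<in> {0..r} \<Longrightarrow> y s = z s) \<Longrightarrow> 0 \<le> r \<Longrightarrow> rhs y r = rhs z r"
  unfolding rhs_def using mass_cong[of r g y g z] D_cong[of r y z] by simp

lemma isol_cong:
  assumes y: "isol T y" and e: "\<And>s. s \<in> {0..T} \<Longrightarrow> y s = z s"
  shows "isol T z"
  unfolding isol_def
proof (intro conjI ballI)
  show "continuous_on {0..T} z" using continuous_on_cong[of "{0..T}" "{0..T}" y z] e isol_cont[OF y] by auto
  fix r assume r: "r \<in> {0..T}"
  show "0 < D z r" using D_cong[of r y z] e r isol_D[OF y r] by auto
  have "integral {0..r} (rhs y) = integral {0..r} (rhs z)"
    using e r by (intro integral_cong rhs_cong) auto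
  then show "z r = y0 - integral {0..r} (rhs z)" using isol_eq[OF y r] e[OF r] by simp
qed

lemma isol_deriv:
  assumes y: "isol T y" and r: "r \<in> {0..T}"
  shows "(y has_real_derivative - rhs y r) (at r within {0..T})"
proof -
  have "((\<lambda>r. y0 - integral {0..r} (rhs y)) has_real_derivative 0 - rhs y r) (at r within {0..T})"
    by (intro DERIV_diff DERIV_const integral_has_real_derivative rhs_continuous r)
       (use y in \<open>auto simp: isol_def\<close>)
  then have "((\<lambda>r. y0 - integral {0..r} (rhs y)) has_real_derivative - rhs y r) (at r within {0..T})" by simp
  then show ?thesis
    using has_field_derivative_transform_within[OF _ zero_less_one r, of _ _ y] isol_eq[OF y] by simp
qed

lemma isol_deriv_at:
  assumes y: "isol T y" and r: "r \<in> {0<..<T}"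
  shows "(y has_real_derivative - rhs y r) (at r)"
  using isol_deriv[OF y, of r] r at_within_Icc_at[of 0 r T] by auto

lemma isol_rhs_nonneg: "isol T y \<Longrightarrow> r \<in> {0..T} \<Longrightarrow> 0 \<le> rhs y r"
  by (rule rhs_nonneg) (auto simp: isol_def intro: continuous_on_subset)

lemma isol_antimono:
  assumes y: "isol T y" and "0 \<le> r" "r \<le> t" "t \<le> T"
  shows "y t \<le> y r"
proof (rule DERIV_nonpos_imp_decreasing_open[OF assms(3)])
  show "continuous_on {r..t} y"
    using assms by (intro continuous_on_subset[OF isol_cont[OF y]]) auto
  fix x assume x: "r < x" "x < t"
  then show "\<exists>z. (y has_real_derivative z) (at x) \<and> z \<le> 0"
    using isol_deriv_at[OF y, of x] isol_rhs_nonneg[OF y, of x] assms by auto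
qed

lemma isol_initial: "isol T y \<Longrightarrow> 0 \<le> T \<Longrightarrow> y 0 = y0"
  using isol_eq[of T y 0] by simp

lemma isol_le: "isol T y \<Longrightarrow> r \<in> {0..T} \<Longrightarrow> y r \<le> y0"
  using isol_antimono[of T y 0 r] isol_initial[of T y] by auto

section \<open>Local solutions by clamping\<close>

definition clamp_to :: "real \<Rightarrow> (real \<Rightarrow> real) \<Rightarrow> real \<Rightarrow> real" where
  "clamp_to e f y = f (max e (min y0 y))"

definition Dc :: "real \<Rightarrow> (real \<Rightarrow> real) \<Rightarrow> real \<Rightarrow> real" where
  "Dc e y s = 1 - 2 * a * (mass l (clamp_to e g) y s / s)"

text \<open>The clamps at \<open>e\<close> from below keep away from the singularity of
  \<open>g'\<close> at \<open>0\<close> and from a zero of \<open>D\<close>. The clamp at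
  \<open>y0\<close> from above makes \<open>g\<close> and \<open>h\<close> bounded and never acts on
  a solution, which decreases from \<open>y0\<close>.\<close>

definition rhsc :: "real \<Rightarrow> (real \<Rightarrow> real) \<Rightarrow> real \<Rightarrow> real" where
  "rhsc e y s = 1 / max e (Dc e y s) *
     (mass l (clamp_to e g) y s / s\<^sup>2 + 4 * pi * s powr (1 + 2*l) * clamp_to e h (y s))"

lemma clamp_to_cont: "continuous_on UNIV f \<Longrightarrow> continuous_on UNIV (clamp_to e f)"
  unfolding clamp_to_def by (rule continuous_on_compose2[of UNIV f]) (auto intro!: continuous_intros)

lemma Dc_cont: "continuous_on {0..T} y \<Longrightarrow> continuous_on {0..T} (Dc e y)"
  unfolding Dc_def by (intro continuous_intros mass_div_continuous(1)[OF clamp_to_cont[OF g_cont]])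

lemma rhsc_cont:
  assumes y: "continuous_on {0..T} y" and e: "0 < e"
  shows "continuous_on {0..T} (rhsc e y)"
  unfolding rhsc_def
  by (intro continuous_intros mass_div_continuous(2)[OF clamp_to_cont[OF g_cont] y] Dc_cont y
      continuous_on_compose2[OF clamp_to_cont[OF h_cont] y] continuous_on_powr') (use e l in fastforce)+

lemma rhsc_nonneg:
  assumes y: "continuous_on {0..r} y" and e: "0 < e" and r: "0 \<le> r"
  shows "0 \<le> rhsc e y r"
proof -
  have "0 \<le> mass l (clamp_to e g) y r"
    using mass_ge[OF clamp_to_cont[OF g_cont] y r, of 0] g_nonneg by (auto simp: clamp_to_def)
  then show ?thesis unfolding rhsc_def using e h_nonneg by (auto simp: clamp_to_def intro!: mult_nonneg_nonneg)
qed

lemma clamp_to_bounded_lipschitz: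
  fixes f f' :: "real \<Rightarrow> real"
  assumes d: "\<And>y. 0 < y \<Longrightarrow> (f has_real_derivative f' y) (at y)" and c: "continuous_on {0<..} f'"
    and e: "0 < e" "e \<le> y0" and fc: "continuous_on UNIV f"
  obtains L B where "0 \<le> L" "0 \<le> B" "\<And>y z. \<bar>clamp_to e f y - clamp_to e f z\<bar> \<le> L * \<bar>y - z\<bar>"
    "\<And>y. \<bar>clamp_to e f y\<bar> \<le> B"
proof -
  obtain L where L: "0 \<le> L" "\<And>y z. y \<in> {e..y0} \<Longrightarrow> z \<in> {e..y0} \<Longrightarrow> \<bar>f y - f z\<bar> \<le> L * \<bar>y - z\<bar>"
    using C1_imp_locally_lipschitz[OF d c e(1)] by blast
  have "bounded (f ` {e..y0})"
    using e by (intro compact_imp_bounded compact_continuous_image continuous_on_subset[OF fc]) auto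
  then obtain B where B: "0 < B" "\<And>s. s \<in> {e..y0} \<Longrightarrow> \<bar>f s\<bar> \<le> B" by (force simp: bounded_pos)
  have in_e: "max e (min y0 y) \<in> {e..y0}" for y using e by auto
  have "\<bar>clamp_to e f y - clamp_to e f z\<bar> \<le> L * \<bar>y - z\<bar>" for y z
  proof -
    have "\<bar>clamp_to e f y - clamp_to e f z\<bar> \<le> L * \<bar>max e (min y0 y) - max e (min y0 z)\<bar>"
      unfolding clamp_to_def by (rule L(2)[OF in_e in_e])
    also have "\<dots> \<le> L * \<bar>y - z\<bar>" using L(1) by (intro mult_left_mono) auto
    finally show ?thesis .
  qed
  moreover have "\<bar>clamp_to e f y\<bar> \<le> B" for y unfolding clamp_to_def by (rule B(2)[OF in_e])
  ultimately show ?thesis using that[of L B] L(1) B(1) by auto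
qed

lemma quotient_lipschitz:
  fixes A A' N N' :: real
  assumes e: "0 < e" "e \<le> A" "e \<le> A'" and N: "\<bar>N - N'\<bar> \<le> K2" "\<bar>N'\<bar> \<le> K1" and A: "\<bar>A - A'\<bar> \<le> K3"
  shows "\<bar>1 / A * N - 1 / A' * N'\<bar> \<le> K2 / e + K1 * K3 / e\<^sup>2"
proof -
  have "1 / A * N - 1 / A' * N' = (N - N') / A + N' * (A' - A) / (A * A')"
    using e by (simp add: field_simps)
  also have "\<bar>\<dots>\<bar> \<le> \<bar>(N - N') / A\<bar> + \<bar>N' * (A' - A) / (A * A')\<bar>" by (rule abs_triangle_ineq)
  also have "\<bar>(N - N') / A\<bar> = \<bar>N - N'\<bar> / A" using e by (simp add: abs_div)
  also have "\<dots> \<le> K2 / e" using e N by (intro frac_le) auto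
  also have "\<bar>N' * (A' - A) / (A * A')\<bar> = \<bar>N'\<bar> * \<bar>A - A'\<bar> / (A * A')"
    using e by (simp add: abs_mult abs_minus_commute)
  also have "\<dots> \<le> K1 * K3 / e\<^sup>2"
    using e N A by (intro frac_le mult_mono) (auto simp: power2_eq_square intro!: mult_mono)
  finally show ?thesis by simp
qed

lemma rhsc_lipschitz:
  assumes e: "0 < e" "e \<le> y0" and T: "0 \<le> T"
  obtains L where "0 \<le> L" "\<And>y z s B. continuous_on {0..T} y \<Longrightarrow> continuous_on {0..T} z \<Longrightarrow> s \<in> {0..T} \<Longrightarrow>
        (\<And>t. t \<in> {0..s} \<Longrightarrow> \<bar>y t - z t\<bar> \<le> B) \<Longrightarrow> \<bar>rhsc e y s - rhsc e z s\<bar> \<le> L * B"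
proof -
  let ?gc = "clamp_to e g" and ?hc = "clamp_to e h"
  obtain Lg G where g: "0 \<le> Lg" "0 \<le> G" "\<And>y z. \<bar>?gc y - ?gc z\<bar> \<le> Lg * \<bar>y - z\<bar>" "\<And>y. \<bar>?gc y\<bar> \<le> G"
    using clamp_to_bounded_lipschitz[OF g_deriv g'_cont e g_cont] by blast
  have "continuous_on {0<..} (\<lambda>y. a * (g y + h y))"
    by (intro continuous_intros continuous_on_subset[OF g_cont] continuous_on_subset[OF h_cont]) auto
  then obtain Lh H where h: "0 \<le> Lh" "0 \<le> H" "\<And>y z. \<bar>?hc y - ?hc z\<bar> \<le> Lh * \<bar>y - z\<bar>" "\<And>y. \<bar>?hc y\<bar> \<le> H"
    using clamp_to_bounded_lipschitz[OF h_deriv _ e h_cont] by blast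
  define k where "k = 4*pi/(2*l+3)"
  have k: "0 \<le> k" using l by (simp add: k_def)
  \<comment> \<open>\<open>K1\<close> bounds the numerator of \<open>rhsc\<close>; \<open>K2\<close>
    and \<open>K3\<close> are Lipschitz constants of this numerator and of \<open>Dc\<close>. The
    powers of \<open>s\<close> that occur have positive exponents, so \<open>s\<close> may be
    replaced by \<open>T\<close>.\<close>
  define K1 where "K1 = T powr (2*l+1) * (k * G + 4*pi*H)"
  define K2 where "K2 = T powr (2*l+1) * (k * Lg + 4*pi*Lh)"
  define K3 where "K3 = 2 * (k * T powr (2*l+2) * Lg)"
  have K: "0 \<le> K1" "0 \<le> K2" "0 \<le> K3" using g h k by (auto simp: K1_def K2_def K3_def)
  define L where "L = K2 / e + K1 * K3 / e\<^sup>2"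
  have L: "0 \<le> L" using K e by (simp add: L_def)
  show ?thesis
  proof (rule that[OF L])
    fix y z :: "real \<Rightarrow> real" and s B
    assume y: "continuous_on {0..T} y" and z: "continuous_on {0..T} z" and s: "s \<in> {0..T}"
      and B: "\<And>t. t \<in> {0..s} \<Longrightarrow> \<bar>y t - z t\<bar> \<le> B"
    have B0: "0 \<le> B" using B[of 0] s by auto
    show "\<bar>rhsc e y s - rhsc e z s\<bar> \<le> L * B"
    proof (cases "s = 0")
      case True
      then show ?thesis using L B0 by (simp add: rhsc_def Dc_def mass_0)
    next
      case False
      with s have s0: "0 < s" by auto
      have gc: "continuous_on UNIV ?gc" by (rule clamp_to_cont[OF g_cont])
      have ys: "continuous_on {0..s} y" and zs: "continuous_on {0..s} z"
        using y z s by (auto intro: continuous_on_subset)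
      let ?my = "mass l ?gc y s" and ?mz = "mass l ?gc z s"
      have "\<bar>?gc (y t) - ?gc (z t)\<bar> \<le> Lg * B" if "t \<in> {0..s}" for t
        using g(3)[of "y t" "z t"] mult_left_mono[OF B[OF that] g(1)] by linarith
      then have md: "\<bar>?my - ?mz\<bar> \<le> w s * (Lg * B)" using s0 by (intro mass_diff gc ys zs) auto
      have mb: "\<bar>?mz\<bar> \<le> w s * G" using s0 g(4) by (intro mass_abs_le gc zs) auto
      have p1: "s powr (2*l+1) \<le> T powr (2*l+1)" "s powr (2*l+2) \<le> T powr (2*l+2)"
        using l s by (auto intro!: powr_mono2)
      have hd: "\<bar>?hc (y s) - ?hc (z s)\<bar> \<le> Lh * B"
        using h(3)[of "y s" "z s"] mult_left_mono[OF B[of s] h(1)] s by auto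
      let ?Ny = "?my / s\<^sup>2 + 4*pi * s powr (1+2*l) * ?hc (y s)"
      let ?Nz = "?mz / s\<^sup>2 + 4*pi * s powr (1+2*l) * ?hc (z s)"
      have "\<bar>?Ny - ?Nz\<bar> = \<bar>(?my - ?mz) / s\<^sup>2 + 4*pi * s powr (1+2*l) * (?hc (y s) - ?hc (z s))\<bar>"
        by (simp add: algebra_simps diff_divide_distrib)
      also have "\<dots> \<le> \<bar>?my - ?mz\<bar> / s\<^sup>2 + 4*pi * s powr (1+2*l) * \<bar>?hc (y s) - ?hc (z s)\<bar>"
        by (rule order_trans[OF abs_triangle_ineq]) (simp add: abs_mult)
      also have "\<dots> \<le> w s * (Lg * B) / s\<^sup>2 + 4*pi * s powr (1+2*l) * (Lh * B)"
        using md hd by (intro add_mono divide_right_mono mult_left_mono) auto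
      also have "w s * (Lg * B) / s\<^sup>2 = s powr (2*l+1) * (k * (Lg * B))"
        by (subst times_divide_eq_left[symmetric]) (simp add: w_div(2)[OF s0] k_def mult_ac)
      also have "s powr (2*l+1) * (k * (Lg * B)) + 4*pi * s powr (1+2*l) * (Lh * B) = s powr (2*l+1) * ((k * Lg + 4*pi*Lh) * B)"
        by (simp add: algebra_simps)
      also have "\<dots> \<le> T powr (2*l+1) * ((k * Lg + 4*pi*Lh) * B)"
        using p1 B0 k g h by (intro mult_right_mono) auto
      finally have Nd: "\<bar>?Ny - ?Nz\<bar> \<le> K2 * B" by (simp add: K2_def mult_ac)
      have "\<bar>?Nz\<bar> \<le> \<bar>?mz\<bar> / s\<^sup>2 + 4*pi * s powr (1+2*l) * \<bar>?hc (z s)\<bar>"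
        by (rule order_trans[OF abs_triangle_ineq]) (simp add: abs_mult)
      also have "\<dots> \<le> w s * G / s\<^sup>2 + 4*pi * s powr (1+2*l) * H"
        using mb h(4) by (intro add_mono divide_right_mono mult_left_mono) auto
      also have "w s * G / s\<^sup>2 = s powr (2*l+1) * (k * G)"
        by (subst times_divide_eq_left[symmetric]) (simp add: w_div(2)[OF s0] k_def mult_ac)
      also have "s powr (2*l+1) * (k * G) + 4*pi * s powr (1+2*l) * H = s powr (2*l+1) * (k * G + 4*pi*H)"
        by (simp add: algebra_simps)
      also have "\<dots> \<le> K1" unfolding K1_def using p1 k g h by (intro mult_right_mono) auto
      finally have Nb: "\<bar>?Nz\<bar> \<le> K1" .
      have "\<bar>max e (Dc e y s) - max e (Dc e z s)\<bar> \<le> \<bar>Dc e y s - Dc e z s\<bar>" by auto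
      also have "Dc e y s - Dc e z s = 2 * a * ((?mz - ?my) / s)"
        by (simp add: Dc_def algebra_simps diff_divide_distrib)
      also have "\<bar>\<dots>\<bar> = 2 * a * (\<bar>?my - ?mz\<bar> / s)"
        using a s0 by (auto simp: abs_mult abs_minus_commute)
      also have "\<dots> \<le> 2 * (w s * (Lg * B) / s)"
        using a md s0 by (auto simp: divide_right_mono)
      also have "\<dots> = 2 * (k * s powr (2*l+2) * (Lg * B))"
        by (subst times_divide_eq_left[symmetric]) (simp add: w_div(1)[OF s0] k_def mult_ac)
      also have "\<dots> \<le> 2 * (k * T powr (2*l+2) * (Lg * B))"
        using p1 k g B0 by (intro mult_left_mono mult_right_mono) auto
      finally have Ad: "\<bar>max e (Dc e y s) - max e (Dc e z s)\<bar> \<le> K3 * B" by (simp add: K3_def mult_ac)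
      have "\<bar>rhsc e y s - rhsc e z s\<bar> \<le> K2 * B / e + K1 * (K3 * B) / e\<^sup>2"
        unfolding rhsc_def by (rule quotient_lipschitz[OF e(1) _ _ Nd Nb Ad]) auto
      then show ?thesis by (simp add: L_def algebra_simps add_divide_distrib)
    qed
  qed
qed

lemma clamped_exists:
  assumes e: "0 < e" "e \<le> y0" and T: "0 \<le> T"
  obtains z where "continuous_on {0..T} z" "\<And>r. r \<in> {0..T} \<Longrightarrow> z r = y0 - integral {0..r} (rhsc e z)"
proof -
  obtain L where L: "0 \<le> L" "\<And>y z s B. continuous_on {0..T} y \<Longrightarrow> continuous_on {0..T} z \<Longrightarrow> s \<in> {0..T} \<Longrightarrow>
        (\<And>t. t \<in> {0..s} \<Longrightarrow> \<bar>y t - z t\<bar> \<le> B) \<Longrightarrow> \<bar>rhsc e y s - rhsc e z s\<bar> \<le> L * B"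
    using rhsc_lipschitz[OF assms] by blast
  have "\<exists>y. continuous_on {0..T} y \<and> (\<forall>r\<in>{0..T}. y r = y0 + integral {0..r} (\<lambda>s. - rhsc e y s))"
  proof (rule volterra_exists[OF T L(1)])
    show "continuous_on {0..T} (\<lambda>s. - rhsc e y s)" if "continuous_on {0..T} y" for y
      by (intro continuous_intros rhsc_cont that e)
    show "\<bar>- rhsc e y s - - rhsc e z s\<bar> \<le> L * B"
      if "continuous_on {0..T} y" "continuous_on {0..T} z" "s \<in> {0..T}" "\<And>t. t \<in> {0..s} \<Longrightarrow> \<bar>y t - z t\<bar> \<le> B" for y z s B
      using L(2)[OF that] by (simp add: abs_minus_commute)
  qed
  then show ?thesis using that by (auto simp: integral_neg)
qed

lemma clamped_unique:
  assumes e: "0 < e" "e \<le> y0"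
    and y: "continuous_on {0..T} y" "\<And>r. r \<in> {0..T} \<Longrightarrow> y r = y0 - integral {0..r} (rhsc e y)"
    and z: "continuous_on {0..T} z" "\<And>r. r \<in> {0..T} \<Longrightarrow> z r = y0 - integral {0..r} (rhsc e z)"
    and r: "r \<in> {0..T}"
  shows "y r = z r"
proof -
  have T: "0 \<le> T" using r by auto
  obtain L where L: "0 \<le> L" "\<And>y z s B. continuous_on {0..T} y \<Longrightarrow> continuous_on {0..T} z \<Longrightarrow> s \<in> {0..T} \<Longrightarrow>
        (\<And>t. t \<in> {0..s} \<Longrightarrow> \<bar>y t - z t\<bar> \<le> B) \<Longrightarrow> \<bar>rhsc e y s - rhsc e z s\<bar> \<le> L * B"
    using rhsc_lipschitz[OF e T] by blast
  show ?thesis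
  proof (rule volterra_unique[where F="\<lambda>y s. - rhsc e y s", OF L(1) _ _ y(1) _ z(1) _ r])
    show "continuous_on {0..T} (\<lambda>s. - rhsc e y s)" if "continuous_on {0..T} y" for y
      by (intro continuous_intros rhsc_cont that e)
    show "\<bar>- rhsc e y s - - rhsc e z s\<bar> \<le> L * B"
      if "continuous_on {0..T} y" "continuous_on {0..T} z" "s \<in> {0..T}" "\<And>t. t \<in> {0..s} \<Longrightarrow> \<bar>y t - z t\<bar> \<le> B" for y z s B
      using L(2)[OF that] by (simp add: abs_minus_commute)
  qed (use y(2) z(2) in \<open>auto simp: integral_neg\<close>)
qed

lemma clamped_eq:
  assumes "0 \<le> r" "\<And>s. s \<in> {0..r} \<Longrightarrow> e \<le> y s \<and> y s \<le> y0"
  shows "Dc e y r = D y r" "e \<le> D y r \<Longrightarrow> rhsc e y r = rhs y r"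
proof -
  have c: "clamp_to e f (y s) = f (y s)" if "s \<in> {0..r}" for f s
    using assms(2)[OF that] by (auto simp: clamp_to_def)
  have m: "mass l (clamp_to e g) y r = mass l g y r" by (rule mass_cong) (rule c)
  then show "Dc e y r = D y r" by (simp add: Dc_def D_def)
  then show "rhsc e y r = rhs y r" if "e \<le> D y r"
    using that m c[of r h] assms(1) by (simp add: rhsc_def rhs_def max_def)
qed

lemma sol_lower_bound:
  assumes y: "sol T y" and T: "0 \<le> T"
  obtains e where "0 < e" "e \<le> y0" "\<And>r. r \<in> {0..T} \<Longrightarrow> e \<le> y r \<and> e \<le> D y r"
proof -
  have c: "continuous_on {0..T} y" using y by (simp add: sol_def isol_def)
  have "continuous_on {0..T} (\<lambda>r. min (y r) (D y r))"
    by (intro continuous_intros D_continuous c)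
  then obtain x where x: "x \<in> {0..T}" "\<And>r. r \<in> {0..T} \<Longrightarrow> min (y x) (D y x) \<le> min (y r) (D y r)"
    using continuous_attains_inf[of "{0..T}" "\<lambda>r. min (y r) (D y r)"] T by auto
  have "0 < min (y x) (D y x)" using y x(1) by (auto simp: sol_def isol_def)
  then show ?thesis
    using that[of "min y0 (min (y x) (D y x))"] x(2) y0 by fastforce
qed

lemma sol_clamped:
  assumes y: "sol T y" and e: "\<And>r. r \<in> {0..T} \<Longrightarrow> e \<le> y r \<and> e \<le> D y r" and r: "r \<in> {0..T}"
  shows "y r = y0 - integral {0..r} (rhsc e y)"
proof -
  have i: "isol T y" using y by (simp add: sol_def)
  have "integral {0..r} (rhsc e y) = integral {0..r} (rhs y)"
    using e r isol_le[OF i] by (intro integral_cong clamped_eq) auto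
  then show ?thesis using isol_eq[OF i r] by simp
qed

text \<open>On a compact interval both solutions and their \<open>D\<close> stay above a common
  positive \<open>e\<close>, so both solve the same clamped problem.\<close>

lemma sol_unique:
  assumes y: "sol T y" and z: "sol T z" and r: "r \<in> {0..T}"
  shows "y r = z r"
proof -
  have T: "0 \<le> T" using r by auto
  obtain e1 where e1: "0 < e1" "e1 \<le> y0" "\<And>r. r \<in> {0..T} \<Longrightarrow> e1 \<le> y r \<and> e1 \<le> D y r"
    using sol_lower_bound[OF y T] by blast
  obtain e2 where e2: "0 < e2" "e2 \<le> y0" "\<And>r. r \<in> {0..T} \<Longrightarrow> e2 \<le> z r \<and> e2 \<le> D z r"
    using sol_lower_bound[OF z T] by blast
  show ?thesis
  proof (rule clamped_unique[of "min e1 e2", OF _ _ _ _ _ _ r])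
    show "\<And>r. r \<in> {0..T} \<Longrightarrow> y r = y0 - integral {0..r} (rhsc (min e1 e2) y)"
      using e1(3) by (intro sol_clamped[OF y]) (auto intro: min.coboundedI1)
    show "\<And>r. r \<in> {0..T} \<Longrightarrow> z r = y0 - integral {0..r} (rhsc (min e1 e2) z)"
      using e2(3) by (intro sol_clamped[OF z]) (auto intro: min.coboundedI2)
  qed (use e1 e2 y z in \<open>auto simp: sol_def isol_def\<close>)
qed

text \<open>The clamped problem is solved on a longer interval with half the lower bound
  \<open>e\<close> of the given solution. Up to \<open>T\<close> its solution agrees with
  \<open>y\<close> and lies strictly above \<open>d\<close>, hence stays above \<open>d\<close> a
  little longer, where the clamps do not act. From \<open>T = 0\<close> this also gives local
  existence at the singular centre.\<close>

lemma sol_extend: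
  assumes y: "sol T y" and T: "0 \<le> T"
  obtains S z where "T < S" "sol S z"
proof -
  obtain e where e: "0 < e" "e \<le> y0" "\<And>r. r \<in> {0..T} \<Longrightarrow> e \<le> y r \<and> e \<le> D y r"
    using sol_lower_bound[OF assms] by blast
  define d where "d = e/2"
  have d: "0 < d" "d \<le> y0" "d < e" using e by (auto simp: d_def)
  obtain z where z: "continuous_on {0..T+1} z" "\<And>r. r \<in> {0..T+1} \<Longrightarrow> z r = y0 - integral {0..r} (rhsc d z)"
    using clamped_exists[OF d(1,2), of "T+1"] T by auto
  have zr: "z t \<le> z r" if "0 \<le> r" "r \<le> t" "t \<le> T+1" for r t
  proof -
    have i: "rhsc d z integrable_on {0..t}"
      using that by (intro integrable_continuous_real rhsc_cont continuous_on_subset[OF z(1)] d) auto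
    have "integral {0..r} (rhsc d z) \<le> integral {0..t} (rhsc d z)"
      using that by (intro integral_subset_le i integrable_subinterval_real[OF i] rhsc_nonneg d
           continuous_on_subset[OF z(1)] ballI) auto
    then show ?thesis using z(2)[of r] z(2)[of t] that by auto
  qed
  have z0: "z 0 = y0" using z(2)[of 0] T by simp
  have zy: "z r = y r" if "r \<in> {0..T}" for r
  proof (rule clamped_unique[OF d(1,2) _ _ _ _ that])
    show "\<And>r. r \<in> {0..T} \<Longrightarrow> y r = y0 - integral {0..r} (rhsc d y)"
      using e(3) d(3) by (intro sol_clamped[OF y]) force+
  qed (use z y in \<open>auto simp: sol_def isol_def intro: continuous_on_subset\<close>)
  have DT: "Dc d z T = D y T"
  proof -
    have "Dc d z T = D z T"
      using zr[of 0] z0 zy e(3) d(3) T by (intro clamped_eq) (force+)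
    then show ?thesis using D_cong[of T z y] zy by simp
  qed
  define m where "m = (\<lambda>s. min (z s) (Dc d z s))"
  have mc: "continuous_on {0..T+1} m" unfolding m_def by (intro continuous_intros z(1) Dc_cont)
  have mT: "d < m T" using e(3)[of T] d(3) zy[of T] T DT by (auto simp: m_def)
  obtain b where b: "0 < b" "\<And>s. s \<in> {0..T+1} \<Longrightarrow> dist s T < b \<Longrightarrow> dist (m s) (m T) < m T - d"
    using mc mT T unfolding continuous_on_iff
    by (metis atLeastAtMost_iff diff_gt_0_iff_gt le_add_same_cancel1 zero_le_one)
  define S where "S = T + min 1 (b/2)"
  have S: "T < S" "S \<le> T+1" using b by (auto simp: S_def)
  have lb: "d \<le> z s \<and> d \<le> Dc d z s" if "s \<in> {0..S}" for s
  proof (cases "s \<le> T")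
    case True
    then have "Dc d z s = D z s"
      using zr[of 0] z0 zy e(3) d(3) that S by (intro clamped_eq) (force+)
    moreover have "D z s = D y s" using True by (intro D_cong zy) auto
    ultimately show ?thesis using e(3)[of s] zy[of s] d(3) True that by auto
  next
    case False
    then have "dist s T < b" "s \<in> {0..T+1}" using that S b T by (auto simp: S_def dist_real_def)
    then have "dist (m s) (m T) < m T - d" by (rule b(2)[rotated])
    then have "d < m s" by (auto simp: dist_real_def)
    then show ?thesis by (auto simp: m_def)
  qed
  have "sol S z"
    unfolding sol_def isol_def
  proof (intro conjI ballI)
    show "continuous_on {0..S} z" using S by (intro continuous_on_subset[OF z(1)]) auto
    fix r assume r: "r \<in> {0..S}"
    have b': "\<And>s. s \<in> {0..r} \<Longrightarrow> d \<le> z s \<and> z s \<le> y0" using lb zr[of 0] z0 r S by fastforce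
    have De: "Dc d z r = D z r" using r b' by (intro clamped_eq) auto
    show "0 < z r" using lb[OF r] d by auto
    show "0 < D z r" using De lb[OF r] d by auto
    have "rhsc d z s = rhs z s" if "s \<in> {0..r}" for s
    proof (rule clamped_eq(2))
      show b2: "d \<le> z t \<and> z t \<le> y0" if "t \<in> {0..s}" for t using that \<open>s \<in> {0..r}\<close> b' by auto
      show "d \<le> D z s" using clamped_eq(1)[of s d z] b2 lb[of s] that r by auto
    qed (use that in auto)
    then have "integral {0..r} (rhsc d z) = integral {0..r} (rhs z)" by (intro integral_cong) auto
    then show "z r = y0 - integral {0..r} (rhs z)" using z(2)[of r] r S by auto
  qed
  then show ?thesis using that[OF S(1)] by blast
qed

section \<open>The positive phase ends at a finite radius\<close>

lemma sol_0: "sol 0 (\<lambda>_. y0)"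
  using y0 by (auto simp: sol_def isol_def D_def)

lemma sol_mass_pos:
  assumes y: "sol T y" and T: "0 < T"
  shows "0 < mass l g y T"
proof -
  have c: "continuous_on {0..T} y" and i: "isol T y" using y by (auto simp: sol_def isol_def)
  obtain b where b: "0 < b" "\<forall>t\<in>{0<..y0}. b * t powr q \<le> g t" using g_lower[OF y0] by blast
  have yT: "0 < y T" using y T by (auto simp: sol_def)
  have "b * y T powr q \<le> g (y s)" if s: "s \<in> {0..T}" for s
  proof -
    have "b * y T powr q \<le> b * y s powr q"
      using isol_antimono[OF i, of s T] yT s q b by (intro mult_left_mono powr_mono2) auto
    also have "\<dots> \<le> g (y s)" using b(2) y s isol_le[OF i s] by (auto simp: sol_def)
    finally show ?thesis .
  qed
  then have "w T * (b * y T powr q) \<le> mass l g y T" using T by (intro mass_ge g_cont c) auto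
  moreover have "0 < w T * (b * y T powr q)" using yT T b l by (simp add: w_def)
  ultimately show ?thesis by linarith
qed

text \<open>Since \<open>y\<close> is nonincreasing, \<open>g (y s) \<ge> b * y x powr q\<close> for
  \<open>s \<le> x\<close>, hence \<open>rhs y x\<close> is at least a constant times
  \<open>x powr (2*l+1) * y x powr q\<close>. Division by \<open>y powr q\<close> turns this into a
  lower bound for the derivative of \<open>y powr (1 - q)\<close>. The constant depends neither on
  the solution nor on \<open>T\<close>.\<close>

lemma sol_powr_bound:
  obtains k where "0 < k" "\<And>T y. 0 \<le> T \<Longrightarrow> sol T y \<Longrightarrow> k * T powr (2*l+2) \<le> y T powr (1 - q)"
proof -
  obtain b where b: "0 < b" "\<forall>t\<in>{0<..y0}. b * t powr q \<le> g t" using g_lower[OF y0] by blast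
  \<comment> \<open>Chosen such that the derivative of \<open>k * r powr (2*l+2)\<close> equals the
    lower bound for the derivative of \<open>y r powr (1 - q)\<close>.\<close>
  define k where "k = (q - 1) * b * (4*pi/(2*l+3)) / (2*l+2)"
  have k: "0 < k" using q b l by (simp add: k_def)
  have kk: "k * (2*l+2) = (q - 1) * b * (4*pi/(2*l+3))" using l by (simp add: k_def)
  have "k * T powr (2*l+2) \<le> y T powr (1 - q)" if T: "0 \<le> T" and y: "sol T y" for T y
  proof -
    have c: "continuous_on {0..T} y" and i: "isol T y" and p: "\<And>r. r \<in> {0..T} \<Longrightarrow> 0 < y r"
      using y by (auto simp: sol_def isol_def)
    define Z where "Z = (\<lambda>r. y r powr (1 - q) - k * r powr (2*l+2))"
    have "Z 0 \<le> Z T"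
    proof (rule DERIV_nonneg_imp_increasing_open[OF T])
      show "continuous_on {0..T} Z" unfolding Z_def
        by (intro continuous_intros continuous_on_powr' c) (use p l in \<open>force+\<close>)
      fix x assume x: "0 < x" "x < T"
      have yx: "0 < y x" "y x \<le> y0" using p x isol_le[OF i, of x] by auto
      have "b * y x powr q \<le> g (y s)" if s: "s \<in> {0..x}" for s
      proof -
        have "b * y x powr q \<le> b * y s powr q"
          using isol_antimono[OF i, of s x] x s q b yx by (auto intro!: mult_left_mono powr_mono2)
        also have "\<dots> \<le> g (y s)" using b(2) p[of s] s x isol_le[OF i, of s] by auto
        finally show ?thesis .
      qed
      then have "w x * (b * y x powr q) \<le> mass l g y x"
        using x by (intro mass_ge g_cont continuous_on_subset[OF c]) auto
      then have "w x * (b * y x powr q) / x\<^sup>2 \<le> mass l g y x / x\<^sup>2" by (intro divide_right_mono) auto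
      also have "\<dots> \<le> rhs y x"
        using x isol_D[OF i, of x] by (intro rhs_ge continuous_on_subset[OF c]) auto
      also have "w x * (b * y x powr q) / x\<^sup>2 = (w x / x\<^sup>2) * (b * y x powr q)" by simp
      finally have rl: "4*pi/(2*l+3) * x powr (2*l+1) * (b * y x powr q) \<le> rhs y x"
        unfolding w_div(2)[OF x(1)] .
      have "(Z has_real_derivative (1 - q) * y x powr (1 - q - 1) * (- rhs y x) - k * ((2*l+2) * x powr (2*l+2-1))) (at x)"
        unfolding Z_def using x yx l isol_deriv_at[OF i, of x] by (auto intro!: derivative_eq_intros)
      moreover have "0 \<le> (1 - q) * y x powr (1 - q - 1) * (- rhs y x) - k * ((2*l+2) * x powr (2*l+2-1))"
      proof -
        have "k * ((2*l+2) * x powr (2*l+2-1)) = (q - 1) * (4*pi/(2*l+3) * x powr (2*l+1) * b)"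
          unfolding mult.assoc[symmetric] kk by (simp add: algebra_simps)
        also have "\<dots> = (q - 1) * y x powr (- q) * (4*pi/(2*l+3) * x powr (2*l+1) * (b * y x powr q))"
          using yx by (simp add: powr_minus)
        also have "\<dots> \<le> (q - 1) * y x powr (- q) * rhs y x"
          using rl q by (intro mult_left_mono) auto
        also have "\<dots> = (1 - q) * y x powr (1 - q - 1) * (- rhs y x)" by (simp add: algebra_simps)
        finally show ?thesis by simp
      qed
      ultimately show "\<exists>z. (Z has_real_derivative z) (at x) \<and> 0 \<le> z" by blast
    qed
    moreover have "Z 0 = y 0 powr (1 - q)" by (simp add: Z_def)
    moreover have "0 \<le> y 0 powr (1 - q)" by simp
    ultimately have "0 \<le> Z T" by linarith
    then show ?thesis by (simp add: Z_def)
  qed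
  then show ?thesis using that k by blast
qed

text \<open>Beyond \<open>r\<close> the force is at least that of the mass inside \<open>r\<close>,
  so \<open>y s - m / s\<close> is nonincreasing in \<open>s\<close>. Comparing \<open>t\<close>
  with \<open>T\<close>, where \<open>y\<close> is still positive, gives the bound.\<close>

lemma sol_coulomb_bound:
  assumes y: "sol T y" and r: "0 < r" "r \<le> t" "t < T"
  shows "mass l g y r * (1 / t - 1 / T) \<le> y t"
proof -
  have c: "continuous_on {0..T} y" and i: "isol T y" and p: "\<And>r. r \<in> {0..T} \<Longrightarrow> 0 < y r"
    using y by (auto simp: sol_def isol_def)
  let ?m = "mass l g y r"
  have "y T - ?m / T \<le> y t - ?m / t"
  proof (rule DERIV_nonpos_imp_decreasing_open[of t T "\<lambda>s. y s - ?m / s"])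
    show "continuous_on {t..T} (\<lambda>s. y s - ?m / s)"
      using r by (intro continuous_intros continuous_on_subset[OF c]) auto
    fix x assume x: "t < x" "x < T"
    have "((\<lambda>s. y s - ?m / s) has_real_derivative - rhs y x + ?m / x\<^sup>2) (at x)"
      using x r isol_deriv_at[OF i, of x]
      by (auto intro!: derivative_eq_intros simp: power2_eq_square)
    moreover have "?m / x\<^sup>2 \<le> mass l g y x / x\<^sup>2"
      using r x by (intro divide_right_mono mass_mono continuous_on_subset[OF c]) auto
    moreover have "mass l g y x / x\<^sup>2 \<le> rhs y x"
      using x r isol_D[OF i, of x] by (intro rhs_ge continuous_on_subset[OF c]) auto
    ultimately show "\<exists>z. ((\<lambda>s. y s - ?m / s) has_real_derivative z) (at x) \<and> z \<le> 0"
      by (intro exI[of _ "- rhs y x + ?m / x\<^sup>2"]) auto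
  qed (use r in auto)
  then show ?thesis using p[of T] r by (simp add: algebra_simps)
qed

text \<open>With \<open>m\<close> the mass in a fixed initial ball, the two bounds at radius
  \<open>T/2\<close> give \<open>k * (T/2) powr (2*l+2) \<le> (m / T) powr (1 - q)\<close>, that is
  \<open>T powr p \<le> K\<close> with \<open>p = 2*l+3-q > 0\<close>.\<close>

lemma sol_bounded: "\<exists>B. \<forall>T y. sol T y \<longrightarrow> T \<le> B"
proof -
  obtain k where k: "0 < k" "\<And>T y. 0 \<le> T \<Longrightarrow> sol T y \<Longrightarrow> k * T powr (2*l+2) \<le> y T powr (1 - q)"
    using sol_powr_bound by blast
  obtain S y1 where S: "0 < S" and y1: "sol S y1" using sol_extend[OF sol_0] by auto
  define m where "m = mass l g y1 S"
  have m: "0 < m" unfolding m_def by (rule sol_mass_pos[OF y1 S])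
  define p where "p = 2*l+3-q"
  have p: "0 < p" using q by (simp add: p_def)
  define K where "K = m powr (1 - q) * 2 powr (2*l+2) / k"
  have "T \<le> max (2*S) (K powr (1/p))" if y: "sol T y" for T y
  proof (rule ccontr)
    assume "\<not> T \<le> max (2*S) (K powr (1/p))"
    then have T: "2*S < T" "K powr (1/p) < T" by auto
    then have T0: "0 < T" using S by simp
    \<comment> \<open>By uniqueness all solutions share the initial piece on \<open>{0..S}\<close>,
      so \<open>m\<close> does not depend on \<open>y\<close>.\<close>
    have "mass l g y S = m" unfolding m_def
      using sol_unique[OF sol_sub[OF y] y1] T S by (intro mass_cong) auto
    then have "m * (1 / (T/2) - 1 / T) \<le> y (T/2)"
      using sol_coulomb_bound[OF y, of S "T/2"] T S by auto
    then have "m / T \<le> y (T/2)" using T0 by (simp add: field_simps)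
    then have "y (T/2) powr (1 - q) \<le> (m / T) powr (1 - q)"
      using m T0 q by (intro powr_mono2') auto
    moreover have "k * (T/2) powr (2*l+2) \<le> y (T/2) powr (1 - q)"
      using T0 by (intro k sol_sub[OF y]) auto
    ultimately have "k * (T/2) powr (2*l+2) \<le> (m / T) powr (1 - q)" by linarith
    then have "T powr (2*l+2) \<le> K * T powr (q - 1)"
      using T0 m k by (simp add: K_def powr_divide powr_diff field_simps)
    then have "T powr (2*l+2) / T powr (q - 1) \<le> K" using T0 by (simp add: field_simps)
    moreover have "T powr (2*l+2) / T powr (q - 1) = T powr p"
      unfolding powr_diff[symmetric] p_def by (rule arg_cong[where f="(powr) T"]) simp
    ultimately have "T powr p \<le> K" by simp
    then have "(T powr p) powr (1/p) \<le> K powr (1/p)" using p by (intro powr_mono2) auto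
    then show False using T p T0 by (simp add: powr_powr)
  qed
  then show ?thesis by blast
qed

text \<open>Up to the factor \<open>exp (- y)\<close>, the function \<open>A\<close> below is \<open>r\<^sup>2 e\<^sup>\<mu>\<^sup>-\<^sup>\<lambda> \<mu>'\<close> in terms of the metric. Its
  derivative contains no derivative of \<open>h (y r)\<close> (this is the Tolman-Oppenheimer-Volkov equation) and
  is dominated by \<open>- y'\<close>, so that \<open>A\<close> stays bounded as long as \<open>y\<close> does.\<close>

lemma D_bounded_below:
  assumes R: "0 < r0" "r0 < R" and y: "\<And>T. T < R \<Longrightarrow> sol T y"
  obtains d where "0 < d" "\<And>r. r \<in> {r0..<R} \<Longrightarrow> d \<le> D y r"
proof (cases "a = 0")
  case True
  then have "1 \<le> D y r" for r unfolding D_def by simp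
  then show ?thesis using that[of 1] by simp
next
  case False
  then have a1: "a = 1" using a by simp
  have i: "isol T y" if "T < R" for T using y[OF that] by (simp add: sol_def)
  have pos: "0 < y r" if "r \<in> {0..<R}" for r using y[of r] that by (auto simp: sol_def)
  have cont: "continuous_on {0..T} y" if "T < R" for T using isol_cont[OF i[OF that]] .
  have Dpos: "0 < D y r" if "r \<in> {0..<R}" for r using isol_D[OF i[of r], of r] that by auto
  have D1: "D y r \<le> 1" if "r \<in> {0..<R}" for r using cont[of r] that by (intro D_le_1) auto
  have le: "y r \<le> y0" if "r \<in> {0..<R}" for r using isol_le[OF i[of r], of r] that by auto
  obtain G where G: "0 < G" "\<And>t. t \<in> {0..y0} \<Longrightarrow> \<bar>g t\<bar> \<le> G"
    using compact_imp_bounded[OF compact_continuous_image[OF continuous_on_subset[OF g_cont subset_UNIV] compact_Icc[of 0 y0]]]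
    by (force simp: bounded_pos)
  obtain H where H: "0 < H" "\<And>t. t \<in> {0..y0} \<Longrightarrow> \<bar>h t\<bar> \<le> H"
    using compact_imp_bounded[OF compact_continuous_image[OF continuous_on_subset[OF h_cont subset_UNIV] compact_Icc[of 0 y0]]]
    by (force simp: bounded_pos)
  define m0 where "m0 = mass l g y r0"
  have m0: "0 < m0" unfolding m0_def by (rule sol_mass_pos[OF y]) (use R in auto)
  have mm: "m0 \<le> mass l g y r" if "r \<in> {r0..<R}" for r
    unfolding m0_def using that R by (intro mass_mono cont) auto
  \<comment> \<open>\<open>C1\<close> bounds the derivative of \<open>A\<close> apart from the
    factor \<open>exp (- y) / sqrt D\<close>. \<open>C2\<close> turns this into a multiple of
    \<open>rhs\<close>, because \<open>rhs \<ge> m0 / (D * R\<^sup>2)\<close> between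
    \<open>r0\<close> and \<open>R\<close>.\<close>
  define C1 where "C1 = 4*pi*R powr (2*l+2) * (G + (2*l+3)*H)"
  have C1: "0 \<le> C1" using G H l by (simp add: C1_def)
  define C2 where "C2 = C1 * R\<^sup>2 / m0"
  have C2: "0 \<le> C2" using C1 m0 by (simp add: C2_def)
  define N where "N = (\<lambda>r. mass l g y r + 4*pi * r powr (2*l+3) * h (y r))"
  define A where "A = (\<lambda>r. exp (- y r) * N r / sqrt (D y r))"
  \<comment> \<open>All terms containing \<open>rhs y x\<close> or the derivative of
    \<open>D\<close> combine to a multiple of \<open>n - (m1 + P * x * h1)\<close>, which is zero by
    the definition of \<open>N\<close>. The relation \<open>h' = g + h\<close> makes the
    contributions of \<open>g\<close> cancel.\<close>
  have Aderiv: "(A has_real_derivative exp (- y x) / sqrt (D y x) * (4*pi*x powr (2*l+2) * (g (y x) + (2*l+3) * h (y x)))) (at x)"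
    if x: "0 < x" "x < R" for x
  proof -
    obtain T where T: "x < T" "T < R" using x dense by blast
    let ?p = "x powr (2*l+2)"
    have p3: "x powr (2*l+3) = ?p * x" using powr_add[of x "2*l+2" 1] x by (simp add: add.assoc)
    have m': "(mass l g y has_real_derivative 4*pi*(?p * g (y x))) (at x)"
      using mass_derivative[OF g_cont cont[OF T(2)], of x] at_within_Icc_at[of 0 x T] x T by auto
    have y': "(y has_real_derivative - rhs y x) (at x)" using isol_deriv_at[OF i[OF T(2)]] x T by auto
    have Dx: "0 < D y x" using Dpos x by auto
    define d where "d = D y x"
    have rr: "rhs y x = N x / (d * x\<^sup>2)"
    proof -
      have "?p / x\<^sup>2 * x = x powr (1 + 2*l)"
        using x powr_add[of x "1+2*l" 1] by (simp add: power2_eq_square field_simps)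
      then show ?thesis unfolding rhs_def N_def p3 d_def using x by (simp add: field_simps)
    qed
    have D': "(D y has_real_derivative - 2 * (4*pi*(?p * g (y x))) / x + 2 * mass l g y x / x\<^sup>2) (at x)"
      unfolding D_def[abs_def] unfolding a1 using x
      by (auto intro!: derivative_eq_intros m' simp: field_simps power2_eq_square)
    have h': "((\<lambda>r. h (y r)) has_real_derivative (g (y x) + h (y x)) * - rhs y x) (at x)"
      using DERIV_chain2[OF h_deriv y'] pos[of x] x a1 by auto
    have pw: "((\<lambda>r. r powr (2*l+3)) has_real_derivative (2*l+3) * ?p) (at x)"
      using has_real_derivative_powr[OF x(1), of "2*l+3"] by (simp add: add_diff_eq[symmetric])
    have N': "(N has_real_derivative 4*pi*(?p * g (y x)) + (4*pi * ((2*l+3) * ?p) * h (y x) + 4*pi * (?p * x) * ((g (y x) + h (y x)) * - rhs y x))) (at x)"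
      using DERIV_add[OF m' DERIV_mult[OF DERIV_cmult[OF pw, of "4*pi"] h']] unfolding N_def p3
      by (simp add: algebra_simps)
    have sq: "((\<lambda>r. sqrt (D y r)) has_real_derivative (- 2 * (4*pi*(?p * g (y x))) / x + 2 * mass l g y x / x\<^sup>2) * (inverse (sqrt d) / 2)) (at x)"
      using DERIV_chain2[OF DERIV_real_sqrt[of "D y x"] D'] Dx by (simp add: d_def mult.commute)
    have ey: "((\<lambda>r. exp (- y r)) has_real_derivative exp (- y x) * rhs y x) (at x)"
      by (auto intro!: derivative_eq_intros y')
    define s where "s = sqrt d"
    have s: "0 < s" "d = s * s" using Dx by (auto simp: s_def d_def)
    have "(A has_real_derivative ((exp (- y x) * rhs y x * N x + (4*pi*(?p * g (y x)) + (4*pi * ((2*l+3) * ?p) * h (y x) + 4*pi * (?p * x) * ((g (y x) + h (y x)) * - rhs y x))) * exp (- y x)) * s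
         - (exp (- y x) * N x) * ((- 2 * (4*pi*(?p * g (y x))) / x + 2 * mass l g y x / x\<^sup>2) * (inverse s / 2))) / (s * s)) (at x)"
      unfolding A_def using DERIV_divide[OF DERIV_mult[OF ey N'] sq] Dx by (simp add: s_def d_def)
    moreover have "((exp (- y x) * rhs y x * N x + (4*pi*(?p * g (y x)) + (4*pi * ((2*l+3) * ?p) * h (y x) + 4*pi * (?p * x) * ((g (y x) + h (y x)) * - rhs y x))) * exp (- y x)) * s
         - (exp (- y x) * N x) * ((- 2 * (4*pi*(?p * g (y x))) / x + 2 * mass l g y x / x\<^sup>2) * (inverse s / 2))) / (s * s)
       = exp (- y x) / s * (4*pi*?p * (g (y x) + (2*l+3) * h (y x)))"
    proof -
      define E P g1 h1 m1 n where "E = exp (- y x)" and "P = 4*pi*?p" and "g1 = g (y x)" and "h1 = h (y x)"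
        and "m1 = mass l g y x" and "n = N x"
      have n: "n = m1 + P * x * h1" by (simp add: n_def N_def p3 P_def m1_def h1_def)
      have "((E * (n / (s * s * x\<^sup>2)) * n + (P * g1 + ((2*l+3) * P * h1 + P * x * ((g1 + h1) * - (n / (s * s * x\<^sup>2))))) * E) * s
         - (E * n) * ((- 2 * (P * g1) / x + 2 * m1 / x\<^sup>2) * (inverse s / 2))) / (s * s)
        = E / s * (P * (g1 + (2*l+3) * h1)) + E * n / (s * s * s * x\<^sup>2) * (n - (m1 + P * x * h1))"
        using s x by (simp add: field_simps power2_eq_square)
      then show ?thesis unfolding rr s(2) E_def P_def g1_def h1_def m1_def[symmetric] n_def
        using n by (simp add: n_def m1_def P_def h1_def mult_ac)
    qed
    ultimately show ?thesis by (simp add: s_def d_def)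
  qed
  define B where "B = A r0 + C2 * y0"
  have AB: "A r \<le> B" if r: "r \<in> {r0..<R}" for r
  proof -
    have "A r + C2 * y r \<le> A r0 + C2 * y r0"
    proof (rule DERIV_nonpos_imp_nonincreasing[of r0 r "\<lambda>s. A s + C2 * y s"])
      fix x assume x: "r0 \<le> x" "x \<le> r"
      then have xR: "0 < x" "x < R" using r R by auto
      obtain T where T: "x < T" "T < R" using xR dense by blast
      have Dx: "0 < D y x" "D y x \<le> 1" using Dpos D1 xR by auto
      have yx: "0 < y x" "y x \<le> y0" using pos le xR by auto
      let ?X = "4*pi*x powr (2*l+2) * (g (y x) + (2*l+3) * h (y x))"
      have y': "(y has_real_derivative - rhs y x) (at x)" using isol_deriv_at[OF i[OF T(2)]] xR T by auto
      have "((\<lambda>s. A s + C2 * y s) has_real_derivative exp (- y x) / sqrt (D y x) * ?X + C2 * - rhs y x) (at x)"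
        by (intro DERIV_add DERIV_cmult Aderiv xR y')
      moreover have "exp (- y x) / sqrt (D y x) * ?X \<le> C2 * rhs y x"
      proof -
        have "g (y x) + (2*l+3) * h (y x) \<le> G + (2*l+3) * H"
          using G(2)[of "y x"] H(2)[of "y x"] yx l by (intro add_mono mult_left_mono) auto
        then have X: "?X \<le> C1" unfolding C1_def
          using xR l g_nonneg h_nonneg by (intro mult_mono powr_mono2) auto
        \<comment> \<open>The derivative of \<open>A\<close> carries \<open>1 / sqrt D\<close>,
          whereas \<open>rhs\<close> carries \<open>1 / D\<close>; since \<open>D \<le> 1\<close>,
          the latter is at least as large.\<close>
        have "D y x \<le> sqrt (D y x)" using Dx real_le_rsqrt[of "D y x" "D y x"] by (simp add: power2_eq_square mult_le_one)
        then have "exp (- y x) / sqrt (D y x) \<le> 1 / D y x" using yx Dx by (intro frac_le) auto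
        then have "exp (- y x) / sqrt (D y x) * ?X \<le> 1 / D y x * C1"
          using X Dx g_nonneg h_nonneg l by (intro mult_mono) auto
        also have "\<dots> = C2 * (1 / D y x * (m0 / R\<^sup>2))" using m0 R by (simp add: C2_def)
        also have "\<dots> \<le> C2 * rhs y x"
        proof (intro mult_left_mono C2)
          have "m0 / R\<^sup>2 \<le> mass l g y x / x\<^sup>2"
            using mm[of x] x r xR m0 by (intro frac_le power_mono) auto
          also have "\<dots> \<le> mass l g y x / x\<^sup>2 + 4 * pi * x powr (1 + 2*l) * h (y x)" using h_nonneg by simp
          finally show "1 / D y x * (m0 / R\<^sup>2) \<le> rhs y x" unfolding rhs_def using Dx by (intro mult_left_mono) auto
        qed
        finally show ?thesis .
      qed
      ultimately show "\<exists>z. ((\<lambda>s. A s + C2 * y s) has_real_derivative z) (at x) \<and> z \<le> 0"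
        by (intro exI conjI) auto
    qed (use r in auto)
    moreover have "C2 * y r0 \<le> C2 * y0" using le[of r0] R C2 by (intro mult_left_mono) auto
    moreover have "0 \<le> C2 * y r" using pos[of r] R r C2 by (intro mult_nonneg_nonneg) (auto intro: less_imp_le)
    ultimately show ?thesis by (simp add: B_def)
  qed
  \<comment> \<open>\<open>A * sqrt D\<close> is \<open>exp (- y) * N\<close> and stays above a
    positive constant, the mass beyond \<open>r0\<close> being at least \<open>m0\<close>. As
    \<open>A\<close> is bounded by \<open>B\<close>, \<open>sqrt D\<close> cannot become small
    either.\<close>
  have low: "exp (- y0) * m0 \<le> A r * sqrt (D y r)" if r: "r \<in> {r0..<R}" for r
  proof -
    have "exp (- y0) * m0 \<le> exp (- y r) * N r"
      using mm[OF r] le[of r] r R m0 h_nonneg[of "y r"] by (intro mult_mono) (auto simp: N_def intro: add_increasing2)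
    then show ?thesis using Dpos[of r] r R by (simp add: A_def)
  qed
  have B0: "0 < B"
  proof -
    have "0 < A r0 * sqrt (D y r0)" using low[of r0] R m0 by (intro less_le_trans[OF _ low]) auto
    then have "0 < A r0" using Dpos[of r0] R by (simp add: zero_less_mult_iff)
    then show ?thesis using AB[of r0] R by simp
  qed
  show ?thesis
  proof (rule that[of "(exp (- y0) * m0 / B)\<^sup>2"])
    show "0 < (exp (- y0) * m0 / B)\<^sup>2" using m0 B0 by simp
    fix r assume r: "r \<in> {r0..<R}"
    have Dr: "0 < D y r" using Dpos r R by auto
    have "exp (- y0) * m0 \<le> B * sqrt (D y r)"
      by (rule order_trans[OF low[OF r] mult_right_mono[OF AB[OF r]]]) (use Dr in simp)
    then have "exp (- y0) * m0 / B \<le> sqrt (D y r)" using B0 by (simp add: field_simps)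
    then have "(exp (- y0) * m0 / B)\<^sup>2 \<le> (sqrt (D y r))\<^sup>2" using m0 B0 by (intro power_mono) auto
    then show "(exp (- y0) * m0 / B)\<^sup>2 \<le> D y r" using Dr by simp
  qed
qed

section \<open>Vacuum exterior and the global solution\<close>

definition W :: "real \<Rightarrow> real \<Rightarrow> real" where
  "W M r = (if a = 0 then M / r else - (1/2) * ln (1 - 2 * M / r))"

text \<open>\<open>W M\<close> solves the reduced equation with constant mass \<open>M\<close> and
  \<open>h = 0\<close>. For \<open>a = 0\<close> it is minus the potential of a point mass, for
  \<open>a = 1\<close> minus the function \<mu> of the Schwarzschild metric.\<close>

lemma W_deriv:
  assumes "0 < r" "2 * a * M < r"
  shows "(W M has_real_derivative - (1 / (1 - 2 * a * M / r) * (M / r\<^sup>2))) (at r)"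
proof (cases "a = 0")
  case True
  then have "W M = (\<lambda>r. M / r)" unfolding W_def[abs_def] by simp
  then show ?thesis using True assms by (auto intro!: derivative_eq_intros simp: power2_eq_square)
next
  case False
  then have a1: "a = 1" using a by simp
  then have W: "W M = (\<lambda>r. - (1/2) * ln (1 - 2 * M / r))" unfolding W_def[abs_def] by simp
  have p: "0 < 1 - 2 * M / r" using assms a1 by (simp add: field_simps)
  have "((\<lambda>r. 1 - 2 * M / r) has_real_derivative 2 * M / r\<^sup>2) (at r)"
    using assms by (auto intro!: derivative_eq_intros simp: power2_eq_square)
  from DERIV_cmult[OF DERIV_chain2[OF DERIV_ln_divide[OF p] this], of "- (1/2)"]
  show ?thesis unfolding W unfolding a1 by simp
qed

lemma W_strict_decreasing:
  assumes "0 < M" "0 < R" "2 * a * M < R" "R < r"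
  shows "W M r < W M R"
proof (cases "a = 0")
  case True
  then show ?thesis unfolding W_def using assms by (simp add: frac_less2)
next
  case False
  then have a1: "a = 1" using a by simp
  have "2 * M / r < 2 * M / R" using assms by (intro divide_strict_left_mono) auto
  moreover have "0 < 1 - 2 * M / R" using assms a1 by (simp add: field_simps)
  ultimately have "ln (1 - 2 * M / R) < ln (1 - 2 * M / r)" by simp
  then show ?thesis unfolding W_def using a1 by simp
qed

lemma W_tendsto: "(W M \<longlongrightarrow> 0) at_top"
proof (cases "a = 0")
  case True
  then have "W M = (\<lambda>r. M / r)" unfolding W_def[abs_def] by simp
  then show ?thesis by (simp add: tendsto_divide_0[OF tendsto_const] filterlim_at_top_imp_at_infinity filterlim_ident)
next
  case False
  then have W: "W M = (\<lambda>r. - (1/2) * ln (1 - 2 * M / r))" unfolding W_def[abs_def] by simp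
  have "((\<lambda>r. 2 * M / r) \<longlongrightarrow> 0) at_top"
    by (rule tendsto_divide_0[OF tendsto_const]) (simp add: filterlim_at_top_imp_at_infinity filterlim_ident)
  then have "((\<lambda>r. - (1/2) * ln (1 - 2 * M / r)) \<longlongrightarrow> - (1/2) * ln (1 - 0)) at_top"
    by (intro tendsto_intros) auto
  then show ?thesis unfolding W by simp
qed

text \<open>\<open>R\<close> is the supremum of the existence radii of positive solutions. By
  uniqueness these fit together, so the value at \<open>r\<close> may be taken from any solution on
  \<open>{0..r}\<close>; a positive solution up to \<open>R\<close> itself could be extended beyond
  \<open>R\<close>.\<close>

lemma maximal_solution:
  obtains R Y where "0 < R" "\<And>T. T < R \<Longrightarrow> sol T Y" "\<nexists>y. sol R y"
proof -
  define S where "S = {T. 0 \<le> T \<and> (\<exists>y. sol T y)}"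
  obtain S1 y1 where S1: "0 < S1" "sol S1 y1" using sol_extend[OF sol_0] by auto
  obtain B where "\<And>T y. sol T y \<Longrightarrow> T \<le> B" using sol_bounded by blast
  then have bdd: "bdd_above S" unfolding S_def by (intro bdd_aboveI[of _ B]) auto
  have S1S: "S1 \<in> S" using S1 by (auto simp: S_def)
  define R where "R = Sup S"
  have R: "0 < R" unfolding R_def using cSup_upper[OF S1S bdd] S1 by linarith
  have ex: "\<exists>y. sol T y" if T: "T < R" for T
  proof -
    obtain T' where T': "T < T'" "T' \<in> S" using less_cSupE[of T S] T S1S unfolding R_def by blast
    then obtain y where "sol T' y" by (auto simp: S_def)
    then show ?thesis using sol_sub T' less_imp_le by blast
  qed
  have notR: "\<not> sol R y" for y
  proof
    assume "sol R y"
    then obtain S' z where "R < S'" "sol S' z" using sol_extend[of R y] R by auto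
    then have "S' \<in> S" using R by (auto simp: S_def)
    from cSup_upper[OF this bdd] \<open>R < S'\<close> show False unfolding R_def by simp
  qed
  define Y where "Y = (\<lambda>r. (SOME z. sol r z) r)"
  have "sol T Y" if T: "T < R" for T
  proof -
    obtain z where z: "sol T z" using ex[OF T] by blast
    have e: "z r = Y r" if "r \<in> {0..T}" for r
    proof -
      have "sol r z" using sol_sub[OF z] that by auto
      then have "sol r (SOME z. sol r z)" by (rule someI[of "sol r"])
      from sol_unique[OF \<open>sol r z\<close> this, of r] show ?thesis using that by (auto simp: Y_def)
    qed
    show ?thesis using z isol_cong[of T z Y] e unfolding sol_def by auto
  qed
  then show ?thesis using that R notR by blast
qed

text \<open>The decreasing positive solution has a limit \<open>c\<close> at \<open>R\<close>, and
  the lower bound on \<open>D\<close> lets the equation pass to the closed interval. If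
  \<open>c\<close> were positive, this would be a positive solution up to \<open>R\<close>, against
  maximality.\<close>

lemma solution_up_to_zero:
  obtains R y where "0 < R" "isol R y" "\<And>T. T < R \<Longrightarrow> sol T y" "y R = 0"
proof -
  obtain R Y where R: "0 < R" and Y: "\<And>T. T < R \<Longrightarrow> sol T Y" and notR: "\<nexists>y. sol R y"
    using maximal_solution by blast
  have anti: "Y t \<le> Y r" if "0 \<le> r" "r \<le> t" "t < R" for r t
    using Y[OF that(3)] isol_antimono[of t Y r t] that by (auto simp: sol_def)
  have pos: "0 < Y r" if "r \<in> {0..<R}" for r using Y[of r] that by (auto simp: sol_def)
  define c where "c = Inf (Y ` {0..<R})"
  have bb: "bdd_below (Y ` {0..<R})" using pos by (auto intro!: bdd_belowI[of _ 0] less_imp_le)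
  have cY: "c \<le> Y r" if "r \<in> {0..<R}" for r unfolding c_def using that bb by (intro cInf_lower) auto
  have c0: "0 \<le> c" unfolding c_def using R pos by (intro cInf_greatest) (auto intro: less_imp_le)
  define y where "y = (\<lambda>r. if r < R then Y r else c)"
  have yY: "y r = Y r" if "r < R" for r using that by (simp add: y_def)
  have y: "sol T y" if "T < R" for T
    using Y[OF that] isol_cong[of T Y y] yY that by (auto simp: sol_def)
  have yc: "continuous_on {0..R} y"
    unfolding continuous_on_eq_continuous_within
  proof
    fix x assume x: "x \<in> {0..R}"
    show "continuous (at x within {0..R}) y"
    proof (cases "x < R")
      case True
      obtain T where T: "x < T" "T < R" using True dense by blast
      have "continuous (at x within {0..T}) y"
        using y[OF T(2)] x T by (auto simp: sol_def isol_def continuous_on_eq_continuous_within)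
      moreover have "at x within {0..T} = at x within {0..R}"
        using T x by (intro at_within_nhd[of _ "{..<T}"]) auto
      ultimately show ?thesis by simp
    next
      case False
      then have xR: "x = R" using x by simp
      have "(y \<longlongrightarrow> c) (at R within {0..R})"
        unfolding tendsto_iff
      proof (intro allI impI)
        fix e :: real assume e: "0 < e"
        have ne: "Y ` {0..<R} \<noteq> {}" using R by auto
        have "Inf (Y ` {0..<R}) < c + e" using e by (simp add: c_def)
        then obtain r where r: "r \<in> {0..<R}" "Y r < c + e"
          unfolding cInf_less_iff[OF ne bb] by blast
        have "dist (y s) c < e" if "s \<in> {0..R}" "s \<noteq> R" "r < s" for s
          using anti[of r s] cY[of s] r that yY[of s] by (auto simp: dist_real_def)
        then show "\<forall>\<^sub>F s in at R within {0..R}. dist (y s) c < e"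
          using r by (auto simp: eventually_at intro!: exI[of _ "R - r"] simp: dist_real_def)
      qed
      then show ?thesis unfolding xR continuous_within by (simp add: y_def)
    qed
  qed
  obtain d where d: "0 < d" "\<And>r. r \<in> {R/2..<R} \<Longrightarrow> d \<le> D y r"
    using D_bounded_below[of "R/2" R y] R y by auto
  have Dc: "continuous_on {0..R} (D y)" by (rule D_continuous[OF yc])
  have "closure {R/2..<R} = {R/2..R}" using R by simp
  moreover have "D y ` closure {R/2..<R} \<subseteq> {d..}"
    using R d(2) by (intro image_closure_subset continuous_on_subset[OF Dc]) auto
  moreover have "R \<in> {R/2..R}" using R by simp
  ultimately have "d \<le> D y R" by blast
  then have DR: "0 < D y R" using d by simp
  have D: "0 < D y r" if "r \<in> {0..R}" for r
    using that DR y[of r] by (cases "r = R") (auto simp: sol_def isol_def)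
  have rc: "continuous_on {0..R} (rhs y)" by (rule rhs_continuous[OF yc D])
  let ?E = "\<lambda>r. y r - (y0 - integral {0..r} (rhs y))"
  have Ec: "continuous_on {0..R} ?E"
    by (intro continuous_intros yc indefinite_integral_continuous_1 integrable_continuous_real rc)
  have "?E r = 0" if "r \<in> {0..<R}" for r using y[of r] that by (auto simp: sol_def isol_def)
  then have "?E r = 0" if "r \<in> {0..R}" for r
    using continuous_constant_on_closure[of "{0..<R}" ?E 0 r] Ec that R by auto
  then have iR: "isol R y" using yc D unfolding isol_def by auto
  have "c = 0"
  proof (rule ccontr)
    assume "c \<noteq> 0"
    then have "sol R y" using iR pos yY c0 by (auto simp: sol_def y_def)
    then show False using notR by blast
  qed
  then show ?thesis using that[OF R iR y] by (simp add: y_def)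
qed

text \<open>Beyond \<open>R\<close> nonpositive values switch off \<open>g\<close> and
  \<open>h\<close>, so the mass is constant and \<open>y\<close> is \<open>W M\<close> shifted to
  vanish at \<open>R\<close>. Positivity of \<open>M\<close> makes it strictly negative there, so
  \<open>R\<close> is the only zero; the shift gives the limit \<open>- W M R\<close>.\<close>

lemma global_solution:
  obtains R M y where "0 < R" "0 < M" "\<And>T. isol T y" "\<And>T. T < R \<Longrightarrow> sol T y" "y R = 0" "\<And>r. R < r \<Longrightarrow> y r < 0"
    "\<And>r. R \<le> r \<Longrightarrow> mass l g y r = M" "(y \<longlongrightarrow> - W M R) at_top"
proof -
  obtain R u where R: "0 < R" and u: "isol R u" "\<And>T. T < R \<Longrightarrow> sol T u" "u R = 0"
    using solution_up_to_zero by blast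
  define M where "M = mass l g u R"
  have M: "0 < M"
  proof -
    have "0 < mass l g u (R/2)" using sol_mass_pos[OF u(2), of "R/2"] R by simp
    also have "\<dots> \<le> M" unfolding M_def using R by (intro mass_mono isol_cont[OF u(1)]) auto
    finally show ?thesis .
  qed
  have "0 < D u R" using isol_D[OF u(1), of R] R by auto
  then have MR: "2 * a * M < R" using R by (simp add: D_def M_def field_simps)
  define y where "y = (\<lambda>r. if r \<le> R then u r else W M r - W M R)"
  have yu: "y r = u r" if "r \<le> R" for r using that by (simp add: y_def)
  have yW: "y r = W M r - W M R" if "R \<le> r" for r using that u(3) by (cases "r = R") (auto simp: y_def)
  have iR: "isol R y" by (rule isol_cong[OF u(1)]) (simp add: yu)
  have sR: "sol T y" if "T < R" for T
    using u(2)[OF that] isol_cong[of T u y] yu that by (auto simp: sol_def)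
  have neg: "y r < 0" if "R < r" for r using W_strict_decreasing[OF M R MR that] yW[of r] that by simp
  have Wd: "(W M has_real_derivative - (1 / (1 - 2 * a * M / r) * (M / r\<^sup>2))) (at r)" if "R \<le> r" for r
    using that R MR by (intro W_deriv) auto
  have yc: "continuous_on {0..T} y" for T
  proof -
    have "continuous_on ({0..R} \<union> {R..}) y"
    proof (intro continuous_on_closed_Un)
      show "continuous_on {0..R} y" by (rule isol_cont[OF iR])
      have "continuous_on {R..} (\<lambda>r. W M r - W M R)"
        using DERIV_isCont[OF Wd] by (intro continuous_intros continuous_at_imp_continuous_on) auto
      then show "continuous_on {R..} y" by (rule continuous_on_eq) (simp add: yW)
    qed auto
    then show ?thesis by (rule continuous_on_subset) auto
  qed
  have mR: "mass l g y R = M" unfolding M_def by (rule mass_cong) (simp add: yu)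
  have mM: "mass l g y r = M" if r: "R \<le> r" for r
  proof -
    have "((\<lambda>s. s powr (2*l+2) * g (y s)) has_integral 0) {R..r}"
      by (rule has_integral_is_0) (use neg g_0 yW in \<open>auto simp: le_less\<close>)
    then have "integral {R..r} (\<lambda>s. s powr (2*l+2) * g (y s)) = 0" by (rule integral_unique)
    moreover have "integral {0..R} (\<lambda>s. s powr (2*l+2) * g (y s)) + integral {R..r} (\<lambda>s. s powr (2*l+2) * g (y s))
       = integral {0..r} (\<lambda>s. s powr (2*l+2) * g (y s))"
      using R r by (intro Henstock_Kurzweil_Integration.integral_combine integrable_continuous_real integrand_continuous g_cont yc) auto
    ultimately show ?thesis using mR by (simp add: mass_eq_integral[OF g_cont yc])
  qed
  have Dy: "D y r = 1 - 2 * a * M / r" if "R \<le> r" for r using mM[OF that] by (simp add: D_def)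
  have Dpos: "0 < D y r" if "0 \<le> r" for r
  proof (cases "r \<le> R")
    case True then show ?thesis using isol_D[OF iR, of r] that by auto
  next
    case False
    then have "2 * a * M / r < 1" using MR R by (simp add: divide_less_eq)
    then show ?thesis using Dy[of r] False by simp
  qed
  have rc: "continuous_on {0..T} (rhs y)" for T by (rule rhs_continuous[OF yc Dpos]) auto
  have iT: "isol T y" for T
    unfolding isol_def
  proof (intro conjI ballI yc)
    fix r assume r: "r \<in> {0..T}"
    then show "0 < D y r" by (intro Dpos) auto
    show "y r = y0 - integral {0..r} (rhs y)"
    proof (cases "r \<le> R")
      case True then show ?thesis using isol_eq[OF iR, of r] r by auto
    next
      case False
      have "(rhs y has_integral ((- W M r) - (- W M R))) {R..r}"
      proof (rule fundamental_theorem_of_calculus)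
        fix x assume x: "x \<in> {R..r}"
        have "rhs y x = 1 / (1 - 2 * a * M / x) * (M / x\<^sup>2)"
          using x mM[of x] Dy[of x] h_0[of "y x"] neg[of x] yW[of R] by (cases "x = R") (auto simp: rhs_def)
        moreover have "((\<lambda>r. - W M r) has_real_derivative - (- (1 / (1 - 2 * a * M / x) * (M / x\<^sup>2)))) (at x within {R..r})"
          using x by (intro DERIV_minus has_field_derivative_at_within[OF Wd]) auto
        ultimately show "((\<lambda>r. - W M r) has_vector_derivative rhs y x) (at x within {R..r})"
          by (simp add: has_real_derivative_iff_has_vector_derivative)
      qed (use False in auto)
      then have "integral {R..r} (rhs y) = W M R - W M r" by (simp add: integral_unique)
      moreover have "integral {0..R} (rhs y) + integral {R..r} (rhs y) = integral {0..r} (rhs y)"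
        using R False by (intro Henstock_Kurzweil_Integration.integral_combine integrable_continuous_real rc) auto
      moreover have "y R = y0 - integral {0..R} (rhs y)" using isol_eq[OF iR, of R] R by auto
      ultimately show ?thesis using yW[of r] yW[of R] False by simp
    qed
  qed
  have "(y \<longlongrightarrow> 0 - W M R) at_top"
  proof (rule Lim_transform_eventually[OF tendsto_diff[OF W_tendsto tendsto_const]])
    show "\<forall>\<^sub>F r in at_top. W M r - W M R = y r"
      using eventually_ge_at_top[of R] by eventually_elim (simp add: yW)
  qed
  then show ?thesis using that[OF R M iT sR _ neg mM] yW[of R] by simp
qed

text \<open>The first zero \<open>x\<close> of a competitor \<open>z\<close> cannot lie before
  \<open>R\<close>: up to \<open>x\<close> both solutions are positive and equal, so
  \<open>y x = 0\<close> by continuity. Beyond \<open>R\<close> both are nonpositive by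
  monotonicity, so the right-hand sides agree there without any Lipschitz bound.\<close>

lemma global_unique:
  assumes y: "\<And>T. isol T y" and sy: "\<And>T. T < R \<Longrightarrow> sol T y" and R: "0 < R" "y R = 0"
    and z: "\<And>T. isol T z" and r: "0 \<le> r"
  shows "z r = y r"
proof -
  have zc: "continuous_on {0..T} z" and yc: "continuous_on {0..T} y" for T using y z isol_cont by auto
  have z0: "z 0 = y0" using isol_initial[OF z order_refl] .
  have pos: "0 < z t" if t: "t \<in> {0..<R}" for t
  proof (rule ccontr)
    assume "\<not> 0 < z t"
    define K where "K = {s\<in>{0..t}. z s = 0}"
    have "closed K" unfolding K_def by (rule continuous_closed_preimage_constant[OF zc]) simp
    moreover have "bounded K" by (rule bounded_subset[of "{0..t}"]) (auto simp: K_def)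
    ultimately have "compact K" by (simp add: compact_eq_bounded_closed)
    moreover have "K \<noteq> {}"
      using IVT2'[of z t 0 0] \<open>\<not> 0 < z t\<close> z0 y0 t zc[of t] by (auto simp: K_def)
    ultimately obtain x where x: "x \<in> K" "\<And>s. s \<in> K \<Longrightarrow> x \<le> s" using compact_attains_inf[of K] by auto
    have x0: "0 < x" using x(1) z0 y0 by (cases "x = 0") (auto simp: K_def)
    have zp: "0 < z s" if sx: "s \<in> {0..<x}" for s
    proof (rule ccontr)
      assume "\<not> 0 < z s"
      then obtain s' where "0 \<le> s'" "s' \<le> s" "z s' = 0"
        using IVT2'[of z s 0 0] z0 y0 sx zc[of s] by auto
      then show False using x(2)[of s'] sx x(1) by (auto simp: K_def)
    qed
    have e: "z s - y s = 0" if "s \<in> {0..<x}" for s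
      using sol_unique[of s z y s] sy[of s] z[of s] zp that x(1) t by (auto simp: sol_def K_def)
    have "z x - y x = 0"
      by (rule continuous_constant_on_closure[of "{0..<x}" "\<lambda>s. z s - y s" 0 x])
         (use e x0 in \<open>auto intro!: continuous_intros zc yc\<close>)
    moreover have "0 < y x" using sy[of x] x(1) t by (auto simp: sol_def K_def)
    ultimately show False using x(1) by (simp add: K_def)
  qed
  have e: "z s - y s = 0" if "s \<in> {0..<R}" for s
    using sol_unique[of s z y s] sy[of s] z[of s] pos that by (auto simp: sol_def)
  have "z R - y R = 0"
    by (rule continuous_constant_on_closure[of "{0..<R}" "\<lambda>s. z s - y s" 0 R])
       (use e R in \<open>auto intro!: continuous_intros zc yc\<close>)
  then have zR: "z R = 0" using R by simp
  have le: "z s \<le> 0" "y s \<le> 0" if "R \<le> s" for s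
    using isol_antimono[OF z, of R s s] isol_antimono[OF y, of R s s] that R zR by auto
  have gh: "g (z s) = g (y s)" "h (z s) = h (y s)" if "0 \<le> s" for s
    using e[of s] le[of s] g_0 h_0 that by (cases "s < R"; simp)+
  have m: "mass l g z s = mass l g y s" if "0 \<le> s" for s by (rule mass_cong) (use gh in auto)
  have "rhs z s = rhs y s" if "0 \<le> s" for s using m[OF that] gh[OF that] by (simp add: rhs_def D_def)
  then have "integral {0..r} (rhs z) = integral {0..r} (rhs y)" by (intro integral_cong) auto
  then show ?thesis using isol_eq[OF z, of r r] isol_eq[OF y, of r r] r by simp
qed

text \<open>The condition \<open>y' 0 = 0\<close> matches the value of \<open>rhs\<close> at the
  centre, which is \<open>0\<close> because division by \<open>0\<close> and powers of base
  \<open>0\<close> give \<open>0\<close>. The fundamental theorem of calculus then passes between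
  both forms on intervals that contain the centre.\<close>

lemma isol_all_iff:
  "(\<forall>T. isol T y) \<longleftrightarrow> y 0 = y0 \<and> (\<forall>r>0. 2 * a * mass l g y r < r) \<and>
     (\<exists>y'. has_C1_derivative y y' \<and> y' 0 = 0 \<and> (\<forall>r>0. y' r = - rhs y r))" (is "?A \<longleftrightarrow> ?B")
proof
  assume A: ?A
  have "2 * a * mass l g y r < r" if "0 < r" for r
  proof -
    have "0 < D y r" using isol_D[of r y r] A that by simp
    then have "2 * a * mass l g y r / r < 1" by (simp add: D_def)
    then show ?thesis using that by (simp add: divide_less_eq)
  qed
  moreover have "has_C1_derivative y (\<lambda>r. - rhs y r)"
    unfolding has_C1_derivative_def continuous_on_eq_continuous_within
  proof (intro conjI ballI allI impI)
    fix r :: real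
    have at: "at r within {0..r+1} = at r within {0..}"
      by (intro at_within_nhd[of _ "{..<r+1}"]) auto
    { assume "0 \<le> r"
      then show "(y has_real_derivative - rhs y r) (at r within {0..})"
        using isol_deriv[of "r+1" y r] A at by simp }
    assume "r \<in> {0..}"
    moreover have "continuous_on {0..r+1} (\<lambda>r. - rhs y r)"
      using A by (intro continuous_intros rhs_continuous) (auto simp: isol_def)
    ultimately have "continuous (at r within {0..r+1}) (\<lambda>r. - rhs y r)"
      unfolding continuous_on_eq_continuous_within by auto
    then show "continuous (at r within {0..}) (\<lambda>r. - rhs y r)"
      using at by simp
  qed
  ultimately show ?B using A isol_initial[of 0 y] by (auto simp: rhs_def intro!: exI[of _ "\<lambda>r. - rhs y r"])
next
  assume B: ?B
  then obtain y' where y': "has_C1_derivative y y'" "y' 0 = 0" "\<And>r. 0 < r \<Longrightarrow> y' r = - rhs y r" by blast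
  have yd: "(y has_real_derivative - rhs y r) (at r within {0..})" if "0 \<le> r" for r
    using y' that by (cases "r = 0") (auto simp: has_C1_derivative_def rhs_def)
  have yc: "continuous_on {0..T} y" for T
  proof (rule continuous_on_subset)
    show "continuous_on {0..} y" using DERIV_continuous[OF yd] by (simp add: continuous_on_eq_continuous_within)
  qed auto
  have D: "0 < D y r" if "0 \<le> r" for r
  proof (cases "r = 0")
    case False
    then have "2 * a * mass l g y r < r" using B that by simp
    then show ?thesis using False that by (simp add: D_def divide_less_eq)
  qed (simp add: D_def)
  have "y r = y0 - integral {0..r} (rhs y)" if "0 \<le> r" for r
  proof -
    have "((\<lambda>r. - rhs y r) has_integral (y r - y 0)) {0..r}"
      using that by (intro fundamental_theorem_of_calculus)
        (simp_all flip: has_real_derivative_iff_has_vector_derivative add: DERIV_subset[OF yd])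
    then have "integral {0..r} (\<lambda>r. - rhs y r) = y r - y 0" by (rule integral_unique)
    then show ?thesis using B by (simp add: integral_neg)
  qed
  then show ?A unfolding isol_def using yc D by auto
qed

end

section \<open>Convolution with a kernel\<close>

text \<open>The kernel enters only through its values at positive arguments.\<close>

definition conv :: "(real \<Rightarrow> real) \<Rightarrow> (real \<Rightarrow> real) \<Rightarrow> real \<Rightarrow> real" where
  "conv \<Psi> k y = (LINT z|lebesgue. \<Psi> z * (if z < y then k (y - z) else 0))"

lemma id_measurable_lebesgue[measurable]: "(\<lambda>x::'a::euclidean_space. x) \<in> borel_measurable lebesgue"
  by (rule measurable_completion) simp

text \<open>\<Phi> is only Lebesgue measurable, so Tonelli's theorem is applied with the completed
  measure as one factor.\<close>

lemma sigma_finite_lebesgue: "sigma_finite_measure (lebesgue :: 'a::euclidean_space measure)"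
proof
  obtain A :: "nat \<Rightarrow> 'a set" where A: "range A \<subseteq> sets lborel" "(\<Union>i. A i) = space lborel" "\<And>i. emeasure lborel (A i) \<noteq> \<infinity>"
    using lborel.sigma_finite by blast
  show "\<exists>A. countable A \<and> A \<subseteq> sets (lebesgue :: 'a measure) \<and> \<Union>A = space lebesgue \<and> (\<forall>a\<in>A. emeasure lebesgue a \<noteq> \<infinity>)"
    using A by (intro exI[of _ "range A"]) (auto intro!: sets_completionI_sets)
qed

text \<open>On bounded intervals \<open>\<Psi>\<close> may blow up only at \<open>0\<close>, and
  integrably. A \<open>kernel\<close> has \<open>k 0 = 0\<close>, and its derivative may likewise
  blow up at \<open>0\<close>, as that of \<open>t powr (l + 1/2)\<close> does for
  \<open>l < 1/2\<close>.\<close>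

locale profile =
  fixes \<Psi> :: "real \<Rightarrow> real"
  assumes nonneg: "\<And>z. 0 \<le> \<Psi> z" and meas[measurable]: "\<Psi> \<in> borel_measurable lebesgue"
    and int: "\<And>Y. set_integrable lebesgue {0..Y} \<Psi>"
    and bdd: "\<And>e Y. 0 < e \<Longrightarrow> \<exists>M. \<forall>z\<in>{e..Y}. \<Psi> z \<le> M"
    and neg: "\<And>z. z < 0 \<Longrightarrow> \<Psi> z = 0"

locale kernel =
  fixes k k' :: "real \<Rightarrow> real"
  assumes k_cont: "continuous_on {0..} k" and k_0: "k 0 = 0"
    and k_deriv: "\<And>t. 0 < t \<Longrightarrow> (k has_real_derivative k' t) (at t)"
    and k'_cont: "continuous_on {0<..} k'" and k'_nonneg: "\<And>t. 0 < t \<Longrightarrow> 0 \<le> k' t"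
begin

definition kp :: "real \<Rightarrow> real" where "kp t = (if 0 < t then k' t else 0)"

lemma kp_nonneg: "0 \<le> kp t" using k'_nonneg by (simp add: kp_def)

lemma kp_meas[measurable]: "kp \<in> borel_measurable borel"
proof -
  have "(\<lambda>t. indicator {0<..} t *\<^sub>R k' t) \<in> borel_measurable borel"
    by (rule borel_measurable_continuous_on_indicator[OF _ k'_cont]) simp
  moreover have "kp = (\<lambda>t. indicator {0<..} t *\<^sub>R k' t)" by (auto simp: kp_def indicator_def fun_eq_iff)
  ultimately show ?thesis by simp
qed

lemma k_mono: assumes "0 \<le> s" "s \<le> t" shows "k s \<le> k t"
proof (rule DERIV_nonneg_imp_increasing_open[OF assms(2)])
  show "continuous_on {s..t} k" using assms by (intro continuous_on_subset[OF k_cont]) auto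
  fix x assume "s < x" "x < t"
  then show "\<exists>z. (k has_real_derivative z) (at x) \<and> 0 \<le> z"
    using k_deriv[of x] k'_nonneg[of x] assms by auto
qed

lemma k_nonneg: "0 \<le> t \<Longrightarrow> 0 \<le> k t" using k_mono[of 0 t] k_0 by simp

lemma nn_integral_kp: assumes "0 \<le> c" shows "(\<integral>\<^sup>+t. ennreal (kp t) * indicator {..c} t \<partial>lborel) = ennreal (k c)"
proof -
  have "(k' has_integral k c - k 0) {0..c}"
    using assms by (intro fundamental_theorem_of_calculus_interior continuous_on_subset[OF k_cont])
      (auto simp flip: has_real_derivative_iff_has_vector_derivative intro: k_deriv)
  then have "(kp has_integral k c) {0..c}"
    using k_0 by (intro has_integral_spike_finite[of "{0}" _ kp k' "k c"]) (auto simp: kp_def)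
  then have "(\<integral>\<^sup>+t. ennreal (kp t) * indicator {0..c} t \<partial>lborel) = ennreal (k c)"
    by (intro nn_integral_has_integral_lebesgue' kp_nonneg)
  moreover have "ennreal (kp t) * indicator {0..c} t = ennreal (kp t) * indicator {..c} t" for t
    by (auto simp: indicator_def kp_def)
  ultimately show ?thesis by simp
qed

lemma nn_integral_kp_shift:
  "(\<integral>\<^sup>+s. ennreal (kp (s - z)) * indicator {..y} s \<partial>lborel) = ennreal (if z < y then k (y - z) else 0)"
proof -
  have "(\<integral>\<^sup>+s. ennreal (kp (s - z)) * indicator {..y} s \<partial>lborel)
     = (\<integral>\<^sup>+s. ennreal (kp (z + 1 * s - z)) * indicator {..y} (z + 1 * s) \<partial>lborel)"
    by (subst nn_integral_real_affine[where c=1 and t=z]) auto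
  also have "\<dots> = (\<integral>\<^sup>+s. ennreal (kp s) * indicator {..y-z} s \<partial>lborel)"
    by (intro nn_integral_cong) (auto simp: indicator_def)
  also have "\<dots> = ennreal (if z < y then k (y - z) else 0)"
  proof (cases "z < y")
    case False
    have "(\<integral>\<^sup>+s. ennreal (kp s) * indicator {..y-z} s \<partial>lborel) = (\<integral>\<^sup>+s. 0 \<partial>(lborel :: real measure))"
      using False by (intro nn_integral_cong) (auto simp: kp_def indicator_def)
    then show ?thesis using False by simp
  qed (simp add: nn_integral_kp)
  finally show ?thesis .
qed

lemma nn_integral_kp_reflect:
  assumes "0 \<le> c"
  shows "(\<integral>\<^sup>+z. ennreal (kp (y - z)) * indicator {y-c..} z \<partial>lborel) = ennreal (k c)"
proof -
  have "(\<integral>\<^sup>+z. ennreal (kp (y - z)) * indicator {y-c..} z \<partial>lborel)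
     = (\<integral>\<^sup>+z. ennreal (kp (y - (y + (-1) * z))) * indicator {y-c..} (y + (-1) * z) \<partial>lborel)"
    by (subst nn_integral_real_affine[where c="-1" and t=y]) auto
  also have "\<dots> = (\<integral>\<^sup>+s. ennreal (kp s) * indicator {..c} s \<partial>lborel)"
    by (intro nn_integral_cong) (auto simp: indicator_def)
  finally show ?thesis using nn_integral_kp[OF assms] by simp
qed

definition k0 :: "real \<Rightarrow> real" where "k0 t = (if 0 < t then k t else 0)"

lemma k0_cont: "continuous_on UNIV k0"
proof -
  have "continuous_on ({..0} \<union> {0..}) k0"
  proof (intro continuous_on_closed_Un)
    show "continuous_on {..0} k0"
      by (rule continuous_on_eq[of _ "\<lambda>_. 0"]) (auto simp: k0_def)
    show "continuous_on {0..} k0"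
      by (rule continuous_on_eq[OF k_cont]) (use k_0 in \<open>auto simp: k0_def\<close>)
  qed auto
  moreover have "{..0} \<union> {0..} = (UNIV :: real set)" by auto
  ultimately show ?thesis by simp
qed

lemma k0_meas[measurable]: "k0 \<in> borel_measurable borel"
  using k0_cont by (rule borel_measurable_continuous_onI)

lemma k0_nonneg: "0 \<le> k0 t" using k_nonneg by (simp add: k0_def)

lemma k0_le: "t \<le> s \<Longrightarrow> k0 t \<le> k0 s"
  using k_mono[of t s] k_nonneg[of s] by (auto simp: k0_def)

lemma conv_k0: "conv \<Psi> k y = (LINT z|lebesgue. \<Psi> z * k0 (y - z))"
  unfolding conv_def k0_def by (intro Bochner_Integration.integral_cong) auto

lemma conv_kp: "conv \<Psi> k' y = (LINT z|lebesgue. \<Psi> z * kp (y - z))"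
  unfolding conv_def kp_def by (intro Bochner_Integration.integral_cong) auto

end

locale convolution = profile \<Psi> + kernel k k' for \<Psi> k k' :: "real \<Rightarrow> real"
begin

lemma integrable_cutoff: "integrable lebesgue (\<lambda>z. \<Psi> z * indicator {..Y} z)"
proof -
  have "(\<lambda>z. \<Psi> z * indicator {..Y} z) = (\<lambda>z. indicator {0..Y} z *\<^sub>R \<Psi> z)"
    using neg by (auto simp: indicator_def fun_eq_iff)
  then show ?thesis using int[of Y] by (simp add: set_integrable_def)
qed

lemma integrable_k0: "integrable lebesgue (\<lambda>z. \<Psi> z * k0 (y - z))"
proof (rule Bochner_Integration.integrable_bound[OF integrable_mult_right[OF integrable_cutoff, of "k0 y" y]])
  show "AE z in lebesgue. norm (\<Psi> z * k0 (y - z)) \<le> norm (k0 y * (\<Psi> z * indicator {..y} z))"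
  proof (rule AE_I2)
    fix z
    show "norm (\<Psi> z * k0 (y - z)) \<le> norm (k0 y * (\<Psi> z * indicator {..y} z))"
    proof (cases "0 \<le> z \<and> z < y")
      case True
      then have "\<Psi> z * k0 (y - z) \<le> \<Psi> z * k0 y" using nonneg by (intro mult_left_mono k0_le) auto
      then show ?thesis using nonneg[of z] k0_nonneg True by (simp add: abs_mult mult.commute)
    next
      case False
      then have "\<Psi> z = 0 \<or> k0 (y - z) = 0" using neg by (auto simp: k0_def)
      then show ?thesis by auto
    qed
  qed
qed measurable

text \<open>The integral is split at \<open>y/2\<close>: to the left \<open>k' (y - z)\<close> is
  bounded and \<open>\<Psi>\<close> integrable, to the right \<open>\<Psi>\<close> is bounded by
  \<open>M\<close> and the derivative of the kernel integrable.\<close>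

lemma integrable_kp:
  assumes y: "0 < y"
  shows "integrable lebesgue (\<lambda>z. \<Psi> z * kp (y - z))"
proof -
  obtain M where M: "\<forall>z\<in>{y/2..y}. \<Psi> z \<le> M" using bdd[of "y/2" y] y by auto
  then have "\<Psi> y \<le> M" using y by auto
  then have M0: "0 \<le> M" using nonneg[of y] by linarith
  have "continuous_on {y/2..y} k'" using y by (intro continuous_on_subset[OF k'_cont]) auto
  then have "bounded (k' ` {y/2..y})" by (intro compact_imp_bounded compact_continuous_image) auto
  then obtain B where B: "0 < B" "\<And>t. t \<in> {y/2..y} \<Longrightarrow> \<bar>k' t\<bar> \<le> B" by (force simp: bounded_pos)
  have ip: "integrable lebesgue (\<lambda>z. kp (y - z) * indicator {y/2..} z)"
  proof -
    have "integrable lborel (\<lambda>z. kp (y - z) * indicator {y/2..} z)"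
    proof (rule integrableI_nonneg)
      have "(\<integral>\<^sup>+z. ennreal (kp (y - z) * indicator {y/2..} z) \<partial>lborel)
         = (\<integral>\<^sup>+z. ennreal (kp (y - z)) * indicator {y-y/2..} z \<partial>lborel)"
        by (intro nn_integral_cong) (auto simp: indicator_def)
      also have "\<dots> < \<infinity>" using y by (subst nn_integral_kp_reflect) auto
      finally show "(\<integral>\<^sup>+z. ennreal (kp (y - z) * indicator {y/2..} z) \<partial>lborel) < \<infinity>" .
    qed (auto simp: kp_nonneg)
    then show ?thesis by (subst integrable_completion) auto
  qed
  have I: "integrable lebesgue (\<lambda>z. B * (\<Psi> z * indicator {..y} z) + M * (kp (y - z) * indicator {y/2..} z))"
    by (intro Bochner_Integration.integrable_add integrable_mult_right integrable_cutoff ip)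
  show ?thesis
  proof (rule Bochner_Integration.integrable_bound[OF I])
    show "AE z in lebesgue. norm (\<Psi> z * kp (y - z)) \<le> norm (B * (\<Psi> z * indicator {..y} z) + M * (kp (y - z) * indicator {y/2..} z))"
    proof (rule AE_I2)
      fix z
      have n: "0 \<le> B * (\<Psi> z * indicator {..y} z)" "0 \<le> M * (kp (y - z) * indicator {y/2..} z)"
        using nonneg kp_nonneg B M0 by auto
      have "\<Psi> z * kp (y - z) \<le> B * (\<Psi> z * indicator {..y} z) + M * (kp (y - z) * indicator {y/2..} z)"
      proof (cases "0 \<le> z \<and> z < y")
        case False
        then have "\<Psi> z = 0 \<or> kp (y - z) = 0" using neg by (auto simp: kp_def)
        then show ?thesis using n by (metis add_nonneg_nonneg mult_eq_0_iff)
      next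
        case True
        show ?thesis
        proof (cases "z < y/2")
          case z: True
          then have "kp (y - z) \<le> B" using True B(2)[of "y - z"] by (auto simp: kp_def)
          then have "\<Psi> z * kp (y - z) \<le> \<Psi> z * B" using nonneg by (intro mult_left_mono)
          then show ?thesis using n True by (simp add: mult.commute)
        next
          case z: False
          then have "\<Psi> z * kp (y - z) \<le> M * kp (y - z)"
            using M True kp_nonneg by (intro mult_right_mono) auto
          then show ?thesis using n z by simp
        qed
      qed
      then show "norm (\<Psi> z * kp (y - z)) \<le> norm (B * (\<Psi> z * indicator {..y} z) + M * (kp (y - z) * indicator {y/2..} z))"
        using nonneg[of z] kp_nonneg[of "y - z"] by (simp add: abs_mult)
    qed
  qed measurable
qed

lemma conv_nonneg: "0 \<le> conv \<Psi> k y"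
  unfolding conv_k0 by (intro integral_nonneg_AE AE_I2 mult_nonneg_nonneg nonneg k0_nonneg)

lemma conv_nonpos: "y \<le> 0 \<Longrightarrow> conv \<Psi> k y = 0"
proof -
  assume "y \<le> 0"
  then have "\<Psi> z * k0 (y - z) = 0" for z using neg[of z] by (cases "z < 0") (auto simp: k0_def)
  then show ?thesis unfolding conv_k0 by (intro integral_eq_zero_AE AE_I2)
qed

lemma conv_le: assumes "0 \<le> y" shows "conv \<Psi> k y \<le> k0 y * (LINT z|lebesgue. \<Psi> z * indicator {..y} z)"
proof -
  have "conv \<Psi> k y \<le> (LINT z|lebesgue. k0 y * (\<Psi> z * indicator {..y} z))"
    unfolding conv_k0
  proof (intro integral_mono integrable_k0 integrable_mult_right integrable_cutoff)
    fix z
    show "\<Psi> z * k0 (y - z) \<le> k0 y * (\<Psi> z * indicator {..y} z)"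
    proof (cases "0 \<le> z \<and> z < y")
      case True
      then have "\<Psi> z * k0 (y - z) \<le> \<Psi> z * k0 y" using nonneg by (intro mult_left_mono k0_le) auto
      then show ?thesis using True by (simp add: mult.commute)
    next
      case False
      then have "\<Psi> z = 0 \<or> k0 (y - z) = 0" using neg by (auto simp: k0_def)
      moreover have "0 \<le> k0 y * (\<Psi> z * indicator {..y} z)" using nonneg k0_nonneg by auto
      ultimately show ?thesis by auto
    qed
  qed
  then show ?thesis by simp
qed

text \<open>Nonnegativity allows the exchange of the integrals; the inner integral over
  \<open>s\<close> then restores \<open>k (y - z)\<close> from its derivative.\<close>

lemma nn_integral_conv:
  "(\<integral>\<^sup>+s. (\<integral>\<^sup>+z. ennreal (\<Psi> z * kp (s - z)) \<partial>lebesgue) * indicator {..y} s \<partial>lborel) = ennreal (conv \<Psi> k y)"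
proof -
  interpret L: sigma_finite_measure "lebesgue :: real measure"
    by (rule sigma_finite_lebesgue)
  interpret pair_sigma_finite "lebesgue :: real measure" "lborel :: real measure" ..
  have m[measurable]: "(\<lambda>(z, s). ennreal (\<Psi> z * kp (s - z)) * indicator {..y} s) \<in> borel_measurable (lebesgue \<Otimes>\<^sub>M lborel)"
    by measurable
  have "(\<integral>\<^sup>+s. (\<integral>\<^sup>+z. ennreal (\<Psi> z * kp (s - z)) \<partial>lebesgue) * indicator {..y} s \<partial>lborel)
      = (\<integral>\<^sup>+s. (\<integral>\<^sup>+z. ennreal (\<Psi> z * kp (s - z)) * indicator {..y} s \<partial>lebesgue) \<partial>lborel)"
    by (intro nn_integral_cong nn_integral_multc[symmetric]) measurable
  also have "\<dots> = (\<integral>\<^sup>+z. (\<integral>\<^sup>+s. ennreal (\<Psi> z * kp (s - z)) * indicator {..y} s \<partial>lborel) \<partial>lebesgue)"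
    using Fubini[OF m] by simp
  also have "\<dots> = (\<integral>\<^sup>+z. ennreal (\<Psi> z) * (\<integral>\<^sup>+s. ennreal (kp (s - z)) * indicator {..y} s \<partial>lborel) \<partial>lebesgue)"
    by (intro nn_integral_cong) (simp add: nn_integral_cmult[symmetric] ennreal_mult nonneg kp_nonneg mult.assoc)
  also have "\<dots> = (\<integral>\<^sup>+z. ennreal (\<Psi> z * k0 (y - z)) \<partial>lebesgue)"
    unfolding nn_integral_kp_shift
    by (intro nn_integral_cong) (auto simp: k0_def ennreal_mult nonneg k_nonneg)
  also have "\<dots> = ennreal (conv \<Psi> k y)"
    unfolding conv_k0 by (intro nn_integral_eq_integral integrable_k0 AE_I2 mult_nonneg_nonneg nonneg k0_nonneg)
  finally show ?thesis .
qed

text \<open>The derivative of the kernel may be singular at \<open>0\<close>. Cutting it off near \<open>0\<close> changes the convolution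
  on \<open>{a..b}\<close> by at most \<open>k (2 / n)\<close> times a bound for \<open>\<Psi>\<close> on \<open>{a/2..b}\<close>.\<close>

definition cut :: "nat \<Rightarrow> real \<Rightarrow> real" where
  "cut n t = kp t * max 0 (min 1 (real n * t - 1))"

lemma cut_cont: assumes n: "0 < n" shows "continuous_on UNIV (cut n)"
proof -
  have "continuous_on ({..1/n} \<union> {1/n..}) (cut n)"
  proof (intro continuous_on_closed_Un)
    show "continuous_on {..1/real n} (cut n)"
      using n by (intro continuous_on_eq[of _ "\<lambda>_. 0" "cut n"]) (auto simp: cut_def field_simps)
    have "continuous_on {1/real n..} (\<lambda>t. k' t * max 0 (min 1 (real n * t - 1)))"
      using n by (intro continuous_intros continuous_on_subset[OF k'_cont]) (auto intro: less_le_trans[of 0 "1/n"])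
    then show "continuous_on {1/real n..} (cut n)"
      by (rule continuous_on_eq) (use n in \<open>auto simp: cut_def kp_def intro: less_le_trans[of 0 "1/n"]\<close>)
  qed auto
  moreover have "{..1/real n} \<union> {1/real n..} = UNIV" by auto
  ultimately show ?thesis by simp
qed

lemma cut_le: "0 \<le> cut n t" "cut n t \<le> kp t"
  using kp_nonneg[of t] mult_left_mono[of "max 0 (min 1 (real n * t - 1))" 1 "kp t"] by (auto simp: cut_def)

lemma cut_eq: "2 \<le> real n * t \<Longrightarrow> cut n t = kp t"
  by (simp add: cut_def min_def)

lemma cut_conv_cont:
  assumes n: "0 < n" and ab: "0 < a"
  shows "continuous_on {a..b} (\<lambda>y. LINT z|lebesgue. \<Psi> z * cut n (y - z))"
  unfolding continuous_on_sequentially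
proof (intro allI ballI impI)
  fix x y assume y: "y \<in> {a..b}" and x: "(\<forall>i. x i \<in> {a..b}) \<and> x \<longlonglongrightarrow> y"
  have cm[measurable]: "cut n \<in> borel_measurable borel" by (rule borel_measurable_continuous_onI[OF cut_cont[OF n]])
  have "bounded (cut n ` {0..b})"
    by (intro compact_imp_bounded compact_continuous_image continuous_on_subset[OF cut_cont[OF n]]) auto
  then obtain B where B: "0 < B" "\<And>t. t \<in> {0..b} \<Longrightarrow> \<bar>cut n t\<bar> \<le> B" by (force simp: bounded_pos)
  have "(\<lambda>i. LINT z|lebesgue. \<Psi> z * cut n (x i - z)) \<longlonglongrightarrow> (LINT z|lebesgue. \<Psi> z * cut n (y - z))"
  proof (rule integral_dominated_convergence[where w="\<lambda>z. B * (\<Psi> z * indicator {..b} z)"])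
    show "integrable lebesgue (\<lambda>z. B * (\<Psi> z * indicator {..b} z))"
      by (intro integrable_mult_right integrable_cutoff)
    show "AE z in lebesgue. (\<lambda>i. \<Psi> z * cut n (x i - z)) \<longlonglongrightarrow> \<Psi> z * cut n (y - z)"
    proof (intro AE_I2 tendsto_mult tendsto_const)
      fix z
      have "(\<lambda>i. x i - z) \<longlonglongrightarrow> y - z" using x by (intro tendsto_intros) auto
      then show "(\<lambda>i. cut n (x i - z)) \<longlonglongrightarrow> cut n (y - z)"
        by (rule continuous_on_tendsto_compose[OF cut_cont[OF n]]) auto
    qed
    fix i
    show "AE z in lebesgue. norm (\<Psi> z * cut n (x i - z)) \<le> B * (\<Psi> z * indicator {..b} z)"
    proof (rule AE_I2)
      fix z
      show "norm (\<Psi> z * cut n (x i - z)) \<le> B * (\<Psi> z * indicator {..b} z)"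
      proof (cases "0 \<le> z \<and> z < x i")
        case True
        have xi: "x i \<le> b" using x by auto
        then have "\<Psi> z * \<bar>cut n (x i - z)\<bar> \<le> \<Psi> z * B"
          using True nonneg by (intro mult_left_mono B) auto
        then show ?thesis using True xi nonneg[of z] by (simp add: abs_mult mult.commute)
      next
        case False
        then have "\<Psi> z = 0 \<or> cut n (x i - z) = 0" using neg by (auto simp: cut_def kp_def)
        moreover have "0 \<le> B * (\<Psi> z * indicator {..b} z)" using nonneg B by auto
        ultimately show ?thesis by auto
      qed
    qed
  qed measurable
  then show "((\<lambda>y. LINT z|lebesgue. \<Psi> z * cut n (y - z)) \<circ> x) \<longlonglongrightarrow> (LINT z|lebesgue. \<Psi> z * cut n (y - z))"
    by (simp add: o_def)
qed

text \<open>\<open>cut n\<close> differs from \<open>kp\<close> only for arguments below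
  \<open>2/n\<close>. The condition \<open>4 \<le> n * a\<close> puts the window
  \<open>{y - 2/n..y}\<close> inside \<open>{a/2..b}\<close>, where \<open>\<Psi> \<le> M\<close>,
  and the integral of \<open>kp\<close> over the window is \<open>k (2/n)\<close>.\<close>

lemma cut_conv_error:
  assumes a: "0 < a" and M: "\<And>z. z \<in> {a/2..b} \<Longrightarrow> \<Psi> z \<le> M" and n: "0 < n" "4 \<le> real n * a" and y: "y \<in> {a..b}"
  shows "\<bar>conv \<Psi> k' y - (LINT z|lebesgue. \<Psi> z * cut n (y - z))\<bar> \<le> M * k (2 / real n)"
proof -
  have cm[measurable]: "cut n \<in> borel_measurable borel" by (rule borel_measurable_continuous_onI[OF cut_cont[OF n(1)]])
  have y0: "0 < y" using a y by auto
  have M0: "0 \<le> M" using M[of y] nonneg[of y] a y by auto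
  have n0: "2 / real n \<le> a / 2" using n by (simp add: field_simps)
  note I = integrable_kp[OF y0]
  have Ic: "integrable lebesgue (\<lambda>z. \<Psi> z * cut n (y - z))"
    by (rule Bochner_Integration.integrable_bound[OF I])
       (auto simp: abs_mult nonneg kp_nonneg cut_le intro!: mult_left_mono)
  have J: "integrable lborel (\<lambda>z. kp (y - z) * indicator {y - 2/n..} z)" "(LINT z|lborel. kp (y - z) * indicator {y - 2/n..} z) = k (2/n)"
  proof -
    have "(\<integral>\<^sup>+z. ennreal (kp (y - z) * indicator {y - 2/n..} z) \<partial>lborel)
         = (\<integral>\<^sup>+z. ennreal (kp (y - z)) * indicator {y-2/n..} z \<partial>lborel)"
      by (intro nn_integral_cong) (auto simp: indicator_def)
    also have "\<dots> = ennreal (k (2/n))" using n by (intro nn_integral_kp_reflect) auto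
    finally have N: "(\<integral>\<^sup>+z. ennreal (kp (y - z) * indicator {y - 2/n..} z) \<partial>lborel) = ennreal (k (2/n))" .
    show "integrable lborel (\<lambda>z. kp (y - z) * indicator {y - 2/n..} z)"
      by (rule integrableI_nonneg) (auto simp: kp_nonneg N)
    show "(LINT z|lborel. kp (y - z) * indicator {y - 2/n..} z) = k (2/n)"
      by (subst integral_eq_nn_integral) (auto simp: kp_nonneg N k_nonneg)
  qed
  have J': "integrable lebesgue (\<lambda>z. kp (y - z) * indicator {y - 2/n..} z)"
    using J(1) by (subst integrable_completion) auto
  have pw: "0 \<le> \<Psi> z * kp (y - z) - \<Psi> z * cut n (y - z) \<and>
     \<Psi> z * kp (y - z) - \<Psi> z * cut n (y - z) \<le> M * (kp (y - z) * indicator {y - 2/n..} z)" for z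
  proof (cases "2/n \<le> y - z")
    case True
    then have "2 \<le> n * (y - z)" using n by (simp add: field_simps)
    then show ?thesis using cut_eq M0 kp_nonneg by (simp add: indicator_def)
  next
    case False
    have le: "\<Psi> z * cut n (y - z) \<le> \<Psi> z * kp (y - z)" using nonneg cut_le by (intro mult_left_mono)
    have c0: "0 \<le> \<Psi> z * cut n (y - z)" using nonneg cut_le by (intro mult_nonneg_nonneg)
    have "\<Psi> z * kp (y - z) \<le> M * kp (y - z)"
    proof (cases "z < y")
      case True
      then have "a/2 \<le> z" "z \<le> b" using False n0 y by (simp_all add: field_simps)
      then show ?thesis using M kp_nonneg by (intro mult_right_mono) auto
    qed (simp add: kp_def)
    then show ?thesis using le c0 False by (simp add: indicator_def)
  qed
  have "conv \<Psi> k' y - (LINT z|lebesgue. \<Psi> z * cut n (y - z)) = (LINT z|lebesgue. \<Psi> z * kp (y - z) - \<Psi> z * cut n (y - z))"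
    unfolding conv_kp by (rule Bochner_Integration.integral_diff[OF I Ic, symmetric])
  moreover have "0 \<le> (LINT z|lebesgue. \<Psi> z * kp (y - z) - \<Psi> z * cut n (y - z))"
    using pw by (intro integral_nonneg_AE AE_I2) auto
  moreover have "(LINT z|lebesgue. \<Psi> z * kp (y - z) - \<Psi> z * cut n (y - z)) \<le> (LINT z|lebesgue. M * (kp (y - z) * indicator {y - 2/n..} z))"
    using pw by (intro integral_mono Bochner_Integration.integrable_diff I Ic integrable_mult_right J') auto
  moreover have "(LINT z|lebesgue. kp (y - z) * indicator {y - 2/n..} z) = k (2/n)"
    using J(2) by (subst integral_completion) auto
  then have "(LINT z|lebesgue. M * (kp (y - z) * indicator {y - 2/n..} z)) = M * k (2/n)"
    by (metis integral_mult_right_zero)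
  ultimately show ?thesis by linarith
qed

text \<open>The cut-off error tends to a multiple of \<open>k 0 = 0\<close> uniformly on
  \<open>{a..b}\<close>, so continuity passes to the limit.\<close>

lemma conv_k'_continuous: "continuous_on {0<..} (conv \<Psi> k')"
proof -
  have "continuous_on {a..b} (conv \<Psi> k')" if a: "0 < a" for a b
  proof (rule uniform_limit_theorem)
    show "\<forall>\<^sub>F n in sequentially. continuous_on {a..b} (\<lambda>y. LINT z|lebesgue. \<Psi> z * cut n (y - z))"
      using eventually_gt_at_top[of 0] by eventually_elim (rule cut_conv_cont[OF _ a])
    obtain M where M: "\<forall>z\<in>{a/2..b}. \<Psi> z \<le> M" using bdd[of "a/2" b] a by auto
    have "(\<lambda>n. k0 (2 * inverse (real n))) \<longlonglongrightarrow> k0 (2 * 0)"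
      by (intro continuous_on_tendsto_compose[OF k0_cont] tendsto_intros lim_inverse_n) auto
    then have "(\<lambda>n. M * k0 (2 * inverse (real n))) \<longlonglongrightarrow> M * k0 (2 * 0)" by (intro tendsto_intros)
    then have lim: "(\<lambda>n. M * k0 (2 * inverse (real n))) \<longlonglongrightarrow> 0" by (simp add: k0_def)
    show "uniform_limit {a..b} (\<lambda>n y. LINT z|lebesgue. \<Psi> z * cut n (y - z)) (conv \<Psi> k') sequentially"
      unfolding uniform_limit_iff
    proof (intro allI impI)
      fix e :: real assume "0 < e"
      have "\<forall>\<^sub>F n in sequentially. M * k0 (2 * inverse (real n)) < e"
        using order_tendstoD(2)[OF lim \<open>0 < e\<close>] .
      moreover have "\<forall>\<^sub>F n in sequentially. 4 / a \<le> real n"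
        by (rule eventually_at_top_linorderI[of "nat \<lceil>4/a\<rceil>"]) linarith
      ultimately show "\<forall>\<^sub>F n in sequentially. \<forall>y\<in>{a..b}. dist (LINT z|lebesgue. \<Psi> z * cut n (y - z)) (conv \<Psi> k' y) < e"
        using eventually_gt_at_top[of 0]
      proof eventually_elim
        case (elim n)
        then have n: "4 \<le> real n * a" using a by (simp add: field_simps)
        have k: "k0 (2 * inverse (real n)) = k (2 / real n)" using elim by (simp add: k0_def divide_inverse)
        show ?case
        proof
          fix y assume "y \<in> {a..b}"
          then have "\<bar>conv \<Psi> k' y - (LINT z|lebesgue. \<Psi> z * cut n (y - z))\<bar> \<le> M * k (2 / real n)"
            using M elim by (intro cut_conv_error[OF a _ _ n]) auto
          also have "\<dots> < e" using elim k by simp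
          finally show "dist (LINT z|lebesgue. \<Psi> z * cut n (y - z)) (conv \<Psi> k' y) < e"
            by (simp add: dist_real_def abs_minus_commute)
        qed
      qed
    qed
  qed simp
  then have "isCont (conv \<Psi> k') y" if "0 < y" for y
    using that by (intro continuous_on_interior[of "{y/2..2*y}"]) auto
  then show ?thesis by (intro continuous_at_imp_continuous_on) auto
qed

text \<open>Writing \<open>conv \<Psi> k\<close> at \<open>a\<close> and at \<open>b\<close> as the
  integral of \<open>conv \<Psi> k'\<close> from minus infinity leaves an integral over
  \<open>{a..b}\<close>, where the integrand is continuous. Sums are formed instead of differences
  because the values are extended reals.\<close>

lemma conv_diff:
  assumes a: "0 < a" "a \<le> b"
  shows "conv \<Psi> k b - conv \<Psi> k a = integral {a..b} (conv \<Psi> k')"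
proof -
  let ?G = "\<lambda>s. \<integral>\<^sup>+z. ennreal (\<Psi> z * kp (s - z)) \<partial>lebesgue"
  interpret L: sigma_finite_measure "lebesgue :: real measure"
    by (rule sigma_finite_lebesgue)
  have Gm[measurable]: "?G \<in> borel_measurable lborel"
    by (rule L.borel_measurable_nn_integral) measurable
  have G: "?G s = ennreal (conv \<Psi> k' s)" if "0 < s" for s
    unfolding conv_kp using integrable_kp[OF that]
    by (intro nn_integral_eq_integral AE_I2 mult_nonneg_nonneg nonneg kp_nonneg)
  have g0: "0 \<le> conv \<Psi> k' s" for s unfolding conv_kp by (intro integral_nonneg_AE AE_I2 mult_nonneg_nonneg nonneg kp_nonneg)
  have c: "continuous_on {a..b} (conv \<Psi> k')" using a by (intro continuous_on_subset[OF conv_k'_continuous]) auto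
  have "((conv \<Psi> k') has_integral integral {a..b} (conv \<Psi> k')) {a..b}"
    by (intro integrable_integral integrable_continuous_real c)
  then have N: "(\<integral>\<^sup>+s. ennreal (conv \<Psi> k' s) * indicator {a..b} s \<partial>lborel) = ennreal (integral {a..b} (conv \<Psi> k'))"
    by (intro nn_integral_has_integral_lebesgue' g0)
  have "ennreal (conv \<Psi> k b) = (\<integral>\<^sup>+s. ?G s * indicator {..b} s \<partial>lborel)" by (rule nn_integral_conv[symmetric])
  also have "\<dots> = (\<integral>\<^sup>+s. ?G s * indicator {..a} s + ennreal (conv \<Psi> k' s) * indicator {a..b} s \<partial>lborel)"
  proof (rule nn_integral_cong_AE)
    show "AE s in lborel. ?G s * indicator {..b} s = ?G s * indicator {..a} s + ennreal (conv \<Psi> k' s) * indicator {a..b} s"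
      using AE_lborel_singleton[of a]
    proof eventually_elim
      case (elim s)
      then show ?case using G[of s] a by (cases "s \<le> a"; cases "s \<le> b") (auto simp: indicator_def)
    qed
  qed
  also have "\<dots> = (\<integral>\<^sup>+s. ?G s * indicator {..a} s \<partial>lborel) + (\<integral>\<^sup>+s. ennreal (conv \<Psi> k' s) * indicator {a..b} s \<partial>lborel)"
  proof (rule nn_integral_add)
    have "(\<lambda>s. indicator {a..b} s *\<^sub>R conv \<Psi> k' s) \<in> borel_measurable borel"
      by (rule borel_measurable_continuous_on_indicator[OF _ c]) simp
    then have "(\<lambda>s. ennreal (indicator {a..b} s *\<^sub>R conv \<Psi> k' s)) \<in> borel_measurable lborel" by simp
    moreover have "ennreal (indicator {a..b} s *\<^sub>R conv \<Psi> k' s) = ennreal (conv \<Psi> k' s) * indicator {a..b} s" for s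
      by (auto simp: indicator_def)
    ultimately show "(\<lambda>s. ennreal (conv \<Psi> k' s) * indicator {a..b} s) \<in> borel_measurable lborel" by simp
  qed measurable
  also have "\<dots> = ennreal (conv \<Psi> k a) + ennreal (integral {a..b} (conv \<Psi> k'))"
    unfolding N nn_integral_conv ..
  also have "\<dots> = ennreal (conv \<Psi> k a + integral {a..b} (conv \<Psi> k'))"
    using conv_nonneg by (intro ennreal_plus[symmetric] integral_nonneg integrable_continuous_real c g0)
  finally have "conv \<Psi> k b = conv \<Psi> k a + integral {a..b} (conv \<Psi> k')"
    using conv_nonneg by (subst (asm) ennreal_inj) (auto intro!: add_nonneg_nonneg integral_nonneg integrable_continuous_real c g0)
  then show ?thesis by simp
qed

lemma conv_deriv:
  assumes y: "0 < y"
  shows "(conv \<Psi> k has_real_derivative conv \<Psi> k' y) (at y)"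
proof -
  have "((\<lambda>u. conv \<Psi> k (y/2) + integral {y/2..u} (conv \<Psi> k')) has_real_derivative 0 + conv \<Psi> k' y) (at y within {y/2..2*y})"
    using y by (intro DERIV_add DERIV_const integral_has_real_derivative continuous_on_subset[OF conv_k'_continuous]) auto
  moreover have "conv \<Psi> k (y/2) + integral {y/2..u} (conv \<Psi> k') = conv \<Psi> k u" if "u \<in> {y/2..2*y}" for u
    using conv_diff[of "y/2" u] that y by simp
  ultimately have "(conv \<Psi> k has_real_derivative conv \<Psi> k' y) (at y within {y/2..2*y})"
    using has_field_derivative_transform_within[OF _ zero_less_one, of _ _ y "{y/2..2*y}" "conv \<Psi> k"] y by simp
  then show ?thesis using at_within_Icc_at[of "y/2" y "2*y"] y by simp
qed

lemma conv_continuous: "continuous_on UNIV (conv \<Psi> k)"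
proof (rule continuous_at_imp_continuous_on, rule ballI)
  fix y :: real
  consider "0 < y" | "y < 0" | "y = 0" by linarith
  then show "isCont (conv \<Psi> k) y"
  proof cases
    case 1 then show ?thesis using DERIV_isCont[OF conv_deriv] by blast
  next
    case 2
    have "\<forall>\<^sub>F x in nhds y. conv \<Psi> k x = 0"
      using eventually_nhds_in_open[of "{..<0}" y] 2 by (auto elim!: eventually_mono simp: conv_nonpos)
    then show ?thesis using isCont_cong[of "conv \<Psi> k" "\<lambda>_. 0" y] by simp
  next
    case 3
    \<comment> \<open>At \<open>0\<close> no derivative is available. Instead
      \<open>conv \<Psi> k x\<close> is at most \<open>k0 x\<close> times the fixed integral of
      \<open>\<Psi>\<close> up to \<open>1\<close>, and \<open>k0\<close> vanishes at
      \<open>0\<close>.\<close>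
    let ?I = "LINT z|lebesgue. \<Psi> z * indicator {..1} z"
    have "((\<lambda>x. k0 x * ?I) \<longlongrightarrow> k0 0 * ?I) (at 0)"
      using k0_cont by (intro tendsto_intros) (simp add: continuous_on_def)
    then have "((\<lambda>x. k0 x * ?I) \<longlongrightarrow> 0) (at 0)" by (simp add: k0_def)
    moreover have "\<forall>\<^sub>F x in at 0. norm (conv \<Psi> k x) \<le> k0 x * ?I"
    proof -
      have "norm (conv \<Psi> k x) \<le> k0 x * ?I" if "x < 1" for x
      proof (cases "x \<le> 0")
        case True then show ?thesis by (simp add: conv_nonpos k0_def)
      next
        case False
        have "(LINT z|lebesgue. \<Psi> z * indicator {..x} z) \<le> ?I"
          using that nonneg by (intro integral_mono integrable_cutoff mult_left_mono) (auto simp: indicator_def)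
        then have "k0 x * (LINT z|lebesgue. \<Psi> z * indicator {..x} z) \<le> k0 x * ?I"
          by (intro mult_left_mono k0_nonneg)
        then show ?thesis using conv_le[of x] conv_nonneg[of x] False by simp
      qed
      then show ?thesis by (auto simp: eventually_at intro!: exI[of _ 1] simp: dist_real_def)
    qed
    ultimately have "(conv \<Psi> k \<longlongrightarrow> 0) (at 0)" by (rule Lim_null_comparison[rotated])
    then show ?thesis using 3 conv_nonpos[of 0] by (simp add: isCont_def)
  qed
qed

end

section \<open>Velocity integrals\<close>

declare id_measurable_lebesgue [measurable del]

text \<open>The image of \<open>M\<close> under \<open>e\<close> has the distribution function
  \<open>C * k\<close> and hence the density \<open>C * k'\<close>; the half-lines generate the
  Borel sets and determine the measure.\<close>

lemma (in kernel) nn_integral_pushforward: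
  fixes e :: "'a \<Rightarrow> real" and C :: ennreal
  assumes e[measurable]: "e \<in> borel_measurable M" and e0: "\<And>v. v \<in> space M \<Longrightarrow> 0 \<le> e v" and C: "C < \<infinity>"
    and em: "\<And>c. 0 \<le> c \<Longrightarrow> emeasure M {v\<in>space M. e v \<le> c} = C * ennreal (k c)"
    and \<phi>[measurable]: "\<phi> \<in> borel_measurable borel"
  shows "(\<integral>\<^sup>+v. \<phi> (e v) \<partial>M) = C * (\<integral>\<^sup>+t. \<phi> t * ennreal (kp t) \<partial>lborel)"
proof -
  have eq: "distr M borel e = density lborel (\<lambda>t. C * ennreal (kp t))"
  proof (rule measure_eqI_generator_eq[where E="range atMost" and A="\<lambda>i. {..real i}" and \<Omega>=UNIV])
    show "Int_stable (range atMost :: real set set)"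
      by (auto simp: Int_stable_def intro!: image_eqI[of _ _ "min _ _"])
    show "sets (distr M borel e) = sigma_sets UNIV (range atMost)"
      "sets (density lborel (\<lambda>t. C * ennreal (kp t))) = sigma_sets UNIV (range atMost)"
      by (simp_all add: borel_eq_atMost)
    have D: "emeasure (distr M borel e) {..c} = C * ennreal (if 0 \<le> c then k c else 0)" for c
    proof -
      have "emeasure (distr M borel e) {..c} = emeasure M {v\<in>space M. e v \<le> c}"
        by (subst emeasure_distr) (auto intro!: arg_cong[where f="emeasure M"])
      also have "\<dots> = C * ennreal (if 0 \<le> c then k c else 0)"
      proof (cases "0 \<le> c")
        case False
        then have "{v\<in>space M. e v \<le> c} = {}" using e0 by force
        then show ?thesis using False by (simp only: emeasure_empty) simp
      qed (simp add: em)
      finally show ?thesis .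
    qed
    have E: "emeasure (density lborel (\<lambda>t. C * ennreal (kp t))) {..c} = C * ennreal (if 0 \<le> c then k c else 0)" for c
    proof -
      have "emeasure (density lborel (\<lambda>t. C * ennreal (kp t))) {..c} = (\<integral>\<^sup>+t. C * (ennreal (kp t) * indicator {..c} t) \<partial>lborel)"
        by (subst emeasure_density) (auto simp: mult.assoc)
      also have "\<dots> = C * (\<integral>\<^sup>+t. ennreal (kp t) * indicator {..c} t \<partial>lborel)"
        by (rule nn_integral_cmult) measurable
      also have "(\<integral>\<^sup>+t. ennreal (kp t) * indicator {..c} t \<partial>lborel) = ennreal (if 0 \<le> c then k c else 0)"
      proof (cases "0 \<le> c")
        case False
        have "(\<integral>\<^sup>+t. ennreal (kp t) * indicator {..c} t \<partial>lborel) = (\<integral>\<^sup>+t. 0 \<partial>(lborel :: real measure))"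
          using False by (intro nn_integral_cong) (auto simp: kp_def indicator_def)
        then show ?thesis using False by simp
      qed (simp add: nn_integral_kp)
      finally show ?thesis .
    qed
    show "emeasure (distr M borel e) X = emeasure (density lborel (\<lambda>t. C * ennreal (kp t))) X"
      if "X \<in> range atMost" for X using that D E by auto
    show "emeasure (distr M borel e) {..real i} \<noteq> \<infinity>" for i
      unfolding D using C by (auto simp: ennreal_mult_eq_top_iff less_top)
    show "(\<Union>i. {..real i}) = UNIV" using real_arch_simple by auto
  qed auto
  have "(\<integral>\<^sup>+v. \<phi> (e v) \<partial>M) = (\<integral>\<^sup>+t. \<phi> t \<partial>distr M borel e)" by (rule nn_integral_distr[symmetric]) measurable
  also have "\<dots> = (\<integral>\<^sup>+t. C * (\<phi> t * ennreal (kp t)) \<partial>lborel)"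
    unfolding eq by (subst nn_integral_density) (auto simp: mult_ac)
  also have "\<dots> = C * (\<integral>\<^sup>+t. \<phi> t * ennreal (kp t) \<partial>lborel)" by (rule nn_integral_cmult) measurable
  finally show ?thesis .
qed

lemma kernel_powr:
  fixes s s' :: "real \<Rightarrow> real"
  assumes p: "0 < p" and s: "continuous_on {0..} s" "s 0 = 0" "\<And>t. 0 < t \<Longrightarrow> 0 < s t"
    and d: "\<And>t. 0 < t \<Longrightarrow> (s has_real_derivative s' t) (at t)" "continuous_on {0<..} s'" "\<And>t. 0 < t \<Longrightarrow> 0 \<le> s' t"
  shows "kernel (\<lambda>t. s t powr p) (\<lambda>t. p * s t powr (p - 1) * s' t)"
proof
  have s0: "0 \<le> s t" if "0 \<le> t" for t using s(2) s(3)[of t] that by (cases "t = 0") auto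
  show "continuous_on {0..} (\<lambda>t. s t powr p)"
    using s0 p by (intro continuous_on_powr' s continuous_intros) auto
  show "((\<lambda>t. s t powr p) has_real_derivative p * s t powr (p - 1) * s' t) (at t)" if "0 < t" for t
    using DERIV_chain2[OF has_real_derivative_powr[OF s(3)[OF that]] d(1)[OF that]] by simp
  have "continuous_on {0<..} s" using s(1) by (rule continuous_on_subset) auto
  then show "continuous_on {0<..} (\<lambda>t. p * s t powr (p - 1) * s' t)"
    using s(3) by (intro continuous_intros d(2)) force+
qed (use p s d in auto)

section \<open>Integrals with homogeneous weights\<close>

lemma nn_integral_lborel_scale:
  fixes f :: "'a::euclidean_space \<Rightarrow> ennreal"
  assumes [measurable]: "f \<in> borel_measurable borel" and c: "0 < c"
  shows "(\<integral>\<^sup>+v. f v \<partial>lborel) = ennreal (c ^ DIM('a)) * (\<integral>\<^sup>+v. f (c *\<^sub>R v) \<partial>lborel)"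
proof -
  have "(\<integral>\<^sup>+v. f v \<partial>lborel) = (\<integral>\<^sup>+v. f v \<partial>density (distr lborel borel (\<lambda>x. 0 + c *\<^sub>R x)) (\<lambda>_. \<bar>c\<bar> ^ DIM('a)))"
    using lborel_affine[of c "0::'a"] c by simp
  also have "\<dots> = (\<integral>\<^sup>+v. ennreal (\<bar>c\<bar> ^ DIM('a)) * f (0 + c *\<^sub>R v) \<partial>lborel)"
    by (subst nn_integral_density) (auto simp: nn_integral_distr)
  also have "\<dots> = ennreal (c ^ DIM('a)) * (\<integral>\<^sup>+v. f (c *\<^sub>R v) \<partial>lborel)"
    using c by (subst nn_integral_cmult) auto
  finally show ?thesis .
qed

text \<open>Scaling \<open>v\<close> by \<open>sqrt r\<close> produces \<open>r powr (d/2)\<close>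
  from the weight and \<open>r powr (DIM('a)/2)\<close> from the volume. Balls are written through
  \<open>(norm v)\<^sup>2\<close> because the energies are functions of it.\<close>

lemma emeasure_homogeneous_ball:
  fixes K :: "'a::euclidean_space \<Rightarrow> real"
  assumes [measurable]: "K \<in> borel_measurable borel" and K0: "\<And>v. 0 \<le> K v"
    and hom: "\<And>t v. 0 < t \<Longrightarrow> K (t *\<^sub>R v) = t powr d * K v" and p: "0 < d + DIM('a)" and r: "0 \<le> r"
  shows "emeasure (density lborel (\<lambda>v. ennreal (K v))) {v. (norm v)\<^sup>2 \<le> r}
     = emeasure (density lborel (\<lambda>v. ennreal (K v))) (cball 0 1) * ennreal (r powr ((d + DIM('a)) / 2))"
proof (cases "r = 0")
  case True
  have "{v::'a. (norm v)\<^sup>2 \<le> r} = {0}" using True by auto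
  moreover have "emeasure (density lborel (\<lambda>v. ennreal (K v))) {0::'a} = (\<integral>\<^sup>+v. ennreal (K v) * indicator {0} v \<partial>lborel)"
    by (rule emeasure_density) auto
  moreover have "(\<integral>\<^sup>+v. ennreal (K v) * indicator {0::'a} v \<partial>lborel) = 0"
  proof -
    have "AE v in lborel. ennreal (K v) * indicator {0::'a} v = 0"
      using AE_lborel_singleton[of "0::'a"] by eventually_elim simp
    then have "(\<integral>\<^sup>+v. ennreal (K v) * indicator {0::'a} v \<partial>lborel) = (\<integral>\<^sup>+v. 0 \<partial>(lborel :: 'a measure))"
      by (rule nn_integral_cong_AE)
    then show ?thesis by simp
  qed
  ultimately show ?thesis using True by simp
next
  case False
  have [measurable]: "cball (0::'a) 1 \<in> sets borel" by simp
  from False r have r: "0 < r" by simp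
  let ?c = "sqrt r"
  have c: "0 < ?c" using r by simp
  have "emeasure (density lborel (\<lambda>v. ennreal (K v))) {v. (norm v)\<^sup>2 \<le> r} = (\<integral>\<^sup>+v. ennreal (K v) * indicator {v. (norm v)\<^sup>2 \<le> r} v \<partial>lborel)"
    by (rule emeasure_density) auto
  also have "\<dots> = ennreal (?c ^ DIM('a)) * (\<integral>\<^sup>+v. ennreal (K (?c *\<^sub>R v)) * indicator {v. (norm v)\<^sup>2 \<le> r} (?c *\<^sub>R v) \<partial>lborel)"
    by (rule nn_integral_lborel_scale[OF _ c]) measurable
  also have "(\<integral>\<^sup>+v. ennreal (K (?c *\<^sub>R v)) * indicator {v. (norm v)\<^sup>2 \<le> r} (?c *\<^sub>R v) \<partial>lborel)
     = (\<integral>\<^sup>+v. ennreal (?c powr d) * (ennreal (K v) * indicator (cball 0 1) v) \<partial>lborel)"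
  proof (rule nn_integral_cong)
    fix v :: 'a
    have "((norm (?c *\<^sub>R v))\<^sup>2 \<le> r) = (norm v \<le> 1)"
      using r by (simp add: power_mult_distrib abs_square_le_1)
    then have "(indicator {v. (norm v)\<^sup>2 \<le> r} (?c *\<^sub>R v) :: ennreal) = indicator (cball 0 1) v"
      by (simp add: indicator_def)
    then show "ennreal (K (?c *\<^sub>R v)) * indicator {v. (norm v)\<^sup>2 \<le> r} (?c *\<^sub>R v) = ennreal (?c powr d) * (ennreal (K v) * indicator (cball 0 1) v)"
      using K0 by (simp add: hom[OF c] ennreal_mult mult.assoc)
  qed
  also have "\<dots> = ennreal (?c powr d) * (\<integral>\<^sup>+v. ennreal (K v) * indicator (cball 0 1) v \<partial>lborel)"
    by (rule nn_integral_cmult) measurable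
  also have "(\<integral>\<^sup>+v. ennreal (K v) * indicator (cball 0 1) v \<partial>lborel) = emeasure (density lborel (\<lambda>v. ennreal (K v))) (cball 0 1)"
    by (rule emeasure_density[symmetric]) auto
  also have "ennreal (?c ^ DIM('a)) * (ennreal (?c powr d) * emeasure (density lborel (\<lambda>v. ennreal (K v))) (cball 0 1))
     = emeasure (density lborel (\<lambda>v. ennreal (K v))) (cball 0 1) * ennreal (?c ^ DIM('a) * ?c powr d)"
    using c by (simp add: ennreal_mult mult_ac)
  also have "?c ^ DIM('a) * ?c powr d = r powr ((d + DIM('a)) / 2)"
    using r by (simp add: powr_realpow[symmetric] powr_half_sqrt[symmetric] powr_powr powr_add[symmetric] add_divide_distrib add.commute)
  finally show ?thesis .
qed

text \<open>Since \<open>s\<close> is increasing and inverts the energy, \<open>e v \<le> c\<close>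
  means \<open>(norm v)\<^sup>2 \<le> s c\<close>. The distribution function of \<open>e\<close> is
  therefore a constant times \<open>s c powr p\<close>, and its derivative is the density on the
  right.\<close>

lemma nn_integral_homogeneous:
  fixes K :: "'a::euclidean_space \<Rightarrow> real" and e :: "'a \<Rightarrow> real" and s s' :: "real \<Rightarrow> real"
  assumes K[measurable]: "K \<in> borel_measurable borel" and K0: "\<And>v. 0 \<le> K v"
    and hom: "\<And>t v. 0 < t \<Longrightarrow> K (t *\<^sub>R v) = t powr d * K v" and d: "0 < d + DIM('a)" and p: "p = (d + DIM('a)) / 2"
    and fin: "emeasure (density lborel (\<lambda>v. ennreal (K v))) (cball 0 1) < \<infinity>"
    and s: "continuous_on {0..} s" "s 0 = 0" "\<And>t u. 0 \<le> t \<Longrightarrow> t < u \<Longrightarrow> s t < s u"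
    and s': "\<And>t. 0 < t \<Longrightarrow> (s has_real_derivative s' t) (at t)" "continuous_on {0<..} s'" "\<And>t. 0 < t \<Longrightarrow> 0 \<le> s' t"
    and e[measurable]: "e \<in> borel_measurable borel" and e0: "\<And>v. 0 \<le> e v" and es: "\<And>v. s (e v) = (norm v)\<^sup>2"
    and \<phi>[measurable]: "\<phi> \<in> borel_measurable borel"
  shows "(\<integral>\<^sup>+v. \<phi> (e v) * ennreal (K v) \<partial>lborel) = emeasure (density lborel (\<lambda>v. ennreal (K v))) (cball 0 1) *
     (\<integral>\<^sup>+t. \<phi> t * ennreal (if 0 < t then p * s t powr (p - 1) * s' t else 0) \<partial>lborel)"
proof -
  have sp: "0 < s t" if "0 < t" for t using s(3)[of 0 t] s(2) that by simp
  interpret k: kernel "\<lambda>t. s t powr p" "\<lambda>t. p * s t powr (p - 1) * s' t"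
    by (rule kernel_powr) (use d p s s' sp in auto)
  let ?M = "density lborel (\<lambda>v. ennreal (K v))"
  have em: "emeasure ?M {v \<in> space ?M. e v \<le> c} = emeasure ?M (cball 0 1) * ennreal (s c powr p)" if c: "0 \<le> c" for c
  proof -
    have "(e v \<le> c) = ((norm v)\<^sup>2 \<le> s c)" for v
      using s(3)[of c "e v"] s(3)[of "e v" c] c e0[of v] es[of v] by (cases "e v" c rule: linorder_cases) auto
    then have "{v \<in> space ?M. e v \<le> c} = {v. (norm v)\<^sup>2 \<le> s c}" by simp
    moreover have "0 \<le> s c" using sp[of c] s(2) c by (cases "c = 0") auto
    ultimately show ?thesis using emeasure_homogeneous_ball[OF K K0 hom d] unfolding p by simp
  qed
  have "(\<integral>\<^sup>+v. \<phi> (e v) * ennreal (K v) \<partial>lborel) = (\<integral>\<^sup>+v. \<phi> (e v) \<partial>?M)"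
    by (subst nn_integral_density) (auto simp: mult.commute)
  also have "\<dots> = emeasure ?M (cball 0 1) * (\<integral>\<^sup>+t. \<phi> t * ennreal (k.kp t) \<partial>lborel)"
    using e0 by (intro k.nn_integral_pushforward fin em) auto
  finally show ?thesis by (simp add: k.kp_def)
qed

subsection \<open>The angular constant\<close>

definition vec3 :: "real \<times> real \<times> real \<Rightarrow> real^3" where
  "vec3 = (\<lambda>(a, b, c). vector [a, b, c])"

lemma vec3_nth: "vec3 (a, b, c) $ 1 = a" "vec3 (a, b, c) $ 2 = b" "vec3 (a, b, c) $ 3 = c"
  by (simp_all add: vec3_def vector_3)

lemma vec3_measurable[measurable]: "vec3 \<in> borel_measurable borel"
proof (rule borel_measurable_continuous_onI)
  have "continuous_on UNIV (\<lambda>x. \<chi> i. vec3 x $ i)"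
  proof (intro continuous_on_vec_lambda)
    fix i :: 3
    have "vec3 x $ i = (if i = 1 then fst x else if i = 2 then fst (snd x) else snd (snd x))" for x
      using exhaust_3[of i] by (cases x) (auto simp: vec3_nth)
    then show "continuous_on UNIV (\<lambda>x. vec3 x $ i)"
      by (cases "i = 1"; cases "i = 2") (auto intro!: continuous_intros)
  qed
  then show "continuous_on UNIV vec3" by simp
qed

lemma lborel_vec3: "distr lborel borel vec3 = lborel"
  unfolding lborel_prod[symmetric]
proof (rule lborel_eqI[symmetric])
  fix l u :: "real^3" assume le: "\<And>b. b \<in> Basis \<Longrightarrow> l \<bullet> b \<le> u \<bullet> b"
  have le': "l $ i \<le> u $ i" for i using le[of "axis i 1"] by (simp add: axis_in_Basis_iff inner_axis)
  have P: "sigma_finite_measure (lborel \<Otimes>\<^sub>M lborel :: (real \<times> real) measure)"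
    unfolding lborel_prod by (rule sigma_finite_lborel)
  have vm: "vec3 \<in> lborel \<Otimes>\<^sub>M (lborel \<Otimes>\<^sub>M lborel) \<rightarrow>\<^sub>M borel" unfolding lborel_prod by simp
  have pre: "vec3 -` box l u \<inter> space (lborel \<Otimes>\<^sub>M (lborel \<Otimes>\<^sub>M lborel)) = {l$1<..<u$1} \<times> {l$2<..<u$2} \<times> {l$3<..<u$3}"
    by (auto simp: vec3_def mem_box_cart forall_3 vector_3 space_pair_measure)
  have "emeasure (distr (lborel \<Otimes>\<^sub>M (lborel \<Otimes>\<^sub>M lborel)) borel vec3) (box l u)
     = emeasure (lborel \<Otimes>\<^sub>M (lborel \<Otimes>\<^sub>M lborel)) ({l$1<..<u$1} \<times> {l$2<..<u$2} \<times> {l$3<..<u$3})"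
    by (subst emeasure_distr[OF vm]) (auto simp: pre)
  also have "\<dots> = ennreal (u$1 - l$1) * (ennreal (u$2 - l$2) * ennreal (u$3 - l$3))"
    using le' by (subst sigma_finite_measure.emeasure_pair_measure_Times[OF P], simp, simp, subst lborel.emeasure_pair_measure_Times) auto
  also have "\<dots> = ennreal ((u$1 - l$1) * ((u$2 - l$2) * (u$3 - l$3)))"
    using le' by (simp add: ennreal_mult)
  also have "(u$1 - l$1) * ((u$2 - l$2) * (u$3 - l$3)) = (\<Prod>b\<in>Basis. (u - l) \<bullet> b)"
  proof -
    have B: "(Basis :: (real^3) set) = (\<lambda>i. axis i 1) ` UNIV" by (auto simp: Basis_vec_def)
    have inj: "inj (\<lambda>i::3. axis i (1::real))" by (simp add: inj_on_def axis_eq_axis)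
    have "(\<Prod>b\<in>(\<lambda>i::3. axis i 1) ` UNIV. (u - l) \<bullet> b) = (\<Prod>i\<in>UNIV. (u - l) \<bullet> axis i 1)"
      using prod.reindex[OF inj, of "\<lambda>b. (u - l) \<bullet> b"] by (simp only: o_def)
    moreover have "(\<Prod>i\<in>(UNIV :: 3 set). h i) = h 1 * (h 2 * h 3)" for h :: "3 \<Rightarrow> real"
      unfolding UNIV_3 by (simp add: ac_simps)
    ultimately show ?thesis unfolding B by (simp only: inner_axis inner_real_def mult_1_right vector_minus_component)
  qed
  finally show "emeasure (distr (lborel \<Otimes>\<^sub>M (lborel \<Otimes>\<^sub>M lborel)) borel vec3) (box l u) = ennreal (\<Prod>b\<in>Basis. (u - l) \<bullet> b)" .
qed simp

lemma lborel_distr_orthogonal: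
  fixes f :: "real^3 \<Rightarrow> real^3"
  assumes f: "orthogonal_transformation f"
  shows "distr lborel borel f = lborel"
proof (rule lborel_eqI[symmetric])
  have lin: "linear f" using f orthogonal_transformation_linear by blast
  have fm[measurable]: "f \<in> borel_measurable borel"
    by (rule borel_measurable_continuous_onI) (rule linear_continuous_on[OF linear_linear[THEN iffD2, OF lin]])
  fix l u :: "real^3" assume le: "\<And>b. b \<in> Basis \<Longrightarrow> l \<bullet> b \<le> u \<bullet> b"
  have g: "orthogonal_transformation (inv f)" using f by (rule orthogonal_transformation_inv)
  have bij: "bij f" using f by (rule orthogonal_transformation_bij)
  have im: "f -` box l u = inv f ` box l u" by (rule bij_vimage_eq_inv_image[OF bij])
  have lm: "box l u \<in> lmeasurable" by simp
  have "inv f ` box l u \<in> sets borel" unfolding im[symmetric] using measurable_sets[OF fm, of "box l u"] by simp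
  moreover have "inv f ` box l u \<in> lmeasurable" by (rule measurable_orthogonal_image[OF g lm])
  ultimately have "emeasure lborel (inv f ` box l u) = ennreal (measure lebesgue (inv f ` box l u))"
    using emeasure_eq_measure2[of "inv f ` box l u" lebesgue] by simp
  also have "\<dots> = ennreal (measure lebesgue (box l u))" using measure_orthogonal_image[OF g lm] by simp
  also have "\<dots> = ennreal (\<Prod>b\<in>Basis. (u - l) \<bullet> b)" using le by (simp add: measure_completion measure_lborel_box_eq)
  finally show "emeasure (distr lborel borel f) (box l u) = ennreal (\<Prod>b\<in>Basis. (u - l) \<bullet> b)"
    by (subst emeasure_distr) (simp_all add: im)
qed simp

text \<open>An orthogonal transformation takes the first axis to \<open>u\<close>; then
  \<open>a = u \<bullet> v\<close> and the pair \<open>b\<close> of the other coordinates separate,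
  with \<open>(norm v)\<^sup>2 = a\<^sup>2 + (norm b)\<^sup>2\<close>.\<close>

lemma nn_integral_frame:
  fixes u :: "real^3" and F :: "real \<Rightarrow> real \<Rightarrow> ennreal"
  assumes u: "norm u = 1" and F[measurable]: "(\<lambda>(a, q). F a q) \<in> borel_measurable (borel \<Otimes>\<^sub>M borel)"
  shows "(\<integral>\<^sup>+v. F (u \<bullet> v) ((norm v)\<^sup>2) \<partial>lborel) = (\<integral>\<^sup>+a. (\<integral>\<^sup>+b. F a (a\<^sup>2 + (norm (b :: real \<times> real))\<^sup>2) \<partial>lborel) \<partial>lborel)"
proof -
  obtain f where f: "orthogonal_transformation f" "f (axis 1 1 :: real^3) = u"
    by (rule orthogonal_transformation_exists[of "axis 1 1 :: real^3" u]) (use u in auto)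
  have lin: "linear f" using f orthogonal_transformation_linear by blast
  have fm[measurable]: "f \<in> borel_measurable borel"
    by (rule borel_measurable_continuous_onI) (rule linear_continuous_on[OF linear_linear[THEN iffD2, OF lin]])
  have fi: "u \<bullet> f v = v $ 1" "norm (f v) = norm v" for v
    using f by (auto simp: orthogonal_transformation_def inner_axis' orthogonal_transformation_norm[OF f(1)] simp flip: f(2))
  have "(\<integral>\<^sup>+v. F (u \<bullet> v) ((norm v)\<^sup>2) \<partial>lborel) = (\<integral>\<^sup>+v. F (u \<bullet> v) ((norm v)\<^sup>2) \<partial>distr lborel borel f)"
    by (simp add: lborel_distr_orthogonal[OF f(1)])
  also have "\<dots> = (\<integral>\<^sup>+v. F ((v :: real^3) $ 1) ((norm v)\<^sup>2) \<partial>lborel)"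
    by (subst nn_integral_distr) (simp_all add: fi)
  also have "\<dots> = (\<integral>\<^sup>+v. F ((v :: real^3) $ 1) ((norm v)\<^sup>2) \<partial>distr lborel borel vec3)"
    by (simp add: lborel_vec3)
  also have "\<dots> = (\<integral>\<^sup>+x. F (vec3 x $ 1) ((norm (vec3 x))\<^sup>2) \<partial>lborel)"
    by (subst nn_integral_distr) simp_all
  also have "\<dots> = (\<integral>\<^sup>+x. (case x of (a, b) \<Rightarrow> F a (a\<^sup>2 + (norm (b :: real \<times> real))\<^sup>2)) \<partial>(lborel \<Otimes>\<^sub>M lborel))"
  proof -
    have "F (vec3 x $ 1) ((norm (vec3 x))\<^sup>2) = (case x of (a, b) \<Rightarrow> F a (a\<^sup>2 + (norm b)\<^sup>2))" for x
    proof (cases x)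
      case (fields a b c)
      have "(norm (vec3 (a, b, c)))\<^sup>2 = a\<^sup>2 + (norm (b, c))\<^sup>2"
        unfolding power2_norm_eq_inner inner_vec_def sum_3 vec3_nth inner_Pair by (simp add: power2_eq_square)
      then show ?thesis by (simp add: fields vec3_nth)
    qed
    then show ?thesis unfolding lborel_prod by simp
  qed
  also have "\<dots> = (\<integral>\<^sup>+a. (\<integral>\<^sup>+b. F a (a\<^sup>2 + (norm (b :: real \<times> real))\<^sup>2) \<partial>lborel) \<partial>lborel)"
    by (subst lborel.nn_integral_fst[symmetric]) auto
  finally show ?thesis .
qed

lemma nn_integral_plane:
  assumes [measurable]: "\<phi> \<in> borel_measurable borel"
  shows "(\<integral>\<^sup>+b. \<phi> ((norm (b :: real \<times> real))\<^sup>2) \<partial>lborel) = ennreal pi * (\<integral>\<^sup>+t. \<phi> t * ennreal (if 0 < t then 1 else 0) \<partial>lborel)"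
proof -
  have d1: "density lborel (\<lambda>v. ennreal 1) = (lborel :: (real \<times> real) measure)" by (simp add: density_1)
  have C: "emeasure lborel (cball (0 :: real \<times> real) 1) = ennreal pi"
    by (simp add: emeasure_cball unit_ball_vol_2)
  have "(\<integral>\<^sup>+b. \<phi> ((norm (b :: real \<times> real))\<^sup>2) * ennreal 1 \<partial>lborel) = emeasure (density lborel (\<lambda>v. ennreal 1)) (cball (0 :: real \<times> real) 1) *
     (\<integral>\<^sup>+t. \<phi> t * ennreal (if 0 < t then 1 * t powr (1 - 1) * 1 else 0) \<partial>lborel)"
    by (rule nn_integral_homogeneous[where d=0]) (auto intro!: derivative_eq_intros continuous_intros simp: density_1 C)
  moreover have "\<phi> t * ennreal (if 0 < t then 1 * t powr (1 - 1) * 1 else 0) = \<phi> t * ennreal (if 0 < t then 1 else 0)" for t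
    by simp
  ultimately show ?thesis unfolding d1 C by simp
qed

text \<open>The weight is homogeneous of degree \<open>2 * j\<close>. Its integral over
  \<open>{-1..1}\<close> is \<open>1 / (j + 1/2)\<close>, which cancels the factor \<open>p\<close>
  in the homogeneous formula.\<close>

lemma nn_integral_line:
  assumes [measurable]: "\<phi> \<in> borel_measurable borel"
  shows "(\<integral>\<^sup>+a. \<phi> (a\<^sup>2) * ennreal (a ^ (2 * j)) \<partial>lborel) = (\<integral>\<^sup>+t. \<phi> t * ennreal (if 0 < t then t powr (j - 1/2) else 0) \<partial>lborel)"
proof -
  let ?p = "real j + 1/2"
  have C: "emeasure (density lborel (\<lambda>a::real. ennreal (a ^ (2 * j)))) (cball 0 1) = ennreal (1 / ?p)"
  proof -
    have "((\<lambda>a. a ^ (2 * j)) has_integral (1 ^ (2 * j + 1) / (2 * j + 1) - (-1) ^ (2 * j + 1) / (2 * j + 1))) {-1..1::real}"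
    proof (rule fundamental_theorem_of_calculus)
      fix x :: real
      have "real (2 * j + 1) \<noteq> 0" by linarith
      then have "((\<lambda>a. a ^ (2 * j + 1) / real (2 * j + 1)) has_real_derivative x ^ (2 * j)) (at x within {-1..1})"
        using DERIV_cdivide[OF DERIV_pow[of "2 * j + 1" x "{-1..1}"], of "real (2 * j + 1)"] by simp
      then show "((\<lambda>a. a ^ (2 * j + 1) / (2 * j + 1)) has_vector_derivative x ^ (2 * j)) (at x within {-1..1})"
        by (simp add: has_real_derivative_iff_has_vector_derivative)
    qed simp
    then have I: "((\<lambda>a. a ^ (2 * j)) has_integral (1 / ?p)) {-1..1::real}" by (simp add: field_simps)
    have "(\<integral>\<^sup>+a. ennreal (a ^ (2 * j)) * indicator {-1..1} a \<partial>lborel) = ennreal (1 / ?p)"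
      by (rule nn_integral_has_integral_lebesgue'[OF _ I]) simp
    moreover have "cball (0::real) 1 = {-1..1}" by (simp add: cball_eq_atLeastAtMost)
    ultimately show ?thesis by (subst emeasure_density) auto
  qed
  have "(\<integral>\<^sup>+a. \<phi> (a\<^sup>2) * ennreal (a ^ (2 * j)) \<partial>lborel) = emeasure (density lborel (\<lambda>a::real. ennreal (a ^ (2 * j)))) (cball 0 1) *
     (\<integral>\<^sup>+t. \<phi> t * ennreal (if 0 < t then ?p * t powr (?p - 1) * 1 else 0) \<partial>lborel)"
  proof (rule nn_integral_homogeneous[where d="2 * real j"])
    show "(t *\<^sub>R a) ^ (2 * j) = t powr (2 * real j) * a ^ (2 * j)" if "0 < t" for t a :: real
      using that by (simp add: power_mult_distrib powr_realpow[symmetric])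
  qed (auto intro!: derivative_eq_intros continuous_intros simp: C add_divide_distrib)
  also have "\<dots> = (\<integral>\<^sup>+t. ennreal (1 / ?p) * (\<phi> t * ennreal (if 0 < t then ?p * t powr (?p - 1) * 1 else 0)) \<partial>lborel)"
    unfolding C by (rule nn_integral_cmult[symmetric]) measurable
  also have "\<dots> = (\<integral>\<^sup>+t. \<phi> t * ennreal (if 0 < t then t powr (j - 1/2) else 0) \<partial>lborel)"
  proof (rule nn_integral_cong)
    fix t :: real
    have "ennreal (1 / ?p) * ennreal (?p * t powr (?p - 1)) = ennreal (t powr (j - 1/2))"
      by (subst ennreal_mult[symmetric]) (auto simp: field_simps)
    then show "ennreal (1 / ?p) * (\<phi> t * ennreal (if 0 < t then ?p * t powr (?p - 1) * 1 else 0)) = \<phi> t * ennreal (if 0 < t then t powr (j - 1/2) else 0)"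
      by (simp add: mult.left_commute)
  qed
  finally show ?thesis .
qed

lemma nn_integral_Gamma:
  assumes "0 < x"
  shows "(\<integral>\<^sup>+t. ennreal (exp (- t)) * ennreal (if 0 < t then t powr (x - 1) else 0) \<partial>lborel) = ennreal (Gamma x)"
proof -
  have "(\<integral>\<^sup>+t. ennreal (exp (- t)) * ennreal (if 0 < t then t powr (x - 1) else 0) \<partial>lborel)
     = (\<integral>\<^sup>+t. ennreal (indicator {0..} t * t powr (x - 1) / exp t) \<partial>lborel)"
    by (intro nn_integral_cong) (auto simp: ennreal_mult[symmetric] exp_minus indicator_def field_simps)
  then show ?thesis using Gamma_conv_nn_integral_real[OF assms] by simp
qed

text \<open>The velocity weight in direction \<open>u\<close>: \<open>j = 0\<close> belongs to the
  density, \<open>j = 1\<close> to the radial pressure with its factor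
  \<open>(u \<bullet> v)\<^sup>2\<close>.\<close>

definition angular_weight :: "real \<Rightarrow> nat \<Rightarrow> real^3 \<Rightarrow> real^3 \<Rightarrow> real" where
  "angular_weight l j u v = (u \<bullet> v) ^ (2 * j) * angular_factor l u v"

lemma angular_factor_unit:
  assumes "norm u = 1"
  shows "angular_factor l u v = (if l = 0 then 1 else sqrt ((norm v)\<^sup>2 - (u \<bullet> v)\<^sup>2) powr (2 * l))"
proof -
  have "(norm (cross3 u v))\<^sup>2 = (norm v)\<^sup>2 - (u \<bullet> v)\<^sup>2"
    using assms by (simp add: norm_cross)
  then have "norm (cross3 u v) = sqrt ((norm v)\<^sup>2 - (u \<bullet> v)\<^sup>2)" by (metis norm_ge_zero real_sqrt_unique)
  then show ?thesis by (simp add: angular_factor_def)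
qed

lemma angular_weight_measurable[measurable]:
  assumes "norm u = 1"
  shows "angular_weight l j u \<in> borel_measurable borel"
  unfolding angular_weight_def[abs_def] angular_factor_unit[OF assms] by measurable

lemma angular_weight_nonneg: "0 \<le> angular_weight l j u v"
  by (simp add: angular_weight_def angular_factor_def)

text \<open>For a Gaussian the variables separate. The component along \<open>u\<close> contributes
  \<open>Gamma (j + 1/2)\<close>; the plane orthogonal to \<open>u\<close>, in which
  \<open>norm (cross3 u v)\<close> is the distance from the axis, contributes
  \<open>pi * Gamma (l + 1)\<close>.\<close>

lemma nn_integral_gaussian:
  assumes u: "norm u = 1" and l: "- 1 < l"
  shows "(\<integral>\<^sup>+v. ennreal (exp (- (norm v)\<^sup>2)) * ennreal (angular_weight l j u v) \<partial>lborel) = ennreal (pi * Gamma (l + 1) * Gamma (j + 1/2))"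
proof -
  define A where "A = (\<lambda>q. if l = 0 then 1 else sqrt q powr (2 * l))"
  have A0: "0 \<le> A q" for q by (simp add: A_def)
  have Am[measurable]: "A \<in> borel_measurable borel" unfolding A_def by measurable
  define F where "F = (\<lambda>a q. ennreal (exp (- q) * (a ^ (2 * j) * A (q - a\<^sup>2))))"
  have Fm: "(\<lambda>(a, q). F a q) \<in> borel_measurable (borel \<Otimes>\<^sub>M borel)" unfolding F_def by measurable
  have "(\<integral>\<^sup>+v. ennreal (exp (- (norm v)\<^sup>2)) * ennreal (angular_weight l j u v) \<partial>lborel) = (\<integral>\<^sup>+v. F (u \<bullet> v) ((norm v)\<^sup>2) \<partial>lborel)"
    by (intro nn_integral_cong)
       (simp add: F_def A_def angular_weight_def angular_factor_unit[OF u] ennreal_mult[symmetric])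
  also have "\<dots> = (\<integral>\<^sup>+a. (\<integral>\<^sup>+b. F a (a\<^sup>2 + (norm (b :: real \<times> real))\<^sup>2) \<partial>lborel) \<partial>lborel)"
    by (rule nn_integral_frame[OF u Fm])
  also have "\<dots> = (\<integral>\<^sup>+a. ennreal (exp (- a\<^sup>2)) * ennreal (a ^ (2 * j)) * ennreal (pi * Gamma (l + 1)) \<partial>lborel)"
  proof (rule nn_integral_cong)
    fix a :: real
    have "(\<integral>\<^sup>+b. F a (a\<^sup>2 + (norm (b :: real \<times> real))\<^sup>2) \<partial>lborel)
       = (\<integral>\<^sup>+b. ennreal (exp (- a\<^sup>2)) * ennreal (a ^ (2 * j)) * ennreal (exp (- (norm (b :: real \<times> real))\<^sup>2) * A ((norm b)\<^sup>2)) \<partial>lborel)"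
    proof (rule nn_integral_cong)
      fix b :: "real \<times> real"
      have eq: "exp (- (a\<^sup>2 + (norm b)\<^sup>2)) * (a ^ (2 * j) * A (a\<^sup>2 + (norm b)\<^sup>2 - a\<^sup>2)) =
          exp (- a\<^sup>2) * a ^ (2 * j) * (exp (- (norm b)\<^sup>2) * A ((norm b)\<^sup>2))"
        unfolding minus_add_distrib exp_add by simp
      then show "F a (a\<^sup>2 + (norm b)\<^sup>2) = ennreal (exp (- a\<^sup>2)) * ennreal (a ^ (2 * j)) * ennreal (exp (- (norm b)\<^sup>2) * A ((norm b)\<^sup>2))"
        unfolding F_def eq by (simp add: ennreal_mult A0)
    qed
    also have "\<dots> = ennreal (exp (- a\<^sup>2)) * ennreal (a ^ (2 * j)) * (\<integral>\<^sup>+b. ennreal (exp (- (norm (b :: real \<times> real))\<^sup>2) * A ((norm b)\<^sup>2)) \<partial>lborel)"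
      by (rule nn_integral_cmult) measurable
    also have "(\<integral>\<^sup>+b. ennreal (exp (- (norm (b :: real \<times> real))\<^sup>2) * A ((norm b)\<^sup>2)) \<partial>lborel)
       = ennreal pi * (\<integral>\<^sup>+t. ennreal (exp (- t) * A t) * ennreal (if 0 < t then 1 else 0) \<partial>lborel)"
      by (rule nn_integral_plane[of "\<lambda>t. ennreal (exp (- t) * A t)"]) measurable
    also have "(\<integral>\<^sup>+t. ennreal (exp (- t) * A t) * ennreal (if 0 < t then 1 else 0) \<partial>lborel)
       = (\<integral>\<^sup>+t. ennreal (exp (- t)) * ennreal (if 0 < t then t powr (l + 1 - 1) else 0) \<partial>lborel)"
    proof (rule nn_integral_cong)
      fix t :: real
      have "A t = t powr l" if "0 < t" using that by (simp add: A_def powr_half_sqrt[symmetric] powr_powr)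
      then show "ennreal (exp (- t) * A t) * ennreal (if 0 < t then 1 else 0) = ennreal (exp (- t)) * ennreal (if 0 < t then t powr (l + 1 - 1) else 0)"
        by (simp add: ennreal_mult A0)
    qed
    also have "\<dots> = ennreal (Gamma (l + 1))" using l by (intro nn_integral_Gamma) auto
    finally show "(\<integral>\<^sup>+b. F a (a\<^sup>2 + (norm (b :: real \<times> real))\<^sup>2) \<partial>lborel) = ennreal (exp (- a\<^sup>2)) * ennreal (a ^ (2 * j)) * ennreal (pi * Gamma (l + 1))"
      using l by (simp add: ennreal_mult less_imp_le Gamma_real_pos)
  qed
  also have "\<dots> = (\<integral>\<^sup>+a. ennreal (exp (- a\<^sup>2)) * ennreal (a ^ (2 * j)) \<partial>lborel) * ennreal (pi * Gamma (l + 1))"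
    by (rule nn_integral_multc) measurable
  also have "(\<integral>\<^sup>+a. ennreal (exp (- a\<^sup>2)) * ennreal (a ^ (2 * j)) \<partial>lborel) = (\<integral>\<^sup>+t. ennreal (exp (- t)) * ennreal (if 0 < t then t powr (j + 1/2 - 1) else 0) \<partial>lborel)"
  proof -
    have "real j + 1/2 - 1 = real j - 1/2" by simp
    then show ?thesis by (simp only: nn_integral_line[of "\<lambda>t. ennreal (exp (- t))" j, simplified])
  qed
  also have "\<dots> = ennreal (Gamma (j + 1/2))" by (intro nn_integral_Gamma) auto
  finally show ?thesis using l by (simp add: ennreal_mult[symmetric] less_imp_le Gamma_real_pos mult_ac)
qed

lemma angular_weight_homogeneous:
  assumes u: "norm u = 1" and t: "0 < t"
  shows "angular_weight l j u (t *\<^sub>R v) = t powr (2 * l + 2 * real j) * angular_weight l j u v"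
proof -
  have "norm (cross3 u (t *\<^sub>R v)) = t * norm (cross3 u v)" using t by (simp add: cross_mult_right)
  then have "angular_factor l u (t *\<^sub>R v) = t powr (2 * l) * angular_factor l u v"
    using t by (simp add: angular_factor_def powr_mult)
  moreover have "(u \<bullet> (t *\<^sub>R v)) ^ (2 * j) = t powr (2 * real j) * (u \<bullet> v) ^ (2 * j)"
    using t by (simp add: power_mult_distrib powr_realpow[symmetric])
  ultimately show ?thesis by (simp add: angular_weight_def powr_add mult_ac)
qed

text \<open>The homogeneous formula leaves the constant \<open>?C\<close> undetermined. It is the
  same for every energy, so the Gaussian case \<open>e v = (norm v)\<^sup>2\<close>,
  \<open>\<phi> t = exp (- t)\<close> determines it.\<close>

lemma nn_integral_velocity:
  fixes e :: "real^3 \<Rightarrow> real" and s s' :: "real \<Rightarrow> real"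
  assumes u: "norm u = 1" and l: "- 1/2 < l"
    and s: "continuous_on {0..} s" "s 0 = 0" "\<And>t u. 0 \<le> t \<Longrightarrow> t < u \<Longrightarrow> s t < s u"
    and s': "\<And>t. 0 < t \<Longrightarrow> (s has_real_derivative s' t) (at t)" "continuous_on {0<..} s'" "\<And>t. 0 < t \<Longrightarrow> 0 \<le> s' t"
    and e: "e \<in> borel_measurable borel" and e0: "\<And>v. 0 \<le> e v" and es: "\<And>v. s (e v) = (norm v)\<^sup>2"
    and \<phi>: "\<phi> \<in> borel_measurable borel"
  shows "(\<integral>\<^sup>+v. \<phi> (e v) * ennreal (angular_weight l j u v) \<partial>lborel) =
     (\<integral>\<^sup>+t. \<phi> t * ennreal (if 0 < t then pi * Beta (l + 1) (j + 1/2) * s t powr (l + j + 1/2) * s' t else 0) \<partial>lborel)"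
proof -
  let ?K = "angular_weight l j u" and ?p = "l + j + 3/2"
  let ?C = "emeasure (density lborel (\<lambda>v. ennreal (?K v))) (cball 0 1)"
  let ?G = "pi * Gamma (l + 1) * Gamma (j + 1/2)"
  have Km[measurable]: "?K \<in> borel_measurable borel" by (rule angular_weight_measurable[OF u])
  have l1: "- 1 < l" using l by simp
  have p: "0 < ?p" using l by simp
  have "?C = (\<integral>\<^sup>+v. ennreal (?K v) * indicator (cball 0 1) v \<partial>lborel)" by (rule emeasure_density) auto
  \<comment> \<open>On the unit ball \<open>exp (1 - (norm v)\<^sup>2) \<ge> 1\<close>, so the
    Gaussian integral dominates and \<open>?C\<close> is finite.\<close>
  also have "\<dots> \<le> (\<integral>\<^sup>+v. ennreal (exp 1) * (ennreal (exp (- (norm v)\<^sup>2)) * ennreal (?K v)) \<partial>lborel)"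
  proof (rule nn_integral_mono)
    fix v :: "real^3"
    have "1 \<le> exp (1 - (norm v)\<^sup>2)" if "norm v \<le> 1" using that by (simp add: abs_square_le_1)
    then have "indicator (cball 0 1) v * ?K v \<le> exp (1 - (norm v)\<^sup>2) * ?K v"
      by (intro mult_right_mono angular_weight_nonneg) (auto simp: indicator_def)
    also have "\<dots> = exp 1 * (exp (- (norm v)\<^sup>2) * ?K v)" by (simp add: exp_add[symmetric] mult.assoc[symmetric])
    finally show "ennreal (?K v) * indicator (cball 0 1) v \<le> ennreal (exp 1) * (ennreal (exp (- (norm v)\<^sup>2)) * ennreal (?K v))"
      by (auto simp: ennreal_mult[symmetric] angular_weight_nonneg indicator_def intro!: ennreal_leI)
  qed
  also have "\<dots> = ennreal (exp 1) * ennreal ?G"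
    by (subst nn_integral_cmult) (simp_all add: nn_integral_gaussian[OF u l1])
  also have "\<dots> < \<infinity>" by (simp add: ennreal_mult_less_top)
  finally have fin: "?C < \<infinity>" .
  have hom: "(\<integral>\<^sup>+v. \<phi> (e v) * ennreal (?K v) \<partial>lborel) = ?C *
     (\<integral>\<^sup>+t. \<phi> t * ennreal (if 0 < t then ?p * s t powr (?p - 1) * s' t else 0) \<partial>lborel)"
    if "continuous_on {0..} s" "s 0 = 0" "\<And>t u. 0 \<le> t \<Longrightarrow> t < u \<Longrightarrow> s t < s u"
      "\<And>t. 0 < t \<Longrightarrow> (s has_real_derivative s' t) (at t)" "continuous_on {0<..} s'" "\<And>t. 0 < t \<Longrightarrow> 0 \<le> s' t"
      "e \<in> borel_measurable borel" "\<And>v. 0 \<le> e v" "\<And>v. s (e v) = (norm v)\<^sup>2" "\<phi> \<in> borel_measurable borel"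
    for e :: "real^3 \<Rightarrow> real" and s s' :: "real \<Rightarrow> real" and \<phi>
    by (rule nn_integral_homogeneous[OF Km angular_weight_nonneg angular_weight_homogeneous[OF u] _ _ fin that])
       (use l in \<open>auto simp: add_divide_distrib\<close>)
  have "ennreal ?G = ?C * (\<integral>\<^sup>+t. ennreal (exp (- t)) * ennreal (if 0 < t then ?p * t powr (?p - 1) * 1 else 0) \<partial>lborel)"
    unfolding nn_integral_gaussian[OF u l1, symmetric]
    by (rule hom[of "\<lambda>t. t" "\<lambda>_. 1" "\<lambda>v. (norm v)\<^sup>2" "\<lambda>t. ennreal (exp (- t))"])
       (auto intro!: derivative_eq_intros continuous_intros)
  also have "(\<integral>\<^sup>+t. ennreal (exp (- t)) * ennreal (if 0 < t then ?p * t powr (?p - 1) * 1 else 0) \<partial>lborel)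
      = (\<integral>\<^sup>+t. ennreal ?p * (ennreal (exp (- t)) * ennreal (if 0 < t then t powr (?p - 1) else 0)) \<partial>lborel)"
    using p by (intro nn_integral_cong) (auto simp: ennreal_mult[symmetric] mult_ac)
  also have "\<dots> = ennreal ?p * ennreal (Gamma ?p)"
    by (subst nn_integral_cmult) (use p nn_integral_Gamma[of ?p] in auto)
  finally have GC: "ennreal ?G = ?C * ennreal (?p * Gamma ?p)" using p by (simp add: ennreal_mult Gamma_real_pos less_imp_le)
  define C where "C = enn2real ?C"
  have C: "?C = ennreal C" "0 \<le> C" using fin by (auto simp: C_def)
  have "ennreal ?G = ennreal (C * (?p * Gamma ?p))"
    using GC C p by (simp add: ennreal_mult[symmetric] Gamma_real_pos less_imp_le)
  then have "?G = C * (?p * Gamma ?p)"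
    using C p l Gamma_real_pos[of "l+1"] Gamma_real_pos[of "j + 1/2"] Gamma_real_pos[OF p]
    by (subst (asm) ennreal_inj) (auto intro!: mult_nonneg_nonneg simp: less_imp_le)
  \<comment> \<open>As \<open>?p\<close> is the sum of \<open>l + 1\<close> and
    \<open>j + 1/2\<close>, solving \<open>?G = C * (?p * Gamma ?p)\<close> for
    \<open>C * ?p\<close> gives the Gamma quotient that defines \<open>Beta\<close>.\<close>
  then have Cp: "C * ?p = pi * Beta (l + 1) (j + 1/2)"
    using Gamma_real_pos[OF p] by (simp add: Beta_def field_simps)
  have "(\<integral>\<^sup>+v. \<phi> (e v) * ennreal (?K v) \<partial>lborel) = ennreal C *
     (\<integral>\<^sup>+t. \<phi> t * ennreal (if 0 < t then ?p * s t powr (?p - 1) * s' t else 0) \<partial>lborel)"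
    unfolding C(1)[symmetric] by (rule hom[OF s s' e e0 es \<phi>])
  also have "\<dots> = (\<integral>\<^sup>+t. ennreal C * (\<phi> t * ennreal (if 0 < t then ?p * s t powr (?p - 1) * s' t else 0)) \<partial>lborel)"
  proof (rule nn_integral_cmult[symmetric])
    have sp: "0 < s t" if "0 < t" for t using s(3)[of 0 t] s(2) that by simp
    interpret k: kernel "\<lambda>t. s t powr ?p" "\<lambda>t. ?p * s t powr (?p - 1) * s' t"
      by (rule kernel_powr) (use p s s' sp in auto)
    have "(\<lambda>t. \<phi> t * ennreal (k.kp t)) \<in> borel_measurable lborel" using \<phi> by measurable
    then show "(\<lambda>t. \<phi> t * ennreal (if 0 < t then ?p * s t powr (?p - 1) * s' t else 0)) \<in> borel_measurable lborel"
      unfolding k.kp_def .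
  qed
  also have "\<dots> = (\<integral>\<^sup>+t. \<phi> t * ennreal (if 0 < t then pi * Beta (l + 1) (j + 1/2) * s t powr (l + j + 1/2) * s' t else 0) \<partial>lborel)"
  proof (rule nn_integral_cong)
    fix t
    have e: "?p - 1 = l + j + 1/2" by simp
    show "ennreal C * (\<phi> t * ennreal (if 0 < t then ?p * s t powr (?p - 1) * s' t else 0)) =
       \<phi> t * ennreal (if 0 < t then pi * Beta (l + 1) (j + 1/2) * s t powr (l + j + 1/2) * s' t else 0)"
      unfolding Cp[symmetric] e using C(2) p s'(3)[of t]
      by (auto simp: ennreal_mult[symmetric] mult_ac) (simp add: ennreal_mult mult_ac)
  qed
  finally show ?thesis .
qed

subsection \<open>Moments of a distribution depending on the particle energy\<close>

text \<open>The kinetic energy \<open>e v\<close> is an increasing function of \<open>norm v\<close>, with inverse \<open>s\<close> in the variable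
  \<open>(norm v)\<^sup>2\<close>.\<close>

locale kinetic =
  fixes e :: "real^3 \<Rightarrow> real" and s s' :: "real \<Rightarrow> real"
  assumes s_cont: "continuous_on {0..} s" and s_0: "s 0 = 0" and s_mono: "\<And>t u. 0 \<le> t \<Longrightarrow> t < u \<Longrightarrow> s t < s u"
    and s_deriv: "\<And>t. 0 < t \<Longrightarrow> (s has_real_derivative s' t) (at t)" and s'_cont: "continuous_on {0<..} s'"
    and s'_nonneg: "\<And>t. 0 < t \<Longrightarrow> 0 \<le> s' t"
    and e_meas[measurable]: "e \<in> borel_measurable borel" and e_nonneg: "\<And>v. 0 \<le> e v" and s_e: "\<And>v. s (e v) = (norm v)\<^sup>2"
begin

text \<open>Composing a Lebesgue measurable function with \<open>y - e v\<close> requires that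
  preimages of null sets are null. The velocity formula with constant angular weight, applied to the
  indicator of \<open>X\<close>, shows this.\<close>

lemma null_preimage:
  assumes X: "X \<in> null_sets lborel"
  shows "(\<lambda>v. y - e v) -` X \<in> null_sets lborel"
proof -
  have Xm[measurable]: "X \<in> sets borel" using X by (auto simp: null_sets_def)
  have pm: "(\<lambda>v. y - e v) -` X \<in> sets borel" using measurable_sets[of "\<lambda>v. y - e v" borel borel X] by simp
  have u: "norm (axis 1 1 :: real^3) = 1" by simp
  have K: "angular_weight 0 0 (axis 1 1) v = 1" for v by (simp add: angular_weight_def angular_factor_def)
  have N: "(\<integral>\<^sup>+t. ennreal (indicator X (y - t)) * ennreal (if 0 < t then pi * Beta (0 + 1) (real 0 + 1/2) * s t powr (0 + real 0 + 1/2) * s' t else 0) \<partial>lborel)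
     = (\<integral>\<^sup>+t. 0 \<partial>(lborel :: real measure))"
  proof (rule nn_integral_cong_AE)
    have "(\<integral>\<^sup>+t. indicator X (y + (-1) * t) \<partial>lborel) = (\<integral>\<^sup>+t. indicator X t \<partial>lborel)"
      using nn_integral_real_affine[of "indicator X" "-1" y] by simp
    also have "\<dots> = 0" using X by (simp add: null_sets_def)
    finally have "AE t in lborel. indicator X (y + (-1) * t) = (0 :: ennreal)"
      by (subst (asm) nn_integral_0_iff_AE) auto
    then show "AE t in lborel. ennreal (indicator X (y - t)) * ennreal (if 0 < t then pi * Beta (0 + 1) (real 0 + 1/2) * s t powr (0 + real 0 + 1/2) * s' t else 0) = 0"
      by eventually_elim (auto simp: indicator_def split: if_splits)
  qed
  have "emeasure lborel ((\<lambda>v. y - e v) -` X) = (\<integral>\<^sup>+v. indicator ((\<lambda>v. y - e v) -` X) v \<partial>lborel)"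
    using pm by simp
  also have "\<dots> = (\<integral>\<^sup>+v. (\<lambda>t. ennreal (indicator X (y - t))) (e v) * ennreal (angular_weight 0 0 (axis 1 1) v) \<partial>lborel)"
    by (intro nn_integral_cong) (simp add: K indicator_def)
  also have "\<dots> = 0"
    by (subst nn_integral_velocity[OF u _ s_cont s_0 s_mono s_deriv s'_cont s'_nonneg e_meas e_nonneg s_e]) (simp_all add: N[simplified])
  finally show ?thesis using pm by (auto simp: null_sets_def)
qed

lemma shifted_measurable: "(\<lambda>v. y - e v) \<in> lebesgue \<rightarrow>\<^sub>M lebesgue"
proof (rule completion.measurable_completion2)
  have "(\<lambda>v. y - e v) \<in> lborel \<rightarrow>\<^sub>M lborel" by simp
  then show "(\<lambda>v. y - e v) \<in> lebesgue \<rightarrow>\<^sub>M lborel" by (rule measurable_completion)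
  then show "null_sets lborel \<subseteq> null_sets (distr lebesgue lborel (\<lambda>v. y - e v))"
    using null_sets_completionI[OF null_preimage[of _ y]]
    by (auto simp: null_sets_distr_iff[OF measurable_completion] null_sets_def[of lborel])
qed

text \<open>\<open>\<Psi>\<close> is replaced by a Borel version \<open>\<Psi>'\<close>, which
  changes the integrand only on a null set of velocities. The velocity formula gives an integral
  over the energy \<open>t\<close>, and \<open>z = y - t\<close> makes it a convolution. The factor
  \<open>\<omega>\<close> carries the powers of \<open>sqrt (1 + (norm v)\<^sup>2)\<close> in the
  relativistic moments.\<close>

lemma moment_integral:
  assumes P: "convolution \<Psi> \<kappa> \<kappa>'" and l: "- 1/2 < l" and u: "norm u = 1"
    and \<omega>[measurable]: "\<omega> \<in> borel_measurable borel" and \<omega>0: "\<And>t. 0 \<le> t \<Longrightarrow> 0 \<le> \<omega> t"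
    and \<kappa>: "\<And>t. 0 < t \<Longrightarrow> \<kappa> t = \<omega> t * (pi * Beta (l + 1) (real j + 1/2) * s t powr (l + j + 1/2) * s' t)"
  shows "integrable lebesgue (\<lambda>v. \<omega> (e v) * \<Psi> (y - e v) * angular_weight l j u v)"
    and "(LINT v|lebesgue. \<omega> (e v) * \<Psi> (y - e v) * angular_weight l j u v) = conv \<Psi> \<kappa> y"
proof -
  interpret c: convolution \<Psi> \<kappa> \<kappa>' by (rule P)
  let ?K = "angular_weight l j u"
  have Km[measurable]: "?K \<in> borel_measurable borel" by (rule angular_weight_measurable[OF u])
  obtain \<Psi>1 where \<Psi>1[measurable]: "\<Psi>1 \<in> borel_measurable lborel" "AE z in lborel. \<Psi> z = \<Psi>1 z"
    using completion_ex_borel_measurable_real[OF c.meas] by auto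
  define \<Psi>' where "\<Psi>' = (\<lambda>z. \<bar>\<Psi>1 z\<bar>)"
  have \<Psi>'[measurable]: "\<Psi>' \<in> borel_measurable borel" unfolding \<Psi>'_def using \<Psi>1 by measurable
  have ae: "AE z in lborel. \<Psi> z = \<Psi>' z" using \<Psi>1(2) by eventually_elim (metis \<Psi>'_def abs_of_nonneg c.nonneg)
  obtain N where N: "N \<in> null_sets lborel" "{z. \<Psi> z \<noteq> \<Psi>' z} \<subseteq> N"
    using ae by (auto elim!: AE_E simp: null_sets_def)
  have aev: "AE v in lebesgue. \<Psi> (y - e v) = \<Psi>' (y - e v)"
  proof (rule AE_I')
    show "(\<lambda>v. y - e v) -` N \<in> null_sets lebesgue" by (rule null_sets_completionI[OF null_preimage[OF N(1)]])
  qed (use N(2) in auto)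
  let ?f = "\<lambda>v. \<omega> (e v) * \<Psi> (y - e v) * ?K v"
  have fm: "?f \<in> borel_measurable lebesgue"
  proof -
    have "(\<lambda>v. \<Psi> (y - e v)) \<in> borel_measurable lebesgue"
      by (rule measurable_compose[OF shifted_measurable c.meas])
    moreover have "(\<lambda>v. \<omega> (e v)) \<in> borel_measurable lebesgue" "?K \<in> borel_measurable lebesgue"
      by (rule measurable_completion, simp)+
    ultimately show ?thesis by (intro borel_measurable_times)
  qed
  have f0: "0 \<le> ?f v" for v
    using \<omega>0 e_nonneg c.nonneg angular_weight_nonneg by (intro mult_nonneg_nonneg) auto
  have "(\<integral>\<^sup>+v. ennreal (?f v) \<partial>lebesgue) = (\<integral>\<^sup>+v. ennreal (\<omega> (e v) * \<Psi>' (y - e v)) * ennreal (?K v) \<partial>lebesgue)"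
  proof (rule nn_integral_cong_AE)
    show "AE v in lebesgue. ennreal (?f v) = ennreal (\<omega> (e v) * \<Psi>' (y - e v)) * ennreal (?K v)"
      using aev by eventually_elim (simp add: ennreal_mult' angular_weight_nonneg \<omega>0 e_nonneg \<Psi>'_def)
  qed
  also have "\<dots> = (\<integral>\<^sup>+v. (\<lambda>t. ennreal (\<omega> t * \<Psi>' (y - t))) (e v) * ennreal (?K v) \<partial>lborel)"
    by (simp add: nn_integral_completion)
  also have "\<dots> = (\<integral>\<^sup>+t. ennreal (\<omega> t * \<Psi>' (y - t)) * ennreal (if 0 < t then pi * Beta (l + 1) (real j + 1/2) * s t powr (l + j + 1/2) * s' t else 0) \<partial>lborel)"
    by (rule nn_integral_velocity[OF u l s_cont s_0 s_mono s_deriv s'_cont s'_nonneg e_meas e_nonneg s_e]) measurable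
  also have "\<dots> = (\<integral>\<^sup>+t. ennreal (\<Psi>' (y - t) * c.k0 t) \<partial>lborel)"
  proof (rule nn_integral_cong)
    fix t :: real
    show "ennreal (\<omega> t * \<Psi>' (y - t)) * ennreal (if 0 < t then pi * Beta (l + 1) (real j + 1/2) * s t powr (l + j + 1/2) * s' t else 0)
        = ennreal (\<Psi>' (y - t) * c.k0 t)"
    proof (cases "0 < t")
      case True
      have b: "0 < Beta (l + 1) (real j + 1/2)"
        using l by (simp add: Beta_def Gamma_real_pos)
      have "ennreal (\<omega> t * \<Psi>' (y - t)) * ennreal (pi * Beta (l + 1) (real j + 1/2) * s t powr (l + j + 1/2) * s' t)
         = ennreal (\<omega> t * \<Psi>' (y - t) * (pi * Beta (l + 1) (real j + 1/2) * s t powr (l + j + 1/2) * s' t))"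
        using True \<omega>0[of t] s'_nonneg[OF True] b by (intro ennreal_mult[symmetric]) (auto simp: \<Psi>'_def)
      then show ?thesis using True by (simp add: c.k0_def \<kappa> mult_ac)
    qed (simp add: c.k0_def)
  qed
  also have "\<dots> = (\<integral>\<^sup>+z. ennreal (\<Psi>' z * c.k0 (y - z)) \<partial>lborel)"
    by (subst nn_integral_real_affine[where c="-1" and t=y and f="\<lambda>z. ennreal (\<Psi>' z * c.k0 (y - z))"]) auto
  also have "\<dots> = (\<integral>\<^sup>+z. ennreal (\<Psi> z * c.k0 (y - z)) \<partial>lebesgue)"
    unfolding nn_integral_completion
    by (rule nn_integral_cong_AE) (use ae in \<open>eventually_elim, simp\<close>)
  also have "\<dots> = ennreal (conv \<Psi> \<kappa> y)"
    unfolding c.conv_k0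
    by (intro nn_integral_eq_integral c.integrable_k0 AE_I2 mult_nonneg_nonneg c.nonneg c.k0_nonneg)
  finally have I: "(\<integral>\<^sup>+v. ennreal (?f v) \<partial>lebesgue) = ennreal (conv \<Psi> \<kappa> y)" .
  show "integrable lebesgue ?f" by (rule integrableI_nonneg[OF fm]) (auto simp: f0 I)
  show "(LINT v|lebesgue. ?f v) = conv \<Psi> \<kappa> y"
    using integral_eq_nn_integral[OF fm] f0 I c.conv_nonneg by simp
qed

end

section \<open>Radial functions and central fields\<close>

text \<open>At the origin \<open>norm\<close> is not differentiable; \<open>D = 0\<close>
  compensates for this, and \<open>sgn 0 = 0\<close> keeps the formula uniform.\<close>

lemma radial_has_derivative:
  fixes x :: "'a::real_inner"
  assumes d: "(\<phi> has_real_derivative D) (at (norm x) within {0..})" and D: "x = 0 \<Longrightarrow> D = 0"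
  shows "((\<lambda>x. \<phi> (norm x)) has_derivative (\<lambda>h. D * (sgn x \<bullet> h))) (at x)"
proof (cases "x = 0")
  case False
  have "(norm has_derivative (\<lambda>h. sgn x \<bullet> h)) (at x within UNIV)"
    using has_derivative_norm[OF False] by (simp add: inner_commute)
  moreover have "(\<phi> has_derivative (*) D) (at (norm x) within norm ` UNIV)"
    using d unfolding has_field_derivative_def by (rule has_derivative_subset) auto
  ultimately show ?thesis using has_derivative_in_compose[of norm _ x UNIV \<phi> "(*) D"] by simp
next
  case True
  then have D0: "D = 0" using D by simp
  have lim: "((\<lambda>t. (\<phi> t - \<phi> 0) / (t - 0)) \<longlongrightarrow> 0) (at 0 within {0..})"
    using d True D0 by (simp add: has_field_derivative_iff)
  have "filterlim norm (at 0 within {0..}) (at (0::'a))"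
    unfolding filterlim_at by (auto simp: tendsto_norm_zero eventually_at_filter)
  from filterlim_compose[OF lim this]
  have "((\<lambda>h::'a. (\<phi> (norm h) - \<phi> 0) / norm h) \<longlongrightarrow> 0) (at 0)" by simp
  then have "((\<lambda>h::'a. norm ((\<phi> (norm h) - \<phi> 0) / norm h)) \<longlongrightarrow> 0) (at 0)" by (rule tendsto_norm_zero)
  then have "((\<lambda>h::'a. norm (\<phi> (norm h) - \<phi> 0) / norm h) \<longlongrightarrow> 0) (at 0)" by (simp add: norm_divide)
  then show ?thesis unfolding True D0 has_derivative_at by simp
qed

lemma C1_onI:
  fixes F :: "real^3 \<Rightarrow> 'b::real_normed_vector"
  assumes d: "\<And>x. x \<in> S \<Longrightarrow> (F has_derivative F' x) (at x)" and c: "\<And>i. i \<in> Basis \<Longrightarrow> continuous_on S (\<lambda>x. F' x i)"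
  shows "C1_on S F"
  unfolding C1_on_def
proof (intro exI[of _ "\<lambda>x. Blinfun (F' x)"] conjI ballI)
  have a: "blinfun_apply (Blinfun (F' x)) = F' x" if "x \<in> S" for x
    using d[OF that] has_derivative_bounded_linear bounded_linear_Blinfun_apply by blast
  show "(F has_derivative blinfun_apply (Blinfun (F' x))) (at x)" if "x \<in> S" for x using d[OF that] a[OF that] by simp
  show "continuous_on S (\<lambda>x. Blinfun (F' x))"
    by (rule continuous_on_blinfun_componentwise) (rule continuous_on_eq[OF c], simp_all add: a)
qed

text \<open>Direction factors built from \<open>sgn x\<close> are bounded but discontinuous at the
  origin; a coefficient that vanishes there restores continuity.\<close>

lemma vanishing_mult_continuous:
  fixes c B :: "'a::real_normed_vector \<Rightarrow> real"
  assumes c: "continuous_on S c" and c0: "0 \<in> S \<Longrightarrow> c 0 = 0" and B: "\<And>x. \<bar>B x\<bar> \<le> M" and Bc: "continuous_on (- {0}) B"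
  shows "continuous_on S (\<lambda>x. c x * B x)"
  unfolding continuous_on_eq_continuous_within
proof
  fix x assume x: "x \<in> S"
  have cx: "continuous (at x within S) c" using c x by (simp add: continuous_on_eq_continuous_within)
  show "continuous (at x within S) (\<lambda>x. c x * B x)"
  proof (cases "x = 0")
    case False
    then have "isCont B x" using Bc continuous_on_eq_continuous_at[of "- {0}" B] by auto
    from continuous_mult[OF cx continuous_at_imp_continuous_at_within[OF this]] show ?thesis .
  next
    case True
    then have "(c \<longlongrightarrow> 0) (at 0 within S)" using cx c0 x by (simp add: continuous_within)
    then have "((\<lambda>x. \<bar>c x\<bar> * M) \<longlongrightarrow> \<bar>0\<bar> * M) (at 0 within S)" by (intro tendsto_intros)
    then have "((\<lambda>x. \<bar>c x\<bar> * M) \<longlongrightarrow> 0) (at 0 within S)" by simp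
    then have "((\<lambda>x. c x * B x) \<longlongrightarrow> 0) (at 0 within S)"
      by (rule Lim_null_comparison[OF always_eventually, rotated]) (simp add: abs_mult mult_left_mono B)
    then show ?thesis using True c0 x by (simp add: continuous_within)
  qed
qed

lemma sgn_inner_continuous: "continuous_on (- {0}) (\<lambda>x::'a::real_inner. sgn x \<bullet> i)"
  unfolding sgn_div_norm by (intro continuous_intros) auto

lemma sgn_inner_le: "\<bar>sgn x \<bullet> i\<bar> \<le> norm i" for x :: "'a::real_inner"
  using Cauchy_Schwarz_ineq2[of "sgn x" i] by (cases "x = 0") (auto simp: norm_sgn)

lemma radial_C1:
  assumes d: "\<And>x. x \<in> S \<Longrightarrow> (\<phi> has_real_derivative \<phi>' (norm x)) (at (norm x) within {0..})"
    and c: "continuous_on (norm ` S) \<phi>'" and z: "0 \<in> S \<Longrightarrow> \<phi>' 0 = 0"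
  shows "C1_on S (\<lambda>x. \<phi> (norm x))"
proof (rule C1_onI[where F'="\<lambda>x h. \<phi>' (norm x) * (sgn x \<bullet> h)"])
  show "((\<lambda>x. \<phi> (norm x)) has_derivative (\<lambda>h. \<phi>' (norm x) * (sgn x \<bullet> h))) (at x)" if "x \<in> S" for x
    using d[OF that] by (rule radial_has_derivative) (use z that in auto)
  show "continuous_on S (\<lambda>x. \<phi>' (norm x) * (sgn x \<bullet> i))" for i
    by (rule vanishing_mult_continuous[OF _ _ sgn_inner_le sgn_inner_continuous])
       (use z in \<open>auto intro!: continuous_on_compose2[OF c] continuous_intros\<close>)
qed

lemma grad_eq:
  assumes "(U has_derivative (\<lambda>h. g \<bullet> h)) (at x)"
  shows "grad U x = g"
proof -
  have "frechet_derivative U (at x) = (\<lambda>h. g \<bullet> h)" using frechet_derivative_at[OF assms] by simp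
  then show ?thesis by (simp add: grad_def inner_axis vec_eq_iff)
qed

text \<open>The derivative of the field \<open>w (norm x) *\<^sub>R x\<close>, with \<open>c\<close>
  standing for \<open>r * w' r\<close>. In terms of \<open>c\<close> the expression still makes
  sense at the origin, where \<open>w\<close> is only assumed continuous.\<close>

definition central_derivative :: "real \<Rightarrow> real \<Rightarrow> real^3 \<Rightarrow> real^3 \<Rightarrow> real^3" where
  "central_derivative w c x h = w *\<^sub>R h + (c * (sgn x \<bullet> h)) *\<^sub>R sgn x"

lemma central_field_derivative:
  fixes x :: "real^3"
  assumes d: "x \<noteq> 0 \<Longrightarrow> (w has_real_derivative c / norm x) (at (norm x) within {0..})"
    and z: "x = 0 \<Longrightarrow> continuous (at 0 within {0..}) w"
  shows "((\<lambda>x. w (norm x) *\<^sub>R x) has_derivative central_derivative (w (norm x)) c x) (at x)"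
proof (cases "x = 0")
  case False
  have "((\<lambda>x. w (norm x)) has_derivative (\<lambda>h. c / norm x * (sgn x \<bullet> h))) (at x)"
    using d[OF False] by (rule radial_has_derivative) (use False in auto)
  from has_derivative_scaleR[OF this has_derivative_ident]
  have "((\<lambda>x. w (norm x) *\<^sub>R x) has_derivative (\<lambda>h. w (norm x) *\<^sub>R h + (c / norm x * (sgn x \<bullet> h)) *\<^sub>R x)) (at x)" .
  moreover have "(c / norm x * (sgn x \<bullet> h)) *\<^sub>R x = (c * (sgn x \<bullet> h)) *\<^sub>R sgn x" for h
    by (simp add: sgn_div_norm divide_inverse mult_ac)
  ultimately show ?thesis by (simp add: central_derivative_def[abs_def])
next
  case True
  have lim: "(w \<longlongrightarrow> w 0) (at 0 within {0..})" using z[OF True] by (simp add: continuous_within)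
  have "filterlim norm (at 0 within {0..}) (at (0::real^3))"
    unfolding filterlim_at by (auto simp: tendsto_norm_zero eventually_at_filter)
  from filterlim_compose[OF lim this]
  have "((\<lambda>h::real^3. w (norm h) - w 0) \<longlongrightarrow> w 0 - w 0) (at 0)" by (intro tendsto_intros)
  then have l0: "((\<lambda>h::real^3. \<bar>w (norm h) - w 0\<bar>) \<longlongrightarrow> 0) (at 0)" by (simp add: tendsto_rabs_zero)
  have "((\<lambda>h::real^3. norm (w (norm h) *\<^sub>R h - w 0 *\<^sub>R h) / norm h) \<longlongrightarrow> 0) (at 0)"
  proof (rule Lim_transform_eventually[OF l0])
    have "\<bar>w (norm h) - w 0\<bar> = norm (w (norm h) *\<^sub>R h - w 0 *\<^sub>R h) / norm h" if "h \<noteq> 0" for h :: "real^3"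
      unfolding scaleR_diff_left[symmetric] using that by simp
    then show "\<forall>\<^sub>F h in at (0::real^3). \<bar>w (norm h) - w 0\<bar> = norm (w (norm h) *\<^sub>R h - w 0 *\<^sub>R h) / norm h"
      by (simp add: eventually_at_filter)
  qed
  then show ?thesis unfolding True has_derivative_at central_derivative_def
    by (simp add: bounded_linear_scaleR_right)
qed

lemma central_field_C1:
  assumes d: "\<And>x. x \<in> S \<Longrightarrow> x \<noteq> 0 \<Longrightarrow> (w has_real_derivative c (norm x) / norm x) (at (norm x) within {0..})"
    and z: "0 \<in> S \<Longrightarrow> continuous (at 0 within {0..}) w" and c0: "0 \<in> S \<Longrightarrow> c 0 = 0"
    and wc: "continuous_on (norm ` S) w" and cc: "continuous_on (norm ` S) c"
  shows "C1_on S (\<lambda>x. w (norm x) *\<^sub>R x)"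
proof (rule C1_onI[where F'="\<lambda>x. central_derivative (w (norm x)) (c (norm x)) x"])
  show "((\<lambda>x. w (norm x) *\<^sub>R x) has_derivative central_derivative (w (norm x)) (c (norm x)) x) (at x)" if "x \<in> S" for x
    by (rule central_field_derivative) (use d z that in auto)
  fix i :: "real^3"
  have w': "continuous_on S (\<lambda>x. w (norm x))" by (intro continuous_on_compose2[OF wc] continuous_intros) auto
  have c': "continuous_on S (\<lambda>x. c (norm x))" by (intro continuous_on_compose2[OF cc] continuous_intros) auto
  have k: "continuous_on S (\<lambda>x. c (norm x) * ((sgn x \<bullet> i) * (sgn x \<bullet> axis k 1)))" for k
  proof (rule vanishing_mult_continuous[OF c', where M="norm i * 1"])
    show "\<bar>(sgn x \<bullet> i) * (sgn x \<bullet> axis k 1)\<bar> \<le> norm i * 1" for x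
      unfolding abs_mult using sgn_inner_le[of x i] sgn_inner_le[of x "axis k 1"] by (intro mult_mono) auto
  qed (use c0 in \<open>auto intro!: continuous_on_mult sgn_inner_continuous\<close>)
  have "continuous_on S (\<lambda>x. \<chi> k. w (norm x) * i $ k + c (norm x) * ((sgn x \<bullet> i) * (sgn x \<bullet> axis k 1)))"
    by (intro continuous_on_vec_lambda continuous_on_add[OF continuous_on_mult[OF w' continuous_on_const] k])
  moreover have "(\<chi> k. w (norm x) * i $ k + c (norm x) * ((sgn x \<bullet> i) * (sgn x \<bullet> axis k 1))) = central_derivative (w (norm x)) (c (norm x)) x i" for x
    by (simp add: vec_eq_iff central_derivative_def inner_axis mult_ac)
  ultimately show "continuous_on S (\<lambda>x. central_derivative (w (norm x)) (c (norm x)) x i)" by simp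
qed

text \<open>The trace of \<open>central_derivative\<close>: the multiple of the identity contributes
  \<open>3 * w\<close>, the projection onto the unit vector \<open>sgn x\<close> contributes
  \<open>c\<close>.\<close>

lemma laplacian_central:
  assumes g: "grad U = (\<lambda>x. w (norm x) *\<^sub>R x)"
    and d: "x \<noteq> 0 \<Longrightarrow> (w has_real_derivative c / norm x) (at (norm x) within {0..})"
    and z: "x = 0 \<Longrightarrow> continuous (at 0 within {0..}) w" and c0: "x = 0 \<Longrightarrow> c = 0"
  shows "laplacian U x = 3 * w (norm x) + c"
proof -
  have D: "((\<lambda>z. (w (norm z) *\<^sub>R z) $ i) has_derivative (\<lambda>h. central_derivative (w (norm x)) c x h $ i)) (at x)" for i
    by (rule bounded_linear.has_derivative[OF bounded_linear_vec_nth central_field_derivative]) (use d z in auto)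
  have "frechet_derivative (\<lambda>z. grad U z $ i) (at x) (axis i 1) = w (norm x) + c * (sgn x $ i)\<^sup>2" for i
    unfolding g frechet_derivative_at[OF D[of i], symmetric]
    by (simp add: central_derivative_def inner_axis power2_eq_square)
  then have "laplacian U x = 3 * w (norm x) + c * (\<Sum>i\<in>UNIV. (sgn x $ i)\<^sup>2)"
    by (simp add: laplacian_def sum.distrib sum_distrib_left)
  also have "(\<Sum>i\<in>UNIV. (sgn x $ i)\<^sup>2) = (norm (sgn x))\<^sup>2"
    unfolding power2_norm_eq_inner inner_vec_def by (simp add: power2_eq_square)
  finally show ?thesis using c0 by (cases "x = 0") (auto simp: norm_sgn)
qed

section \<open>Conserved quantities\<close>

text \<open>The energy \<open>e v - y\<close> and the angular momentum \<open>cross3 x v\<close> are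
  conserved. The gradient of \<open>e\<close> is \<open>b1 v *\<^sub>R v\<close>, the velocity
  \<open>b2 v *\<^sub>R v\<close>, and \<open>b3 v\<close> is the factor in the force, so energy
  conservation amounts to \<open>b2 = b1 * b3\<close>. Angular momentum is conserved since the force
  is central and the velocity parallel to \<open>v\<close>.\<close>

lemma constant_along_characteristics_energy:
  fixes e :: "real^3 \<Rightarrow> real"
  assumes y: "\<And>r. 0 \<le> r \<Longrightarrow> (y has_real_derivative y' r) (at r within {0..})" and y'0: "y' 0 = 0"
    and e: "\<And>v. (e has_derivative (\<lambda>h. b1 v * (v \<bullet> h))) (at v)"
    and b: "\<And>v. b2 v = b1 v * b3 v"
    and f: "\<And>x v. f x v = H (y (norm x) - e v) * angular_factor l x v"
    and force: "\<And>x v. F x v = (b3 v * y' (norm x)) *\<^sub>R sgn x"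
  shows "constant_along_characteristics D (\<lambda>x v. b2 v *\<^sub>R v) F f"
  unfolding constant_along_characteristics_def
proof (intro allI impI ballI)
  fix I :: "real set" and X V s t
  assume I: "is_interval I"
    and XV: "\<forall>t\<in>I. (X t, V t) \<in> D \<and> (X has_vector_derivative b2 (V t) *\<^sub>R V t) (at t within I) \<and>
        (V has_vector_derivative F (X t) (V t)) (at t within I)"
    and s: "s \<in> I" and t: "t \<in> I"
  have con: "convex I" using I by (simp add: is_interval_convex)
  have Xd: "(X has_derivative (\<lambda>h. h *\<^sub>R (b2 (V t) *\<^sub>R V t))) (at t within I)"
    and Vd: "(V has_derivative (\<lambda>h. h *\<^sub>R ((b3 (V t) * y' (norm (X t))) *\<^sub>R sgn (X t)))) (at t within I)" if "t \<in> I" for t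
    using XV that by (auto simp: has_vector_derivative_def force)
  have "((\<lambda>t. y (norm (X t)) - e (V t)) has_derivative (\<lambda>h. 0)) (at t within I)" if t: "t \<in> I" for t
  proof -
    have "((\<lambda>x. y (norm x)) has_derivative (\<lambda>h. y' (norm (X t)) * (sgn (X t) \<bullet> h))) (at (X t) within X ` I)"
      by (rule has_derivative_at_withinI[OF radial_has_derivative]) (use y y'0 in auto)
    from has_derivative_in_compose[OF Xd[OF t] this]
    have 1: "((\<lambda>t. y (norm (X t))) has_derivative (\<lambda>h. y' (norm (X t)) * (sgn (X t) \<bullet> (h *\<^sub>R (b2 (V t) *\<^sub>R V t))))) (at t within I)" .
    have 2: "((\<lambda>t. e (V t)) has_derivative (\<lambda>h. b1 (V t) * (V t \<bullet> (h *\<^sub>R ((b3 (V t) * y' (norm (X t))) *\<^sub>R sgn (X t)))))) (at t within I)"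
      using has_derivative_in_compose[OF Vd[OF t] has_derivative_at_withinI[OF e]] .
    have "((\<lambda>t. y (norm (X t)) - e (V t)) has_derivative (\<lambda>h. y' (norm (X t)) * (sgn (X t) \<bullet> (h *\<^sub>R (b2 (V t) *\<^sub>R V t)))
       - b1 (V t) * (V t \<bullet> (h *\<^sub>R ((b3 (V t) * y' (norm (X t))) *\<^sub>R sgn (X t)))))) (at t within I)"
      by (rule has_derivative_diff[OF 1 2])
    moreover have "y' (norm (X t)) * (sgn (X t) \<bullet> (h *\<^sub>R (b2 (V t) *\<^sub>R V t)))
       - b1 (V t) * (V t \<bullet> (h *\<^sub>R ((b3 (V t) * y' (norm (X t))) *\<^sub>R sgn (X t)))) = 0" for h
      by (simp add: b inner_commute)
    ultimately show ?thesis by (simp only:)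
  qed
  from has_derivative_zero_constant[OF con this]
  have E: "y (norm (X s)) - e (V s) = y (norm (X t)) - e (V t)" using s t by metis
  have "((\<lambda>t. cross3 (X t) (V t)) has_derivative (\<lambda>h. 0)) (at t within I)" if t: "t \<in> I" for t
  proof -
    have bb: "bounded_bilinear cross3" using bilinear_cross bilinear_conv_bounded_bilinear by blast
    have "((\<lambda>t. cross3 (X t) (V t)) has_derivative (\<lambda>h. cross3 (X t) (h *\<^sub>R ((b3 (V t) * y' (norm (X t))) *\<^sub>R sgn (X t)))
       + cross3 (h *\<^sub>R (b2 (V t) *\<^sub>R V t)) (V t))) (at t within I)"
      by (rule bounded_bilinear.FDERIV[OF bb Xd[OF t] Vd[OF t]])
    then show ?thesis by (simp add: cross_mult_left cross_mult_right sgn_div_norm)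
  qed
  from has_derivative_zero_constant[OF con this]
  have "cross3 (X s) (V s) = cross3 (X t) (V t)" using s t by metis
  then show "f (X s) (V s) = f (X t) (V t)" using E by (simp add: f angular_factor_def)
qed

lemma spherically_symmetric_energy:
  assumes f: "\<And>x v. f x v = h (norm x) (norm v) * angular_factor l x v"
  shows "spherically_symmetric l f"
  unfolding spherically_symmetric_def
proof (intro allI impI ballI, clarify)
  fix A :: "real^3^3" and x v assume A: "rotation_matrix A"
  then have "orthogonal_transformation ((*v) A)" by (simp add: rotation_matrix_def orthogonal_transformation_matrix)
  then have n: "norm (A *v x) = norm x" for x by (rule orthogonal_transformation_norm)
  show "f (A *v x) (A *v v) = f x v"
    by (simp add: f angular_factor_def cross_rotation_matrix[OF A] n)
qed

section \<open>Static solutions with an isotropic energy profile\<close>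

text \<open>The factor split off \<open>angular_factor\<close> when \<open>x\<close> is replaced by
  a unit vector. The case \<open>l = 0\<close> is separate because
  \<open>0 powr 0 = 0\<close>.\<close>

definition rad :: "real \<Rightarrow> real \<Rightarrow> real" where
  "rad l r = (if l = 0 then 1 else r powr (2 * l))"

lemma norm_radial_direction: "norm (radial_direction x) = 1"
  by (simp add: radial_direction_def)

lemma angular_factor_radial: "angular_factor l x v = rad l (norm x) * angular_factor l (radial_direction x) v"
proof (cases "x = 0")
  case False
  then have "cross3 x v = norm x *\<^sub>R cross3 (radial_direction x) v"
    by (simp add: radial_direction_def cross_mult_left)
  then have "norm (cross3 x v) = norm x * norm (cross3 (radial_direction x) v)" by (metis norm_scaleR abs_norm_cancel)
  then show ?thesis by (simp add: angular_factor_def rad_def powr_mult)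
qed (simp add: angular_factor_def rad_def)

lemma DERIV_powr_0:
  assumes "1 < p"
  shows "((\<lambda>r. r powr p) has_real_derivative 0) (at 0 within {0..})"
proof -
  have "((\<lambda>r. r powr (p - 1)) \<longlongrightarrow> 0 powr (p - 1)) (at 0 within {0..})"
    using assms by (intro tendsto_powr2 tendsto_intros) (auto simp: eventually_at_filter)
  then have "((\<lambda>r. r powr (p - 1)) \<longlongrightarrow> 0) (at 0 within {0..})" using assms by simp
  moreover have "\<forall>\<^sub>F r in at 0 within {0..}. r powr (p - 1) = (r powr p - 0 powr p) / (r - 0)"
    by (simp add: eventually_at_filter powr_diff)
  ultimately have "((\<lambda>r. (r powr p - 0 powr p) / (r - 0)) \<longlongrightarrow> 0) (at 0 within {0..})"
    by (rule Lim_transform_eventually)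
  then show ?thesis by (simp add: has_field_derivative_iff)
qed

definition rad' :: "real \<Rightarrow> real \<Rightarrow> real" where
  "rad' l r = (if l = 0 then 0 else 2 * l * r powr (2 * l - 1))"

text \<open>At \<open>r = 0\<close> the derivative must vanish for the radial function to be
  differentiable in space; this is the case for \<open>l = 0\<close> and for
  \<open>2 * l > 1\<close>.\<close>

lemma rad_deriv:
  assumes "0 \<le> r" "0 < r \<or> l = 0 \<or> 1/2 < l"
  shows "(rad l has_real_derivative rad' l r) (at r within {0..})"
proof (cases "l = 0")
  case True
  then show ?thesis by (simp add: rad_def[abs_def] rad'_def)
next
  case False
  then have e: "rad l = (\<lambda>r. r powr (2 * l))" by (simp add: rad_def fun_eq_iff)
  show ?thesis
  proof (cases "r = 0")
    case True
    then show ?thesis using assms False DERIV_powr_0[of "2 * l"] by (simp add: e rad'_def)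
  next
    case r: False
    then have "((\<lambda>r. r powr (2 * l)) has_real_derivative 2 * l * r powr (2 * l - 1)) (at r)"
      using assms by (intro has_real_derivative_powr) auto
    then show ?thesis using False by (simp add: e rad'_def has_field_derivative_at_within)
  qed
qed

lemma rad'_continuous:
  assumes "\<And>r. r \<in> S \<Longrightarrow> 0 \<le> r \<and> (0 < r \<or> l = 0 \<or> 1/2 < l)"
  shows "continuous_on S (rad' l)"
proof (cases "l = 0")
  case False
  then have e: "rad' l = (\<lambda>r. 2 * l * r powr (2 * l - 1))" by (simp add: rad'_def fun_eq_iff)
  show ?thesis unfolding e
    by (intro continuous_intros continuous_on_powr') (use assms False in force)+
qed (simp add: rad'_def[abs_def])

lemma rad_continuous:
  assumes "\<And>r. r \<in> S \<Longrightarrow> 0 \<le> r \<and> (0 < r \<or> 0 \<le> l)"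
  shows "continuous_on S (rad l)"
proof (cases "l = 0")
  case False
  then have e: "rad l = (\<lambda>r. r powr (2 * l))" by (simp add: rad_def fun_eq_iff)
  show ?thesis unfolding e
    by (intro continuous_intros continuous_on_powr') (use assms False in force)+
qed (simp add: rad_def[abs_def])

lemma radial_product_continuous:
  assumes y: "continuous_on {0..} y" and G: "continuous_on UNIV G"
  shows "continuous_on (position_domain l) (\<lambda>x. rad l (norm x) * G (y (norm x)))"
proof (intro continuous_on_mult)
  show "continuous_on (position_domain l) (\<lambda>x. rad l (norm x))"
    by (rule continuous_on_compose2[OF rad_continuous[of "norm ` position_domain l" l]])
       (auto simp: position_domain_def intro!: continuous_intros)
  show "continuous_on (position_domain l) (\<lambda>x. G (y (norm x)))"
    by (rule continuous_on_compose2[OF G continuous_on_compose2[OF y]]) (auto intro!: continuous_intros)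
qed

text \<open>\<open>G\<close> is C1 for positive arguments, hence the restriction to the ball where
  \<open>y\<close> is positive. At the origin the radial derivative vanishes because
  \<open>rad' l 0 = 0\<close> and \<open>y' 0 = 0\<close>.\<close>

lemma radial_product_C1:
  assumes y: "has_C1_derivative y y'" and y'0: "y' 0 = 0" and pos: "\<And>r. 0 \<le> r \<Longrightarrow> r < R \<Longrightarrow> 0 < y r"
    and G: "\<And>t. 0 < t \<Longrightarrow> (G has_real_derivative G' t) (at t)" and G': "continuous_on {0<..} G'"
  shows "C1_on (ball 0 R \<inter> C1_domain l) (\<lambda>x. rad l (norm x) * G (y (norm x)))"
proof (rule radial_C1[where \<phi>="\<lambda>r. rad l r * G (y r)" and \<phi>'="\<lambda>r. rad' l r * G (y r) + G' (y r) * y' r * rad l r"])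
  let ?S = "ball 0 R \<inter> C1_domain l"
  have S: "0 \<le> r \<and> r < R \<and> (0 < r \<or> l = 0 \<or> 1/2 < l)" if "r \<in> norm ` ?S" for r
    using that by (auto simp: C1_domain_def)
  have yd: "(y has_real_derivative y' r) (at r within {0..})" if "0 \<le> r" for r
    using y that by (simp add: has_C1_derivative_def)
  have yc: "continuous_on {0..} y" using DERIV_continuous[OF yd] by (simp add: continuous_on_eq_continuous_within)
  fix x assume x: "x \<in> ?S"
  have r: "0 \<le> norm x" "norm x < R" "0 < norm x \<or> l = 0 \<or> 1/2 < l" using S[of "norm x"] x by auto
  have "((\<lambda>r. G (y r)) has_real_derivative G' (y (norm x)) * y' (norm x)) (at (norm x) within {0..})"
    by (rule DERIV_chain2[OF G[OF pos[OF r(1,2)]] yd[OF r(1)]])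
  from DERIV_mult[OF rad_deriv[OF r(1,3)] this]
  show "((\<lambda>r. rad l r * G (y r)) has_real_derivative rad' l (norm x) * G (y (norm x)) + G' (y (norm x)) * y' (norm x) * rad l (norm x)) (at (norm x) within {0..})" .
next
  let ?S = "ball (0::real^3) R \<inter> C1_domain l"
  have S: "0 \<le> r \<and> r < R \<and> (0 < r \<or> l = 0 \<or> 1/2 < l)" if "r \<in> norm ` ?S" for r
    using that by (auto simp: C1_domain_def)
  have yd: "(y has_real_derivative y' r) (at r within {0..})" if "0 \<le> r" for r
    using y that by (simp add: has_C1_derivative_def)
  have "continuous_on {0..} y" using DERIV_continuous[OF yd] by (simp add: continuous_on_eq_continuous_within)
  then have yc: "continuous_on (norm ` ?S) y" by (rule continuous_on_subset) auto
  have y'c: "continuous_on (norm ` ?S) y'"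
    using y by (auto simp: has_C1_derivative_def intro: continuous_on_subset)
  have G0: "continuous_on {0<..} G" using DERIV_isCont[OF G] by (intro continuous_at_imp_continuous_on) auto
  have yi: "y ` (norm ` ?S) \<subseteq> {0<..}"
  proof (rule image_subsetI)
    fix r assume "r \<in> norm ` ?S"
    from S[OF this] pos[of r] show "y r \<in> {0<..}" by simp
  qed
  have Gc: "continuous_on (norm ` ?S) (\<lambda>r. G (y r))" by (rule continuous_on_compose2[OF G0 yc yi])
  have G'c: "continuous_on (norm ` ?S) (\<lambda>r. G' (y r))" by (rule continuous_on_compose2[OF G' yc yi])
  have r1: "continuous_on (norm ` ?S) (rad' l)" by (rule rad'_continuous) (use S in blast)
  have r2: "continuous_on (norm ` ?S) (rad l)"
  proof (rule rad_continuous)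
    fix r assume "r \<in> norm ` ?S"
    from S[OF this] show "0 \<le> r \<and> (0 < r \<or> 0 \<le> l)" by auto
  qed
  show "continuous_on (norm ` ?S) (\<lambda>r. rad' l r * G (y r) + G' (y r) * y' r * rad l r)"
    by (intro continuous_on_add continuous_on_mult r1 r2 Gc G'c y'c)
  assume "0 \<in> ?S"
  then have "l = 0 \<or> 1/2 < l" by (simp add: C1_domain_def)
  then show "rad' l 0 * G (y 0) + G' (y 0) * y' 0 * rad l 0 = 0" using y'0 by (auto simp: rad'_def)
qed

locale energy_profile = kinetic e s s' + profile \<Psi> for e s s' \<Psi> +
  fixes l :: real and c k \<eta>0 :: real
  assumes l: "- 1/2 < l" and c: "0 < c" and \<eta>0: "0 < \<eta>0" and k: "0 \<le> k" "k < l + 3/2"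
    and lower: "\<And>\<eta>. 0 < \<eta> \<Longrightarrow> \<eta> < \<eta>0 \<Longrightarrow> c * \<eta> powr k \<le> \<Psi> \<eta>"
begin

definition f :: "(real \<Rightarrow> real) \<Rightarrow> real^3 \<Rightarrow> real^3 \<Rightarrow> real" where
  "f y x v = \<Psi> (y (norm x) - e v) * angular_factor l x v"

lemma f_nonneg: "0 \<le> f y x v" using nonneg by (simp add: f_def angular_factor_def)

lemma e_le_iff: "0 \<le> t \<Longrightarrow> e v \<le> t \<longleftrightarrow> (norm v)\<^sup>2 \<le> s t"
  using s_mono[of t "e v"] s_mono[of "e v" t] e_nonneg[of v] s_e[of v] by (cases "e v" t rule: linorder_cases) auto

lemma e_eq: "0 \<le> t \<Longrightarrow> (norm v)\<^sup>2 = s t \<Longrightarrow> e v = t"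
  using s_mono[of t "e v"] s_mono[of "e v" t] e_nonneg[of v] s_e[of v] by (cases "e v" t rule: linorder_cases) auto

lemma velocity_moment:
  assumes K: "kernel \<kappa> \<kappa>'"
    and \<omega>: "\<omega> \<in> borel_measurable borel" "\<And>t. 0 \<le> t \<Longrightarrow> 0 \<le> \<omega> t"
    and \<kappa>: "\<And>t. 0 < t \<Longrightarrow> \<kappa> t = \<omega> t * (pi * Beta (l + 1) (real j + 1/2) * s t powr (l + j + 1/2) * s' t)"
  shows "integrable lebesgue (\<lambda>v. (radial_direction x \<bullet> v) ^ (2 * j) * \<omega> (e v) * f y x v)"
    and "(LINT v|lebesgue. (radial_direction x \<bullet> v) ^ (2 * j) * \<omega> (e v) * f y x v) = rad l (norm x) * conv \<Psi> \<kappa> (y (norm x))"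
proof -
  have C: "convolution \<Psi> \<kappa> \<kappa>'" by (intro convolution.intro K profile_axioms)
  note m = moment_integral[OF C l norm_radial_direction[of x] \<omega> \<kappa>, of "y (norm x)"]
  have e: "(radial_direction x \<bullet> v) ^ (2 * j) * \<omega> (e v) * f y x v
     = rad l (norm x) * (\<omega> (e v) * \<Psi> (y (norm x) - e v) * angular_weight l j (radial_direction x) v)" for v
    unfolding f_def angular_weight_def angular_factor_radial[of l x v] by (simp add: mult_ac)
  show "integrable lebesgue (\<lambda>v. (radial_direction x \<bullet> v) ^ (2 * j) * \<omega> (e v) * f y x v)"
    unfolding e by (intro integrable_mult_right m(1))
  show "(LINT v|lebesgue. (radial_direction x \<bullet> v) ^ (2 * j) * \<omega> (e v) * f y x v) = rad l (norm x) * conv \<Psi> \<kappa> (y (norm x))"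
    unfolding e by (simp add: m(2))
qed

text \<open>Integration is restricted to \<open>z\<close> between \<open>\<theta>/2 * y\<close> and
  \<open>\<theta> * y\<close>. There \<open>\<Psi> z\<close> is at least a multiple of
  \<open>y powr k\<close> and the kernel at least a multiple of \<open>y powr (l + 1/2)\<close>; the
  length of the interval adds one more power of \<open>y\<close>.\<close>

lemma conv_lower:
  assumes K: "kernel \<kappa> \<kappa>'" and c2: "0 < c2" "\<And>t. 0 < t \<Longrightarrow> c2 * t powr (l + 1/2) \<le> \<kappa> t" and Y: "0 < Y"
  shows "\<exists>b>0. \<forall>y\<in>{0<..Y}. b * y powr (k + l + 3/2) \<le> conv \<Psi> \<kappa> y"
proof -
  interpret C: convolution \<Psi> \<kappa> \<kappa>' by (intro convolution.intro K profile_axioms)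
  \<comment> \<open>\<open>\<theta> \<le> 1/2\<close> keeps \<open>y - z \<ge> y/2\<close>, and
    \<open>\<theta> * Y < \<eta>0\<close> keeps \<open>z\<close> in the range of the lower bound on
    \<open>\<Psi>\<close>.\<close>
  define \<theta> where "\<theta> = min 1 (\<eta>0 / Y) / 2"
  have \<theta>: "0 < \<theta>" "\<theta> \<le> 1/2" using \<eta>0 Y by (auto simp: \<theta>_def)
  have \<theta>Y: "\<theta> * Y < \<eta>0"
  proof -
    have "\<theta> \<le> \<eta>0 / Y / 2" by (simp add: \<theta>_def)
    then have "\<theta> * Y \<le> \<eta>0 / 2" using Y by (simp add: field_simps)
    then show ?thesis using \<eta>0 by simp
  qed
  define b where "b = c * (\<theta>/2) powr k * (c2 * (1/2) powr (l + 1/2)) * (\<theta>/2)"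
  have b: "0 < b" using c c2 \<theta> by (simp add: b_def)
  have "b * y powr (k + l + 3/2) \<le> conv \<Psi> \<kappa> y" if y: "0 < y" "y \<le> Y" for y
  proof -
    define B where "B = c * (\<theta>/2 * y) powr k * (c2 * (y/2) powr (l + 1/2))"
    have ty: "\<theta> * y < \<eta>0" using \<theta>Y mult_left_mono[OF y(2), of \<theta>] \<theta> by linarith
    have m: "measure lebesgue {\<theta>/2 * y..\<theta> * y} = \<theta>/2 * y" using \<theta> y by (simp add: field_simps)
    have "B * (\<theta>/2 * y) = (LINT z|lebesgue. B * indicator {\<theta>/2 * y..\<theta> * y} z)"
      using m by simp
    also have "\<dots> \<le> (LINT z|lebesgue. \<Psi> z * C.k0 (y - z))"
    proof (rule integral_mono[OF _ C.integrable_k0])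
      show "integrable lebesgue (\<lambda>z. B * indicator {\<theta>/2 * y..\<theta> * y} z)"
        by (intro integrable_mult_right integrable_real_indicator) (auto simp: emeasure_lborel_Icc_eq)
      fix z
      show "B * indicator {\<theta>/2 * y..\<theta> * y} z \<le> \<Psi> z * C.k0 (y - z)"
      proof (cases "z \<in> {\<theta>/2 * y..\<theta> * y}")
        case True
        have z0: "0 < \<theta>/2 * y" using \<theta> y by simp
        have "\<theta> * y \<le> 1/2 * y" using \<theta> y by (intro mult_right_mono) auto
        then have zy: "z \<le> y/2" using True unfolding atLeastAtMost_iff by linarith
        have z: "0 < z" "z < \<eta>0" "\<theta>/2 * y \<le> z" using True ty z0 by auto
        have "c * (\<theta>/2 * y) powr k \<le> c * z powr k" using c k z z0 by (intro mult_left_mono powr_mono2) auto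
        also have "\<dots> \<le> \<Psi> z" by (rule lower[OF z(1,2)])
        finally have 1: "c * (\<theta>/2 * y) powr k \<le> \<Psi> z" .
        have "c2 * (y/2) powr (l + 1/2) \<le> c2 * (y - z) powr (l + 1/2)"
          using c2 l y zy by (intro mult_left_mono powr_mono2) auto
        also have "\<dots> \<le> \<kappa> (y - z)" using zy y by (intro c2) auto
        also have "\<dots> = C.k0 (y - z)" using zy y by (simp add: C.k0_def)
        finally have 2: "c2 * (y/2) powr (l + 1/2) \<le> C.k0 (y - z)" .
        have "B \<le> \<Psi> z * C.k0 (y - z)" unfolding B_def
          using 1 2 c c2 nonneg by (intro mult_mono) auto
        then show ?thesis using True by simp
      qed (simp add: nonneg C.k0_nonneg)
    qed
    also have "\<dots> = conv \<Psi> \<kappa> y" by (rule C.conv_k0[symmetric])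
    also have "B * (\<theta>/2 * y) = b * y powr (k + l + 3/2)"
    proof -
      have p: "(\<theta>/2 * y) powr k = (\<theta>/2) powr k * y powr k" using \<theta> y by (intro powr_mult)
      have q: "(y/2) powr (l + 1/2) = (1/2) powr (l + 1/2) * y powr (l + 1/2)" using powr_mult[of "1/2" y "l + 1/2"] y by simp
      have "y powr (k + l + 3/2) = y powr (k + (l + 1/2) + 1)" by (rule arg_cong[where f="(powr) y"]) simp
      also have "\<dots> = y powr k * y powr (l + 1/2) * y" unfolding powr_add using y by simp
      finally show ?thesis unfolding B_def b_def p q by (simp add: mult_ac)
    qed
    finally show ?thesis .
  qed
  then show ?thesis using b by auto
qed

text \<open>For the exponent \<open>q = k + l + 3/2\<close>, the inequality \<open>1 < q\<close>
  follows from \<open>k \<ge> 0\<close> and \<open>l > - 1/2\<close>, and \<open>q < 2*l + 3\<close>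
  is the condition \<open>k < l + 3/2\<close>.\<close>

lemma reduced_model:
  assumes K1: "kernel \<kappa>1 \<kappa>1'" and low: "0 < c2" "\<And>t. 0 < t \<Longrightarrow> c2 * t powr (l + 1/2) \<le> \<kappa>1 t"
    and a: "a = 0 \<or> a = 1" and y0: "0 < y0"
    and h: "continuous_on UNIV h" "\<And>y. 0 \<le> h y" "\<And>y. y \<le> 0 \<Longrightarrow> h y = 0"
      "\<And>y. 0 < y \<Longrightarrow> (h has_real_derivative a * (conv \<Psi> \<kappa>1 y + h y)) (at y)"
  shows "reduced l a (k + l + 3/2) y0 (conv \<Psi> \<kappa>1) (conv \<Psi> \<kappa>1') h"
proof -
  interpret C: convolution \<Psi> \<kappa>1 \<kappa>1' by (intro convolution.intro K1 profile_axioms)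
  show ?thesis
    by unfold_locales
       (use l a y0 h k C.conv_continuous C.conv_nonneg C.conv_nonpos C.conv_deriv C.conv_k'_continuous conv_lower[OF K1 low] in auto)
qed

text \<open>Where \<open>f\<close> does not vanish, \<open>e v \<le> y (norm x)\<close>, which
  bounds \<open>x\<close> and \<open>v\<close>. Conversely, for \<open>x \<noteq> 0\<close> inside
  the ball a velocity orthogonal to \<open>x\<close> with energy \<open>y (norm x) - \<zeta>\<close>
  is chosen: then \<open>cross3 x v \<noteq> 0\<close>, and the argument of \<open>\<Psi>\<close> is
  \<open>\<zeta>\<close>, small enough for the lower bound to give positivity.\<close>

lemma support:
  assumes R: "0 < R" and pos: "\<And>r. 0 \<le> r \<Longrightarrow> r < R \<Longrightarrow> 0 < y r" and out: "\<And>r. R < r \<Longrightarrow> y r < 0"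
    and le: "\<And>r. 0 \<le> r \<Longrightarrow> y r \<le> y0"
  shows "compact (support_in_phase_space l (f y))" "spatial_support l (f y) = cball 0 R"
proof -
  have y0: "0 \<le> y0" using le[of 0] pos[of 0] R by simp
  have nz: "norm x \<le> R \<and> norm v \<le> sqrt (s y0)" if "f y x v \<noteq> 0" for x v
  proof -
    have "\<Psi> (y (norm x) - e v) \<noteq> 0" using that by (auto simp: f_def)
    then have ge: "e v \<le> y (norm x)" using neg[of "y (norm x) - e v"] by (cases "e v \<le> y (norm x)") auto
    then have "0 \<le> y (norm x)" using e_nonneg[of v] by linarith
    then have "norm x \<le> R" using out[of "norm x"] by linarith
    moreover have "e v \<le> y0" using ge le[of "norm x"] by simp
    then have "(norm v)\<^sup>2 \<le> s y0" using e_le_iff[OF y0] by simp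
    then have "norm v \<le> sqrt (s y0)" by (rule real_le_rsqrt)
    ultimately show ?thesis by simp
  qed
  show "compact (support_in_phase_space l (f y))"
    unfolding support_in_phase_space_def compact_closure
    by (rule bounded_subset[of "cball 0 R \<times> cball 0 (sqrt (s y0))"])
       (use nz in \<open>auto intro!: bounded_Times\<close>)
  let ?A = "{x. \<exists>v. (x, v) \<in> phase_domain l \<and> f y x v \<noteq> 0}"
  have inA: "x \<in> ?A" if x: "x \<noteq> 0" "norm x < R" for x
  proof -
    have yx: "0 < y (norm x)" using pos x by simp
    define \<zeta> where "\<zeta> = min (y (norm x)) \<eta>0 / 2"
    have \<zeta>: "0 < \<zeta>" "\<zeta> < y (norm x)" "\<zeta> < \<eta>0" using yx \<eta>0 by (auto simp: \<zeta>_def)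
    define t where "t = y (norm x) - \<zeta>"
    have t: "0 < t" using \<zeta> by (simp add: t_def)
    have st: "0 < s t" using s_mono[of 0 t] s_0 t by simp
    obtain u :: "real^3" where u: "u \<noteq> 0" "orthogonal x u"
      using orthogonal_to_vector_exists[of x] by auto
    define v where "v = (sqrt (s t) / norm u) *\<^sub>R u"
    have nv: "(norm v)\<^sup>2 = s t" using st u by (simp add: v_def power_divide)
    have "e v = t" using e_eq[of t v] nv t by simp
    then have "y (norm x) - e v = \<zeta>" by (simp add: t_def)
    moreover have "0 < c * \<zeta> powr k" using c \<zeta> by simp
    ultimately have "0 < \<Psi> (y (norm x) - e v)" using lower[OF \<zeta>(1,3)] by simp
    moreover have cr: "cross3 x v \<noteq> 0"
    proof
      assume "cross3 x v = 0"
      moreover have "x \<bullet> v = 0" using u by (simp add: v_def orthogonal_def)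
      ultimately have "(norm x)\<^sup>2 * (norm v)\<^sup>2 = 0" using norm_cross[of x v] by simp
      then show False using x nv st by simp
    qed
    ultimately have "f y x v \<noteq> 0" by (simp add: f_def angular_factor_def)
    then show ?thesis using cr by (auto simp: phase_domain_def)
  qed
  have "closure ?A \<subseteq> cball 0 R"
    by (rule closure_minimal) (use nz in auto)
  moreover have "ball 0 R \<subseteq> closure ?A"
  proof
    fix x :: "real^3" assume x: "x \<in> ball 0 R"
    show "x \<in> closure ?A"
    proof (cases "x = 0")
      case False
      then have "x \<in> ?A" using x by (intro inA) auto
      then show ?thesis using closure_subset[of ?A] by (rule subsetD[rotated])
    next
      case True
      show ?thesis unfolding True closure_approachable
      proof (intro allI impI)
        fix d :: real assume d: "0 < d"
        define z :: "real^3" where "z = (min d R / 2) *\<^sub>R axis 1 1"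
        have z: "norm z = min d R / 2" using d R by (simp add: z_def)
        then have "z \<in> ?A" using d R by (intro inA) (auto simp: z_def axis_eq_0_iff)
        moreover have "dist z 0 < d" using z d R by simp
        ultimately show "\<exists>z\<in>?A. dist z 0 < d" by blast
      qed
    qed
  qed
  then have "cball 0 R \<subseteq> closure ?A" using closure_mono[of "ball (0::real^3) R" "closure ?A"] R by simp
  ultimately show "spatial_support l (f y) = cball 0 R" unfolding spatial_support_def by blast
qed

end

lemma (in reduced) solution:
  obtains y y' R M yinf where "\<forall>T. isol T y" "has_C1_derivative y y'" "y' 0 = 0" "\<And>r. 0 < r \<Longrightarrow> y' r = - rhs y r"
    "0 < R" "\<And>r. 0 \<le> r \<Longrightarrow> r < R \<Longrightarrow> 0 < y r" "y R = 0" "\<And>r. R < r \<Longrightarrow> y r < 0"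
    "\<And>r. R \<le> r \<Longrightarrow> mass l g y r = M" "(y \<longlongrightarrow> yinf) at_top"
    "\<And>z. \<forall>T. isol T z \<Longrightarrow> \<forall>r\<ge>0. z r = y r" "y 0 = y0" "\<And>r. 0 \<le> r \<Longrightarrow> y r \<le> y0"
    "\<And>r. 0 < r \<Longrightarrow> 2 * a * mass l g y r < r"
proof -
  obtain R M y where R: "0 < R" "0 < M" and y: "\<And>T. isol T y" "\<And>T. T < R \<Longrightarrow> sol T y" "y R = 0" "\<And>r. R < r \<Longrightarrow> y r < 0"
    "\<And>r. R \<le> r \<Longrightarrow> mass l g y r = M" "(y \<longlongrightarrow> - W M R) at_top"
    using global_solution by blast
  have B: "y 0 = y0 \<and> (\<forall>r>0. 2 * a * mass l g y r < r) \<and>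
     (\<exists>y'. has_C1_derivative y y' \<and> y' 0 = 0 \<and> (\<forall>r>0. y' r = - rhs y r))"
    using isol_all_iff[of y] y(1) by blast
  then obtain y' where y': "has_C1_derivative y y'" "y' 0 = 0" "\<forall>r>0. y' r = - rhs y r" by blast
  show ?thesis
  proof (rule that[of y y' R M "- W M R"])
    show "0 < y r" if "0 \<le> r" "r < R" for r using y(2)[OF that(2)] that by (simp add: sol_def)
    show "\<forall>r\<ge>0. z r = y r" if "\<forall>T. isol T z" for z
      using global_unique[OF y(1,2) R(1) y(3)] that by blast
    show "y r \<le> y0" if "0 \<le> r" for r using isol_le[OF y(1)[of r], of r] that by simp
  qed (use R y y' B in auto)
qed

section \<open>From the reduced equation to the field equations\<close>

lemma grad_radial:
  assumes y: "has_C1_derivative y y'" and y'0: "y' 0 = 0"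
  shows "grad (\<lambda>x. C - y (norm x)) x = - (y' (norm x) *\<^sub>R sgn x)"
proof (rule grad_eq)
  have "((\<lambda>r. C - y r) has_real_derivative - y' (norm x)) (at (norm x) within {0..})"
    using y DERIV_diff[OF DERIV_const, of y "y' (norm x)"] by (simp add: has_C1_derivative_def)
  then have "((\<lambda>x. C - y (norm x)) has_derivative (\<lambda>h. - y' (norm x) * (sgn x \<bullet> h))) (at x)"
    by (rule radial_has_derivative) (use y'0 in auto)
  then show "((\<lambda>x. C - y (norm x)) has_derivative (\<lambda>h. - (y' (norm x) *\<^sub>R sgn x) \<bullet> h)) (at x)" by simp
qed

lemma continuous_on_atLeast:
  fixes F :: "real \<Rightarrow> 'b::topological_space"
  assumes "\<And>T. continuous_on {0..T} F"
  shows "continuous_on {0..} F"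
  unfolding continuous_on_eq_continuous_within
proof
  fix x :: real assume x: "x \<in> {0..}"
  have "continuous (at x within {0..x+1}) F"
    using assms[of "x+1"] x unfolding continuous_on_eq_continuous_within by auto
  moreover have "at x within {0..x+1} = at x within {0..}" by (intro at_within_nhd[of _ "{..<x+1}"]) auto
  ultimately show "continuous (at x within {0..}) F" by simp
qed

context radial_weight
begin

lemma mass_derivative_atLeast:
  assumes g: "continuous_on UNIV g" "continuous_on {0..} y" and r: "0 \<le> r"
  shows "(mass l g y has_real_derivative 4*pi*(r powr (2*l+2) * g (y r))) (at r within {0..})"
proof -
  have "(mass l g y has_real_derivative 4*pi*(r powr (2*l+2) * g (y r))) (at r within {0..r+1})"
    by (rule mass_derivative[OF g(1) continuous_on_subset[OF g(2)]]) (use r in auto)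
  moreover have "at r within {0..r+1} = at r within {0..}" by (intro at_within_nhd[of _ "{..<r+1}"]) auto
  ultimately show ?thesis by simp
qed

text \<open>\<open>m / r ^ 3\<close> is the coefficient of \<open>x\<close> in the gradient of the
  potential, so its limit decides the regularity of the field at the centre. It is found by
  comparison with the mass of the constant \<open>g (y 0)\<close>.\<close>

lemma mean_density_tendsto:
  assumes g: "continuous_on UNIV g" "continuous_on {0..} y" and l0: "0 \<le> l"
  shows "((\<lambda>r. mass l g y r / r ^ 3) \<longlongrightarrow> 4 * pi / 3 * (rad l 0 * g (y 0))) (at 0 within {0..})"
proof -
  have wr: "w r / r ^ 3 = 4 * pi / (2*l+3) * rad l r" if "0 < r" for r
  proof -
    have "r powr (2*l+3) = r powr (2*l) * r ^ 3" using that by (simp add: powr_add powr_numeral)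
    then show ?thesis using that by (simp add: w_def rad_def)
  qed
  have rc: "continuous_on {0..} (rad l)" by (rule rad_continuous) (use l0 in auto)
  then have "(rad l \<longlongrightarrow> rad l 0) (at 0 within {0..})" by (simp add: continuous_on)
  then have "((\<lambda>r. 4 * pi / (2*l+3) * rad l r * g (y 0)) \<longlongrightarrow> 4 * pi / (2*l+3) * rad l 0 * g (y 0)) (at 0 within {0..})"
    by (intro tendsto_intros)
  \<comment> \<open>For \<open>l = 0\<close> the denominators agree; for \<open>l > 0\<close> both
    sides are \<open>0\<close>, since \<open>rad l 0 = 0\<close>.\<close>
  moreover have "4 * pi / (2*l+3) * rad l 0 * g (y 0) = 4 * pi / 3 * (rad l 0 * g (y 0))" by (simp add: rad_def)
  ultimately have T2: "((\<lambda>r. 4 * pi / (2*l+3) * rad l r * g (y 0)) \<longlongrightarrow> 4 * pi / 3 * (rad l 0 * g (y 0))) (at 0 within {0..})" by (simp only:)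
  have gy: "((\<lambda>s. g (y s)) \<longlongrightarrow> g (y 0)) (at 0 within {0..})"
    using continuous_on_compose2[OF g] by (simp add: continuous_on)
  have T1: "((\<lambda>r. mass l g y r / r ^ 3 - 4 * pi / (2*l+3) * rad l r * g (y 0)) \<longlongrightarrow> 0) (at 0 within {0..})"
    unfolding tendsto_iff
  proof (intro allI impI)
    fix e :: real assume e: "0 < e"
    define e1 where "e1 = e / (8 * pi)"
    have e1: "0 < e1" using e by (simp add: e1_def)
    obtain d where d: "0 < d" "\<And>s. s \<in> {0..} \<Longrightarrow> s \<noteq> 0 \<Longrightarrow> dist s 0 < d \<Longrightarrow> dist (g (y s)) (g (y 0)) < e1"
      using gy e1 unfolding tendsto_iff eventually_at by metis
    have "dist (mass l g y r / r ^ 3 - 4 * pi / (2*l+3) * rad l r * g (y 0)) 0 < e" if r: "0 < r" "r < min 1 d" for r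
    proof -
      have c: "continuous_on {0..r} y" using g(2) by (rule continuous_on_subset) auto
      have m: "mass l (\<lambda>_. g (y 0)) y r = w r * g (y 0)"
      proof -
        have "integral {0..r} (\<lambda>s. s powr (2*l+2) * g (y 0)) = r powr (2*l+3) / (2*l+3) * g (y 0)"
          using has_integral_powr[of r] r by (intro integral_unique has_integral_mult_left) auto
        then show ?thesis by (simp add: mass_eq_integral[OF continuous_on_const c] w_def)
      qed
      have "\<bar>mass l g y r - w r * g (y 0)\<bar> \<le> w r * e1"
        unfolding m[symmetric]
      proof (rule mass_diff[OF g(1) c continuous_on_const c])
        fix s assume "s \<in> {0..r}"
        then show "\<bar>g (y s) - g (y 0)\<bar> \<le> e1" using d(2)[of s] r e1 by (cases "s = 0") (auto simp: dist_real_def)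
      qed (use r in auto)
      then have "\<bar>mass l g y r - w r * g (y 0)\<bar> / r ^ 3 \<le> w r * e1 / r ^ 3"
        using r by (intro divide_right_mono) auto
      also have "w r * e1 / r ^ 3 = 4 * pi / (2*l+3) * rad l r * e1"
        by (subst times_divide_eq_left[symmetric]) (simp add: wr[OF r(1)])
      also have "\<dots> \<le> 4 * pi * 1 * e1"
      proof (intro mult_mono)
        show "4 * pi / (2*l+3) \<le> 4 * pi" using l0 by (simp add: field_simps)
        show "rad l r \<le> 1" using r l0 powr_mono2[of "2*l" r 1] by (simp add: rad_def)
      qed (use e1 in \<open>auto simp: rad_def\<close>)
      also have "\<dots> < e" using e by (simp add: e1_def)
      finally have "\<bar>mass l g y r - w r * g (y 0)\<bar> / r ^ 3 < e" .
      moreover have "mass l g y r / r ^ 3 - 4 * pi / (2*l+3) * rad l r * g (y 0) = (mass l g y r - w r * g (y 0)) / r ^ 3"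
        unfolding wr[OF r(1), symmetric] by (simp add: diff_divide_distrib)
      ultimately show ?thesis using r by (simp add: dist_real_def abs_div)
    qed
    then show "\<forall>\<^sub>F r in at 0 within {0..}. dist (mass l g y r / r ^ 3 - 4 * pi / (2*l+3) * rad l r * g (y 0)) 0 < e"
      unfolding eventually_at using d(1) by (intro exI[of _ "min 1 d"]) (auto simp: dist_real_def)
  qed
  from tendsto_add[OF T1 T2] show ?thesis by simp
qed

text \<open>The gradient is the central field with \<open>w = m / r ^ 3\<close>. Since
  \<open>r * w' = 4 * pi * \<rho> - 3 * w\<close>, the Laplacian \<open>3 * w + r * w'\<close> is
  \<open>4 * pi * \<rho>\<close>. For \<open>l \<ge> 0\<close> the centre is included by giving
  \<open>w\<close> its limit \<open>w0\<close> there.\<close>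

lemma solves_Poisson_radial:
  assumes g: "continuous_on UNIV g" and y: "has_C1_derivative y y'" "y' 0 = 0" "\<And>r. 0 < r \<Longrightarrow> y' r = - mass l g y r / r\<^sup>2"
    and yinf: "(y \<longlongrightarrow> yinf) at_top" and \<rho>: "\<And>x. \<rho> x = rad l (norm x) * g (y (norm x))"
  shows "solves_Poisson l \<rho> (\<lambda>x. yinf - y (norm x))"
proof -
  let ?U = "\<lambda>x::real^3. yinf - y (norm x)"
  let ?P = "position_domain l"
  have yd: "(y has_real_derivative y' r) (at r within {0..})" if "0 \<le> r" for r
    using y that by (simp add: has_C1_derivative_def)
  have yc: "continuous_on {0..} y" using DERIV_continuous[OF yd] by (simp add: continuous_on_eq_continuous_within)
  have y'c: "continuous_on {0..} y'" using y by (simp add: has_C1_derivative_def)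
  have Ud: "((\<lambda>r. yinf - y r) has_real_derivative - y' r) (at r within {0..})" if "0 \<le> r" for r
    using DERIV_diff[OF DERIV_const yd[OF that]] by simp
  define w0 where "w0 = 4 * pi / 3 * (rad l 0 * g (y 0))"
  define wf where "wf = (\<lambda>r. if r = 0 then w0 else mass l g y r / r ^ 3)"
  define cf where "cf = (\<lambda>r. 4 * pi * (rad l r * g (y r)) - 3 * wf r)"
  have C1: "C1_on UNIV ?U"
    by (rule radial_C1[where \<phi>="\<lambda>r. yinf - y r" and \<phi>'="\<lambda>r. - y' r"])
       (use Ud y in \<open>auto intro!: continuous_on_minus continuous_on_subset[OF y'c]\<close>)
  have G: "grad ?U = (\<lambda>x. wf (norm x) *\<^sub>R x)"
  proof
    fix x :: "real^3"
    have "grad ?U x = (- y' (norm x)) *\<^sub>R sgn x" using grad_radial[OF y(1,2), of yinf x] by simp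
    also have "\<dots> = wf (norm x) *\<^sub>R x"
      using y(3)[of "norm x"] by (cases "x = 0") (auto simp: wf_def sgn_div_norm power3_eq_cube power2_eq_square divide_inverse)
    finally show "grad ?U x = wf (norm x) *\<^sub>R x" .
  qed
  have wd: "(wf has_real_derivative cf r / r) (at r within {0..})" if r: "0 < r" for r
  proof -
    have rp: "r powr (2*l+2) = rad l r * r\<^sup>2" using r by (simp add: rad_def powr_add)
    have "((\<lambda>r. mass l g y r / r ^ 3) has_real_derivative (4*pi*(r powr (2*l+2) * g (y r)) * r ^ 3 - mass l g y r * (3 * r\<^sup>2)) / (r ^ 3 * r ^ 3)) (at r within {0..})"
      by (intro DERIV_divide mass_derivative_atLeast[OF g yc less_imp_le[OF r]]) (use r in \<open>auto intro!: derivative_eq_intros\<close>)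
    moreover have "(4*pi*(r powr (2*l+2) * g (y r)) * r ^ 3 - mass l g y r * (3 * r\<^sup>2)) / (r ^ 3 * r ^ 3) = cf r / r"
      unfolding rp using r by (simp add: cf_def wf_def field_simps power3_eq_cube power2_eq_square)
    ultimately have "((\<lambda>r. mass l g y r / r ^ 3) has_real_derivative cf r / r) (at r within {0..})" by simp
    then show ?thesis
      by (rule has_field_derivative_transform_within[OF _ r]) (use r in \<open>auto simp: wf_def dist_real_def\<close>)
  qed
  have w_0: "continuous (at 0 within {0..}) wf" if "0 \<le> l"
  proof -
    have "(wf \<longlongrightarrow> w0) (at 0 within {0..})"
      by (rule Lim_transform_eventually[OF mean_density_tendsto[OF g yc that, folded w0_def]])
         (auto simp: eventually_at_filter wf_def)
    then show ?thesis by (simp add: continuous_within wf_def)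
  qed
  have c0: "cf 0 = 0" by (simp add: cf_def wf_def w0_def)
  have np: "0 \<le> r \<and> (0 < r \<or> 0 \<le> l)" if "r \<in> norm ` ?P" for r
    using that by (auto simp: position_domain_def)
  have wc: "continuous_on (norm ` ?P) wf"
    unfolding continuous_on_eq_continuous_within
  proof
    fix r assume "r \<in> norm ` ?P"
    from np[OF this] have "continuous (at r within {0..}) wf" using w_0 DERIV_continuous[OF wd] by (cases "r = 0") auto
    then show "continuous (at r within norm ` ?P) wf" by (rule continuous_within_subset) auto
  qed
  have cc: "continuous_on (norm ` ?P) cf"
  proof -
    have "continuous_on (norm ` ?P) (rad l)" by (rule rad_continuous) (rule np)
    moreover have "continuous_on (norm ` ?P) (\<lambda>r. g (y r))"
      by (rule continuous_on_compose2[OF g continuous_on_subset[OF yc]]) auto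
    ultimately show ?thesis unfolding cf_def by (intro continuous_intros wc)
  qed
  have C1g: "C1_on ?P (grad ?U)"
    unfolding G by (rule central_field_C1[OF _ _ _ wc cc]) (use wd w_0 c0 in \<open>auto simp: position_domain_def\<close>)
  have "laplacian ?U x = 4 * pi * \<rho> x" if x: "x \<in> ?P" for x
  proof -
    have "laplacian ?U x = 3 * wf (norm x) + cf (norm x)"
      by (rule laplacian_central[OF G]) (use x wd w_0 c0 in \<open>auto simp: position_domain_def\<close>)
    then show ?thesis by (simp add: cf_def \<rho>)
  qed
  moreover have "(?U \<longlongrightarrow> 0) at_infinity"
  proof -
    have "((\<lambda>x::real^3. y (norm x)) \<longlongrightarrow> yinf) at_infinity"
      by (rule filterlim_compose[OF yinf filterlim_norm_at_top])
    from tendsto_diff[OF tendsto_const[of yinf] this] show ?thesis by simp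
  qed
  ultimately show ?thesis unfolding solves_Poisson_def using C1 C1g by blast
qed

text \<open>With \<open>q = m / r\<close> and \<open>exp (- 2 * lam) = 1 - 2 * q\<close> the first
  field equation says \<open>m' = 4 * pi * r\<^sup>2 * \<rho>\<close>, and the second is the reduced
  equation rearranged with \<open>\<mu>' = - y'\<close>. \<open>lam\<close> is C1 up to the centre
  because \<open>q' = 4 * pi * r powr (2*l+1) * g - m / r\<^sup>2\<close> tends to \<open>0\<close>
  there.\<close>

lemma EV_metric:
  assumes g: "continuous_on UNIV g" and y: "has_C1_derivative y y'"
    "\<And>r. 0 < r \<Longrightarrow> y' r = - (1 / (1 - 2 * mass l g y r / r)) * (mass l g y r / r\<^sup>2 + 4 * pi * r powr (1 + 2*l) * h (y r))"
    and D: "\<And>r. 0 < r \<Longrightarrow> 2 * mass l g y r < r" and M: "\<And>r. R \<le> r \<Longrightarrow> mass l g y r = M"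
  obtains lam lam' where "has_C1_derivative lam lam'" "\<And>r. 0 < r \<Longrightarrow> exp (- 2 * lam r) = 1 - 2 * mass l g y r / r"
    "lam 0 = 0" "(lam \<longlongrightarrow> 0) at_top"
    "\<And>r. 0 < r \<Longrightarrow> exp (- 2 * lam r) * (2 * r * lam' r - 1) + 1 = 8 * pi * r\<^sup>2 * (rad l r * g (y r))"
    "\<And>r. 0 < r \<Longrightarrow> exp (- 2 * lam r) * (2 * r * (- y' r) + 1) - 1 = 8 * pi * r\<^sup>2 * (rad l r * h (y r))"
proof -
  have yd: "(y has_real_derivative y' r) (at r within {0..})" if "0 \<le> r" for r
    using y that by (simp add: has_C1_derivative_def)
  have yc: "continuous_on {0..} y" using DERIV_continuous[OF yd] by (simp add: continuous_on_eq_continuous_within)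
  have ycT: "continuous_on {0..T} y" for T using yc by (rule continuous_on_subset) auto
  define q where "q = (\<lambda>r. mass l g y r / r)"
  define q' where "q' = (\<lambda>r. 4 * pi * (r powr (2*l+1) * g (y r)) - mass l g y r / r\<^sup>2)"
  have m2: "continuous_on {0..} (\<lambda>r. mass l g y r / r\<^sup>2)"
    by (rule continuous_on_atLeast) (rule mass_div_continuous(2)[OF g ycT])
  have q'c: "continuous_on {0..} q'"
    unfolding q'_def
    by (intro continuous_intros m2 continuous_on_powr' continuous_on_compose2[OF g yc]) (use l in auto)
  have qd: "(q has_real_derivative q' r) (at r within {0..})" if r: "0 \<le> r" for r
  proof (cases "r = 0")
    case True
    have "((\<lambda>r. mass l g y r / r\<^sup>2) \<longlongrightarrow> 0) (at 0 within {0..})" using m2 by (force simp: continuous_on)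
    moreover have "\<forall>\<^sub>F r in at 0 within {0..}. mass l g y r / r\<^sup>2 = (q r - q 0) / (r - 0)"
      by (simp add: eventually_at_filter q_def power2_eq_square)
    ultimately have "((\<lambda>r. (q r - q 0) / (r - 0)) \<longlongrightarrow> 0) (at 0 within {0..})" by (rule Lim_transform_eventually)
    then show ?thesis using True by (simp add: has_field_derivative_iff q'_def)
  next
    case False
    then have r: "0 < r" using r by simp
    have rp: "r powr (2*l+2) = r powr (2*l+1) * r" using r powr_add[of r "2*l+1" 1] by (simp add: add.assoc)
    have "(q has_real_derivative (4*pi*(r powr (2*l+2) * g (y r)) * r - mass l g y r * 1) / (r * r)) (at r within {0..})"
      unfolding q_def by (intro DERIV_divide mass_derivative_atLeast[OF g yc less_imp_le[OF r]] DERIV_ident) (use r in auto)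
    moreover have "(4*pi*(r powr (2*l+2) * g (y r)) * r - mass l g y r * 1) / (r * r) = q' r"
      unfolding rp q'_def using r by (simp add: field_simps power2_eq_square)
    ultimately show ?thesis by simp
  qed
  have qc: "continuous_on {0..} q" using DERIV_continuous[OF qd] by (simp add: continuous_on_eq_continuous_within)
  have qp: "0 < 1 - 2 * q r" if "0 \<le> r" for r
  proof (cases "r = 0")
    case False
    then have "2 * mass l g y r / r < 1" using D[of r] that by (simp add: divide_less_eq)
    then show ?thesis by (simp add: q_def)
  qed (simp add: q_def)
  define lam where "lam = (\<lambda>r. - (1/2) * ln (1 - 2 * q r))"
  define lam' where "lam' = (\<lambda>r. q' r / (1 - 2 * q r))"
  have ex: "exp (- 2 * lam r) = 1 - 2 * q r" if "0 \<le> r" for r using qp[OF that] by (simp add: lam_def)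
  have "has_C1_derivative lam lam'"
    unfolding has_C1_derivative_def
  proof (intro conjI allI impI)
    show "continuous_on {0..} lam'"
      unfolding lam'_def by (intro continuous_intros q'c qc) (use qp in force)
    fix r :: real assume r: "0 \<le> r"
    have "((\<lambda>r. 1 - 2 * q r) has_real_derivative - (2 * q' r)) (at r within {0..})"
      using DERIV_diff[OF DERIV_const DERIV_cmult[OF qd[OF r]]] by simp
    from DERIV_cmult[OF DERIV_chain2[OF DERIV_ln_divide[OF qp[OF r]] this], of "- (1/2)"]
    show "(lam has_real_derivative lam' r) (at r within {0..})" by (simp add: lam_def lam'_def)
  qed
  moreover have "lam 0 = 0" by (simp add: lam_def q_def)
  moreover have "(lam \<longlongrightarrow> 0) at_top"
  proof -
    have "((\<lambda>r. M / r) \<longlongrightarrow> 0) at_top"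
      by (rule tendsto_divide_0[OF tendsto_const]) (simp add: filterlim_at_top_imp_at_infinity filterlim_ident)
    then have "(q \<longlongrightarrow> 0) at_top"
      by (rule Lim_transform_eventually)
         (use eventually_ge_at_top[of R] in \<open>eventually_elim, simp add: q_def M\<close>)
    then have "(lam \<longlongrightarrow> - (1/2) * ln (1 - 2 * 0)) at_top" unfolding lam_def by (intro tendsto_intros) auto
    then show ?thesis by simp
  qed
  moreover have "exp (- 2 * lam r) * (2 * r * lam' r - 1) + 1 = 8 * pi * r\<^sup>2 * (rad l r * g (y r))"
    "exp (- 2 * lam r) * (2 * r * (- y' r) + 1) - 1 = 8 * pi * r\<^sup>2 * (rad l r * h (y r))" if r: "0 < r" for r
  proof -
    define d where "d = 1 - 2 * q r"
    have d: "0 < d" using qp[of r] r by (simp add: d_def)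
    have rp: "r powr (2*l+1) * r = r\<^sup>2 * rad l r"
      using r by (simp add: rad_def powr_add power2_eq_square)
    have m: "mass l g y r / r\<^sup>2 * r = q r" using r by (simp add: q_def power2_eq_square)
    have "d * (2 * r * lam' r - 1) + 1 = 2 * r * q' r - d + 1"
    proof -
      have "lam' r = q' r / d" by (simp add: lam'_def d_def)
      then show ?thesis using d by (simp add: field_simps)
    qed
    also have "\<dots> = 8 * pi * (r powr (2*l+1) * r) * g (y r) - 2 * (mass l g y r / r\<^sup>2 * r) - d + 1"
      by (simp add: q'_def algebra_simps)
    also have "\<dots> = 8 * pi * r\<^sup>2 * (rad l r * g (y r))" unfolding rp m by (simp add: d_def mult_ac)
    finally show "exp (- 2 * lam r) * (2 * r * lam' r - 1) + 1 = 8 * pi * r\<^sup>2 * (rad l r * g (y r))"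
      using ex[of r] r by (simp add: d_def)
    have "- y' r = (mass l g y r / r\<^sup>2 + 4 * pi * r powr (2*l+1) * h (y r)) / d"
      using y(2)[OF r] by (simp add: d_def q_def add.commute)
    then have dy: "d * - y' r = mass l g y r / r\<^sup>2 + 4 * pi * r powr (2*l+1) * h (y r)" using d by simp
    have "d * (2 * r * (- y' r) + 1) - 1 = 2 * r * (d * - y' r) + d - 1" by (simp add: algebra_simps)
    also have "\<dots> = 2 * (mass l g y r / r\<^sup>2 * r) + 8 * pi * (r powr (2*l+1) * r) * h (y r) + d - 1"
      unfolding dy by (simp add: algebra_simps)
    also have "\<dots> = 8 * pi * r\<^sup>2 * (rad l r * h (y r))" unfolding rp m by (simp add: d_def mult_ac)
    finally show "exp (- 2 * lam r) * (2 * r * (- y' r) + 1) - 1 = 8 * pi * r\<^sup>2 * (rad l r * h (y r))"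
      using ex[of r] r by (simp add: d_def)
  qed
  ultimately show ?thesis using that[of lam lam'] ex by (simp add: q_def)
qed

end

text \<open>The conclusion common to both Poisson models, the particle velocity being
  \<open>b v *\<^sub>R v\<close>. With \<open>b = 1\<close> and
  \<open>b v = inverse (sqrt (1 + (norm v)\<^sup>2))\<close> it unfolds to the two corresponding
  parts of the theorem.\<close>

definition newton_state ::
    "real \<Rightarrow> (real \<Rightarrow> real) \<Rightarrow> ((real \<Rightarrow> real) \<Rightarrow> real^3 \<Rightarrow> real^3 \<Rightarrow> real) \<Rightarrow> (real^3 \<Rightarrow> real) \<Rightarrow>
     ((real^3 \<Rightarrow> real^3 \<Rightarrow> real) \<Rightarrow> real^3 \<Rightarrow> real^3 \<Rightarrow> real) \<Rightarrow> real \<Rightarrow> bool" where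
  "newton_state l g F b P y0 \<longleftrightarrow> (\<exists>y R yinf.
       solves_reduced_newton l g y0 y \<and>
       (\<forall>z. solves_reduced_newton l g y0 z \<longrightarrow> (\<forall>r\<ge>0. z r = y r)) \<and>
       0 < R \<and> (\<forall>r\<ge>0. y r = 0 \<longleftrightarrow> r = R) \<and>
       (y \<longlongrightarrow> yinf) at_top \<and>
       (let f = F y; U = (\<lambda>r. yinf - y r);
            \<rho> = moment density_integrand f; p = moment P f
        in ((\<forall>(x, v) \<in> phase_domain l. 0 \<le> f x v) \<and>
            constant_along_characteristics (phase_domain l) (\<lambda>x v. b v *\<^sub>R v) (\<lambda>x v. - grad (\<lambda>x. U (norm x)) x) f \<and>
            moment_exists l density_integrand f \<and> solves_Poisson l \<rho> (\<lambda>x. U (norm x))) \<and> spherically_symmetric l f \<and>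
           compact (support_in_phase_space l f) \<and> spatial_support l f = cball 0 R \<and>
           y0 = U R - U 0 \<and>
           moment_exists l P f \<and>
           continuous_on (position_domain l) \<rho> \<and> C1_on (ball 0 R \<inter> C1_domain l) \<rho> \<and>
           continuous_on (position_domain l) p \<and> C1_on (ball 0 R \<inter> C1_domain l) p))"

definition EV_state ::
    "real \<Rightarrow> (real \<Rightarrow> real) \<Rightarrow> (real \<Rightarrow> real) \<Rightarrow> ((real \<Rightarrow> real) \<Rightarrow> real^3 \<Rightarrow> real^3 \<Rightarrow> real) \<Rightarrow> real \<Rightarrow> bool" where
  "EV_state l g h F y0 \<longleftrightarrow> (\<exists>y R yinf.
       solves_reduced_EV l g h y0 y \<and>
       (\<forall>z. solves_reduced_EV l g h y0 z \<longrightarrow> (\<forall>r\<ge>0. z r = y r)) \<and>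
       0 < R \<and> (\<forall>r\<ge>0. y r = 0 \<longleftrightarrow> r = R) \<and>
       (y \<longlongrightarrow> yinf) at_top \<and>
       (let f = F y; \<mu> = (\<lambda>r. yinf - y r);
            \<rho> = moment energy_density_integrand f; p = moment rel_pressure_integrand f
        in (\<exists>lam. (\<forall>r>0. exp (- 2 * lam r) = 1 - 2 * mass l g y r / r) \<and>
                static_solution_EV l f \<mu> lam) \<and>
           spherically_symmetric l f \<and>
           compact (support_in_phase_space l f) \<and> spatial_support l f = cball 0 R \<and>
           y0 = \<mu> R - \<mu> 0 \<and>
           continuous_on (position_domain l) \<rho> \<and> C1_on (ball 0 R \<inter> C1_domain l) \<rho> \<and>
           continuous_on (position_domain l) p \<and> C1_on (ball 0 R \<inter> C1_domain l) p))"

context energy_profile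
begin

lemma e_axis: "e (norm v *\<^sub>R axis 1 1) = e v"
  by (rule e_eq) (simp_all add: e_nonneg s_e)

text \<open>The density induced by \<open>f\<close> is \<open>rad l r\<close> times the same
  convolution with \<open>\<kappa>1\<close> that drives the reduced equation, which makes the
  solution self-consistent. The pressure has its own kernel \<open>\<kappa>2\<close>, with one more
  power of \<open>s\<close>.\<close>

lemma newton_solution:
  fixes b1 :: "real^3 \<Rightarrow> real"
  assumes K1: "kernel \<kappa>1 \<kappa>1'" and low: "0 < c2" "\<And>t. 0 < t \<Longrightarrow> c2 * t powr (l + 1/2) \<le> \<kappa>1 t"
    and \<kappa>1: "\<And>t. 0 < t \<Longrightarrow> \<kappa>1 t = 1 * (pi * Beta (l + 1) (real 0 + 1/2) * s t powr (l + real 0 + 1/2) * s' t)"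
    and K2: "kernel \<kappa>2 \<kappa>2'" and \<omega>: "\<omega> \<in> borel_measurable borel" "\<And>t. 0 \<le> t \<Longrightarrow> 0 \<le> \<omega> t"
    and \<kappa>2: "\<And>t. 0 < t \<Longrightarrow> \<kappa>2 t = \<omega> t * (pi * Beta (l + 1) (real 1 + 1/2) * s t powr (l + real 1 + 1/2) * s' t)"
    and p: "\<And>f x v. p f x v = (radial_direction x \<bullet> v) ^ (2 * 1) * \<omega> (e v) * f x v"
    and e: "\<And>v. (e has_derivative (\<lambda>h. b1 v * (v \<bullet> h))) (at v)"
    and y0: "0 < y0"
  shows "newton_state l (conv \<Psi> \<kappa>1) f b1 p y0"
proof -
  interpret reduced l 0 "k + l + 3/2" y0 "conv \<Psi> \<kappa>1" "conv \<Psi> \<kappa>1'" "\<lambda>_. 0"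
    by (rule reduced_model[OF K1 low]) (use y0 in auto)
  interpret C1: convolution \<Psi> \<kappa>1 \<kappa>1' by (intro convolution.intro K1 profile_axioms)
  interpret C2: convolution \<Psi> \<kappa>2 \<kappa>2' by (intro convolution.intro K2 profile_axioms)
  let ?g = "conv \<Psi> \<kappa>1"
  have iff: "(\<forall>T. isol T y) \<longleftrightarrow> solves_reduced_newton l ?g y0 y" for y
    unfolding isol_all_iff solves_reduced_newton_def by (auto simp: rhs_def D_def)
  obtain y y' R M yinf where y: "\<forall>T. isol T y" and y': "has_C1_derivative y y'" "y' 0 = 0" "\<And>r. 0 < r \<Longrightarrow> y' r = - rhs y r"
    and R: "0 < R" and pos: "\<And>r. 0 \<le> r \<Longrightarrow> r < R \<Longrightarrow> 0 < y r" and yR: "y R = 0" and out: "\<And>r. R < r \<Longrightarrow> y r < 0"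
    and M: "\<And>r. R \<le> r \<Longrightarrow> mass l ?g y r = M"
    and yinf: "(y \<longlongrightarrow> yinf) at_top" and uniq: "\<And>z. \<forall>T. isol T z \<Longrightarrow> \<forall>r\<ge>0. z r = y r"
    and init: "y 0 = y0" and le: "\<And>r. 0 \<le> r \<Longrightarrow> y r \<le> y0" and Dm: "\<And>r. 0 < r \<Longrightarrow> 2 * 0 * mass l ?g y r < r"
    by (rule solution) (rule that)
  have y'm: "y' r = - mass l ?g y r / r\<^sup>2" if "0 < r" for r using y'(3)[OF that] by (simp add: rhs_def D_def)
  have yd: "(y has_real_derivative y' r) (at r within {0..})" if "0 \<le> r" for r
    using y' that by (simp add: has_C1_derivative_def)
  have yc: "continuous_on {0..} y" using DERIV_continuous[OF yd] by (simp add: continuous_on_eq_continuous_within)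
  have zero: "y r = 0 \<longleftrightarrow> r = R" if "0 \<le> r" for r
    using pos[of r] out[of r] yR that by (cases r R rule: linorder_cases) auto
  note m1 = velocity_moment[OF K1 _ _ \<kappa>1, where y=y, simplified] and m2 = velocity_moment[OF K2 \<omega> \<kappa>2, where y=y]
  have me1: "moment_exists l density_integrand (f y)" and \<rho>: "moment density_integrand (f y) = (\<lambda>x. rad l (norm x) * ?g (y (norm x)))"
    using m1 by (auto simp: moment_exists_def moment_def density_integrand_def[abs_def])
  have me2: "moment_exists l p (f y)" and pr: "moment p (f y) = (\<lambda>x. rad l (norm x) * conv \<Psi> \<kappa>2 (y (norm x)))"
    using m2 by (simp_all add: moment_exists_def moment_def p[abs_def] fun_eq_iff)
  have ch: "constant_along_characteristics (phase_domain l) (\<lambda>x v. b1 v *\<^sub>R v) (\<lambda>x v. - grad (\<lambda>x. yinf - y (norm x)) x) (f y)"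
  proof (rule constant_along_characteristics_energy[where y=y and y'=y' and e=e and ?b1.0=b1 and ?b3.0="\<lambda>_. 1" and H=\<Psi> and l=l])
    show "- grad (\<lambda>x. yinf - y (norm x)) x = (1 * y' (norm x)) *\<^sub>R sgn x" for x
      by (simp add: grad_radial[OF y'(1,2)])
  qed (use yd y' e in \<open>auto simp: f_def\<close>)
  have poi: "solves_Poisson l (moment density_integrand (f y)) (\<lambda>x. yinf - y (norm x))"
    by (rule solves_Poisson_radial[OF g_cont y'(1,2) y'm yinf]) (simp_all add: \<rho>)
  have sph: "spherically_symmetric l (f y)"
    by (rule spherically_symmetric_energy[where h="\<lambda>r t. \<Psi> (y r - e (t *\<^sub>R axis 1 1))"])
       (simp add: f_def e_axis)
  have cn: "continuous_on (position_domain l) (moment density_integrand (f y))" "continuous_on (position_domain l) (moment p (f y))"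
    unfolding \<rho> pr by (rule radial_product_continuous[OF yc C1.conv_continuous], rule radial_product_continuous[OF yc C2.conv_continuous])
  have c1: "C1_on (ball 0 R \<inter> C1_domain l) (moment density_integrand (f y))"
    unfolding \<rho> by (rule radial_product_C1[OF y'(1,2) pos C1.conv_deriv C1.conv_k'_continuous])
  have c2: "C1_on (ball 0 R \<inter> C1_domain l) (moment p (f y))"
    unfolding pr by (rule radial_product_C1[OF y'(1,2) pos C2.conv_deriv C2.conv_k'_continuous])
  have sup1: "compact (support_in_phase_space l (f y))" by (rule support(1)[OF R pos out le])
  have sup2: "spatial_support l (f y) = cball 0 R" by (rule support(2)[OF R pos out le])
  have sol: "solves_reduced_newton l ?g y0 y" "\<forall>z. solves_reduced_newton l ?g y0 z \<longrightarrow> (\<forall>r\<ge>0. z r = y r)"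
    using iff y uniq by blast+
  show ?thesis unfolding newton_state_def Let_def
    by (intro exI[of _ y] exI[of _ R] exI[of _ yinf] conjI allI impI sol(1) sol(2)[rule_format] R zero yinf ch me1 me2 poi sph sup1 sup2 cn c1 c2)
       (use f_nonneg init yR in auto)
qed

text \<open>The derivative of \<open>\<kappa>2\<close> is prescribed as
  \<open>\<kappa>1 + \<kappa>2\<close>, whence \<open>h' = g + h\<close> for the convolutions. The
  hypothesis on \<open>b\<close> is the relation \<open>b2 = b1 * b3\<close> for a force
  proportional to \<open>sqrt (1 + (norm v)\<^sup>2)\<close>.\<close>

lemma EV_solution:
  fixes b :: "real^3 \<Rightarrow> real"
  assumes K1: "kernel \<kappa>1 \<kappa>1'" and low: "0 < c2" "\<And>t. 0 < t \<Longrightarrow> c2 * t powr (l + 1/2) \<le> \<kappa>1 t"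
    and \<omega>1: "\<omega>1 \<in> borel_measurable borel" "\<And>t. 0 \<le> t \<Longrightarrow> 0 \<le> \<omega>1 t"
    and \<kappa>1: "\<And>t. 0 < t \<Longrightarrow> \<kappa>1 t = \<omega>1 t * (pi * Beta (l + 1) (real 0 + 1/2) * s t powr (l + real 0 + 1/2) * s' t)"
    and K2: "kernel \<kappa>2 (\<lambda>t. \<kappa>1 t + \<kappa>2 t)"
    and \<omega>2: "\<omega>2 \<in> borel_measurable borel" "\<And>t. 0 \<le> t \<Longrightarrow> 0 \<le> \<omega>2 t"
    and \<kappa>2: "\<And>t. 0 < t \<Longrightarrow> \<kappa>2 t = \<omega>2 t * (pi * Beta (l + 1) (real 1 + 1/2) * s t powr (l + real 1 + 1/2) * s' t)"
    and d: "\<And>f x v. energy_density_integrand f x v = (radial_direction x \<bullet> v) ^ (2 * 0) * \<omega>1 (e v) * f x v"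
    and p: "\<And>f x v. rel_pressure_integrand f x v = (radial_direction x \<bullet> v) ^ (2 * 1) * \<omega>2 (e v) * f x v"
    and e: "\<And>v. (e has_derivative (\<lambda>h. b v * (v \<bullet> h))) (at v)"
    and b: "\<And>v. inverse (sqrt (1 + (norm v)\<^sup>2)) = b v * sqrt (1 + (norm v)\<^sup>2)"
    and y0: "0 < y0"
  shows "EV_state l (conv \<Psi> \<kappa>1) (conv \<Psi> \<kappa>2) f y0"
proof -
  interpret C1: convolution \<Psi> \<kappa>1 \<kappa>1' by (intro convolution.intro K1 profile_axioms)
  interpret C2: convolution \<Psi> \<kappa>2 "\<lambda>t. \<kappa>1 t + \<kappa>2 t" by (intro convolution.intro K2 profile_axioms)
  let ?g = "conv \<Psi> \<kappa>1" and ?h = "conv \<Psi> \<kappa>2"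
  have add: "conv \<Psi> (\<lambda>t. \<kappa>1 t + \<kappa>2 t) y = ?g y + ?h y" for y
    unfolding C1.conv_k0 C2.conv_k0 Bochner_Integration.integral_add[OF C1.integrable_k0 C2.integrable_k0, symmetric]
    unfolding conv_def by (intro Bochner_Integration.integral_cong) (auto simp: C1.k0_def C2.k0_def algebra_simps)
  interpret reduced l 1 "k + l + 3/2" y0 ?g "conv \<Psi> \<kappa>1'" ?h
    by (rule reduced_model[OF K1 low])
       (use y0 C2.conv_continuous C2.conv_nonneg C2.conv_nonpos C2.conv_deriv add in auto)
  have iff: "(\<forall>T. isol T y) \<longleftrightarrow> solves_reduced_EV l ?g ?h y0 y" for y
    unfolding isol_all_iff solves_reduced_EV_def by (auto simp: rhs_def D_def)
  obtain y y' R M yinf where y: "\<forall>T. isol T y" and y': "has_C1_derivative y y'" "y' 0 = 0" "\<And>r. 0 < r \<Longrightarrow> y' r = - rhs y r"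
    and R: "0 < R" and pos: "\<And>r. 0 \<le> r \<Longrightarrow> r < R \<Longrightarrow> 0 < y r" and yR: "y R = 0" and out: "\<And>r. R < r \<Longrightarrow> y r < 0"
    and M: "\<And>r. R \<le> r \<Longrightarrow> mass l ?g y r = M"
    and yinf: "(y \<longlongrightarrow> yinf) at_top" and uniq: "\<And>z. \<forall>T. isol T z \<Longrightarrow> \<forall>r\<ge>0. z r = y r"
    and init: "y 0 = y0" and le: "\<And>r. 0 \<le> r \<Longrightarrow> y r \<le> y0" and Dm: "\<And>r. 0 < r \<Longrightarrow> 2 * 1 * mass l ?g y r < r"
    by (rule solution) (rule that)
  have y'm: "y' r = - (1 / (1 - 2 * mass l ?g y r / r)) * (mass l ?g y r / r\<^sup>2 + 4 * pi * r powr (1 + 2*l) * ?h (y r))" if "0 < r" for r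
    using y'(3)[OF that] by (simp add: rhs_def D_def)
  have yd: "(y has_real_derivative y' r) (at r within {0..})" if "0 \<le> r" for r
    using y' that by (simp add: has_C1_derivative_def)
  have yc: "continuous_on {0..} y" using DERIV_continuous[OF yd] by (simp add: continuous_on_eq_continuous_within)
  have zero: "y r = 0 \<longleftrightarrow> r = R" if "0 \<le> r" for r
    using pos[of r] out[of r] yR that by (cases r R rule: linorder_cases) auto
  note m1 = velocity_moment[OF K1 \<omega>1 \<kappa>1, where y=y] and m2 = velocity_moment[OF K2 \<omega>2 \<kappa>2, where y=y]
  have me1: "moment_exists l energy_density_integrand (f y)" and \<rho>: "moment energy_density_integrand (f y) = (\<lambda>x. rad l (norm x) * ?g (y (norm x)))"
    using m1 by (simp_all add: moment_exists_def moment_def d[abs_def] fun_eq_iff)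
  have me2: "moment_exists l rel_pressure_integrand (f y)" and pr: "moment rel_pressure_integrand (f y) = (\<lambda>x. rad l (norm x) * ?h (y (norm x)))"
    using m2 by (simp_all add: moment_exists_def moment_def p[abs_def] fun_eq_iff)
  have ch: "constant_along_characteristics (phase_domain l) (\<lambda>x v. inverse (sqrt (1 + (norm v)\<^sup>2)) *\<^sub>R v) (\<lambda>x v. - (sqrt (1 + (norm v)\<^sup>2) * - y' (norm x)) *\<^sub>R (x /\<^sub>R norm x)) (f y)"
    by (rule constant_along_characteristics_energy[where y=y and y'=y' and e=e and ?b1.0=b and ?b3.0="\<lambda>v. sqrt (1 + (norm v)\<^sup>2)" and H=\<Psi> and l=l])
       (use yd y' e b in \<open>auto simp: f_def sgn_div_norm\<close>)
  have Dm': "2 * mass l ?g y r < r" if "0 < r" for r using Dm[OF that] by simp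
  obtain lam lam' where lam: "has_C1_derivative lam lam'" "\<And>r. 0 < r \<Longrightarrow> exp (- 2 * lam r) = 1 - 2 * mass l ?g y r / r"
    "lam 0 = 0" "(lam \<longlongrightarrow> 0) at_top"
    "\<And>r. 0 < r \<Longrightarrow> exp (- 2 * lam r) * (2 * r * lam' r - 1) + 1 = 8 * pi * r\<^sup>2 * (rad l r * ?g (y r))"
    "\<And>r. 0 < r \<Longrightarrow> exp (- 2 * lam r) * (2 * r * (- y' r) + 1) - 1 = 8 * pi * r\<^sup>2 * (rad l r * ?h (y r))"
    by (rule EV_metric[OF g_cont y'(1) y'm Dm' M]) (assumption | rule that)+
  have \<mu>: "has_C1_derivative (\<lambda>r. yinf - y r) (\<lambda>r. - y' r)"
    using y'(1) DERIV_diff[OF DERIV_const, of y] by (auto simp: has_C1_derivative_def intro!: continuous_intros)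
  have \<mu>0: "((\<lambda>r. yinf - y r) \<longlongrightarrow> 0) at_top" using tendsto_diff[OF tendsto_const[of yinf] yinf] by simp
  have sph: "spherically_symmetric l (f y)"
    by (rule spherically_symmetric_energy[where h="\<lambda>r t. \<Psi> (y r - e (t *\<^sub>R axis 1 1))"])
       (simp add: f_def e_axis)
  have cn: "continuous_on (position_domain l) (moment energy_density_integrand (f y))" "continuous_on (position_domain l) (moment rel_pressure_integrand (f y))"
    unfolding \<rho> pr by (rule radial_product_continuous[OF yc C1.conv_continuous], rule radial_product_continuous[OF yc C2.conv_continuous])
  have c1: "C1_on (ball 0 R \<inter> C1_domain l) (moment energy_density_integrand (f y))"
    unfolding \<rho> by (rule radial_product_C1[OF y'(1,2) pos C1.conv_deriv C1.conv_k'_continuous])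
  have c2: "C1_on (ball 0 R \<inter> C1_domain l) (moment rel_pressure_integrand (f y))"
    unfolding pr by (rule radial_product_C1[OF y'(1,2) pos C2.conv_deriv C2.conv_k'_continuous])
  have sup1: "compact (support_in_phase_space l (f y))" by (rule support(1)[OF R pos out le])
  have sup2: "spatial_support l (f y) = cball 0 R" by (rule support(2)[OF R pos out le])
  have sol: "solves_reduced_EV l ?g ?h y0 y" "\<forall>z. solves_reduced_EV l ?g ?h y0 z \<longrightarrow> (\<forall>r\<ge>0. z r = y r)"
    using iff y uniq by blast+
  have static: "static_solution_EV l (f y) (\<lambda>r. yinf - y r) lam"
    unfolding static_solution_EV_def \<rho> pr
    by (intro exI[of _ "\<lambda>r. - y' r"] exI[of _ lam'] conjI allI impI \<mu> lam(1) ch me1 me2 lam(3-6) \<mu>0)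
       (use f_nonneg y'(2) in auto)
  show ?thesis unfolding EV_state_def Let_def
    by (intro exI[of _ y] exI[of _ R] exI[of _ yinf] exI[of _ lam] conjI allI impI sol(1) sol(2)[rule_format] R zero yinf static lam(2) sph sup1 sup2 cn c1 c2)
       (use f_nonneg init yR in auto)
qed

end

section \<open>The three models\<close>

subsection \<open>Kinetic energies and kernels\<close>

lemma has_derivative_norm_square:
  fixes v :: "'a::real_inner"
  assumes "(\<phi> has_real_derivative D) (at ((norm v)\<^sup>2))"
  shows "((\<lambda>v. \<phi> ((norm v)\<^sup>2)) has_derivative (\<lambda>h. (2 * D) * (v \<bullet> h))) (at v)"
proof -
  have "((\<lambda>v. v \<bullet> v) has_derivative (\<lambda>h. 2 * (v \<bullet> h))) (at v)"
    by (auto intro!: derivative_eq_intros simp: inner_commute)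
  then have "((\<lambda>v. (norm v)\<^sup>2) has_derivative (\<lambda>h. 2 * (v \<bullet> h))) (at v)" by (simp add: power2_norm_eq_inner)
  from has_derivative_compose[OF this assms[unfolded has_field_derivative_def]]
  show ?thesis by (simp add: mult_ac)
qed

lemma kernel_mult:
  assumes "kernel k k'" and W: "continuous_on {0..} W" "\<And>t. 0 < t \<Longrightarrow> 0 \<le> W t"
    and W': "\<And>t. 0 < t \<Longrightarrow> (W has_real_derivative W' t) (at t)" "continuous_on {0<..} W'" "\<And>t. 0 < t \<Longrightarrow> 0 \<le> W' t"
    and d: "\<And>t. 0 < t \<Longrightarrow> d t = W' t * k t + W t * k' t"
  shows "kernel (\<lambda>t. W t * k t) d"
proof -
  interpret k: kernel k k' by fact
  have c: "continuous_on {0<..} k" "continuous_on {0<..} W" using k.k_cont W(1) by (auto intro: continuous_on_subset)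
  show ?thesis
  proof
    show "continuous_on {0..} (\<lambda>t. W t * k t)" by (intro continuous_intros W k.k_cont)
    show "((\<lambda>t. W t * k t) has_real_derivative d t) (at t)" if "0 < t" for t
      unfolding d[OF that] using DERIV_mult[OF W'(1)[OF that] k.k_deriv[OF that]] by (simp add: algebra_simps)
    have "continuous_on {0<..} (\<lambda>t. W' t * k t + W t * k' t)" by (intro continuous_intros W' c k.k'_cont)
    then show "continuous_on {0<..} d" by (rule continuous_on_eq) (simp add: d)
    show "0 \<le> d t" if "0 < t" for t
      unfolding d[OF that] using that by (intro add_nonneg_nonneg mult_nonneg_nonneg W W' k.k_nonneg k.k'_nonneg) auto
  qed (simp add: k.k_0)
qed

lemma kinetic_VP: "kinetic (\<lambda>v. (norm v)\<^sup>2 / 2) (\<lambda>t. 2 * t) (\<lambda>_. 2)"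
  by unfold_locales (auto intro!: continuous_intros derivative_eq_intros)

lemma kinetic_RVP: "kinetic (\<lambda>v. sqrt (1 + (norm v)\<^sup>2) - 1) (\<lambda>t. (1 + t)\<^sup>2 - 1) (\<lambda>t. 2 * (1 + t))"
proof
  show "(1 + t)\<^sup>2 - 1 < (1 + u)\<^sup>2 - 1" if "0 \<le> t" "t < u" for t u :: real
    using that power_strict_mono[of "1 + t" "1 + u" 2] by simp
qed (auto intro!: continuous_intros derivative_eq_intros)

lemma kinetic_EV: "kinetic (\<lambda>v. ln (1 + (norm v)\<^sup>2) / 2) (\<lambda>t. exp (2 * t) - 1) (\<lambda>t. 2 * exp (2 * t))"
proof
  show "exp (2 * (ln (1 + (norm v)\<^sup>2) / 2)) - 1 = (norm v)\<^sup>2" for v :: "real^3"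
    by (simp add: add_pos_nonneg)
qed (auto intro!: continuous_intros derivative_eq_intros)

context kinetic
begin

lemma s_pos: "0 < t \<Longrightarrow> 0 < s t"
  using s_mono[of 0 t] s_0 by simp

lemma s_powr_kernel: "0 < p \<Longrightarrow> kernel (\<lambda>t. s t powr p) (\<lambda>t. p * s t powr (p - 1) * s' t)"
  by (rule kernel_powr) (use s_cont s_0 s_pos s_deriv s'_cont s'_nonneg in auto)

end

lemma Beta_half: "- 1/2 < l \<Longrightarrow> 0 < Beta (l + 1) (real j + 1/2)"
  by (simp add: Beta_def Gamma_real_pos)

text \<open>This ratio of \<open>c_rel\<close> and \<open>d_rel\<close> gives the pressure kernel of
  the Einstein-Vlasov system the derivative \<open>\<kappa>1 + \<kappa>2\<close>.\<close>

lemma Beta_recursion: "(2 * l + 3) * Beta (l + 1) (3/2) = Beta (l + 1) (1/2)" for l :: real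
proof -
  have "(1/2 :: real) \<notin> \<int>\<^sub>\<le>\<^sub>0" by (auto dest: nonpos_Ints_nonpos)
  from Beta_plus1_right[OF this, of "l + 1"] show ?thesis by (simp add: field_simps)
qed

lemma set_integral_Beta:
  fixes a b :: real
  assumes "0 < a" "0 < b"
  shows "(LINT s:{0..1}|lebesgue. s powr (a - 1) * (1 - s) powr (b - 1)) = Beta a b"
proof -
  have i: "set_integrable lborel {0..1} (\<lambda>s. s powr (a - 1) * (1 - s) powr (b - 1))"
    by (rule integrable_Beta[OF assms])
  have "(LINT s:{0..1}|lebesgue. s powr (a - 1) * (1 - s) powr (b - 1)) = (LINT s:{0..1}|lborel. s powr (a - 1) * (1 - s) powr (b - 1))"
    unfolding set_lebesgue_integral_def by (rule integral_completion) (use i in \<open>auto simp: set_integrable_def\<close>)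
  also have "\<dots> = integral {0..1} (\<lambda>s. s powr (a - 1) * (1 - s) powr (b - 1))"
    by (rule set_borel_integral_eq_integral(2)[OF i])
  also have "\<dots> = Beta a b" by (rule integral_unique[OF has_integral_Beta_real[OF assms]])
  finally show ?thesis .
qed

lemma c_rel_eq: assumes "- 1/2 < l" shows "c_rel l = 2 * pi * Beta (l + 1) (1/2)"
proof -
  have "(LINT s:{0..1}|lebesgue. s powr l / sqrt (1 - s)) = (LINT s:{0..1}|lebesgue. s powr (l + 1 - 1) * (1 - s) powr (1/2 - 1))"
  proof (rule set_lebesgue_integral_cong, simp, intro allI impI)
    fix s :: real assume "s \<in> {0..1}"
    moreover have "(1 - s) powr (1/2 - 1) = inverse ((1 - s) powr (1/2))" unfolding powr_minus[symmetric] by simp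
    \<comment> \<open>At \<open>s = 1\<close> both sides are \<open>0\<close>: the left one by
      division by \<open>0\<close>, the right one because powers of base \<open>0\<close> are
      \<open>0\<close>.\<close>
    ultimately show "s powr l / sqrt (1 - s) = s powr (l + 1 - 1) * (1 - s) powr (1/2 - 1)"
      by (simp only: powr_half_sqrt divide_inverse) (simp add: powr_half_sqrt)
  qed
  then show ?thesis using assms set_integral_Beta[of "l + 1" "1/2"] by (simp only: c_rel_def)
qed

lemma c_VP_eq: assumes "- 1/2 < l" shows "c_VP l = 2 powr (l + 1/2) * (2 * pi * Beta (l + 1) (1/2))"
proof -
  have "2 powr (l + 3/2) = 2 powr (l + 1/2) * (2::real)" using powr_add[of 2 "l + 1/2" 1] by (simp add: add.assoc)
  then have "c_VP l = 2 powr (l + 1/2) * c_rel l" by (simp add: c_VP_def c_rel_def)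
  then show ?thesis using c_rel_eq[OF assms] by simp
qed

lemma d_rel_eq: assumes "- 1/2 < l" shows "d_rel l = 2 * pi * Beta (l + 1) (3/2)"
proof -
  have "(LINT s:{0..1}|lebesgue. s powr l * sqrt (1 - s)) = (LINT s:{0..1}|lebesgue. s powr (l + 1 - 1) * (1 - s) powr (3/2 - 1))"
    by (rule set_lebesgue_integral_cong) (auto simp: powr_half_sqrt)
  then show ?thesis using assms set_integral_Beta[of "l + 1" "3/2"] by (simp only: d_rel_def)
qed

subsection \<open>The profile\<close>

text \<open>The exponent is nonpositive, so \<open>z powr \<kappa>\<close> is largest at the left
  end of \<open>{e..Y}\<close>; \<open>\<kappa> > - 1\<close> gives integrability. The bound leaves
  the value at \<open>0\<close> open, which concerns only a null set.\<close>

lemma profileI: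
  fixes \<Psi> :: "real \<Rightarrow> real"
  assumes nonneg: "\<And>z. 0 \<le> \<Psi> z" and meas: "\<Psi> \<in> borel_measurable lebesgue" and neg: "\<And>z. z < 0 \<Longrightarrow> \<Psi> z = 0"
    and \<kappa>: "- 1 < \<kappa>" "\<kappa> \<le> 0" and bd: "\<And>Y. \<exists>C. \<forall>z\<in>{0<..Y}. \<Psi> z \<le> C * z powr \<kappa>"
  shows "profile \<Psi>"
proof
  fix Y :: real
  obtain C where C: "\<forall>z\<in>{0<..Y}. \<Psi> z \<le> C * z powr \<kappa>" using bd by blast
  show "set_integrable lebesgue {0..Y} \<Psi>"
  proof (cases "0 \<le> Y")
    case True
    have "(\<lambda>z. z powr \<kappa>) absolutely_integrable_on {0..Y}"
      using has_integral_powr_from_0[OF \<kappa>(1) True] by (intro nonnegative_absolutely_integrable_1) (auto simp: integrable_on_def)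
    then have i: "integrable lebesgue (\<lambda>z. C * (indicator {0..Y} z *\<^sub>R z powr \<kappa>))"
      unfolding set_integrable_def by (rule integrable_mult_right)
    have "AE z in lebesgue. z \<noteq> (0::real)" using AE_completion[OF AE_lborel_singleton[of "0::real"]] .
    then have "AE z in lebesgue. norm (indicator {0..Y} z *\<^sub>R \<Psi> z) \<le> norm (C * (indicator {0..Y} z *\<^sub>R z powr \<kappa>))"
    proof eventually_elim
      case (elim z)
      show ?case
      proof (cases "z \<in> {0..Y}")
        case True
        then have "\<Psi> z \<le> C * z powr \<kappa>" using C elim by auto
        then show ?thesis using True nonneg[of z] by simp
      qed simp
    qed
    moreover have "(\<lambda>z. indicator {0..Y} z *\<^sub>R \<Psi> z) \<in> borel_measurable lebesgue"
      using meas by (intro borel_measurable_scaleR borel_measurable_indicator) auto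
    ultimately show ?thesis unfolding set_integrable_def
      using Bochner_Integration.integrable_bound[OF i] by blast
  qed (simp add: set_integrable_def)
next
  fix e Y :: real assume e: "0 < e"
  obtain C where C: "\<forall>z\<in>{0<..Y}. \<Psi> z \<le> C * z powr \<kappa>" using bd by blast
  have "\<Psi> z \<le> \<bar>C\<bar> * e powr \<kappa>" if "z \<in> {e..Y}" for z
  proof -
    have "\<Psi> z \<le> C * z powr \<kappa>" using C that e by auto
    also have "\<dots> \<le> \<bar>C\<bar> * z powr \<kappa>" by (intro mult_right_mono) auto
    also have "\<dots> \<le> \<bar>C\<bar> * e powr \<kappa>" using that e \<kappa> by (intro mult_left_mono powr_mono2') auto
    finally show ?thesis .
  qed
  then show "\<exists>M. \<forall>z\<in>{e..Y}. \<Psi> z \<le> M" by blast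
qed (use nonneg meas neg in auto)

text \<open>With \<open>e v = ln (1 + (norm v)\<^sup>2) / 2\<close> the product
  \<open>exp (- y) * sqrt (1 + (norm v)\<^sup>2)\<close> is \<open>exp (- (y - e v))\<close>. This
  profile thus writes the Einstein-Vlasov distribution as a function of \<open>y - e v\<close>, as
  in the other two models.\<close>

definition EV_profile :: "(real \<Rightarrow> real) \<Rightarrow> real \<Rightarrow> real" where
  "EV_profile \<Phi> z = \<Phi> (1 - exp (- z))"

text \<open>Preimages of null sets under \<open>1 - exp (- z)\<close> are images under the
  differentiable inverse \<open>- ln (1 - \<eta>)\<close>, hence null; this makes the composition
  Lebesgue measurable.\<close>

lemma EV_profile_measurable:
  assumes "\<Phi> \<in> borel_measurable lebesgue"
  shows "EV_profile \<Phi> \<in> borel_measurable lebesgue"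
proof -
  let ?t = "\<lambda>z::real. 1 - exp (- z)"
  have tb: "?t \<in> lborel \<rightarrow>\<^sub>M lborel" by simp
  have "?t \<in> lebesgue \<rightarrow>\<^sub>M lebesgue"
  proof (rule completion.measurable_completion2)
    show t: "?t \<in> lebesgue \<rightarrow>\<^sub>M lborel" using tb by (rule measurable_completion)
    show "null_sets lborel \<subseteq> null_sets (distr lebesgue lborel ?t)"
    proof
      fix X :: "real set" assume X: "X \<in> null_sets lborel"
      have "?t -` X = (\<lambda>\<eta>. - ln (1 - \<eta>)) ` (X \<inter> {..<1})"
      proof
        show "?t -` X \<subseteq> (\<lambda>\<eta>. - ln (1 - \<eta>)) ` (X \<inter> {..<1})"
          by (auto intro!: image_eqI[where x="1 - exp (- _)"])
      qed auto
      moreover have "negligible ((\<lambda>\<eta>. - ln (1 - \<eta>)) ` (X \<inter> {..<1}))"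
      proof (rule negligible_differentiable_image_negligible)
        have "negligible X" using null_sets_completionI[OF X] by (simp add: negligible_iff_null_sets)
        then show "negligible (X \<inter> {..<1})" by (rule negligible_subset) auto
        show "(\<lambda>\<eta>. - ln (1 - \<eta>)) differentiable_on (X \<inter> {..<1})"
          unfolding differentiable_on_def
        proof
          fix x assume "x \<in> X \<inter> {..<1}"
          then have "((\<lambda>\<eta>. - ln (1 - \<eta>)) has_real_derivative 1 / (1 - x)) (at x)"
            by (auto intro!: derivative_eq_intros)
          then show "(\<lambda>\<eta>. - ln (1 - \<eta>)) differentiable at x within X \<inter> {..<1}"
            using real_differentiable_def differentiable_at_withinI by blast
        qed
      qed simp
      ultimately have "?t -` X \<in> null_sets lebesgue" by (simp add: negligible_iff_null_sets)
      then show "X \<in> null_sets (distr lebesgue lborel ?t)"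
        using X t by (auto simp: null_sets_distr_iff null_sets_def[of lborel])
    qed
  qed
  from measurable_compose[OF this assms] show ?thesis by (simp add: EV_profile_def[abs_def])
qed

lemma one_minus_exp_bounds:
  fixes z :: real assumes "0 \<le> z"
  shows "z * exp (- z) \<le> 1 - exp (- z)" "1 - exp (- z) \<le> z"
proof -
  have "1 + z \<le> exp z" by (rule exp_ge_add_one_self)
  then have "(1 + z) * exp (- z) \<le> exp z * exp (- z)" by (intro mult_right_mono) auto
  then show "z * exp (- z) \<le> 1 - exp (- z)" by (simp add: exp_minus field_simps)
  show "1 - exp (- z) \<le> z" using exp_ge_add_one_self[of "- z"] by linarith
qed

text \<open>Substitution of \<open>\<eta> = 1 - exp (- z)\<close>. Integrability is assumed on the
  side of \<open>z\<close>, where the convolution provides it.\<close>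

lemma set_integral_EV_substitution:
  fixes F :: "real \<Rightarrow> real"
  assumes i: "set_integrable lebesgue {0..y} (\<lambda>z. exp (- z) * F (1 - exp (- z)))"
  shows "(LINT \<eta>:{0..1 - exp (- y)}|lebesgue. F \<eta>) = (LINT z:{0..y}|lebesgue. exp (- z) * F (1 - exp (- z)))"
proof -
  let ?t = "\<lambda>z::real. 1 - exp (- z)"
  have im: "?t ` {0..y} = {0..1 - exp (- y)}"
  proof
    show "{0..1 - exp (- y)} \<subseteq> ?t ` {0..y}"
    proof
      fix \<eta> assume \<eta>: "\<eta> \<in> {0..1 - exp (- y)}"
      then have p: "0 < 1 - \<eta>" using exp_gt_zero[of "- y"] unfolding atLeastAtMost_iff by linarith
      have "ln (1 - \<eta>) \<ge> ln (exp (- y))" using \<eta> p by (subst ln_le_cancel_iff) auto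
      then have "- ln (1 - \<eta>) \<in> {0..y}" using \<eta> p by auto
      moreover have "\<eta> = ?t (- ln (1 - \<eta>))" using p by simp
      ultimately show "\<eta> \<in> ?t ` {0..y}" by blast
    qed
  qed auto
  have "(\<lambda>z. \<bar>exp (- z)\<bar> * F (?t z)) absolutely_integrable_on {0..y} \<and>
      integral {0..y} (\<lambda>z. \<bar>exp (- z)\<bar> * F (?t z)) = integral {0..y} (\<lambda>z. \<bar>exp (- z)\<bar> * F (?t z))
    \<longleftrightarrow> F absolutely_integrable_on ?t ` {0..y} \<and> integral (?t ` {0..y}) F = integral {0..y} (\<lambda>z. \<bar>exp (- z)\<bar> * F (?t z))"
    by (rule has_absolute_integral_change_of_variables_1')
       (auto simp: inj_on_def intro!: derivative_eq_intros)
  then have "F absolutely_integrable_on {0..1 - exp (- y)}" "integral {0..1 - exp (- y)} F = integral {0..y} (\<lambda>z. exp (- z) * F (?t z))"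
    using i unfolding im by auto
  then show ?thesis using i by (simp add: set_lebesgue_integral_eq_integral)
qed

lemma (in convolution) conv_set_integral:
  "conv \<Psi> k y = (LINT z:{0..y}|lebesgue. \<Psi> z * k (y - z))"
  "set_integrable lebesgue {0..y} (\<lambda>z. \<Psi> z * k (y - z))"
proof -
  have e: "\<Psi> z * k0 (y - z) = indicator {0..y} z *\<^sub>R (\<Psi> z * k (y - z))" for z
    using neg[of z] k_0 by (auto simp: k0_def indicator_def)
  show "conv \<Psi> k y = (LINT z:{0..y}|lebesgue. \<Psi> z * k (y - z))"
    unfolding conv_k0 set_lebesgue_integral_def e ..
  show "set_integrable lebesgue {0..y} (\<lambda>z. \<Psi> z * k (y - z))"
    unfolding set_integrable_def e[symmetric] by (rule integrable_k0)
qed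

subsection \<open>The Vlasov-Poisson system\<close>

lemma g_VP_eq_conv:
  assumes l: "- 1/2 < l" and C: "convolution \<Phi> (\<lambda>t. 2 * pi * Beta (l + 1) (1/2) * (2 * t) powr (l + 1/2)) k'"
  shows "g_VP l \<Phi> = conv \<Phi> (\<lambda>t. 2 * pi * Beta (l + 1) (1/2) * (2 * t) powr (l + 1/2))"
proof
  fix y
  interpret C: convolution \<Phi> "\<lambda>t. 2 * pi * Beta (l + 1) (1/2) * (2 * t) powr (l + 1/2)" k' by (rule C)
  show "g_VP l \<Phi> y = conv \<Phi> (\<lambda>t. 2 * pi * Beta (l + 1) (1/2) * (2 * t) powr (l + 1/2)) y"
  proof (cases "y \<le> 0")
    case False
    have "(LINT z:{0..y}|lebesgue. \<Phi> z * (2 * pi * Beta (l + 1) (1/2) * (2 * (y - z)) powr (l + 1/2)))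
       = (LINT z:{0..y}|lebesgue. c_VP l * (\<Phi> z * (y - z) powr (l + 1/2)))"
    proof (rule set_lebesgue_integral_cong, simp, intro allI impI)
      fix z
      have "(2 * (y - z)) powr (l + 1/2) = 2 powr (l + 1/2) * (y - z) powr (l + 1/2)" by (rule powr_mult)
      then show "\<Phi> z * (2 * pi * Beta (l + 1) (1/2) * (2 * (y - z)) powr (l + 1/2)) = c_VP l * (\<Phi> z * (y - z) powr (l + 1/2))"
        by (simp only: c_VP_eq[OF l] mult_ac)
    qed
    then show ?thesis using False by (simp add: C.conv_set_integral(1) g_VP_def)
  qed (simp add: g_VP_def C.conv_nonpos)
qed

lemma VP_model:
  assumes E: "energy_profile (\<lambda>v. (norm v)\<^sup>2 / 2) (\<lambda>t. 2 * t) (\<lambda>_. 2) \<Phi> l c k \<eta>0" and y0: "0 < y0"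
  shows "newton_state l (g_VP l \<Phi>) (f_VP l \<Phi>) (\<lambda>_. 1) pressure_integrand y0"
proof -
  interpret E: energy_profile "\<lambda>v. (norm v)\<^sup>2 / 2" "\<lambda>t. 2 * t" "\<lambda>_. 2" \<Phi> l c k \<eta>0 by (rule E)
  let ?k1 = "\<lambda>t. 2 * pi * Beta (l + 1) (1/2) * (2 * t) powr (l + 1/2)"
  let ?k2 = "\<lambda>t. 2 * pi * Beta (l + 1) (3/2) * (2 * t) powr (l + 3/2)"
  have B: "0 < Beta (l + 1) (1/2)" "0 < Beta (l + 1) (3/2)"
    using Beta_half[OF E.l, of 0] Beta_half[OF E.l, of 1] by simp_all
  have K1: "kernel ?k1 (\<lambda>t. 0 * (2 * t) powr (l + 1/2) + 2 * pi * Beta (l + 1) (1/2) * ((l + 1/2) * (2 * t) powr (l + 1/2 - 1) * 2))"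
    by (rule kernel_mult[OF E.s_powr_kernel[of "l + 1/2"], where W'="\<lambda>_. 0"]) (use E.l B in auto)
  have K2: "kernel ?k2 (\<lambda>t. 0 * (2 * t) powr (l + 3/2) + 2 * pi * Beta (l + 1) (3/2) * ((l + 3/2) * (2 * t) powr (l + 3/2 - 1) * 2))"
    by (rule kernel_mult[OF E.s_powr_kernel[of "l + 3/2"], where W'="\<lambda>_. 0"]) (use E.l B in auto)
  have f: "E.f = f_VP l \<Phi>" by (simp add: fun_eq_iff E.f_def f_VP_def)
  have g: "conv \<Phi> ?k1 = g_VP l \<Phi>"
    by (rule g_VP_eq_conv[OF E.l convolution.intro[OF E.profile_axioms K1], symmetric])
  have e: "((\<lambda>v::real^3. (norm v)\<^sup>2 / 2) has_derivative (\<lambda>h. 1 * (v \<bullet> h))) (at v)" for v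
    using has_derivative_norm_square[of "\<lambda>q. q / 2" "1/2" v] by (auto intro!: derivative_eq_intros)
  have low: "2 * pi * Beta (l + 1) (1/2) * t powr (l + 1/2) \<le> ?k1 t" if "0 < t" for t
    using that B E.l by (intro mult_left_mono powr_mono2) auto
  have p3: "l + real 1 + 1/2 = l + 3/2" "real 1 + 1/2 = 3/2" by simp_all
  have \<kappa>1: "?k1 t = 1 * (pi * Beta (l + 1) (real 0 + 1/2) * (2 * t) powr (l + real 0 + 1/2) * 2)" for t by simp
  have \<kappa>2: "?k2 t = 1 * (pi * Beta (l + 1) (real 1 + 1/2) * (2 * t) powr (l + real 1 + 1/2) * 2)" for t
    unfolding p3 by simp
  have pr: "pressure_integrand F x v = (radial_direction x \<bullet> v) ^ (2 * 1) * 1 * F x v" for F x v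
    by (simp add: pressure_integrand_def)
  show ?thesis unfolding f[symmetric] g[symmetric]
    by (rule E.newton_solution[where ?\<kappa>1.0="?k1" and ?\<kappa>2.0="?k2" and p=pressure_integrand and ?b1.0="\<lambda>_. 1" and \<omega>="\<lambda>_. 1", OF K1 _ low \<kappa>1 K2 _ _ \<kappa>2 pr e y0])
       (use B in auto)
qed

subsection \<open>The relativistic Vlasov-Poisson system\<close>

lemma g_RVP_eq_conv:
  assumes l: "- 1/2 < l" and C: "convolution \<Phi> (\<lambda>t. (2 * pi * Beta (l + 1) (1/2) * (1 + t)) * ((1 + t)\<^sup>2 - 1) powr (l + 1/2)) k'"
  shows "g_RVP l \<Phi> = conv \<Phi> (\<lambda>t. (2 * pi * Beta (l + 1) (1/2) * (1 + t)) * ((1 + t)\<^sup>2 - 1) powr (l + 1/2))"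
proof
  fix y
  interpret C: convolution \<Phi> "\<lambda>t. (2 * pi * Beta (l + 1) (1/2) * (1 + t)) * ((1 + t)\<^sup>2 - 1) powr (l + 1/2)" k' by (rule C)
  show "g_RVP l \<Phi> y = conv \<Phi> (\<lambda>t. (2 * pi * Beta (l + 1) (1/2) * (1 + t)) * ((1 + t)\<^sup>2 - 1) powr (l + 1/2)) y"
  proof (cases "y \<le> 0")
    case False
    have "(LINT z:{0..y}|lebesgue. \<Phi> z * ((2 * pi * Beta (l + 1) (1/2) * (1 + (y - z))) * ((1 + (y - z))\<^sup>2 - 1) powr (l + 1/2)))
       = (LINT z:{0..y}|lebesgue. c_rel l * (\<Phi> z * (1 + y - z) * ((1 + y - z)\<^sup>2 - 1) powr (l + 1/2)))"
      by (rule set_lebesgue_integral_cong) (auto simp: c_rel_eq[OF l] add_diff_eq)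
    then show ?thesis using False by (simp add: C.conv_set_integral(1) g_RVP_def)
  qed (simp add: g_RVP_def C.conv_nonpos)
qed

lemma RVP_model:
  assumes E: "energy_profile (\<lambda>v. sqrt (1 + (norm v)\<^sup>2) - 1) (\<lambda>t. (1 + t)\<^sup>2 - 1) (\<lambda>t. 2 * (1 + t)) \<Phi> l c k \<eta>0" and y0: "0 < y0"
  shows "newton_state l (g_RVP l \<Phi>) (f_RVP l \<Phi>) (\<lambda>v. inverse (sqrt (1 + (norm v)\<^sup>2))) rel_pressure_integrand y0"
proof -
  interpret E: energy_profile "\<lambda>v. sqrt (1 + (norm v)\<^sup>2) - 1" "\<lambda>t. (1 + t)\<^sup>2 - 1" "\<lambda>t. 2 * (1 + t)" \<Phi> l c k \<eta>0 by (rule E)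
  let ?k1 = "\<lambda>t. (2 * pi * Beta (l + 1) (1/2) * (1 + t)) * ((1 + t)\<^sup>2 - 1) powr (l + 1/2)"
  let ?k2 = "\<lambda>t. 2 * pi * Beta (l + 1) (3/2) * ((1 + t)\<^sup>2 - 1) powr (l + 3/2)"
  have B: "0 < Beta (l + 1) (1/2)" "0 < Beta (l + 1) (3/2)"
    using Beta_half[OF E.l, of 0] Beta_half[OF E.l, of 1] by simp_all
  have K1: "kernel ?k1 (\<lambda>t. 2 * pi * Beta (l + 1) (1/2) * ((1 + t)\<^sup>2 - 1) powr (l + 1/2)
      + (2 * pi * Beta (l + 1) (1/2) * (1 + t)) * ((l + 1/2) * ((1 + t)\<^sup>2 - 1) powr (l + 1/2 - 1) * (2 * (1 + t))))"
    by (rule kernel_mult[OF E.s_powr_kernel[of "l + 1/2"], where W'="\<lambda>_. 2 * pi * Beta (l + 1) (1/2)"])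
       (use E.l B in \<open>auto intro!: continuous_intros derivative_eq_intros\<close>)
  have K2: "kernel ?k2 (\<lambda>t. 0 * ((1 + t)\<^sup>2 - 1) powr (l + 3/2) + 2 * pi * Beta (l + 1) (3/2) * ((l + 3/2) * ((1 + t)\<^sup>2 - 1) powr (l + 3/2 - 1) * (2 * (1 + t))))"
    by (rule kernel_mult[OF E.s_powr_kernel[of "l + 3/2"], where W'="\<lambda>_. 0"]) (use E.l B in auto)
  have f: "E.f = f_RVP l \<Phi>" by (simp add: fun_eq_iff E.f_def f_RVP_def algebra_simps)
  have g: "conv \<Phi> ?k1 = g_RVP l \<Phi>"
    by (rule g_RVP_eq_conv[OF E.l convolution.intro[OF E.profile_axioms K1], symmetric])
  have e: "((\<lambda>v::real^3. sqrt (1 + (norm v)\<^sup>2) - 1) has_derivative (\<lambda>h. inverse (sqrt (1 + (norm v)\<^sup>2)) * (v \<bullet> h))) (at v)" for v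
  proof -
    have p: "0 < 1 + (norm v)\<^sup>2" by (rule add_pos_nonneg, simp_all)
    have "((\<lambda>q. sqrt (1 + q) - 1) has_real_derivative inverse (sqrt (1 + (norm v)\<^sup>2)) / 2) (at ((norm v)\<^sup>2))"
      using p by (auto intro!: derivative_eq_intros)
    from has_derivative_norm_square[OF this] show ?thesis by simp
  qed
  have low: "2 * pi * Beta (l + 1) (1/2) * t powr (l + 1/2) \<le> ?k1 t" if "0 < t" for t
  proof (rule mult_mono)
    show "2 * pi * Beta (l + 1) (1/2) \<le> 2 * pi * Beta (l + 1) (1/2) * (1 + t)"
      using mult_left_mono[of 1 "1 + t" "2 * pi * Beta (l + 1) (1/2)"] B that by simp
    show "t powr (l + 1/2) \<le> ((1 + t)\<^sup>2 - 1) powr (l + 1/2)"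
      using that E.l by (intro powr_mono2) (auto simp: power2_eq_square algebra_simps)
  qed (use B that in auto)
  have \<omega>m: "(\<lambda>t::real. 1 / (1 + t)) \<in> borel_measurable borel" by measurable
  have p3: "l + real 1 + 1/2 = l + 3/2" "real 1 + 1/2 = 3/2" by simp_all
  have \<kappa>1: "?k1 t = 1 * (pi * Beta (l + 1) (real 0 + 1/2) * ((1 + t)\<^sup>2 - 1) powr (l + real 0 + 1/2) * (2 * (1 + t)))" for t by simp
  \<comment> \<open>The weight \<open>1 / (1 + t)\<close> of the pressure cancels the factor
    \<open>1 + t\<close> in the derivative of \<open>(1 + t)\<^sup>2 - 1\<close>.\<close>
  have \<kappa>2: "?k2 t = 1 / (1 + t) * (pi * Beta (l + 1) (real 1 + 1/2) * ((1 + t)\<^sup>2 - 1) powr (l + real 1 + 1/2) * (2 * (1 + t)))"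
    if "0 < t" for t
  proof -
    have "1 / (1 + t) * (X * (2 * (1 + t))) = 2 * X" for X using that by (simp add: field_simps)
    from this[of "pi * Beta (l + 1) (3/2) * ((1 + t)\<^sup>2 - 1) powr (l + 3/2)"] show ?thesis
      unfolding p3 by (simp only: mult_ac)
  qed
  have pr: "rel_pressure_integrand F x v = (radial_direction x \<bullet> v) ^ (2 * 1) * (1 / (1 + (sqrt (1 + (norm v)\<^sup>2) - 1))) * F x v" for F x v
    by (simp add: rel_pressure_integrand_def)
  show ?thesis unfolding f[symmetric] g[symmetric]
    by (rule E.newton_solution[where ?\<kappa>1.0="?k1" and ?\<kappa>2.0="?k2" and p=rel_pressure_integrand and ?b1.0="\<lambda>v. inverse (sqrt (1 + (norm v)\<^sup>2))" and \<omega>="\<lambda>t. 1 / (1 + t)", OF K1 _ low \<kappa>1 K2 \<omega>m _ \<kappa>2 pr e y0])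
       (use B in auto)
qed

subsection \<open>The Einstein-Vlasov system\<close>

lemma exp_half_ln: "0 < q \<Longrightarrow> exp (ln q / 2) = sqrt q"
  by (simp add: ln_sqrt[symmetric])

text \<open>After the substitution the factors \<open>exp (3 * y)\<close> and
  \<open>(1 - \<eta>)\<^sup>2\<close> and the Jacobian \<open>exp (- z)\<close> combine to
  \<open>exp (3 * (y - z))\<close>, so that besides the profile only \<open>y - z\<close> is
  left.\<close>

lemma g_EV_eq_conv:
  assumes l: "- 1/2 < l" and C: "convolution (EV_profile \<Phi>) (\<lambda>t. (2 * pi * Beta (l + 1) (1/2) * exp (3 * t)) * (exp (2 * t) - 1) powr (l + 1/2)) k'"
  shows "g_EV l \<Phi> = conv (EV_profile \<Phi>) (\<lambda>t. (2 * pi * Beta (l + 1) (1/2) * exp (3 * t)) * (exp (2 * t) - 1) powr (l + 1/2))" (is "_ = conv _ ?k")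
proof
  fix y
  interpret C: convolution "EV_profile \<Phi>" ?k k' by (rule C)
  let ?A = "2 * pi * Beta (l + 1) (1/2)"
  show "g_EV l \<Phi> y = conv (EV_profile \<Phi>) ?k y"
  proof (cases "y \<le> 0")
    case False
    define F where "F = (\<lambda>\<eta>. \<Phi> \<eta> * (1 - \<eta>)\<^sup>2 * (exp (2 * y) * (1 - \<eta>)\<^sup>2 - 1) powr (l + 1/2))"
    have eq: "?A * exp (3 * y) * (exp (- z) * F (1 - exp (- z))) = EV_profile \<Phi> z * ?k (y - z)" for z
    proof -
      have 1: "exp (3 * y) * (exp (- z) * (exp (- z))\<^sup>2) = exp (3 * (y - z))"
        by (simp add: exp_double[symmetric] mult_exp_exp)
      have 2: "exp (2 * y) * (exp (- z))\<^sup>2 = exp (2 * (y - z))"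
        by (simp add: exp_double[symmetric] mult_exp_exp)
      have "?A * exp (3 * y) * (exp (- z) * F (1 - exp (- z))) =
         ?A * (exp (3 * y) * (exp (- z) * (exp (- z))\<^sup>2)) * EV_profile \<Phi> z * (exp (2 * y) * (exp (- z))\<^sup>2 - 1) powr (l + 1/2)"
        by (simp add: F_def EV_profile_def mult_ac)
      then show ?thesis unfolding 1 2 by (simp add: mult_ac)
    qed
    have i: "set_integrable lebesgue {0..y} (\<lambda>z. exp (- z) * F (1 - exp (- z)))"
    proof -
      have "set_integrable lebesgue {0..y} (\<lambda>z. 1 / (?A * exp (3 * y)) * (EV_profile \<Phi> z * ?k (y - z)))"
        by (rule set_integrable_mult_right[OF C.conv_set_integral(2)])
      moreover have "1 / (?A * exp (3 * y)) * ((?A * exp (3 * y)) * x) = x" for x using Beta_half[OF l, of 0] by simp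
      ultimately show ?thesis unfolding eq[symmetric] by (simp only:)
    qed
    have "g_EV l \<Phi> y = ?A * exp (3 * y) * (LINT \<eta>:{0..1 - exp (- y)}|lebesgue. F \<eta>)"
      using False by (simp add: g_EV_def F_def c_rel_eq[OF l])
    also have "\<dots> = (LINT z:{0..y}|lebesgue. ?A * exp (3 * y) * (exp (- z) * F (1 - exp (- z))))"
      unfolding set_integral_EV_substitution[OF i] by simp
    also have "\<dots> = conv (EV_profile \<Phi>) ?k y" unfolding eq C.conv_set_integral(1) ..
    finally show ?thesis .
  qed (simp add: g_EV_def C.conv_nonpos)
qed

lemma h_EV_eq_conv:
  assumes l: "- 1/2 < l" and C: "convolution (EV_profile \<Phi>) (\<lambda>t. (2 * pi * Beta (l + 1) (3/2) * exp t) * (exp (2 * t) - 1) powr (l + 3/2)) k'"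
  shows "h_EV l \<Phi> = conv (EV_profile \<Phi>) (\<lambda>t. (2 * pi * Beta (l + 1) (3/2) * exp t) * (exp (2 * t) - 1) powr (l + 3/2))" (is "_ = conv _ ?k")
proof
  fix y
  interpret C: convolution "EV_profile \<Phi>" ?k k' by (rule C)
  let ?A = "2 * pi * Beta (l + 1) (3/2)"
  show "h_EV l \<Phi> y = conv (EV_profile \<Phi>) ?k y"
  proof (cases "y \<le> 0")
    case False
    define F where "F = (\<lambda>\<eta>. \<Phi> \<eta> * (exp (2 * y) * (1 - \<eta>)\<^sup>2 - 1) powr (l + 3/2))"
    have eq: "?A * exp y * (exp (- z) * F (1 - exp (- z))) = EV_profile \<Phi> z * ?k (y - z)" for z
    proof -
      have 1: "exp y * exp (- z) = exp (y - z)"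
        by (simp add: mult_exp_exp)
      have 2: "exp (2 * y) * (exp (- z))\<^sup>2 = exp (2 * (y - z))"
        by (simp add: exp_double[symmetric] mult_exp_exp)
      have "?A * exp y * (exp (- z) * F (1 - exp (- z))) =
         ?A * (exp y * exp (- z)) * EV_profile \<Phi> z * (exp (2 * y) * (exp (- z))\<^sup>2 - 1) powr (l + 3/2)"
        by (simp add: F_def EV_profile_def mult_ac)
      then show ?thesis unfolding 1 2 by (simp add: mult_ac)
    qed
    have i: "set_integrable lebesgue {0..y} (\<lambda>z. exp (- z) * F (1 - exp (- z)))"
    proof -
      have "set_integrable lebesgue {0..y} (\<lambda>z. 1 / (?A * exp y) * (EV_profile \<Phi> z * ?k (y - z)))"
        by (rule set_integrable_mult_right[OF C.conv_set_integral(2)])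
      moreover have "1 / (?A * exp y) * ((?A * exp y) * x) = x" for x using Beta_half[OF l, of 1] by simp
      ultimately show ?thesis unfolding eq[symmetric] by (simp only:)
    qed
    have "h_EV l \<Phi> y = ?A * exp y * (LINT \<eta>:{0..1 - exp (- y)}|lebesgue. F \<eta>)"
      using False by (simp add: h_EV_def F_def d_rel_eq[OF l])
    also have "\<dots> = (LINT z:{0..y}|lebesgue. ?A * exp y * (exp (- z) * F (1 - exp (- z))))"
      unfolding set_integral_EV_substitution[OF i] by simp
    also have "\<dots> = conv (EV_profile \<Phi>) ?k y" unfolding eq C.conv_set_integral(1) ..
    finally show ?thesis .
  qed (simp add: h_EV_def C.conv_nonpos)
qed

lemma EV_model:
  assumes E: "energy_profile (\<lambda>v. ln (1 + (norm v)\<^sup>2) / 2) (\<lambda>t. exp (2 * t) - 1) (\<lambda>t. 2 * exp (2 * t)) (EV_profile \<Phi>) l c k \<eta>0" and y0: "0 < y0"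
  shows "EV_state l (g_EV l \<Phi>) (h_EV l \<Phi>) (f_EV l \<Phi>) y0"
proof -
  interpret E: energy_profile "\<lambda>v. ln (1 + (norm v)\<^sup>2) / 2" "\<lambda>t. exp (2 * t) - 1" "\<lambda>t. 2 * exp (2 * t)" "EV_profile \<Phi>" l c k \<eta>0
    by (rule E)
  let ?A1 = "2 * pi * Beta (l + 1) (1/2)" and ?A2 = "2 * pi * Beta (l + 1) (3/2)"
  let ?s = "\<lambda>t::real. exp (2 * t) - 1"
  let ?k1 = "\<lambda>t. (?A1 * exp (3 * t)) * ?s t powr (l + 1/2)"
  let ?k2 = "\<lambda>t. (?A2 * exp t) * ?s t powr (l + 3/2)"
  have B: "0 < Beta (l + 1) (1/2)" "0 < Beta (l + 1) (3/2)"
    using Beta_half[OF E.l, of 0] Beta_half[OF E.l, of 1] by simp_all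
  have K1: "kernel ?k1 (\<lambda>t. (?A1 * (3 * exp (3 * t))) * ?s t powr (l + 1/2) + (?A1 * exp (3 * t)) * ((l + 1/2) * ?s t powr (l + 1/2 - 1) * (2 * exp (2 * t))))"
    by (rule kernel_mult[OF E.s_powr_kernel[of "l + 1/2"], where W'="\<lambda>t. ?A1 * (3 * exp (3 * t))"])
       (use E.l B in \<open>auto intro!: continuous_intros derivative_eq_intros\<close>)
  have K2: "kernel ?k2 (\<lambda>t. ?k1 t + ?k2 t)"
  proof (rule kernel_mult[OF E.s_powr_kernel[of "l + 3/2"], where W'="\<lambda>t. ?A2 * exp t"])
    fix t :: real
    have p: "l + 3/2 - 1 = l + 1/2" by simp
    have A: "?A1 = (2 * l + 3) * ?A2" using Beta_recursion[of l] by (simp add: mult_ac)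
    have x: "exp (3 * t) = exp t * exp (2 * t)" by (simp add: mult_exp_exp)
    \<comment> \<open>Differentiating the power of \<open>?s\<close> gives
      \<open>(2 * l + 3) * ?A2 * exp (3 * t) * ?s t powr (l + 1/2)\<close>, which is
      \<open>?k1\<close> since \<open>?A1 = (2 * l + 3) * ?A2\<close>; differentiating
      \<open>exp t\<close> reproduces \<open>?k2\<close>.\<close>
    show "?k1 t + ?k2 t = ?A2 * exp t * ?s t powr (l + 3/2) + ?A2 * exp t * ((l + 3/2) * ?s t powr (l + 3/2 - 1) * (2 * exp (2 * t)))"
      unfolding p A x by (simp add: algebra_simps)
  qed (use E.l B in \<open>auto intro!: continuous_intros derivative_eq_intros\<close>)
  have ex: "exp (ln (1 + (norm v)\<^sup>2) / 2) = sqrt (1 + (norm v)\<^sup>2)" for v :: "real^3"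
    by (rule exp_half_ln, rule add_pos_nonneg, simp_all)
  have f: "E.f = f_EV l \<Phi>"
  proof (intro ext)
    fix y :: "real \<Rightarrow> real" and x v :: "real^3"
    have "exp (- (y (norm x) - ln (1 + (norm v)\<^sup>2) / 2)) = exp (- y (norm x)) * exp (ln (1 + (norm v)\<^sup>2) / 2)"
      by (simp add: mult_exp_exp)
    also have "\<dots> = exp (- y (norm x)) * sqrt (1 + (norm v)\<^sup>2)" unfolding ex ..
    finally have "exp (- (y (norm x) - ln (1 + (norm v)\<^sup>2) / 2)) = exp (- y (norm x)) * sqrt (1 + (norm v)\<^sup>2)" .
    then show "E.f y x v = f_EV l \<Phi> y x v" by (simp add: E.f_def f_EV_def EV_profile_def)
  qed
  have g: "conv (EV_profile \<Phi>) ?k1 = g_EV l \<Phi>"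
    by (rule g_EV_eq_conv[OF E.l convolution.intro[OF E.profile_axioms K1], symmetric])
  have h: "conv (EV_profile \<Phi>) ?k2 = h_EV l \<Phi>"
    by (rule h_EV_eq_conv[OF E.l convolution.intro[OF E.profile_axioms K2], symmetric])
  have e: "((\<lambda>v::real^3. ln (1 + (norm v)\<^sup>2) / 2) has_derivative (\<lambda>h. inverse (1 + (norm v)\<^sup>2) * (v \<bullet> h))) (at v)" for v
  proof -
    have p: "0 < 1 + (norm v)\<^sup>2" by (rule add_pos_nonneg, simp_all)
    have "((\<lambda>q. 1 + q) has_real_derivative 1) (at ((norm v)\<^sup>2))" by (auto intro!: derivative_eq_intros)
    from DERIV_cdivide[OF DERIV_chain2[OF DERIV_ln[OF p] this], of 2]
    have "((\<lambda>q. ln (1 + q) / 2) has_real_derivative inverse (1 + (norm v)\<^sup>2) / 2) (at ((norm v)\<^sup>2))" by simp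
    from has_derivative_norm_square[OF this] show ?thesis by simp
  qed
  have b: "inverse (sqrt (1 + (norm v)\<^sup>2)) = inverse (1 + (norm v)\<^sup>2) * sqrt (1 + (norm v)\<^sup>2)" for v :: "real^3"
  proof -
    have "0 < 1 + (norm v)\<^sup>2" by (rule add_pos_nonneg, simp_all)
    then have "sqrt (1 + (norm v)\<^sup>2) * sqrt (1 + (norm v)\<^sup>2) = 1 + (norm v)\<^sup>2" "0 < sqrt (1 + (norm v)\<^sup>2)" by simp_all
    then show ?thesis by (simp add: field_simps)
  qed
  have low: "?A1 * t powr (l + 1/2) \<le> ?k1 t" if "0 < t" for t
  proof (rule mult_mono)
    show "?A1 \<le> ?A1 * exp (3 * t)"
      using mult_left_mono[of 1 "exp (3 * t)" ?A1] B that by simp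
    show "t powr (l + 1/2) \<le> ?s t powr (l + 1/2)"
    proof (rule powr_mono2)
      show "t \<le> ?s t" using that exp_ge_add_one_self[of "2 * t"] by linarith
    qed (use that E.l in auto)
  qed (use B in auto)
  \<comment> \<open>At logarithmic energy \<open>t\<close> one has
    \<open>sqrt (1 + (norm v)\<^sup>2) = exp t\<close>, so the weights of energy density and
    pressure are \<open>exp t\<close> and \<open>exp (- t)\<close>.\<close>
  have \<kappa>1: "?k1 t = exp t * (pi * Beta (l + 1) (real 0 + 1/2) * ?s t powr (l + real 0 + 1/2) * (2 * exp (2 * t)))" for t
  proof -
    have "exp (3 * t) = exp t * exp (2 * t)" by (simp add: mult_exp_exp)
    then show ?thesis by simp
  qed
  have \<kappa>2: "?k2 t = exp (- t) * (pi * Beta (l + 1) (real 1 + 1/2) * ?s t powr (l + real 1 + 1/2) * (2 * exp (2 * t)))" for t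
  proof -
    have x: "exp t = exp (- t) * exp (2 * t)" by (simp add: mult_exp_exp)
    have p: "l + real 1 + 1/2 = l + 3/2" "real 1 + 1/2 = 3/2" by simp_all
    show ?thesis unfolding p by (subst x) (simp add: mult_ac)
  qed
  have pr: "rel_pressure_integrand F x v = (radial_direction x \<bullet> v) ^ (2 * 1) * exp (- (ln (1 + (norm v)\<^sup>2) / 2)) * F x v" for F x v
    unfolding exp_minus ex by (simp add: rel_pressure_integrand_def divide_inverse mult_ac)
  have de: "energy_density_integrand F x v = (radial_direction x \<bullet> v) ^ (2 * 0) * exp (ln (1 + (norm v)\<^sup>2) / 2) * F x v" for F x v
    unfolding ex by (simp add: energy_density_integrand_def)
  have m: "(\<lambda>t::real. exp t) \<in> borel_measurable borel" "(\<lambda>t::real. exp (- t)) \<in> borel_measurable borel" by measurable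
  show ?thesis unfolding f[symmetric] g[symmetric] h[symmetric]
    by (rule E.EV_solution[where ?\<kappa>1.0="?k1" and ?\<kappa>2.0="?k2" and b="\<lambda>v. inverse (1 + (norm v)\<^sup>2)",
          OF K1 _ low m(1) _ \<kappa>1 K2 m(2) _ \<kappa>2 de pr e b y0])
       (use B in auto)
qed

section \<open>Normalising the bounds on \<Phi>\<close>

lemma upper_bound_nonpos_exponent:
  fixes \<Phi> :: "real \<Rightarrow> real"
  assumes "\<exists>\<kappa>>- 1. \<forall>K. compact K \<longrightarrow> (\<exists>C>0. \<forall>\<eta>\<in>K. 0 < \<eta> \<longrightarrow> \<Phi> \<eta> \<le> C * \<eta> powr \<kappa>)"
  obtains \<kappa> where "- 1 < \<kappa>" "\<kappa> \<le> 0" "\<And>Y. \<exists>C>0. \<forall>z\<in>{0<..Y}. \<Phi> z \<le> C * z powr \<kappa>"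
proof -
  obtain \<kappa> where \<kappa>: "- 1 < \<kappa>" "\<And>K. compact K \<Longrightarrow> \<exists>C>0. \<forall>\<eta>\<in>K. 0 < \<eta> \<longrightarrow> \<Phi> \<eta> \<le> C * \<eta> powr \<kappa>"
    using assms by blast
  have "\<exists>C>0. \<forall>z\<in>{0<..Y}. \<Phi> z \<le> C * z powr (min \<kappa> 0)" for Y
  proof -
    obtain C where C: "0 < C" "\<forall>\<eta>\<in>{0..Y}. 0 < \<eta> \<longrightarrow> \<Phi> \<eta> \<le> C * \<eta> powr \<kappa>" using \<kappa>(2)[of "{0..Y}"] by auto
    \<comment> \<open>On a bounded interval a positive power is at most a constant, which is
      absorbed into \<open>D\<close>; this allows the exponent
      \<open>min \<kappa> 0\<close>.\<close>
    define D where "D = C * (if \<kappa> \<le> 0 then 1 else max 1 Y powr \<kappa>)"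
    have "\<Phi> z \<le> D * z powr (min \<kappa> 0)" if z: "z \<in> {0<..Y}" for z
    proof -
      have "\<Phi> z \<le> C * z powr \<kappa>" using C(2) z by auto
      also have "\<dots> \<le> D * z powr (min \<kappa> 0)"
      proof (cases "\<kappa> \<le> 0")
        case False
        have "z powr \<kappa> \<le> max 1 Y powr \<kappa>" using z False by (intro powr_mono2) auto
        then show ?thesis using False C(1) z by (simp add: D_def min_def)
      qed (simp add: D_def min_def)
      finally show ?thesis .
    qed
    moreover have "0 < D" using C(1) by (simp add: D_def)
    ultimately show ?thesis by blast
  qed
  then show ?thesis using that[of "min \<kappa> 0"] \<kappa>(1) by simp
qed

text \<open>Below \<open>1\<close> a larger exponent gives a smaller power, so \<open>k\<close> may
  be replaced by \<open>max k 0\<close>, which is still below \<open>l + 3/2\<close>. A nonnegative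
  \<open>k\<close> is what yields \<open>1 < q\<close> in the reduced equation.\<close>

lemma lower_bound_nonneg_exponent:
  fixes \<Phi> :: "real \<Rightarrow> real"
  assumes l: "- 1/2 < l"
    and "\<exists>c>0. \<exists>\<eta>0>0. \<exists>k. - 1 < k \<and> k < l + 3/2 \<and> (\<forall>\<eta>\<in>{0<..<\<eta>0}. c * \<eta> powr k \<le> \<Phi> \<eta>)"
  obtains c k \<eta>0 where "0 < c" "0 < \<eta>0" "\<eta>0 \<le> 1" "0 \<le> k" "k < l + 3/2" "\<And>\<eta>. 0 < \<eta> \<Longrightarrow> \<eta> < \<eta>0 \<Longrightarrow> c * \<eta> powr k \<le> \<Phi> \<eta>"
proof -
  obtain c \<eta>0 k where c: "0 < c" "0 < \<eta>0" "k < l + 3/2" and low: "\<And>\<eta>. 0 < \<eta> \<Longrightarrow> \<eta> < \<eta>0 \<Longrightarrow> c * \<eta> powr k \<le> \<Phi> \<eta>"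
    using assms(2) by auto
  show ?thesis
  proof (rule that[of c "min 1 \<eta>0" "max k 0"])
    fix \<eta> assume \<eta>: "0 < \<eta>" "\<eta> < min 1 \<eta>0"
    have "\<eta> powr (max k 0) \<le> \<eta> powr k" using \<eta> by (intro powr_mono') auto
    then have "c * \<eta> powr (max k 0) \<le> c * \<eta> powr k" using c by (intro mult_left_mono) auto
    also have "\<dots> \<le> \<Phi> \<eta>" using \<eta> by (intro low) auto
    finally show "c * \<eta> powr (max k 0) \<le> \<Phi> \<eta>" .
  qed (use c l in auto)
qed

text \<open>On \<open>{0<..Y}\<close> one has \<open>exp (- Y) * z \<le> 1 - exp (- z)\<close>, and
  the nonpositive exponent reverses the inequality between the powers.\<close>

lemma EV_profile_upper_bound:
  assumes \<kappa>: "\<kappa> \<le> 0" and bd: "\<And>Y. \<exists>C>0. \<forall>z\<in>{0<..Y}. \<Phi> z \<le> C * z powr \<kappa>"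
  shows "\<exists>C. \<forall>z\<in>{0<..Y}. EV_profile \<Phi> z \<le> C * z powr \<kappa>"
proof -
  obtain C where C: "0 < C" "\<forall>z\<in>{0<..1}. \<Phi> z \<le> C * z powr \<kappa>" using bd by blast
  have "EV_profile \<Phi> z \<le> (C * exp (- Y) powr \<kappa>) * z powr \<kappa>" if z: "z \<in> {0<..Y}" for z
  proof -
    let ?t = "1 - exp (- z)"
    have t: "0 < ?t" "?t \<le> 1" using z by auto
    have "exp (- Y) * z \<le> exp (- z) * z" using z by (intro mult_right_mono) auto
    also have "\<dots> \<le> ?t" using one_minus_exp_bounds(1)[of z] z by (simp add: mult.commute)
    finally have "?t powr \<kappa> \<le> (exp (- Y) * z) powr \<kappa>" using z \<kappa> by (intro powr_mono2') auto
    also have "\<dots> = exp (- Y) powr \<kappa> * z powr \<kappa>" by (rule powr_mult)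
    finally have "C * ?t powr \<kappa> \<le> C * (exp (- Y) powr \<kappa> * z powr \<kappa>)" using C by (intro mult_left_mono) auto
    moreover have "\<Phi> ?t \<le> C * ?t powr \<kappa>" using C t by auto
    ultimately show ?thesis by (simp add: EV_profile_def mult.assoc)
  qed
  then show ?thesis by blast
qed

text \<open>From \<open>z < \<eta>0 \<le> 1\<close> follows
  \<open>exp (- 1) * z \<le> 1 - exp (- z)\<close>, the origin of the constant, while
  \<open>1 - exp (- z) \<le> z\<close> keeps the argument of \<open>\<Phi>\<close> in the range of
  the hypothesis.\<close>

lemma EV_profile_lower_bound:
  assumes c: "0 < c" and k: "0 \<le> k" and \<eta>0: "\<eta>0 \<le> 1" and low: "\<And>\<eta>. 0 < \<eta> \<Longrightarrow> \<eta> < \<eta>0 \<Longrightarrow> c * \<eta> powr k \<le> \<Phi> \<eta>"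
    and z: "0 < z" "z < \<eta>0"
  shows "c * exp (- 1) powr k * z powr k \<le> EV_profile \<Phi> z"
proof -
  let ?t = "1 - exp (- z)"
  have "exp (- 1) * z \<le> exp (- z) * z" using z \<eta>0 by (intro mult_right_mono) auto
  also have "\<dots> \<le> ?t" using one_minus_exp_bounds(1)[of z] z by (simp add: mult.commute)
  finally have "(exp (- 1) * z) powr k \<le> ?t powr k" using z k by (intro powr_mono2) auto
  moreover have "(exp (- 1) * z) powr k = exp (- 1) powr k * z powr k" by (rule powr_mult)
  ultimately have "c * (exp (- 1) powr k * z powr k) \<le> c * ?t powr k" using c by (intro mult_left_mono) auto
  also have "\<dots> \<le> \<Phi> ?t" using z one_minus_exp_bounds(2)[of z] by (intro low) auto
  finally show ?thesis by (simp add: EV_profile_def mult.assoc)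
qed

theorem theorem4p1:
  fixes l :: real and \<Phi> :: "real \<Rightarrow> real"
  assumes l: "l > - 1/2"
    and nonneg: "\<forall>\<eta>. 0 \<le> \<Phi> \<eta>"
    and measurable: "\<Phi> \<in> borel_measurable lebesgue"
    and zero: "\<forall>\<eta><0. \<Phi> \<eta> = 0"
    and pos: "\<exists>\<eta>1>0. AE \<eta> in lebesgue. \<eta> \<in> {0..\<eta>1} \<longrightarrow> 0 < \<Phi> \<eta>"
    and upper: "\<exists>\<kappa>>- 1. \<forall>K. compact K \<longrightarrow>
      (\<exists>C>0. \<forall>\<eta>\<in>K. 0 < \<eta> \<longrightarrow> \<Phi> \<eta> \<le> C * \<eta> powr \<kappa>)"
    and lower: "\<exists>c>0. \<exists>\<eta>0>0. \<exists>k. - 1 < k \<and> k < l + 3/2 \<and>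
      (\<forall>\<eta>\<in>{0<..<\<eta>0}. c * \<eta> powr k \<le> \<Phi> \<eta>)"
  shows
    "(\<forall>y0>0. \<exists>y R yinf.
       solves_reduced_newton l (g_VP l \<Phi>) y0 y \<and>
       (\<forall>z. solves_reduced_newton l (g_VP l \<Phi>) y0 z \<longrightarrow> (\<forall>r\<ge>0. z r = y r)) \<and>
       0 < R \<and> (\<forall>r\<ge>0. y r = 0 \<longleftrightarrow> r = R) \<and>
       (y \<longlongrightarrow> yinf) at_top \<and>
       (let f = f_VP l \<Phi> y; U = (\<lambda>r. yinf - y r);
            \<rho> = moment density_integrand f; p = moment pressure_integrand f
        in static_solution_VP l f (\<lambda>x. U (norm x)) \<and> spherically_symmetric l f \<and>
           compact (support_in_phase_space l f) \<and> spatial_support l f = cball 0 R \<and>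
           y0 = U R - U 0 \<and>
           moment_exists l pressure_integrand f \<and>
           continuous_on (position_domain l) \<rho> \<and> C1_on (ball 0 R \<inter> C1_domain l) \<rho> \<and>
           continuous_on (position_domain l) p \<and> C1_on (ball 0 R \<inter> C1_domain l) p)) \<and>
     (\<forall>y0>0. \<exists>y R yinf.
       solves_reduced_newton l (g_RVP l \<Phi>) y0 y \<and>
       (\<forall>z. solves_reduced_newton l (g_RVP l \<Phi>) y0 z \<longrightarrow> (\<forall>r\<ge>0. z r = y r)) \<and>
       0 < R \<and> (\<forall>r\<ge>0. y r = 0 \<longleftrightarrow> r = R) \<and>
       (y \<longlongrightarrow> yinf) at_top \<and>
       (let f = f_RVP l \<Phi> y; U = (\<lambda>r. yinf - y r);
            \<rho> = moment density_integrand f; p = moment rel_pressure_integrand f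
        in static_solution_RVP l f (\<lambda>x. U (norm x)) \<and> spherically_symmetric l f \<and>
           compact (support_in_phase_space l f) \<and> spatial_support l f = cball 0 R \<and>
           y0 = U R - U 0 \<and>
           moment_exists l rel_pressure_integrand f \<and>
           continuous_on (position_domain l) \<rho> \<and> C1_on (ball 0 R \<inter> C1_domain l) \<rho> \<and>
           continuous_on (position_domain l) p \<and> C1_on (ball 0 R \<inter> C1_domain l) p)) \<and>
     (\<forall>y0>0. \<exists>y R yinf.
       solves_reduced_EV l (g_EV l \<Phi>) (h_EV l \<Phi>) y0 y \<and>
       (\<forall>z. solves_reduced_EV l (g_EV l \<Phi>) (h_EV l \<Phi>) y0 z \<longrightarrow> (\<forall>r\<ge>0. z r = y r)) \<and>
       0 < R \<and> (\<forall>r\<ge>0. y r = 0 \<longleftrightarrow> r = R) \<and>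
       (y \<longlongrightarrow> yinf) at_top \<and>
       (let f = f_EV l \<Phi> y; \<mu> = (\<lambda>r. yinf - y r);
            \<rho> = moment energy_density_integrand f; p = moment rel_pressure_integrand f
        in (\<exists>lam. (\<forall>r>0. exp (- 2 * lam r) = 1 - 2 * mass l (g_EV l \<Phi>) y r / r) \<and>
                static_solution_EV l f \<mu> lam) \<and>
           spherically_symmetric l f \<and>
           compact (support_in_phase_space l f) \<and> spatial_support l f = cball 0 R \<and>
           y0 = \<mu> R - \<mu> 0 \<and>
           continuous_on (position_domain l) \<rho> \<and> C1_on (ball 0 R \<inter> C1_domain l) \<rho> \<and>
           continuous_on (position_domain l) p \<and> C1_on (ball 0 R \<inter> C1_domain l) p))"
proof -
  have l: "- 1/2 < l" by fact
  obtain \<kappa> where \<kappa>: "- 1 < \<kappa>" "\<kappa> \<le> 0" "\<And>Y. \<exists>C>0. \<forall>z\<in>{0<..Y}. \<Phi> z \<le> C * z powr \<kappa>"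
    using upper_bound_nonpos_exponent[OF upper] by blast
  obtain c k \<eta>0 where c: "0 < c" and \<eta>0: "0 < \<eta>0" "\<eta>0 \<le> 1" and k: "0 \<le> k" "k < l + 3/2"
    and low: "\<And>\<eta>. 0 < \<eta> \<Longrightarrow> \<eta> < \<eta>0 \<Longrightarrow> c * \<eta> powr k \<le> \<Phi> \<eta>"
    using lower_bound_nonneg_exponent[OF l lower] by metis
  have P: "profile \<Phi>"
    by (rule profileI[OF _ measurable _ \<kappa>(1,2)]) (use nonneg zero \<kappa>(3) in \<open>auto, blast\<close>)
  have Pe: "profile (EV_profile \<Phi>)"
    by (rule profileI[OF _ EV_profile_measurable[OF measurable] _ \<kappa>(1,2) EV_profile_upper_bound[OF \<kappa>(2,3)]])
       (use nonneg zero in \<open>auto simp: EV_profile_def\<close>)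
  have VP: "energy_profile (\<lambda>v. (norm v)\<^sup>2 / 2) (\<lambda>t. 2 * t) (\<lambda>_. 2) \<Phi> l c k \<eta>0"
    by (intro energy_profile.intro energy_profile_axioms.intro kinetic_VP P l c \<eta>0 k low)
  have RVP: "energy_profile (\<lambda>v. sqrt (1 + (norm v)\<^sup>2) - 1) (\<lambda>t. (1 + t)\<^sup>2 - 1) (\<lambda>t. 2 * (1 + t)) \<Phi> l c k \<eta>0"
    by (intro energy_profile.intro energy_profile_axioms.intro kinetic_RVP P l c \<eta>0 k low)
  have EV: "energy_profile (\<lambda>v. ln (1 + (norm v)\<^sup>2) / 2) (\<lambda>t. exp (2 * t) - 1) (\<lambda>t. 2 * exp (2 * t)) (EV_profile \<Phi>) l (c * exp (- 1) powr k) k \<eta>0"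
    by (intro energy_profile.intro energy_profile_axioms.intro kinetic_EV Pe l \<eta>0 k EV_profile_lower_bound[OF c k(1) \<eta>0(2) low])
       (use c in auto)
  note models = VP_model[OF VP] RVP_model[OF RVP] EV_model[OF EV]
  show ?thesis
    \<comment> \<open>\<open>scaleR_one\<close> turns the velocity factor \<open>1\<close> of the
      Vlasov-Poisson model into the plain \<open>v\<close> of \<open>static_solution_VP\<close>; in
      the relativistic model, division of a vector by a number already abbreviates scaling by the
      inverse.\<close>
    using models unfolding newton_state_def EV_state_def scaleR_one Let_def static_solution_VP_def static_solution_RVP_def
    by (intro conjI allI impI)
qed

end
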